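(* Let $\mathfrak{o}$ be the ring of integers of a $p$-adic field $\mathfrak{f}$ (a finite extension of $\mathbb{Q}_p$) with maximal ideal $\mathfrak{p}$, residue field of cardinality $q$, and let $e$ be the ramification index of $\mathfrak{f}$ over $\mathbb{Q}_p$. Let $n,t\in\mathbb{N}$ with $1\le t\le n-t$. Let $G^r=\ker(\mathrm{GL}_n(\mathfrak{o})\to\mathrm{GL}_n(\mathfrak{o}/\mathfrak{p}^r))$ for $r\in\mathbb{N}$, let $H=\{(g_{ij})\in\mathrm{GL}_n(\mathfrak{o})\mid g_{ij}=0\text{ for }i\le t<j\}$ and $H^r=H\cap G^r$. Suppose that $r\ge2e$ if $p=2$ and $r\ge e(p-2)^{-1}$ if $p>2$. Then the zeta function of the representation $\rho=\mathrm{Ind}_{H^r}^{G^r}(\mathbb{1}_{H^r})$ is $$\zeta_\rho(s)=q^{rt(n-t)}\sum_{J\subseteq\{1,\dots,t\}}V_{n,t}(J)\prod_{j\in J}\frac{q^{-j(n-j)s}}{1-q^{-j(n-j)s}}.$$ The abscissa of convergence is $\alpha(\rho)=0$.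
   Context: For $m\in\mathbb{N}_0$ put $\mathcal{V}_q(m)=\prod_{j=1}^m(1-q^{-j})$. For a subset $J=\{x_1<\dots<x_{|J|}\}\subseteq\{1,\dots,t\}$ put $$V_{n,t}(J)=\frac{\mathcal{V}_q(t)\,\mathcal{V}_q(n-t)}{\mathcal{V}_q(t-x_{|J|})\,\mathcal{V}_q(n-t-x_{|J|})}\prod_{j=1}^{|J|}\mathcal{V}_q(x_j-x_{j-1})^{-1},$$ with the convention $x_0=0$. All representations are over $\mathbb{C}$. For a profinite group $G$ and closed subgroup $H$, $\mathrm{Ind}_H^G(\mathbb{1}_H)$ is the space of locally constant functions $f\colon G\to\mathbb{C}$ with $f(hx)=f(x)$ for $h\in H$, with $G$ acting by right translation. For a smooth representation $\rho$ with finitely many irreducible constituents (with multiplicity) of each dimension, $\zeta_\rho(s)=\sum_\pi m(\pi,\rho)(\dim\pi)^{-s}$, summed over isomorphism classes of smooth irreducible representations $\pi$ of $G$, with $m(\pi,\rho)$ the multiplicity of $\pi$ in $\rho$; $\alpha(\rho)$ is the abscissa of convergence of this Dirichlet series. *)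

theory Defs
  imports
    "HOL-Analysis.Analysis"
    "HOL-Library.Function_Algebras"
    "HOL-Algebra.Subrings"
    "HOL-Algebra.Ideal_Product"
    "HOL-Algebra.QuotRing"
    "Jordan_Normal_Form.Matrix"
begin

section \<open>\<open>p\<close>-adic fields\<close>

definition ring_on :: "'a::ring_1 set \<Rightarrow> 'a ring" where
  "ring_on S = \<lparr>carrier = S, mult = (*), one = 1, zero = 0, add = (+)\<rparr>"

definition padic_abs :: "nat \<Rightarrow> rat \<Rightarrow> real" where
  "padic_abs p x = (case quotient_of x of (a, b) \<Rightarrow>
     if a = 0 then 0
     else real p powr (real (multiplicity (int p) b) - real (multiplicity (int p) a)))"

text \<open>The subfield \<open>Qp\<close> with the absolute value \<open>absp\<close> is a completion of the rationals with
  respect to the \<open>p\<close>-adic absolute value. Nothing is assumed about \<open>absp\<close> outside \<open>Qp\<close>.\<close>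

definition is_Qp :: "nat \<Rightarrow> 'k::field_char_0 set \<Rightarrow> ('k \<Rightarrow> real) \<Rightarrow> bool" where
  "is_Qp p Qp absp \<longleftrightarrow>
     Factorial_Ring.prime p \<and>
     subfield Qp (ring_on UNIV) \<and>
     (\<forall>x\<in>Qp. absp x \<ge> 0 \<and> (absp x = 0 \<longleftrightarrow> x = 0)) \<and>
     (\<forall>x\<in>Qp. \<forall>y\<in>Qp. absp (x * y) = absp x * absp y \<and> absp (x + y) \<le> absp x + absp y) \<and>
     (\<forall>x. absp (of_rat x) = padic_abs p x) \<and>
     (\<forall>x\<in>Qp. \<forall>\<epsilon>>0. \<exists>y. absp (x - of_rat y) < \<epsilon>) \<and>
     (\<forall>X :: nat \<Rightarrow> 'k. (\<forall>i. X i \<in> Qp) \<and>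
        (\<forall>\<epsilon>>0. \<exists>N. \<forall>i\<ge>N. \<forall>j\<ge>N. absp (X i - X j) < \<epsilon>) \<longrightarrow>
        (\<exists>L\<in>Qp. (\<lambda>i. absp (X i - L)) \<longlonglongrightarrow> 0))"

text \<open>The type \<open>'k\<close> is a finite extension of its subfield \<open>Qp\<close>.\<close>

definition padic_field :: "nat \<Rightarrow> 'k::field_char_0 set \<Rightarrow> ('k \<Rightarrow> real) \<Rightarrow> bool" where
  "padic_field p Qp absp \<longleftrightarrow>
     is_Qp p Qp absp \<and>
     (\<exists>B. finite B \<and> (\<forall>x. \<exists>c. (\<forall>b\<in>B. c b \<in> Qp) \<and> x = (\<Sum>b\<in>B. c b * b)))"

text \<open>The integral closure of the \<open>p\<close>-adic integers.\<close>

definition integers_of :: "'k::field_char_0 set \<Rightarrow> ('k \<Rightarrow> real) \<Rightarrow> 'k set" where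
  "integers_of Qp absp =
     {x. \<exists>f. lead_coeff f = 1 \<and> (\<forall>i. Polynomial.coeff f i \<in> {y \<in> Qp. absp y \<le> 1}) \<and> poly f x = 0}"

definition ideal_power :: "'k::comm_ring_1 set \<Rightarrow> 'k set \<Rightarrow> nat \<Rightarrow> 'k set" where
  "ideal_power S P r = P [^]\<^bsub>ideals_set (ring_on S)\<^esub> r"

section \<open>\<open>GL\<^sub>n\<close> over a subring and its congruence subgroups\<close>

definition mat_monoid :: "nat \<Rightarrow> 'k::comm_ring_1 set \<Rightarrow> 'k mat monoid" where
  "mat_monoid n S =
     \<lparr>carrier = {A \<in> carrier_mat n n. \<forall>i<n. \<forall>j<n. A $$ (i, j) \<in> S}, mult = (*), one = 1\<^sub>m n\<rparr>"

definition GL_grp :: "nat \<Rightarrow> 'k::comm_ring_1 set \<Rightarrow> 'k mat monoid" where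
  "GL_grp n S = units_of (mat_monoid n S)"

definition mat_cong :: "nat \<Rightarrow> 'k::comm_ring_1 set \<Rightarrow> 'k set \<Rightarrow> nat \<Rightarrow> 'k mat \<Rightarrow> 'k mat \<Rightarrow> bool" where
  "mat_cong n S P r A B \<longleftrightarrow> (\<forall>i<n. \<forall>j<n. A $$ (i, j) - B $$ (i, j) \<in> ideal_power S P r)"

definition congruence_subgroup :: "nat \<Rightarrow> 'k::comm_ring_1 set \<Rightarrow> 'k set \<Rightarrow> nat \<Rightarrow> 'k mat monoid" where
  "congruence_subgroup n S P r =
     (GL_grp n S)\<lparr>carrier := {A \<in> carrier (GL_grp n S). mat_cong n S P r A (1\<^sub>m n)}\<rparr>"

text \<open>The \<open>P\<close>-adic topology, entrywise.\<close>

definition GL_topology :: "nat \<Rightarrow> 'k::comm_ring_1 set \<Rightarrow> 'k set \<Rightarrow> 'k mat topology" where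
  "GL_topology n S P = topology_generated_by
     {{B \<in> carrier (GL_grp n S). mat_cong n S P m B A} |A m. A \<in> carrier (GL_grp n S)}"

text \<open>Matrix indices start at 0, so \<open>i \<le> t < j\<close> for indices starting at 1 becomes \<open>i < t \<le> j\<close>.\<close>

definition block_subgroup :: "nat \<Rightarrow> nat \<Rightarrow> 'k::comm_ring_1 set \<Rightarrow> 'k mat set" where
  "block_subgroup n t S =
     {A \<in> carrier (GL_grp n S). \<forall>i j. i < t \<and> t \<le> j \<and> j < n \<longrightarrow> A $$ (i, j) = 0}"

section \<open>Complex representations\<close>

text \<open>A complex vector space is given as a subspace of \<open>'x \<Rightarrow> complex\<close>; linear maps between such
  spaces, extended by zero, form a complex vector space in turn.\<close>

definition cscale :: "complex \<Rightarrow> ('x \<Rightarrow> complex) \<Rightarrow> 'x \<Rightarrow> complex" where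
  "cscale c f = (\<lambda>x. c * f x)"

definition homscale :: "complex \<Rightarrow> ('v \<Rightarrow> 'x \<Rightarrow> complex) \<Rightarrow> 'v \<Rightarrow> 'x \<Rightarrow> complex" where
  "homscale c f = (\<lambda>v. cscale c (f v))"

interpretation cfun: vector_space cscale
  by unfold_locales (auto simp: cscale_def fun_eq_iff algebra_simps)

interpretation chom: vector_space homscale
  by unfold_locales (auto simp: homscale_def cscale_def fun_eq_iff algebra_simps)

type_synonym ('g, 'x) rep = "('x \<Rightarrow> complex) set \<times> ('g \<Rightarrow> ('x \<Rightarrow> complex) \<Rightarrow> 'x \<Rightarrow> complex)"

definition linear_betw ::
    "('x \<Rightarrow> complex) set \<Rightarrow> ('y \<Rightarrow> complex) set \<Rightarrow> (('x \<Rightarrow> complex) \<Rightarrow> 'y \<Rightarrow> complex) \<Rightarrow> bool" where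
  "linear_betw V W f \<longleftrightarrow>
     f ` V \<subseteq> W \<and> (\<forall>u\<in>V. \<forall>v\<in>V. f (u + v) = f u + f v) \<and>
     (\<forall>c. \<forall>v\<in>V. f (cscale c v) = cscale c (f v))"

definition is_rep :: "('g, 'm) monoid_scheme \<Rightarrow> ('g, 'x) rep \<Rightarrow> bool" where
  "is_rep G \<rho> \<longleftrightarrow> (case \<rho> of (V, act) \<Rightarrow>
     cfun.subspace V \<and>
     (\<forall>g\<in>carrier G. linear_betw V V (act g)) \<and>
     (\<forall>v\<in>V. act \<one>\<^bsub>G\<^esub> v = v) \<and>
     (\<forall>g\<in>carrier G. \<forall>h\<in>carrier G. \<forall>v\<in>V. act (g \<otimes>\<^bsub>G\<^esub> h) v = act g (act h v)))"

definition smooth_rep :: "('g, 'm) monoid_scheme \<Rightarrow> 'g topology \<Rightarrow> ('g, 'x) rep \<Rightarrow> bool" where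
  "smooth_rep G T \<rho> \<longleftrightarrow> is_rep G \<rho> \<and> (case \<rho> of (V, act) \<Rightarrow>
     \<forall>v\<in>V. openin T {g \<in> carrier G. act g v = v})"

definition irreducible_rep :: "('g, 'm) monoid_scheme \<Rightarrow> ('g, 'x) rep \<Rightarrow> bool" where
  "irreducible_rep G \<rho> \<longleftrightarrow> is_rep G \<rho> \<and> (case \<rho> of (V, act) \<Rightarrow>
     V \<noteq> {0} \<and>
     (\<forall>W. cfun.subspace W \<and> W \<subseteq> V \<and> (\<forall>g\<in>carrier G. act g ` W \<subseteq> W) \<longrightarrow> W = {0} \<or> W = V))"

definition rep_dim :: "('g, 'x) rep \<Rightarrow> nat" where
  "rep_dim \<rho> = cfun.dim (fst \<rho>)"

definition rep_hom :: "('g, 'm) monoid_scheme \<Rightarrow> ('g, 'x) rep \<Rightarrow> ('g, 'y) rep \<Rightarrow>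
    (('x \<Rightarrow> complex) \<Rightarrow> 'y \<Rightarrow> complex) set" where
  "rep_hom G \<pi> \<rho> = {f. linear_betw (fst \<pi>) (fst \<rho>) f \<and>
     (\<forall>g\<in>carrier G. \<forall>v\<in>fst \<pi>. f (snd \<pi> g v) = snd \<rho> g (f v)) \<and>
     (\<forall>v. v \<notin> fst \<pi> \<longrightarrow> f v = 0)}"

definition rep_iso :: "('g, 'm) monoid_scheme \<Rightarrow> ('g, 'x) rep \<Rightarrow> ('g, 'y) rep \<Rightarrow> bool" where
  "rep_iso G \<pi> \<rho> \<longleftrightarrow> (\<exists>f\<in>rep_hom G \<pi> \<rho>. bij_betw f (fst \<pi>) (fst \<rho>))"

text \<open>The multiplicity of an irreducible \<open>\<pi>\<close> in \<open>\<rho>\<close> is the dimension of \<open>Hom\<^sub>G(\<pi>, \<rho>)\<close>. As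
  \<^const>\<open>vector_space.dim\<close> is 0 on infinite-dimensional spaces, the value is meaningful only if
  this space is finite-dimensional; see \<open>finitely_many_constituents\<close> below.\<close>

definition rep_mult :: "('g, 'm) monoid_scheme \<Rightarrow> ('g, 'x) rep \<Rightarrow> ('g, 'y) rep \<Rightarrow> nat" where
  "rep_mult G \<pi> \<rho> = chom.dim (rep_hom G \<pi> \<rho>)"

text \<open>Isomorphism classes of smooth irreducible representations of \<open>G\<close>. Every such representation
  occurs, up to isomorphism, on a space of functions on \<open>G\<close>: send \<open>v\<close> to its matrix
  coefficients \<open>g \<mapsto> \<lambda>(g v)\<close> for a fixed nonzero linear form \<open>\<lambda>\<close>.\<close>

definition smooth_irreps :: "('g, 'm) monoid_scheme \<Rightarrow> 'g topology \<Rightarrow> ('g, 'g) rep set" where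
  "smooth_irreps G T = {\<pi>. smooth_rep G T \<pi> \<and> irreducible_rep G \<pi>}"

definition irr_classes :: "('g, 'm) monoid_scheme \<Rightarrow> 'g topology \<Rightarrow> ('g, 'g) rep set set" where
  "irr_classes G T =
     smooth_irreps G T //
       {(\<pi>, \<pi>'). \<pi> \<in> smooth_irreps G T \<and> \<pi>' \<in> smooth_irreps G T \<and> rep_iso G \<pi> \<pi>'}"

definition rep_of :: "('g, 'x) rep set \<Rightarrow> ('g, 'x) rep" where
  "rep_of C = (SOME \<pi>. \<pi> \<in> C)"

definition classes_of_dim :: "('g, 'm) monoid_scheme \<Rightarrow> 'g topology \<Rightarrow> ('g, 'y) rep \<Rightarrow> nat \<Rightarrow>
    ('g, 'g) rep set set" where
  "classes_of_dim G T \<rho> d =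
     {C \<in> irr_classes G T. rep_dim (rep_of C) = d \<and> rep_hom G (rep_of C) \<rho> \<noteq> {0}}"

definition finitely_many_constituents ::
    "('g, 'm) monoid_scheme \<Rightarrow> 'g topology \<Rightarrow> ('g, 'y) rep \<Rightarrow> bool" where
  "finitely_many_constituents G T \<rho> \<longleftrightarrow>
     (\<forall>d. finite (classes_of_dim G T \<rho> d)) \<and>
     (\<forall>C\<in>irr_classes G T. \<exists>B. finite B \<and> rep_hom G (rep_of C) \<rho> \<subseteq> chom.span B)"

section \<open>Zeta functions of representations\<close>

definition zeta_summand ::
    "('g, 'm) monoid_scheme \<Rightarrow> ('g, 'y) rep \<Rightarrow> complex \<Rightarrow> ('g, 'g) rep set \<Rightarrow> complex" where
  "zeta_summand G \<rho> s C =
     of_nat (rep_mult G (rep_of C) \<rho>) * of_nat (rep_dim (rep_of C)) powr (- s)"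

text \<open>\<open>\<zeta>\<^sub>\<rho>(s) = z\<close>, with the defining series converging.\<close>

definition has_zeta_value :: "('g, 'm) monoid_scheme \<Rightarrow> 'g topology \<Rightarrow> ('g, 'y) rep \<Rightarrow> complex \<Rightarrow>
    complex \<Rightarrow> bool" where
  "has_zeta_value G T \<rho> s z \<longleftrightarrow> (zeta_summand G \<rho> s has_sum z) (irr_classes G T)"

definition zeta_coeff :: "('g, 'm) monoid_scheme \<Rightarrow> 'g topology \<Rightarrow> ('g, 'y) rep \<Rightarrow> nat \<Rightarrow> nat" where
  "zeta_coeff G T \<rho> d = (\<Sum>C\<in>classes_of_dim G T \<rho> d. rep_mult G (rep_of C) \<rho>)"

definition abscissa :: "('g, 'm) monoid_scheme \<Rightarrow> 'g topology \<Rightarrow> ('g, 'y) rep \<Rightarrow> ereal" where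
  "abscissa G T \<rho> =
     (INF s\<in>{s::complex. summable (\<lambda>d. of_nat (zeta_coeff G T \<rho> d) * of_nat d powr (- s))}.
        ereal (Re s))"

section \<open>Induced representations\<close>

text \<open>Functions on \<open>G\<close> are extended by zero to the ambient type.\<close>

definition ind_space :: "('g, 'm) monoid_scheme \<Rightarrow> 'g topology \<Rightarrow> 'g set \<Rightarrow> ('g \<Rightarrow> complex) set" where
  "ind_space G T H = {f.
     (\<forall>x\<in>carrier G. \<exists>U. openin T U \<and> x \<in> U \<and> (\<forall>y\<in>U. f y = f x)) \<and>
     (\<forall>h\<in>H. \<forall>x\<in>carrier G. f (h \<otimes>\<^bsub>G\<^esub> x) = f x) \<and>
     (\<forall>x. x \<notin> carrier G \<longrightarrow> f x = 0)}"

definition ind_trivial :: "('g, 'm) monoid_scheme \<Rightarrow> 'g topology \<Rightarrow> 'g set \<Rightarrow> ('g, 'g) rep" where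
  "ind_trivial G T H =
     (ind_space G T H, \<lambda>g f x. if x \<in> carrier G then f (x \<otimes>\<^bsub>G\<^esub> g) else 0)"

section \<open>The coefficients\<close>

definition Vq :: "nat \<Rightarrow> nat \<Rightarrow> real" where
  "Vq q m = (\<Prod>j=1..m. 1 - real q powi (- int j))"

text \<open>\<open>xs\<close> lists \<open>x\<^sub>0 = 0\<close> and then the elements of \<open>J\<close> in increasing order.\<close>

definition V_coeff :: "nat \<Rightarrow> nat \<Rightarrow> nat \<Rightarrow> nat set \<Rightarrow> real" where
  "V_coeff q n t J =
     (let xs = 0 # sorted_list_of_set J in
        Vq q t * Vq q (n - t) / (Vq q (t - xs ! card J) * Vq q (n - t - xs ! card J)) *
        (\<Prod>j=1..card J. inverse (Vq q (xs ! j - xs ! (j - 1)))))"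

end

theory Submission
 imports Defs "Jordan_Normal_Form.Determinant" "Jordan_Normal_Form.Gauss_Jordan_Elimination"
begin

text \<open>Let \<open>m = n - t\<close>. Sending a block matrix with rows \<open>(A, B)\<close> and \<open>(C, D)\<close> to \<open>A\<^sup>-\<^sup>1 B\<close> identifies the
 coset space with the \<open>t \<times> m\<close> matrices over \<open>P\<^sup>r\<close>, so the induced representation is spanned by the
 additive characters \<open>chi Y\<close>, where \<open>Y\<close> runs through \<open>m \<times> t\<close> matrices over the field modulo integral ones.
 The diagonal blocks permute these characters by \<open>Y \<mapsto> D Y A\<close>; although the whole group acts by fractional linear
 maps, it changes differences of coordinates only by such block factors, so convolution with
 the sum of the characters in one orbit commutes with the group. Hence every orbit spans a stable
 subspace; these are irreducible, pairwise non-isomorphic, and of dimension the orbit size.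
 The orbit size is read off from the ranks \<open>j\<^sub>0 \<ge> j\<^sub>1 \<ge> \<dots>\<close> of \<open>w\<^sup>r Y, w\<^sup>r\<^sup>+\<^sup>1 Y, \<dots>\<close> modulo integral matrices as the
 product of the \<open>q\<^sup>j\<^sup>(\<^sup>n\<^sup>-\<^sup>j\<^sup>)\<close>. Counting matrices with prescribed ranks turns the zeta function into the limit
 of a triangular affine recursion, which is solved by the sum over subsets \<open>J\<close>.\<close>

text \<open>The ring of integers is given only as an integral closure; no absolute value on the
  extension is at hand. It is recovered as the set of power-bounded elements for a lattice:
  compactness bounds the failure of multiplicativity, which suffices for a valuation ring, and
  finiteness modulo p yields a uniformizer. Irreducibility rests on the unipotent translations
  \<open>uu X\<close>, for which every \<open>chi Y\<close> is an eigenvector with eigenvalue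
  \<open>ev X Y\<close>: a stable subspace contains each character occurring in one of its elements,
  and block-diagonal elements then supply the orbit. For the orbit sizes, multiplication by w maps
  the orbit of Y onto that of w Y, and the fibres are cut out by a linear commutator condition with
  q^(j(n-j)) solutions, j the rank of w^r Y. The number of lifts of a matrix to rank j contains the
  same power of q. Since a sum over matrices counts an orbit once per element, each Y gets the
  weight size^(-1-s), and the two powers combine to q^(-j(n-j)s). A rank can repeat along the
  sequence any number of times; the geometric series over the repetitions gives x/(1-x), and
  q^(rt(n-t)) is the number of Y with the same w^r Y.\<close>

text \<open>The sequential form of compactness: by pigeonhole keep a class modulo \<open>A k\<close>
  that contains infinitely many \<open>y i\<close>, refine it through the finitely many classes
  modulo \<open>A (Suc k)\<close>, and take the limit of the nested choices by completeness.\<close>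

lemma cluster_point_of_filtration:
 fixes A :: "nat \<Rightarrow> 'g::ab_group_add set" and y :: "nat \<Rightarrow> 'g"
 assumes add: "\<And>k x y. x \<in> A k ==> y \<in> A k ==> x + y \<in> A k"
  and minus: "\<And>k x. x \<in> A k ==> - x \<in> A k"
  and fin: "\<And>k. \<exists>F. finite F \<and> F \<subseteq> A k \<and> (\<forall>x\<in>A k. \<exists>f\<in>F. x - f \<in> A (Suc k))"
  and sub: "\<And>k. A (Suc k) \<subseteq> A k"
  and complete: "\<And>X. (\<forall>i. X i \<in> A 0) ==> (\<forall>i. X (Suc i) - X i \<in> A i) ==>
          \<exists>x. \<forall>i. x - X i \<in> A i"
  and y: "\<And>i. y i \<in> A 0"
 shows "\<exists>x\<in>A 0. \<forall>k. infinite {i. y i - x \<in> A k}"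
proof -
 have A0: "A k \<subseteq> A 0" for k by (induction k) (use sub in blast)+
 obtain X where X: "\<And>k. X k \<in> A 0 \<and> infinite {i. y i - X k \<in> A k}"
  and Xs: "\<And>k. X (Suc k) - X k \<in> A k"
 proof (rule exE[OF dependent_nat_choice[of "\<lambda>k x. x \<in> A 0 \<and> infinite {i. y i - x \<in> A k}" "\<lambda>k x x'. x' - x \<in> A k"]])
  have "y i - y 0 \<in> A 0" for i using add[OF y minus[OF y]] by simp
  then show "\<exists>x. x \<in> A 0 \<and> infinite {i. y i - x \<in> A 0}" by (intro exI[of _ "y 0"]) (use y in simp)
 next
  fix x k assume x: "x \<in> A 0 \<and> infinite {i. y i - x \<in> A k}"
  obtain F where F: "finite F" "F \<subseteq> A k" "\<And>z. z \<in> A k ==> \<exists>f\<in>F. z - f \<in> A (Suc k)" using fin by metis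
  have "{i. y i - x \<in> A k} \<subseteq> (\<Union>f\<in>F. {i. y i - x - f \<in> A (Suc k)})" using F(3) by blast
  then obtain f where f: "f \<in> F" "infinite {i. y i - x - f \<in> A (Suc k)}" using x F(1) by (meson finite_UN_I finite_subset)
  then have "x + f \<in> A 0 \<and> infinite {i. y i - (x + f) \<in> A (Suc k)}" "x + f - x \<in> A k"
   using x F(2) A0[of k] add[of x 0 f] by (auto simp: algebra_simps)
  then show "\<exists>x'. (x' \<in> A 0 \<and> infinite {i. y i - x' \<in> A (Suc k)}) \<and> x' - x \<in> A k" by blast
 qed blast
 obtain x where x: "\<And>i. x - X i \<in> A i" using complete X Xs by metis
 have "{i. y i - X k \<in> A k} \<subseteq> {i. y i - x \<in> A k}" for k
 proof
  fix i assume "i \<in> {i. y i - X k \<in> A k}"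
  then show "i \<in> {i. y i - x \<in> A k}" using add[OF _ minus[OF x[of k]], of "y i - X k"] by simp
 qed
 moreover have "x \<in> A 0" using add[OF x[of 0] conjunct1[OF X[of 0]]] by simp
 ultimately show ?thesis using X by (meson finite_subset)
qed

section \<open>Lattices over the \<open>p\<close>-adic integers\<close>

text \<open>A lattice \<open>L\<close> in a field of characteristic 0, abstracting from a free module of full rank over
 the \<open>p\<close>-adic integers; \<open>Lk k\<close> is \<open>p\<^sup>k L\<close>.\<close>

locale compact_lattice =
 fixes p :: nat and L :: "'k::field_char_0 set"
 assumes p_gt_1: "p > 1"
  and L_zero: "0 \<in> L"
  and L_add: "x \<in> L ==> y \<in> L ==> x + y \<in> L"
  and L_minus: "x \<in> L ==> - x \<in> L"
  and L_cover: "\<exists>k. x * of_nat p ^ k \<in> L"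
  and L_hausdorff: "(\<And>k. x / of_nat p ^ k \<in> L) ==> x = 0"
  and L_mult: "\<exists>a. \<forall>x\<in>L. \<forall>y\<in>L. x * y * of_nat p ^ a \<in> L"
  and L_finite: "\<exists>F. finite F \<and> F \<subseteq> L \<and> (\<forall>x\<in>L. \<exists>f\<in>F. (x - f) / of_nat p \<in> L)"
  and L_complete: "(\<And>i. X i \<in> L) ==> (\<And>i. (X (Suc i) - X i) / of_nat p ^ i \<in> L) ==>
   \<exists>x. \<forall>i. (x - X i) / of_nat p ^ i \<in> L"
begin

abbreviation pp :: 'k where "pp \<equiv> of_nat p"

definition Lk :: "int \<Rightarrow> 'k set" where "Lk k = {x. x * pp powi (-k) \<in> L}"

lemma p_pos [simp]: "p > 0" "p \<noteq> 0" using p_gt_1 by auto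

lemma pp_nz: "pp \<noteq> 0" by simp

lemma pp_add: "pp powi (k + l) = pp powi k * pp powi l" by (simp add: power_int_add)

lemma pp_diff: "pp powi (k - l) = pp powi k / pp powi l" by (simp add: power_int_diff)

lemma Lk_0: "Lk 0 = L" by (simp add: Lk_def)

lemma Lk_nat: "x \<in> Lk (int k) \<longleftrightarrow> x / pp ^ k \<in> L" by (simp add: Lk_def power_int_minus divide_inverse)

lemma Lk_shift: "x * pp powi j \<in> Lk (k + j) \<longleftrightarrow> x \<in> Lk k"
proof -
 have "x * pp powi j * pp powi (- (k + j)) = x * pp powi (-k)"
  by (simp add: mult.assoc pp_add[symmetric])
 then show ?thesis by (simp only: Lk_def mem_Collect_eq)
qed

lemma Lk_zero [simp]: "0 \<in> Lk k" by (simp add: Lk_def L_zero)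

lemma Lk_add: "x \<in> Lk k ==> y \<in> Lk k ==> x + y \<in> Lk k" by (simp add: Lk_def L_add algebra_simps)

lemma Lk_minus: "x \<in> Lk k ==> - x \<in> Lk k" using L_minus by (fastforce simp add: Lk_def)

lemma Lk_diff: "x \<in> Lk k ==> y \<in> Lk k ==> x - y \<in> Lk k" using Lk_add[OF _ Lk_minus] by fastforce

lemma Lk_of_nat: "x \<in> Lk k ==> of_nat n * x \<in> Lk k" by (induction n) (auto simp: Lk_add algebra_simps)

lemma Lk_sum: "(\<And>i. i \<in> I ==> f i \<in> Lk k) ==> sum f I \<in> Lk k" by (induction I rule: infinite_finite_induct) (auto simp: Lk_add)

lemma Lk_Suc: "Lk (k + 1) \<subseteq> Lk k"
proof
 fix x assume x: "x \<in> Lk (k + 1)"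
 have "of_nat p * (x * pp powi (-(k+1))) = x * pp powi (-k)"
 proof -
  have "pp powi (- k) = pp powi (-(k+1)) * pp" using pp_add[of "-(k+1)" 1] by simp
  then show ?thesis by simp
 qed
 then show "x \<in> Lk k" using Lk_of_nat[of "x * pp powi (-(k+1))" 0 p] x
  by (simp only: Lk_def mem_Collect_eq power_int_0_right minus_zero mult_1_right)
qed

lemma Lk_mono: "k \<le> l ==> Lk l \<subseteq> Lk k"
proof (induction l rule: int_ge_induct)
 case (step i) then show ?case using Lk_Suc[of i] by blast
qed simp

text \<open>\<open>L\<close> need not be a ring; \<open>a\<close> bounds the denominator created by
  one multiplication, and rescaling makes it the same at all levels.\<close>

lemma Lk_mult: obtains a :: nat where "\<And>k l x y. x \<in> Lk k ==> y \<in> Lk l ==> x * y \<in> Lk (k + l - int a)"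
proof -
 obtain a where a: "\<And>x y. x \<in> L ==> y \<in> L ==> x * y * of_nat p ^ a \<in> L" using L_mult by blast
 have "x * y \<in> Lk (k + l - int a)" if "x \<in> Lk k" "y \<in> Lk l" for k l x y
 proof -
  have "x * pp powi (-k) * (y * pp powi (-l)) * of_nat p ^ a \<in> L"
   using that a by (auto simp: Lk_def)
  moreover have "x * pp powi (-k) * (y * pp powi (-l)) * of_nat p ^ a = x * y * pp powi (-(k + l - int a))"
   using pp_add[of "-k" "-l + int a"] pp_add[of "-l" "int a"] by (simp add: algebra_simps)
  ultimately show ?thesis by (simp add: Lk_def)
 qed
 then show ?thesis using that by blast
qed

lemma Lk_cover: "\<exists>k. x \<in> Lk k"
proof -
 obtain k where "x * pp ^ k \<in> L" using L_cover by blast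
 then have "x \<in> Lk (- int k)" by (simp add: Lk_def)
 then show ?thesis ..
qed

lemma Lk_hausdorff: assumes "\<And>k. k \<ge> m ==> x \<in> Lk k" shows "x = 0"
proof (rule L_hausdorff)
 fix k show "x / pp ^ k \<in> L" using assms[of "max m (int k)"] Lk_mono[of "int k" "max m (int k)"] Lk_nat by auto
qed

lemma Lk_finite: "\<exists>F. finite F \<and> F \<subseteq> Lk k \<and> (\<forall>x\<in>Lk k. \<exists>f\<in>F. x - f \<in> Lk (k + 1))"
proof -
 obtain F where F: "finite F" "F \<subseteq> L" "\<And>x. x \<in> L ==> \<exists>f\<in>F. (x - f) / pp \<in> L" using L_finite by blast
 let ?F = "(\<lambda>f. f * pp powi k) ` F"
 have "\<exists>f\<in>?F. x - f \<in> Lk (k + 1)" if x: "x \<in> Lk k" for x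
 proof -
  obtain f where f: "f \<in> F" "(x * pp powi (-k) - f) / pp \<in> L" using F(3)[of "x * pp powi (-k)"] x by (auto simp: Lk_def)
  have "pp powi (-(k+1)) = pp powi (-k) / pp" using pp_diff[of "-k" 1] by simp
  then have "(x - f * pp powi k) * pp powi (-(k+1)) = (x * pp powi (-k) - f) / pp" by (simp add: field_simps power_int_minus)
  with f show ?thesis by (intro bexI[of _ "f * pp powi k"]) (simp_all only: Lk_def mem_Collect_eq image_eqI)
 qed
 moreover have "?F \<subseteq> Lk k" using F(2) Lk_shift[of _ k 0] by (auto simp: Lk_0)
 ultimately show ?thesis using F(1) by blast
qed

lemma Lk_finite_le: "k \<le> l ==> \<exists>F. finite F \<and> F \<subseteq> Lk k \<and> (\<forall>x\<in>Lk k. \<exists>f\<in>F. x - f \<in> Lk l)"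
proof (induction l rule: int_ge_induct)
 case base show ?case by (rule exI[of _ "{0}"]) simp
next
 case (step l)
 obtain F where F: "finite F" "F \<subseteq> Lk k" "\<And>x. x \<in> Lk k ==> \<exists>f\<in>F. x - f \<in> Lk l" using step by blast
 obtain F' where F': "finite F'" "F' \<subseteq> Lk l" "\<And>x. x \<in> Lk l ==> \<exists>f\<in>F'. x - f \<in> Lk (l+1)"
  using Lk_finite[of l] by metis
 let ?F = "(\<lambda>(f,g). f + g) ` (F \<times> F')"
 have 1: "finite ?F" using F(1) F'(1) by simp
 have 2: "?F \<subseteq> Lk k" using F(2) F'(2) Lk_mono[OF step(1)] by (auto intro!: Lk_add)
 have 3: "\<exists>f\<in>?F. x - f \<in> Lk (l + 1)" if "x \<in> Lk k" for x
 proof -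
  obtain f g where "f \<in> F" "g \<in> F'" "x - f - g \<in> Lk (l + 1)" using F F' \<open>x \<in> Lk k\<close> by meson
  then show ?thesis by (intro bexI[of _ "f + g"]) (auto simp: algebra_simps)
 qed
 show ?case by (rule exI[of _ ?F]) (intro conjI ballI 1 2 3)
qed

lemma Lk_complete:
 assumes "\<And>i. X i \<in> L" "\<And>i. X (Suc i) - X i \<in> Lk (int i)"
 shows "\<exists>x. \<forall>i. x - X i \<in> Lk (int i)"
proof -
 have "\<exists>x. \<forall>i. (x - X i) / of_nat p ^ i \<in> L" by (rule L_complete) (use assms Lk_nat in blast)+
 then show ?thesis using Lk_nat by blast
qed

text \<open>Compactness of the set of pairs of primitive elements, together with the absence of zero
 divisors, makes the lattice norm multiplicative up to a bounded factor.\<close>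

lemma primitive_mult:
 obtains kp :: nat where "\<And>y z. y \<in> L ==> z \<in> L ==> y \<notin> Lk 1 ==> z \<notin> Lk 1 ==> y * z \<notin> Lk (int kp)"
proof (rule ccontr)
 assume "\<not> thesis"
 then have "\<forall>kp. \<exists>y z. y \<in> L \<and> z \<in> L \<and> y \<notin> Lk 1 \<and> z \<notin> Lk 1 \<and> y * z \<in> Lk (int kp)"
  using that by blast
 then obtain y z where yz: "\<And>i. y i \<in> L \<and> z i \<in> L \<and> y i \<notin> Lk 1 \<and> z i \<notin> Lk 1 \<and> y i * z i \<in> Lk (int i)"
  by metis
 \<comment> \<open>Pairs are filtered together, so that \<open>y\<close> and \<open>z\<close>
   cluster along the same indices.\<close>
 define A where "A = (\<lambda>k::nat. Lk (int k) \<times> Lk (int k))"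
 obtain a where a: "\<And>k l x y. x \<in> Lk k ==> y \<in> Lk l ==> x * y \<in> Lk (k + l - int a)" using Lk_mult by blast
 have "\<exists>x\<in>A 0. \<forall>k. infinite {i. (y i, z i) - x \<in> A k}"
 proof (rule cluster_point_of_filtration)
  show "u + v \<in> A k" if "u \<in> A k" "v \<in> A k" for u v k using that by (auto simp: A_def Lk_add)
  show "- u \<in> A k" if "u \<in> A k" for u k using that by (auto simp: A_def Lk_minus)
  show "A (Suc k) \<subseteq> A k" for k using Lk_Suc[of "int k"] by (auto simp: A_def add.commute)
  show "(y i, z i) \<in> A 0" for i using yz by (auto simp: A_def Lk_0)
  show "\<exists>F. finite F \<and> F \<subseteq> A k \<and> (\<forall>x\<in>A k. \<exists>f\<in>F. x - f \<in> A (Suc k))" for k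
  proof -
   obtain F where F: "finite F" "F \<subseteq> Lk (int k)" "\<And>x. x \<in> Lk (int k) ==> \<exists>f\<in>F. x - f \<in> Lk (int k + 1)"
    using Lk_finite[of "int k"] by metis
   have "finite (F \<times> F) \<and> F \<times> F \<subseteq> A k \<and> (\<forall>x\<in>A k. \<exists>f\<in>F \<times> F. x - f \<in> A (Suc k))"
    using F by (fastforce simp: A_def add.commute)
   then show ?thesis by blast
  qed
  show "\<exists>x. \<forall>i. x - X i \<in> A i" if X: "\<forall>i. X i \<in> A 0" "\<forall>i. X (Suc i) - X i \<in> A i" for X
  proof -
   have "fst (X i) \<in> L" "snd (X i) \<in> L" "fst (X (Suc i)) - fst (X i) \<in> Lk i" "snd (X (Suc i)) - snd (X i) \<in> Lk i" for i
    using spec[OF X(1), of i] spec[OF X(2), of i] by (auto simp: A_def Lk_0 mem_Times_iff)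
   then obtain x x' where "\<forall>i. x - fst (X i) \<in> Lk i" "\<forall>i. x' - snd (X i) \<in> Lk i"
    using Lk_complete[of "\<lambda>i. fst (X i)"] Lk_complete[of "\<lambda>i. snd (X i)"] by blast
   then show ?thesis by (intro exI[of _ "(x, x')"]) (auto simp: A_def mem_Times_iff)
  qed
 qed
 then obtain u v where uv: "u \<in> L" "v \<in> L" "\<And>k. infinite {i. y i - u \<in> Lk (int k) \<and> z i - v \<in> Lk (int k)}"
  by (auto simp: A_def Lk_0)
 \<comment> \<open>Agreement at level 1 already keeps \<open>u\<close> and \<open>v\<close> outside
   \<open>Lk 1\<close>, hence nonzero, and a field has no zero divisors.\<close>
 obtain i where "y i - u \<in> Lk 1" "z i - v \<in> Lk 1" using not_finite_existsD[OF uv(3)[of 1]] by auto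
 then have "u \<notin> Lk 1" "v \<notin> Lk 1" using yz[of i] Lk_add by fastforce+
 then have "u * v \<noteq> 0" by auto
 moreover have "u * v = 0"
 proof (rule Lk_hausdorff[of 0])
  fix j :: int assume "j \<ge> 0"
  \<comment> \<open>The extra \<open>a\<close> pays for the denominator of a product, so the error
    terms still land in \<open>Lk j\<close>.\<close>
  define J where "J = nat j + a"
  obtain i where i: "i \<ge> J" "y i - u \<in> Lk (int J)" "z i - v \<in> Lk (int J)"
   using uv(3)[of J] unfolding infinite_nat_iff_unbounded_le by auto
  have Jj: "j \<le> int J + 0 - int a" "j \<le> 0 + int J - int a" "j \<le> int i" using \<open>j \<ge> 0\<close> i(1) by (auto simp: J_def)
  have "y i * z i \<in> Lk j" using yz[of i] Lk_mono[OF Jj(3)] by blast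
  moreover have "y i * (z i - v) \<in> Lk j" using a[of "y i" 0 "z i - v" "int J"] yz[of i] i(3) Lk_mono[OF Jj(2)] by (auto simp: Lk_0)
  moreover have "(y i - u) * v \<in> Lk j" using a[of "y i - u" "int J" "v" 0] uv i(2) Lk_mono[OF Jj(1)] by (auto simp: Lk_0)
  ultimately have "y i * z i - y i * (z i - v) - (y i - u) * v \<in> Lk j" using Lk_diff by blast
  then show "u * v \<in> Lk j" by (simp add: algebra_simps)
 qed
 ultimately show False by blast
qed

text \<open>The order of a nonzero element along the filtration. It is additive on products only up
  to a bounded error in both directions, so it is not itself a valuation; its value at 0 is
  arbitrary.\<close>

definition lv :: "'k \<Rightarrow> int" where "lv x = (SOME k. x \<in> Lk k \<and> x \<notin> Lk (k + 1))"

lemma lv: assumes "x \<noteq> 0" shows "x \<in> Lk (lv x)" "x \<notin> Lk (lv x + 1)"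
proof -
 obtain k where k: "x \<in> Lk k" using Lk_cover by blast
 obtain l where l: "l \<ge> k" "x \<notin> Lk l" using Lk_hausdorff[of k x] assms by blast
 have "\<exists>k. x \<in> Lk k \<and> x \<notin> Lk (k + 1)"
 proof (rule ccontr)
  assume "\<not> ?thesis"
  then have "\<And>k. x \<in> Lk k ==> x \<in> Lk (k + 1)" by blast
  with l(1) k have "x \<in> Lk l" by (induction l rule: int_ge_induct) auto
  with l show False by blast
 qed
 then show "x \<in> Lk (lv x)" "x \<notin> Lk (lv x + 1)"
  using someI_ex[of "\<lambda>k. x \<in> Lk k \<and> x \<notin> Lk (k + 1)"] unfolding lv_def by blast+
qed

lemma Lk_iff: "x \<noteq> 0 ==> x \<in> Lk k \<longleftrightarrow> k \<le> lv x" using lv[of x] Lk_mono[of k "lv x"] Lk_mono[of "lv x + 1" k] by force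

text \<open>Divide both factors by the powers of p given by their orders: the quotients are
  primitive, and \<open>primitive_mult\<close> bounds the order of their product by a
  constant.\<close>

lemma lv_mult:
 obtains kp :: int where "kp \<ge> 0" "\<And>x y. x \<noteq> 0 ==> y \<noteq> 0 ==> lv (x * y) \<le> lv x + lv y + kp"
proof -
 obtain kp :: nat where kp: "\<And>y z. y \<in> L ==> z \<in> L ==> y \<notin> Lk 1 ==> z \<notin> Lk 1 ==> y * z \<notin> Lk (int kp)"
  using primitive_mult by blast
 have "lv (x * y) \<le> lv x + lv y + int kp" if nz: "x \<noteq> 0" "y \<noteq> 0" for x y
 proof (rule ccontr)
  assume "\<not> ?thesis"
  then have "x * y \<in> Lk (int kp + (lv x + lv y))" using Lk_iff[of "x * y"] nz by auto
  then have 1: "x * y * pp powi (-(lv x + lv y)) \<in> Lk (int kp)" using Lk_shift[of "x * y" "-(lv x + lv y)" "int kp + (lv x + lv y)"] by simp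
  have 2: "x * pp powi (-lv x) \<in> L" "x * pp powi (-lv x) \<notin> Lk 1"
   "y * pp powi (-lv y) \<in> L" "y * pp powi (-lv y) \<notin> Lk 1" using lv[OF nz(1)] lv[OF nz(2)] Lk_shift[of x "- lv x" "lv x + 1"]
    Lk_shift[of y "- lv y" "lv y + 1"] by (auto simp: Lk_def)
  have "x * pp powi (-lv x) * (y * pp powi (-lv y)) = x * y * pp powi (-(lv x + lv y))"
   using pp_add[of "-lv x" "-lv y"] by simp
  with kp[OF 2(1,3,2,4)] 1 show False by metis
 qed
 then show ?thesis using that[of "int kp"] by auto
qed

text \<open>A description of the ring of integers in terms of the lattice only, insensitive to
  bounded errors in the order; \<open>integers_powerbounded\<close> identifies it with the integral
  closure.\<close>

definition powerbounded :: "'k set" where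
 "powerbounded = {x. \<exists>N. \<forall>i. x ^ i \<in> Lk N}"

lemma pb_one: "1 \<in> powerbounded" using Lk_cover[of 1] by (auto simp: powerbounded_def)

lemma pb_mult: "x \<in> powerbounded ==> y \<in> powerbounded ==> x * y \<in> powerbounded"
proof -
 assume "x \<in> powerbounded" "y \<in> powerbounded"
 then obtain M N where MN: "\<And>i. x ^ i \<in> Lk M" "\<And>i. y ^ i \<in> Lk N" by (auto simp: powerbounded_def)
 obtain a where a: "\<And>k l x y. x \<in> Lk k ==> y \<in> Lk l ==> x * y \<in> Lk (k + l - int a)" using Lk_mult by blast
 have "(x * y) ^ i \<in> Lk (M + N - int a)" for i using a[OF MN(1)[of i] MN(2)[of i]] by (simp add: power_mult_distrib)
 then show ?thesis by (auto simp: powerbounded_def)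
qed

lemma pb_add: "x \<in> powerbounded ==> y \<in> powerbounded ==> x + y \<in> powerbounded"
proof -
 assume "x \<in> powerbounded" "y \<in> powerbounded"
 then obtain M N where MN: "\<And>i. x ^ i \<in> Lk M" "\<And>i. y ^ i \<in> Lk N" by (auto simp: powerbounded_def)
 obtain a where a: "\<And>k l x y. x \<in> Lk k ==> y \<in> Lk l ==> x * y \<in> Lk (k + l - int a)" using Lk_mult by blast
 have "(x + y) ^ i \<in> Lk (M + N - int a)" for i unfolding binomial_ring using a[OF MN(1) MN(2)]
  by (intro Lk_sum) (auto simp: mult.assoc intro!: Lk_of_nat)
 then show ?thesis by (auto simp: powerbounded_def)
qed

lemma pb_minus_one: "-1 \<in> powerbounded"
proof -
 obtain N where N: "1 \<in> Lk N" using Lk_cover by blast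
 have "(-1) ^ i \<in> Lk N" for i using N Lk_minus[OF N] by (cases "even i") auto
 then show ?thesis by (auto simp: powerbounded_def)
qed

lemma pb_minus: "x \<in> powerbounded ==> - x \<in> powerbounded" using pb_mult[OF pb_minus_one, of x] by simp

lemma pb_zero: "0 \<in> powerbounded" using pb_add[OF pb_one pb_minus_one] by simp

lemma pb_power: "x \<in> powerbounded ==> x ^ i \<in> powerbounded" by (induction i) (auto simp: pb_one pb_mult)

lemma pb_of_nat: "of_nat i \<in> powerbounded" by (induction i) (auto simp: pb_zero pb_add pb_one)

text \<open>Once some power of \<open>x\<close> has order below the error bound, its further powers
  cannot climb back above 0, so the orders of all \<open>x ^ i\<close> are bounded above. Comparing
  with the order of \<open>1 = x ^ i * inverse x ^ i\<close> bounds the orders of the inverse powers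
  below.\<close>

lemma pb_valuation: assumes x: "x \<notin> powerbounded" shows "inverse x \<in> powerbounded"
proof -
 have nz: "x \<noteq> 0" using x pb_zero by auto
 obtain kp :: int where kp: "kp \<ge> 0" "\<And>x y. x \<noteq> 0 ==> y \<noteq> 0 ==> lv (x * y) \<le> lv x + lv y + kp" using lv_mult by blast
 obtain i0 where "x ^ i0 \<notin> Lk (-kp)" using x by (auto simp: powerbounded_def)
 then have i0: "lv (x ^ i0) < - kp" using Lk_iff[of "x ^ i0" "-kp"] nz by simp
 have l: "lv ((x ^ i0) ^ Suc l) \<le> 0" for l
 proof (induction l)
  case (Suc l)
  have "lv ((x ^ i0) * (x ^ i0) ^ Suc l) \<le> lv (x ^ i0) + lv ((x ^ i0) ^ Suc l) + kp" by (rule kp(2)) (use nz in auto)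
  with Suc i0 show ?case by simp
 qed (use i0 kp in simp)
 \<comment> \<open>The maximum covers the remainders of the exponents modulo \<open>i0\<close>, and
   \<open>kp\<close> pays for the one multiplication that splits a remainder off.\<close>
 define C where "C = Max ((\<lambda>j. lv (x ^ j)) ` {..i0}) + kp"
 have C1: "lv (x ^ j) \<le> C - kp" if "j \<le> i0" for j unfolding C_def using that by auto
 have i0pos: "i0 > 0"
 proof (rule ccontr)
  assume "\<not> 0 < i0"
  then have "lv 1 < -kp" using i0 by simp
  moreover have "lv 1 \<le> lv 1 + lv 1 + kp" using kp(2)[of 1 1] by simp
  ultimately show False by linarith
 qed
 have C: "lv (x ^ i) \<le> C" for i
 proof (cases "i div i0")
  case 0
  then have "i < i0" using i0pos by (simp add: div_eq_0_iff)
  then show ?thesis using C1[of i] kp by simp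
 next
  case (Suc l)
  have "i = i0 * Suc l + i mod i0" using Suc by (metis mult_div_mod_eq)
  then have "x ^ i = (x ^ i0) ^ Suc l * x ^ (i mod i0)" by (metis power_add power_mult)
  then have "lv (x ^ i) \<le> lv ((x ^ i0) ^ Suc l) + lv (x ^ (i mod i0)) + kp" using kp(2)[of "(x ^ i0) ^ Suc l" "x ^ (i mod i0)"] nz by simp
  moreover have "i mod i0 \<le> i0" using i0pos by simp
  ultimately show ?thesis using C1[of "i mod i0"] l[of l] by linarith
 qed
 have "inverse x ^ i \<in> Lk (lv 1 - kp - C)" for i
 proof -
  have "lv (x ^ i * inverse x ^ i) \<le> lv (x ^ i) + lv (inverse x ^ i) + kp" by (rule kp(2)) (use nz in auto)
  moreover have "x ^ i * inverse x ^ i = 1" using nz by (simp add: power_mult_distrib[symmetric])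
  ultimately show ?thesis using C[of i] nz by (subst Lk_iff) auto
 qed
 then show ?thesis by (auto simp: powerbounded_def)
qed

text \<open>Outside \<open>Lk (-kp)\<close> each further factor \<open>x\<close> lowers the order by
  at least 1, even after the error \<open>kp\<close>, so the powers leave every
  \<open>Lk N\<close>.\<close>

lemma pb_bounded: obtains kp :: int where "powerbounded \<subseteq> Lk kp"
proof -
 obtain kp :: int where kp: "kp \<ge> 0" "\<And>x y. x \<noteq> 0 ==> y \<noteq> 0 ==> lv (x * y) \<le> lv x + lv y + kp" using lv_mult by blast
 have "x \<in> Lk (-kp)" if x: "x \<in> powerbounded" for x
 proof (rule ccontr)
  assume "x \<notin> Lk (-kp)"
  then have nz: "x \<noteq> 0" by auto
  with \<open>x \<notin> Lk (-kp)\<close> have lx: "lv x < - kp" using Lk_iff[of x "-kp"] by simp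
  obtain N where N: "\<And>i. x ^ i \<in> Lk N" using x by (auto simp: powerbounded_def)
  have "lv (x ^ i) \<le> lv 1 - int i" for i
  proof (induction i)
   case (Suc i)
   have "lv (x * x ^ i) \<le> lv x + lv (x ^ i) + kp" by (rule kp(2)) (use nz in auto)
   with Suc lx show ?case by simp
  qed simp
  from this[of "nat (lv 1 - N + 1)"] N[of "nat (lv 1 - N + 1)"] Lk_iff[of "x ^ nat (lv 1 - N + 1)" N] nz
   N[of 0] Lk_iff[of 1 N]
  show False by simp
 qed
 then show ?thesis using that by blast
qed

text \<open>At level \<open>a\<close> the denominator of a product is absorbed, so
  \<open>Lk a\<close> is closed under multiplication.\<close>

lemma pb_contains: obtains a :: int where "Lk a \<subseteq> powerbounded"
proof -
 obtain a where a: "\<And>k l x y. x \<in> Lk k ==> y \<in> Lk l ==> x * y \<in> Lk (k + l - int a)" using Lk_mult by blast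
 obtain N where N: "1 \<in> Lk N" using Lk_cover by blast
 have "x \<in> powerbounded" if x: "x \<in> Lk (int a)" for x
 proof -
  have 1: "x ^ Suc i \<in> Lk (int a)" for i
  proof (induction i)
   case (Suc i)
   show ?case using a[OF x Suc] by simp
  qed (use x in simp)
  have "x ^ i \<in> Lk (min N (int a))" for i
   using 1[of "i - 1"] N Lk_mono[of "min N (int a)" N] Lk_mono[of "min N (int a)" "int a"] by (cases i) auto
  then show ?thesis by (auto simp: powerbounded_def)
 qed
 then show ?thesis using that by blast
qed

end

section \<open>Complete discrete valuation rings\<close>

text \<open>A complete discrete valuation ring inside its fraction field. The valuation is present
  only through the decomposition of elements into a unit and a power of the uniformizer
  \<open>w\<close>; the residue classes counted by \<open>q\<close> are the cosets themselves, as
  subsets of \<open>S\<close>.\<close>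

locale complete_dvr =
 fixes S :: "'k::field set" and w :: 'k and q :: nat
 assumes S_zero [simp]: "0 \<in> S" and S_one [simp]: "1 \<in> S"
  and S_add: "x \<in> S ==> y \<in> S ==> x + y \<in> S"
  and S_minus: "x \<in> S ==> - x \<in> S"
  and S_mult: "x \<in> S ==> y \<in> S ==> x * y \<in> S"
  and w_S: "w \<in> S" and w_nz [simp]: "w \<noteq> 0" and w_nonunit: "inverse w \<notin> S"
  and valuation: "x \<noteq> 0 ==> \<exists>u k. x = u * w powi k \<and> u \<in> S \<and> inverse u \<in> S"
  and complete: "(\<And>i. X i \<in> S) ==> (\<And>i. (X (Suc i) - X i) / w ^ i \<in> S) ==>
          \<exists>x\<in>S. \<forall>i. (x - X i) / w ^ i \<in> S"
  and finite_residues: "finite ((\<lambda>x. {y \<in> S. (y - x) / w \<in> S}) ` S)"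
  and q_eq: "q = card ((\<lambda>x. {y \<in> S. (y - x) / w \<in> S}) ` S)"

context compact_lattice
begin

text \<open>Otherwise all negative powers of p lie in one \<open>Lk N\<close>, so 1 lies in every
  later \<open>Lk k\<close>, against the Hausdorff property.\<close>

lemma pp_pb_nonunit: "inverse pp \<notin> powerbounded"
proof
 assume "inverse pp \<in> powerbounded"
 then obtain N where N: "\<And>i. inverse pp ^ i \<in> Lk N" by (auto simp: powerbounded_def)
 have "(1::'k) = 0"
 proof (rule Lk_hausdorff[of N])
  fix k assume "k \<ge> N"
  have "inverse pp ^ nat (k - N) = 1 * pp powi (-(k - N))"
   using \<open>k \<ge> N\<close> by (subst power_int_minus) (simp add: power_int_def power_inverse)
  then have "1 * pp powi (-(k - N)) \<in> Lk N" using N[of "nat (k - N)"] by simp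
  then show "1 \<in> Lk k" using Lk_shift[of 1 "-(k - N)" k] by simp
 qed
 then show False by simp
qed

lemma pb_finite: "\<exists>F. finite F \<and> F \<subseteq> powerbounded \<and> (\<forall>x\<in>powerbounded. \<exists>f\<in>F. (x - f) / pp \<in> powerbounded)"
proof -
 obtain kp where kp: "powerbounded \<subseteq> Lk kp" using pb_bounded by blast
 obtain a where a: "Lk a \<subseteq> powerbounded" using pb_contains by blast
 \<comment> \<open>Division by p turns level \<open>a + 1\<close> into level \<open>a\<close>, which
   lies in \<open>powerbounded\<close>; the maximum keeps \<open>Lk l\<close> inside
   \<open>Lk kp\<close>.\<close>
 define l where "l = max kp (a + 1)"
 obtain F where F: "finite F" "\<And>x. x \<in> Lk kp ==> \<exists>f\<in>F. x - f \<in> Lk l"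
  using Lk_finite_le[of kp l] unfolding l_def by (metis max.cobounded1)
 \<comment> \<open>A representative taken from the lattice need not be power-bounded;
   \<open>g\<close> replaces it by a power-bounded element of its class where there is one.\<close>
 define g where "g f = (SOME x. x \<in> powerbounded \<and> x - f \<in> Lk l)" for f
 define F' where "F' = {f \<in> F. \<exists>x. x \<in> powerbounded \<and> x - f \<in> Lk l}"
 have g: "g f \<in> powerbounded \<and> g f - f \<in> Lk l" if "f \<in> F'" for f
 proof -
  have "\<exists>x. x \<in> powerbounded \<and> x - f \<in> Lk l" using that by (simp add: F'_def)
  then show ?thesis unfolding g_def by (rule someI_ex)
 qed
 have "\<exists>f\<in>g ` F'. (x - f) / pp \<in> powerbounded" if x: "x \<in> powerbounded" for x
 proof -
  obtain f where f: "f \<in> F" "x - f \<in> Lk l" using F(2)[of x] x kp by blast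
  then have f': "f \<in> F'" using x by (auto simp: F'_def)
  have "x - g f \<in> Lk l" using Lk_diff[OF f(2)] g[OF f'] by fastforce
  then have "x - g f \<in> Lk (a + 1)" using Lk_mono[of "a + 1" l] by (auto simp: l_def)
  then have "(x - g f) / pp \<in> Lk a" using Lk_shift[of "x - g f" "-1" "a + 1"] by (simp add: power_int_minus divide_inverse)
  then show ?thesis using a f' by blast
 qed
 moreover have "finite (g ` F')" using F(1) by (simp add: F'_def)
 moreover have "g ` F' \<subseteq> powerbounded" using g by blast
 ultimately show ?thesis by (intro exI[of _ "g ` F'"] conjI ballI)
qed

text \<open>The principal ideals of a valuation ring form a chain, and there are finitely many
  classes modulo p. Among the nonunits dividing p, one whose ideal contains most of the
  representatives \<open>F\<close> therefore generates the maximal ideal.\<close>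

lemma pb_uniformizer:
 obtains w where "w \<in> powerbounded" "w \<noteq> 0" "inverse w \<notin> powerbounded"
  "\<And>x. x \<in> powerbounded ==> x = 0 \<or> inverse x \<notin> powerbounded ==> x / w \<in> powerbounded"
  "\<exists>k. w ^ k / pp \<in> powerbounded"
proof -
 let ?O = "powerbounded"
 note O_mult = pb_mult
 have O_div: "x / y \<in> ?O \<or> y / x \<in> ?O" for x y using pb_valuation[of "x / y"] by auto
 have tr: "x / y \<in> ?O ==> y / z \<in> ?O ==> x / z \<in> ?O" if "y \<noteq> 0" for x y z using pb_mult[of "x / y" "y / z"] that by simp
 obtain F where F: "finite F" "F \<subseteq> ?O" "\<And>x. x \<in> ?O ==> \<exists>f\<in>F. (x - f) / pp \<in> ?O" using pb_finite by metis
 \<comment> \<open>\<open>I x\<close> records the classes modulo p that lie in the ideal of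
   \<open>x\<close>. For \<open>x\<close> dividing p it determines that ideal, which is the content
   of \<open>mem\<close> below.\<close>
 define I where "I x = {f \<in> F. f / x \<in> ?O}" for x
 have finI: "finite (I x)" for x using F(1) by (simp add: I_def)
 define cand where "cand = {x. x \<in> ?O \<and> x \<noteq> 0 \<and> inverse x \<notin> ?O \<and> pp / x \<in> ?O}"
 have pc: "pp \<in> cand" using pp_pb_nonunit by (simp add: cand_def pb_of_nat pb_one)
 have bd: "\<forall>x. x \<in> cand --> card (I x) < Suc (card F)" by (auto simp: I_def less_Suc_eq_le intro: card_mono F(1))
 obtain w where w: "w \<in> cand" "\<And>x. x \<in> cand ==> card (I x) \<le> card (I w)"
  using ex_has_greatest_nat[of "\<lambda>x. x \<in> cand" pp "\<lambda>x. card (I x)" "Suc (card F)"] pc bd by metis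
 have wO: "w \<in> ?O" "w \<noteq> 0" "inverse w \<notin> ?O" "pp / w \<in> ?O" using w(1) by (auto simp: cand_def)
 have mem: "y / x \<in> ?O" if y: "y \<in> ?O" and x: "x \<noteq> 0" "pp / x \<in> ?O" and z: "z \<noteq> 0" "pp / z \<in> ?O" "y / z \<in> ?O"
  and eq: "I x = I z" for x y z
 proof -
  obtain f where f: "f \<in> F" "(y - f) / pp \<in> ?O" using F(3)[OF y] by blast
  have "(y - f) / z \<in> ?O" using tr[OF _ f(2) z(2)] by simp
  then have "f / z \<in> ?O" using pb_add[OF z(3) pb_minus] by (fastforce simp: diff_divide_distrib)
  then have "f / x \<in> ?O" using f(1) eq by (auto simp: I_def)
  moreover have "(y - f) / x \<in> ?O" using tr[OF _ f(2) x(2)] by simp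
  ultimately show ?thesis using pb_add by (fastforce simp: diff_divide_distrib)
 qed
 have Imono: "I x \<subseteq> I y" if "x / y \<in> ?O" "x \<noteq> 0" for x y using that tr[of x _ y] by (auto simp: I_def)
 have max: "x / w \<in> ?O" if x: "x \<in> ?O" "x = 0 \<or> inverse x \<notin> ?O" for x
 proof (cases "x = 0 \<or> x / pp \<in> ?O")
  case True then show ?thesis using tr[of pp x w] wO pb_zero by auto
 next
  case False
  then have c: "x \<in> cand" using x O_div[of x pp] by (auto simp: cand_def)
  show ?thesis
  proof (rule ccontr)
   assume "x / w \<notin> ?O"
   then have "I w \<subseteq> I x" using O_div[of x w] Imono wO by blast
   then have "I w = I x" using w(2)[OF c] finI by (metis card_seteq)
   then have "x / w \<in> ?O" using mem[OF x(1), of w x] wO c x(1) by (auto simp: cand_def pb_one)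
   then show False using \<open>x / w \<notin> ?O\<close> by blast
  qed
 qed
 \<comment> \<open>If no power of \<open>w\<close> were divisible by p, all powers would divide p;
   two of them would then have the same \<open>I\<close>, hence generate the same ideal, which makes
   \<open>w\<close> a unit.\<close>
 have "\<exists>k. w ^ k / pp \<in> ?O"
 proof (rule ccontr)
  assume neg: "\<not> ?thesis"
  then have p: "pp / w ^ k \<in> ?O" for k using O_div[of "w ^ k" pp] by blast
  have "\<not> inj (\<lambda>k. I (w ^ k))"
  proof
   assume "inj (\<lambda>k. I (w ^ k))"
   then have "infinite (range (\<lambda>k. I (w ^ k)))" by (rule range_inj_infinite)
   moreover have "range (\<lambda>k. I (w ^ k)) \<subseteq> Pow F" by (auto simp: I_def)
   ultimately show False using F(1) finite_subset by blast
  qed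
  then obtain k l where kl: "k < l" "I (w ^ k) = I (w ^ l)" unfolding inj_on_def by (metis linorder_neqE_nat UNIV_I)
  have "w ^ k / w ^ l \<in> ?O" using mem[of "w ^ k" "w ^ l" "w ^ k"] p wO kl(2) by (auto simp: pb_power pb_one)
  moreover have "w ^ k / w ^ l * w ^ (l - k - 1) = inverse w"
  proof -
   have "l = k + Suc (l - k - 1)" using kl(1) by simp
   then have "w ^ l = w ^ k * (w ^ (l - k - 1) * w)" by (metis power_add power_Suc2)
   then show ?thesis using wO by (simp add: field_simps)
  qed
  ultimately show False using pb_mult[OF _ pb_power[OF wO(1)], of "w ^ k / w ^ l" "l - k - 1"] wO(3) by simp
 qed
 then show ?thesis using that[OF wO(1-3) max] by blast
qed

lemma pb_complete_dvr:
 obtains w where "complete_dvr powerbounded w (card ((\<lambda>x. {y \<in> powerbounded. (y - x) / w \<in> powerbounded}) ` powerbounded))"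
  "\<And>x. x \<in> powerbounded ==> x = 0 \<or> inverse x \<notin> powerbounded ==> x / w \<in> powerbounded"
proof -
 let ?O = "powerbounded"
 obtain w where w: "w \<in> ?O" "w \<noteq> 0" "inverse w \<notin> ?O"
  "\<And>x. x \<in> ?O ==> x = 0 \<or> inverse x \<notin> ?O ==> x / w \<in> ?O"
  and "\<exists>k. w ^ k / pp \<in> ?O" using pb_uniformizer by blast
 then obtain e where e: "w ^ e / pp \<in> ?O" by blast
 obtain kp where kp: "?O \<subseteq> Lk kp" using pb_bounded by blast
 obtain a where a: "Lk a \<subseteq> ?O" using pb_contains by blast
 have pw: "w ^ (e * j) / pp ^ j \<in> ?O" for j using pb_power[OF e, of j] by (simp add: power_divide power_mult)
 \<comment> \<open>An element divisible by all powers of \<open>w\<close> is divisible by all powers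
   of p up to the bounded error \<open>kp\<close>, hence is 0 by the Hausdorff property of the
   lattice.\<close>
 have arch: "\<exists>k. x / w ^ k \<notin> ?O" if "x \<noteq> 0" for x
 proof (rule ccontr)
  assume "\<not> ?thesis"
  then have x: "x / w ^ k \<in> ?O" for k by blast
  have xp: "x / pp ^ j \<in> Lk kp" for j using pb_mult[OF x[of "e * j"] pw[of j]] kp w(2) by auto
  have "x = 0"
  proof (rule Lk_hausdorff[of kp])
   fix k assume k: "k \<ge> kp"
   have "x / pp ^ nat (k - kp) = x * pp powi (-(k - kp))"
    using k by (subst power_int_minus) (simp add: power_int_def divide_inverse)
   then show "x \<in> Lk k" using xp[of "nat (k - kp)"] Lk_shift[of x "-(k-kp)" k] by simp
  qed
  then show False using that by blast
 qed
 have valO: "\<exists>u k. x = u * w ^ k \<and> u \<in> ?O \<and> inverse u \<in> ?O" if x: "x \<in> ?O" "x \<noteq> 0" for x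
 proof -
  define k where "k = (LEAST k. x / w ^ k \<notin> ?O)"
  have k: "x / w ^ k \<notin> ?O" using LeastI_ex[OF arch[OF x(2)]] by (simp add: k_def)
  have "k \<noteq> 0" using k x by (intro notI) auto
  then have k1: "x / w ^ (k - 1) \<in> ?O" using not_less_Least[of "k - 1" "\<lambda>k. x / w ^ k \<notin> ?O"] by (auto simp: k_def)
  have "x / w ^ (k - 1) / w \<notin> ?O" using k \<open>k \<noteq> 0\<close> by (cases k) (auto simp: mult.commute)
  then have "inverse (x / w ^ (k - 1)) \<in> ?O" using w(4)[OF k1] by blast
  then show ?thesis using k1 w(2) by (intro exI[of _ "x / w ^ (k - 1)"] exI[of _ "k - 1"]) simp
 qed
 have val: "\<exists>u k. x = u * w powi k \<and> u \<in> ?O \<and> inverse u \<in> ?O" if "x \<noteq> 0" for x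
 proof (cases "x \<in> ?O")
  case True
  then obtain u k where "x = u * w ^ k" "u \<in> ?O" "inverse u \<in> ?O" using valO \<open>x \<noteq> 0\<close> by blast
  then show ?thesis by (intro exI[of _ u] exI[of _ "int k"]) simp
 next
  case False
  then obtain u k where u: "inverse x = u * w ^ k" "u \<in> ?O" "inverse u \<in> ?O"
   using valO[of "inverse x"] pb_valuation \<open>x \<noteq> 0\<close> by auto
  then have "x = inverse u * w powi (- int k)" by (metis inverse_inverse_eq inverse_mult_distrib power_int_minus power_int_of_nat)
  then show ?thesis using u by (intro exI[of _ "inverse u"] exI[of _ "- int k"]) simp
 qed
 \<comment> \<open>Comparison of the two topologies: \<open>e0\<close> powers of p bring the lattice
   into \<open>powerbounded\<close>, and since \<open>w\<close> divides p the other \<open>i\<close>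
   powers of p give \<open>i\<close> powers of \<open>w\<close>.\<close>
 have Lw: "x / pp ^ (e0 + i) \<in> L ==> x / w ^ i \<in> ?O" if "e0 = nat a" for x i e0
 proof -
  assume "x / pp ^ (e0 + i) \<in> L"
  then have "x \<in> Lk (int (e0 + i))" using Lk_nat by blast
  then have "x / pp ^ i \<in> Lk (int e0)" using Lk_shift[of x "- int i" "int (e0 + i)"] by (simp add: power_int_minus divide_inverse)
  then have "x / pp ^ i \<in> ?O" using a Lk_mono[of a "int e0"] that by (meson int_nat_eq nat_le_iff order_refl subsetD zle_int)
  moreover have "pp / w \<in> ?O" using w(4)[OF pb_of_nat] pp_pb_nonunit by auto
  then have "(pp / w) ^ i \<in> ?O" using pb_power by blast
  ultimately have "x / pp ^ i * (pp / w) ^ i \<in> ?O" using pb_mult by blast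
  then show ?thesis by (simp add: power_divide)
 qed
 have comp: "\<exists>x\<in>?O. \<forall>i. (x - X i) / w ^ i \<in> ?O"
  if X: "\<And>i. X i \<in> ?O" "\<And>i. (X (Suc i) - X i) / w ^ i \<in> ?O" for X
 proof -
  have X2: "(X (i + j) - X i) / w ^ i \<in> ?O" for i j
  proof (induction j)
   case (Suc j)
   have "(X (Suc (i + j)) - X (i + j)) / w ^ (i + j) * w ^ j \<in> ?O" using X(2) pb_mult pb_power w(1) by blast
   then have "(X (Suc (i + j)) - X (i + j)) / w ^ i \<in> ?O" using w(2) by (simp add: power_add)
   then show ?case using pb_add[OF Suc] by (fastforce simp: diff_divide_distrib)
  qed (simp add: pb_zero)
  define N where "N = nat (- kp)"
  \<comment> \<open>Completeness is available only p-adically in the lattice: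
    \<open>w ^ (e * i)\<close> is divisible by \<open>pp ^ i\<close>, and the factor
    \<open>pp ^ N\<close> moves \<open>powerbounded\<close> into the lattice.\<close>
  define Y where "Y i = X (e * i) * pp ^ N" for i
  have XL: "x * pp ^ N \<in> L" if "x \<in> ?O" for x
  proof -
   have "- int N \<le> kp" by (simp add: N_def)
   then have "x \<in> Lk (- int N)" using that kp Lk_mono[of "- int N" kp] by blast
   then show ?thesis by (simp add: Lk_def)
  qed
  have "\<exists>x. \<forall>i. (x - Y i) / pp ^ i \<in> L"
  proof (rule L_complete)
   show "Y i \<in> L" for i using XL X by (simp add: Y_def)
   fix i
   have "(X (e * i + e) - X (e * i)) / w ^ (e * i) * (w ^ (e * i) / pp ^ i) \<in> ?O" using X2 pw pb_mult by blast
   then have "(X (e * i + e) - X (e * i)) / pp ^ i \<in> ?O" using w(2) by simp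
   from XL[OF this] show "(Y (Suc i) - Y i) / pp ^ i \<in> L" by (simp add: Y_def field_simps)
  qed
  then obtain y where y: "\<And>i. (y - Y i) / pp ^ i \<in> L" by blast
  define x where "x = y / pp ^ N"
  have "(x - X i) / w ^ i \<in> ?O" for i
  proof -
   \<comment> \<open>\<open>N\<close> undoes the factor \<open>pp ^ N\<close>, \<open>nat a\<close>
     pays for the way from the lattice back to \<open>powerbounded\<close>, and \<open>i\<close> is
     the precision wanted.\<close>
   define j where "j = nat a + i + N"
   define j' where "j' = max i (e * j)"
   have "(y - Y j) / pp ^ j = (x - X (e * j)) / pp ^ (nat a + i)" by (simp add: x_def Y_def j_def power_add field_simps)
   then have 1: "(x - X (e * j)) / w ^ i \<in> ?O" using y[of j] Lw by simp
   have 2: "(X j' - X i) / w ^ i \<in> ?O" using X2[of i "j' - i"] by (simp add: j'_def)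
   have "e * j \<ge> i \<or> e = 0" by (cases e) (auto simp: j_def)
   moreover have "e \<noteq> 0" using e pp_pb_nonunit by (intro notI) (simp add: divide_inverse)
   ultimately have "j' = e * j" by (simp add: j'_def)
   then have "(x - X (e * j)) / w ^ i + (X (e * j) - X i) / w ^ i \<in> ?O" using pb_add[OF 1] 2 by simp
   then show ?thesis by (simp add: diff_divide_distrib)
  qed note x = this
  have "x \<in> ?O" using pb_add[OF x[of 0] X(1)[of 0]] by simp
  then show ?thesis using x by blast
 qed
 have fin: "finite ((\<lambda>x. {y \<in> ?O. (y - x) / w \<in> ?O}) ` ?O)"
 proof -
  obtain F where F: "finite F" "F \<subseteq> ?O" "\<And>x. x \<in> ?O ==> \<exists>f\<in>F. (x - f) / pp \<in> ?O" using pb_finite by metis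
  have ppw: "pp / w \<in> ?O" using w(4)[OF pb_of_nat] pp_pb_nonunit by auto
  have "(\<lambda>x. {y \<in> ?O. (y - x) / w \<in> ?O}) ` ?O \<subseteq> (\<lambda>x. {y \<in> ?O. (y - x) / w \<in> ?O}) ` F"
  proof
   fix A assume "A \<in> (\<lambda>x. {y \<in> ?O. (y - x) / w \<in> ?O}) ` ?O"
   then obtain x where x: "x \<in> ?O" "A = {y \<in> ?O. (y - x) / w \<in> ?O}" by blast
   obtain f where f: "f \<in> F" "(x - f) / pp \<in> ?O" using F(3)[OF x(1)] by blast
   have xf: "(x - f) / w \<in> ?O" using pb_mult[OF f(2) ppw] by simp
   have "(y - x) / w \<in> ?O \<longleftrightarrow> (y - f) / w \<in> ?O" for y
    using pb_add[OF xf, of "(y - x) / w"] pb_add[OF pb_minus[OF xf], of "(y - f) / w"] by (auto simp: diff_divide_distrib)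
   then show "A \<in> (\<lambda>x. {y \<in> ?O. (y - x) / w \<in> ?O}) ` F" using x(2) f(1) by auto
  qed
  then show ?thesis using F(1) finite_surj by blast
 qed
 have "complete_dvr ?O w (card ((\<lambda>x. {y \<in> ?O. (y - x) / w \<in> ?O}) ` ?O))"
  by unfold_locales (use w val comp fin pb_zero pb_one pb_add pb_minus pb_mult in auto)
 then show ?thesis using that w(4) by blast
qed

end

section \<open>Rings of integers of \<open>p\<close>-adic fields\<close>

lemma ring_on_simps [simp]:
 "carrier (ring_on S) = S" "mult (ring_on S) = (*)" "one (ring_on S) = 1"
 "zero (ring_on S) = 0" "add (ring_on S) = (+)" by (simp_all add: ring_on_def)

lemma cring_ring_on:
 fixes S :: "'a::comm_ring_1 set"
 assumes "0 \<in> S" "1 \<in> S" "\<And>x y. x \<in> S ==> y \<in> S ==> x + y \<in> S"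
  "\<And>x. x \<in> S ==> - x \<in> S" "\<And>x y. x \<in> S ==> y \<in> S ==> x * y \<in> S"
 shows "cring (ring_on S)"
proof (rule cringI)
 show "abelian_group (ring_on S)" by (rule abelian_groupI) (use assms in \<open>auto simp: algebra_simps intro!: bexI[of _ "- _"]\<close>)
 show "Group.comm_monoid (ring_on S)" by (rule comm_monoidI) (use assms in \<open>auto simp: algebra_simps\<close>)
qed (use assms in \<open>auto simp: algebra_simps\<close>)

lemma a_inv_ring_on: "x \<in> S ==> cring (ring_on S) ==> - x \<in> S ==> \<ominus>\<^bsub>ring_on S\<^esub> x = - x"
 for x :: "'a::comm_ring_1" by (rule abelian_group.minus_equality[of "ring_on S"]) (auto simp: cring_def ring_def)

lemma subfield_closed:
 fixes K :: "'a::field set"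
 assumes "subfield K (ring_on UNIV)"
 shows "0 \<in> K" "1 \<in> K" "x \<in> K ==> y \<in> K ==> x + y \<in> K" "x \<in> K ==> - x \<in> K"
  "x \<in> K ==> y \<in> K ==> x * y \<in> K" "x \<in> K ==> inverse x \<in> K"
proof -
 have cr: "cring (ring_on (UNIV :: 'a set))" by (rule cring_ring_on) auto
 note sr = subring.axioms[OF subfieldE(1)[OF assms]]
 show K0: "0 \<in> K" and "1 \<in> K" "x \<in> K ==> y \<in> K ==> x + y \<in> K" and
  xy: "x \<in> K ==> y \<in> K ==> x * y \<in> K" using subringE(2,3,6,7)[OF subfieldE(1)[OF assms]] by auto
 show "x \<in> K ==> - x \<in> K" using subringE(5)[OF subfieldE(1)[OF assms], of x] a_inv_ring_on[OF _ cr, of x] by simp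
 show "inverse x \<in> K" if "x \<in> K"
 proof (cases "x = 0")
  case False
  have "x \<in> Units (ring_on UNIV \<lparr>carrier := K\<rparr>)"
   using subfield.subfield_Units[OF assms] False that by simp
  then obtain y where "y \<in> K" "y * x = 1" by (auto simp: Units_def)
  then show ?thesis by (metis inverse_unique mult.commute)
 qed (use K0 in simp)
qed

locale padic_numbers =
 fixes p :: nat and Qp :: "'k::field_char_0 set" and absp :: "'k \<Rightarrow> real"
 assumes Qp: "is_Qp p Qp absp"
begin

lemma prime_p: "Factorial_Ring.prime p" using Qp by (simp add: is_Qp_def)

lemma p_gt1: "p > 1" using prime_p prime_gt_1_nat by blast

lemma Qp_closed:
 shows "0 \<in> Qp" "1 \<in> Qp" "x \<in> Qp ==> y \<in> Qp ==> x + y \<in> Qp" "x \<in> Qp ==> - x \<in> Qp"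
  "x \<in> Qp ==> y \<in> Qp ==> x * y \<in> Qp" "x \<in> Qp ==> inverse x \<in> Qp" using subfield_closed[of Qp] Qp by (auto simp: is_Qp_def)

lemma Qp_diff: "x \<in> Qp ==> y \<in> Qp ==> x - y \<in> Qp" using Qp_closed(3)[OF _ Qp_closed(4)] by fastforce

lemma Qp_divide: "x \<in> Qp ==> y \<in> Qp ==> x / y \<in> Qp" using Qp_closed(5)[OF _ Qp_closed(6)] by (simp add: divide_inverse)

lemma Qp_of_nat: "of_nat n \<in> Qp" by (induction n) (auto simp: Qp_closed)

lemma Qp_of_int: "of_int n \<in> Qp" using Qp_of_nat Qp_closed(4) by (cases n) (metis of_int_of_nat_eq, metis of_int_minus of_int_of_nat_eq)

lemma Qp_of_rat: "of_rat x \<in> Qp"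
proof (cases x)
 case (Fract a b)
 then show ?thesis using Qp_divide[OF Qp_of_int Qp_of_int, of a b] by (simp add: of_rat_rat)
qed

lemma Qp_power: "x \<in> Qp ==> x ^ i \<in> Qp" by (induction i) (auto simp: Qp_closed)

lemma abs_nonneg: "x \<in> Qp ==> absp x \<ge> 0"
 and abs_0_iff: "x \<in> Qp ==> absp x = 0 \<longleftrightarrow> x = 0"
 and abs_mult: "x \<in> Qp ==> y \<in> Qp ==> absp (x * y) = absp x * absp y"
 and abs_tri: "x \<in> Qp ==> y \<in> Qp ==> absp (x + y) \<le> absp x + absp y"
 and abs_rat: "absp (of_rat r) = padic_abs p r"
 and abs_dense: "x \<in> Qp ==> \<epsilon> > 0 ==> \<exists>y. absp (x - of_rat y) < \<epsilon>"
 and abs_complete: "(\<And>i. X i \<in> Qp) ==> (\<And>\<epsilon>. \<epsilon> > 0 ==> \<exists>N. \<forall>i\<ge>N. \<forall>j\<ge>N. absp (X i - X j) < \<epsilon>) ==>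
   \<exists>L\<in>Qp. (\<lambda>i. absp (X i - L)) \<longlonglongrightarrow> 0" using Qp unfolding is_Qp_def by blast+

lemma abs_1: "absp 1 = 1" using abs_mult[of 1 1] abs_0_iff[of 1] Qp_closed(2) by simp

lemma abs_minus: assumes "x \<in> Qp" shows "absp (- x) = absp x"
proof -
 have "absp (-1) * absp (-1) = 1" using abs_mult[of "-1" "-1"] abs_1 Qp_closed by simp
 then have "absp (-1) = 1"
  using abs_nonneg[of "-1"] Qp_closed by (metis abs_1 abs_mult_self_eq abs_of_nonneg mult_cancel_left1 power2_eq_1_iff power2_eq_square minus_equation_iff neg_0_le_iff_le not_one_le_zero)
 then show ?thesis using abs_mult[of "-1" x] assms Qp_closed by simp
qed

lemma abs_divide: assumes "x \<in> Qp" "y \<in> Qp" shows "absp (x / y) = absp x / absp y"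
proof (cases "y = 0")
 case True then show ?thesis using abs_0_iff[of 0] Qp_closed(1) by simp
next
 case False
 then have "absp (x / y) * absp y = absp x" using abs_mult[of "x / y" y] assms Qp_divide by simp
 then show ?thesis using False assms abs_0_iff by (simp add: field_simps)
qed

lemma abs_int_le: "absp (of_int n) \<le> 1"
proof -
 have "padic_abs p (of_int n) \<le> 1" using p_gt1 by (simp add: padic_abs_def powr_minus inverse_le_1_iff ge_one_powr_ge_zero)
 then show ?thesis using abs_rat[of "of_int n"] by simp
qed

lemma abs_p: "absp (of_nat p) = 1 / real p"
proof -
 have "padic_abs p (of_int (int p)) = 1 / real p" using p_gt1 prime_p by (simp add: padic_abs_def powr_minus_divide not_dvd_imp_multiplicity_0)
 then show ?thesis using abs_rat[of "of_int (int p)"] by simp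
qed

lemma rat_le_1:
 assumes "absp (of_rat r) \<le> 1"
 obtains a b where "r = of_int a / of_int b" "\<not> int p dvd b" "b \<noteq> 0" "absp (of_int b) = 1"
proof -
 obtain a b where ab: "quotient_of r = (a, b)" by fastforce
 note b = quotient_of_denom_pos[OF ab] and r = quotient_of_div[OF ab] and co = quotient_of_coprime[OF ab]
 have prime: "Factorial_Ring.prime (int p)" using prime_p by simp
 have nd: "\<not> int p dvd b"
 proof
  assume pb: "int p dvd b"
  then have pa: "\<not> int p dvd a" using co prime by (metis coprime_common_divisor not_prime_unit)
  then have "a \<noteq> 0" by auto
  have "multiplicity (int p) b \<ge> 1" using pb b prime by (intro multiplicity_geI) (auto simp: not_prime_unit)
  then have "real p powr 1 \<le> padic_abs p r" unfolding padic_abs_def ab using \<open>a \<noteq> 0\<close> pa p_gt1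
   using powr_mono[of 1 "real (multiplicity (int p) b)" "real p"] by (simp add: not_dvd_imp_multiplicity_0)
  then show False using assms abs_rat[of r] p_gt1 by simp
 qed
 have "padic_abs p (of_int b) = 1" using nd b p_gt1 by (simp add: padic_abs_def not_dvd_imp_multiplicity_0)
 then have "absp (of_int b) = 1" using abs_rat[of "of_int b"] by simp
 then show ?thesis using that r nd b by auto
qed

text \<open>Only the triangle inequality is built into \<open>is_Qp\<close>. For rationals factor
  out the larger summand: the quotient has a denominator prime to p, so adding 1 to it leaves the
  absolute value at most 1. \<open>abs_ultra\<close> extends this by density.\<close>

lemma abs_ultra_rat: "absp (of_rat (x + y)) \<le> max (absp (of_rat x)) (absp (of_rat y))"
proof -
 have *: "absp (of_rat (x + y)) \<le> absp (of_rat y)" if le: "absp (of_rat x) \<le> absp (of_rat y)" for x y :: rat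
 proof (cases "y = 0")
  case True
  then have "absp (of_rat x) = 0" using le abs_0_iff[of 0] abs_nonneg[OF Qp_of_rat[of x]] Qp_closed(1) by simp
  then show ?thesis using True le by simp
 next
  case False
  have ypos: "absp (of_rat y) > 0" using abs_nonneg[OF Qp_of_rat] abs_0_iff[OF Qp_of_rat] False by (metis less_eq_real_def of_rat_eq_0_iff)
  have "absp (of_rat (x / y)) \<le> 1" using le ypos abs_divide[OF Qp_of_rat Qp_of_rat, of x y] by (simp add: of_rat_divide)
  then obtain a b where ab: "x / y = of_int a / of_int b" "b \<noteq> 0" "absp (of_int b) = 1" using rat_le_1 by metis
  have "x + y = y * (of_int (a + b) / of_int b)" using ab(1,2) False by (simp add: field_simps)
  then have "absp (of_rat (x + y)) = absp (of_rat y) * (absp (of_int (a + b)) / absp (of_int b))"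
   using abs_mult[OF Qp_of_rat Qp_of_rat, of y "of_int (a + b) / of_int b"] abs_divide[OF Qp_of_int Qp_of_int, of "a + b" b]
   by (simp add: of_rat_mult of_rat_divide of_rat_add)
  also have "... \<le> absp (of_rat y) * 1" using ab(3) abs_int_le[of "a + b"] ypos by (intro mult_left_mono) auto
  finally show ?thesis by simp
 qed
 show ?thesis using *[of x y] *[of y x] by (cases "absp (of_rat x) \<le> absp (of_rat y)") (auto simp: add.commute)
qed

lemma abs_ultra: assumes x: "x \<in> Qp" and y: "y \<in> Qp" shows "absp (x + y) \<le> max (absp x) (absp y)"
proof (rule field_le_epsilon)
 fix e :: real assume e: "e > 0"
 obtain a where a: "absp (x - of_rat a) < e / 3" using abs_dense[OF x, of "e/3"] e by auto
 obtain b where b: "absp (y - of_rat b) < e / 3" using abs_dense[OF y, of "e/3"] e by auto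
 have mem: "x - of_rat a \<in> Qp" "y - of_rat b \<in> Qp" using x y Qp_diff Qp_of_rat by auto
 have "absp (x + y) \<le> absp ((x - of_rat a) + (y - of_rat b)) + absp (of_rat (a + b))"
  using abs_tri[of "(x - of_rat a) + (y - of_rat b)" "of_rat (a + b)"] mem Qp_closed(3) Qp_of_rat by (simp add: of_rat_add)
 also have "... \<le> absp (x - of_rat a) + absp (y - of_rat b) + absp (of_rat (a + b))" using abs_tri[OF mem] by simp
 also have "absp (of_rat (a + b)) \<le> max (absp (of_rat a)) (absp (of_rat b))" by (rule abs_ultra_rat)
 also have "absp (of_rat a) \<le> absp x + absp (x - of_rat a)" using abs_tri[OF x Qp_closed(4)[OF mem(1)]] abs_minus[OF mem(1)] by simp
 also have "absp (of_rat b) \<le> absp y + absp (y - of_rat b)" using abs_tri[OF y Qp_closed(4)[OF mem(2)]] abs_minus[OF mem(2)] by simp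
 finally show "absp (x + y) \<le> max (absp x) (absp y) + e" using a b by linarith
qed

text \<open>By the ultrametric inequality a rational whose distance to \<open>x\<close> is below
  \<open>absp x\<close> has the same absolute value, so no values appear beyond those of the
  rationals.\<close>

lemma abs_value: assumes x: "x \<in> Qp" "x \<noteq> 0" obtains k where "absp x = real p powi k"
proof -
 have pos: "absp x > 0" using abs_nonneg[OF x(1)] abs_0_iff[OF x(1)] x(2) by simp
 obtain a where a: "absp (x - of_rat a) < absp x" using abs_dense[OF x(1) pos] by blast
 have mem: "x - of_rat a \<in> Qp" using x Qp_diff Qp_of_rat by auto
 have "absp x \<le> max (absp (x - of_rat a)) (absp (of_rat a))" using abs_ultra[OF mem Qp_of_rat[of a]] by simp
 moreover have "absp (of_rat a) \<le> max (absp x) (absp (x - of_rat a))" using abs_ultra[OF x(1) Qp_closed(4)[OF mem]] abs_minus[OF mem] by simp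
 ultimately have eq: "absp x = padic_abs p a" using a abs_rat[of a] by simp
 obtain c d where cd: "quotient_of a = (c, d)" by fastforce
 have "c \<noteq> 0" using eq pos cd by (auto simp: padic_abs_def)
 then have "padic_abs p a = real p powr (of_int (int (multiplicity (int p) d) - int (multiplicity (int p) c)))" unfolding padic_abs_def cd by simp
 also have "... = real p powi (int (multiplicity (int p) d) - int (multiplicity (int p) c))" using p_gt1 by (intro powr_real_of_int') auto
 finally show ?thesis using that eq by simp
qed

lemma abs_lt_1: assumes x: "x \<in> Qp" "absp x < 1" shows "absp (x / of_nat p) \<le> 1"
proof (cases "x = 0")
 case False
 then obtain k where k: "absp x = real p powi k" using abs_value x by blast
 have "k < 0"
 proof (rule ccontr)
  assume "\<not> k < 0"
  then have "real p powi k \<ge> 1" using p_gt1 by (simp add: power_int_def)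
  then show False using k x(2) by simp
 qed
 then have "real p powi k \<le> real p powi (-1)" using p_gt1 by (intro power_int_increasing) auto
 moreover have "absp (x / of_nat p) = real p powi k / (1 / real p)" by (simp only: abs_divide[OF x(1) Qp_of_nat] k abs_p)
 ultimately show ?thesis using p_gt1 by (simp add: field_simps)
qed (use abs_0_iff[of 0] Qp_closed(1) in simp)

definition Zp :: "'k set" where "Zp = {y \<in> Qp. absp y \<le> 1}"

lemma Zp_0 [simp]: "0 \<in> Zp" and Zp_1 [simp]: "1 \<in> Zp" using abs_0_iff[of 0] abs_1 Qp_closed by (auto simp: Zp_def)

lemma Zp_add: "x \<in> Zp ==> y \<in> Zp ==> x + y \<in> Zp" using abs_ultra[of x y] Qp_closed by (fastforce simp: Zp_def)

lemma Zp_minus: "x \<in> Zp ==> - x \<in> Zp" using abs_minus Qp_closed by (auto simp: Zp_def)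

lemma Zp_mult: "x \<in> Zp ==> y \<in> Zp ==> x * y \<in> Zp" using abs_mult[of x y] abs_nonneg Qp_closed by (auto simp: Zp_def mult_le_one)

lemma Zp_power: "x \<in> Zp ==> x ^ i \<in> Zp" by (induction i) (auto simp: Zp_mult)

lemma Zp_Qp: "x \<in> Zp ==> x \<in> Qp" by (simp add: Zp_def)

lemma Zp_of_nat: "of_nat n \<in> Zp" by (induction n) (auto simp: Zp_add)

lemma abs_p_power: "absp (of_nat p ^ k) = 1 / real p ^ k" by (induction k) (auto simp: abs_1 abs_mult abs_p Qp_of_nat Qp_power)

lemma Zp_p_power: "x \<in> Qp ==> x / of_nat p ^ k \<in> Zp \<longleftrightarrow> absp x \<le> 1 / real p ^ k"
 using p_gt1 by (simp add: Zp_def Qp_divide Qp_power Qp_of_nat abs_divide abs_p_power field_simps)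

text \<open>Density gives a rational at distance less than 1; its denominator is prime to p and is
  inverted modulo p by Bezout, so the rational is congruent to a natural number below p.\<close>

lemma Zp_residue: assumes x: "x \<in> Zp" shows "\<exists>c<p. (x - of_nat c) / of_nat p \<in> Zp"
proof -
 obtain r where r: "absp (x - of_rat r) < 1" using abs_dense[OF Zp_Qp[OF x], of 1] by auto
 have mem: "x - of_rat r \<in> Qp" using x Zp_Qp Qp_diff Qp_of_rat by auto
 have "absp (of_rat r) \<le> 1"
  using abs_ultra[OF Zp_Qp[OF x] Qp_closed(4)[OF mem]] abs_minus[OF mem] r x by (simp add: Zp_def max_def split: if_splits)
 then obtain a b where ab: "r = of_int a / of_int b" "\<not> int p dvd b" "b \<noteq> 0" "absp (of_int b) = 1" using rat_le_1 by metis
 have "coprime b (int p)" using ab(2) prime_p by (metis coprime_commute prime_imp_coprime prime_nat_int_transfer)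
 then obtain b' m where bb: "b * b' + m * int p = 1" using bezout_int[of b "int p"] by (metis coprime_iff_gcd_eq_1 mult.commute)
 define c where "c = nat (a * b' mod int p)"
 have c: "int c = a * b' mod int p" using p_gt1 by (simp add: c_def)
 have "int p dvd a - b * int c"
 proof -
  have "int p dvd a * b' - int c" unfolding c by (simp add: mod_eq_dvd_iff[symmetric])
  then have "int p dvd b * (a * b' - int c)" by simp
  moreover have "a * (b * b' + m * int p) = a" by (simp add: bb)
  then have "b * (a * b' - int c) = (a - b * int c) - a * m * int p" by (simp add: algebra_simps)
  ultimately have "int p dvd (a - b * int c - a * m * int p) + a * m * int p" by (metis dvd_add dvd_triv_right)
  then show ?thesis by simp
 qed
 then obtain l where l: "a - b * int c = int p * l" by blast
 have "of_rat r - of_nat c = (of_int (a - b * int c) / of_int b :: 'k)"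
 proof -
  have "of_rat r = (of_int a / of_int b :: 'k)" by (simp add: ab(1) of_rat_divide)
  then show ?thesis using ab(3) by (simp add: field_simps)
 qed
 also have "... = of_nat p * of_int l / of_int b" by (simp only: l of_int_mult of_int_of_nat_eq)
 finally have "absp (of_rat r - of_nat c) = absp (of_nat p) * absp (of_int l)"
  using ab(4) abs_divide[OF Qp_closed(5)[OF Qp_of_nat Qp_of_int] Qp_of_int] abs_mult[OF Qp_of_nat Qp_of_int] by simp
 also have "... \<le> 1 / real p * 1" unfolding abs_p using abs_int_le by (intro mult_left_mono) auto
 finally have "absp (of_rat r - of_nat c) \<le> 1 / real p" by simp
 moreover have "1 / real p < 1" using p_gt1 by simp
 ultimately have "absp (of_rat r - of_nat c) < 1" by linarith
 then have "absp (x - of_nat c) < 1" using abs_ultra[OF mem Qp_diff[OF Qp_of_rat Qp_of_nat], of r c] r by simp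
 then have "absp ((x - of_nat c) / of_nat p) \<le> 1" using abs_lt_1 Qp_diff[OF Zp_Qp[OF x] Qp_of_nat] by blast
 moreover have "int c < int p" unfolding c by (rule pos_mod_bound) (use p_gt1 in simp)
 then have "c < p" by simp
 ultimately show ?thesis using Qp_divide[OF Qp_diff[OF Zp_Qp[OF x] Qp_of_nat] Qp_of_nat] by (auto simp: Zp_def)
qed

lemma Zp_complete:
 assumes X: "\<And>i. X i \<in> Zp" "\<And>i. (X (Suc i) - X i) / of_nat p ^ i \<in> Zp"
 shows "\<exists>x\<in>Zp. \<forall>i. (x - X i) / of_nat p ^ i \<in> Zp"
proof -
 have XQ: "X i \<in> Qp" for i using X Zp_Qp by blast
 have X2: "absp (X (i + j) - X i) \<le> 1 / real p ^ i" for i j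
 proof (induction j)
  case (Suc j)
  have "absp (X (Suc (i + j)) - X (i + j)) \<le> 1 / real p ^ (i + j)" using X(2)[of "i + j"] Zp_p_power Qp_diff XQ by blast
  also have "... \<le> 1 / real p ^ i" using p_gt1 by (intro divide_left_mono power_increasing) auto
  finally show ?case using abs_ultra[OF Qp_diff[OF XQ XQ] Qp_diff[OF XQ XQ], of "Suc (i + j)" "i + j" "i + j" i] Suc by simp
 qed (use abs_0_iff[of 0] Qp_closed(1) in simp)
 have small: "\<exists>N. 1 / real p ^ N < \<epsilon>" if "\<epsilon> > 0" for \<epsilon>
  using real_arch_pow_inv[OF that, of "1 / real p"] p_gt1 by (auto simp: power_divide)
 have "\<exists>L\<in>Qp. (\<lambda>i. absp (X i - L)) \<longlonglongrightarrow> 0"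
 proof (rule abs_complete[OF XQ])
  fix \<epsilon> :: real assume "\<epsilon> > 0"
  then obtain N where N: "1 / real p ^ N < \<epsilon>" using small by blast
  have "absp (X i - X j) < \<epsilon>" if "i \<ge> N" "j \<ge> N" for i j
  proof -
   have "absp (X i - X N) \<le> 1 / real p ^ N" "absp (X j - X N) \<le> 1 / real p ^ N" using X2[of N "i - N"] X2[of N "j - N"] that by auto
   moreover have "absp (X i - X j) \<le> max (absp (X i - X N)) (absp (X j - X N))"
    using abs_ultra[OF Qp_diff[OF XQ XQ] Qp_closed(4)[OF Qp_diff[OF XQ XQ]], of i N j N]
     abs_minus[OF Qp_diff[OF XQ XQ], of j N] by simp
   ultimately show ?thesis using N by linarith
  qed
  then show "\<exists>N. \<forall>i\<ge>N. \<forall>j\<ge>N. absp (X i - X j) < \<epsilon>" by blast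
 qed
 then obtain x where x: "x \<in> Qp" "(\<lambda>i. absp (X i - x)) \<longlonglongrightarrow> 0" by blast
 have xi: "(x - X i) / of_nat p ^ i \<in> Zp" for i
 proof -
  have "1 / real p ^ i > 0" using p_gt1 by simp
  from order_tendstoD(2)[OF x(2) this] obtain N where N: "\<And>j. j \<ge> N ==> absp (X j - x) < 1 / real p ^ i"
   unfolding eventually_sequentially by blast
  define j where "j = max i N"
  have j: "j \<ge> i" "absp (X j - x) < 1 / real p ^ i" using N[of j] by (auto simp: j_def)
  have "absp (X i - x) \<le> max (absp (X i - X j)) (absp (X j - x))" using abs_ultra[OF Qp_diff[OF XQ XQ] Qp_diff[OF XQ x(1)], of i j j] by simp
  moreover have "absp (X i - X j) = absp (X j - X i)" using abs_minus[OF Qp_diff[OF XQ XQ], of i j] by simp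
  moreover have "absp (x - X i) = absp (X i - x)" using abs_minus[OF Qp_diff[OF XQ x(1)], of i] by simp
  ultimately show ?thesis using X2[of i "j - i"] j Zp_p_power[OF Qp_diff[OF x(1) XQ]] by simp
 qed
 have "x \<in> Zp" using Zp_add[OF xi[of 0] X(1)[of 0]] by simp
 then show ?thesis using xi by blast
qed

lemma Zp_hausdorff: assumes "x \<in> Qp" "\<And>k. x / of_nat p ^ k \<in> Zp" shows "x = 0"
proof (rule ccontr)
 assume "x \<noteq> 0"
 then have "absp x > 0" using abs_nonneg abs_0_iff assms by fastforce
 then obtain N where "1 / real p ^ N < absp x" using real_arch_pow_inv[of "absp x" "1 / real p"] p_gt1 by (auto simp: power_divide)
 then show False using assms Zp_p_power[of x N] by simp
qed

lemma Zp_cover: assumes "x \<in> Qp" shows "\<exists>k. x * of_nat p ^ k \<in> Zp"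
proof -
 obtain N where "absp x < real p ^ N" using real_arch_pow[of "real p" "absp x"] p_gt1 by auto
 moreover have "absp (x * of_nat p ^ N) = absp x * (1 / real p ^ N)" by (simp only: abs_mult[OF assms Qp_power[OF Qp_of_nat]] abs_p_power)
 ultimately have "absp (x * of_nat p ^ N) \<le> 1" using p_gt1 by (simp add: divide_le_eq)
 then show ?thesis using Qp_closed(5)[OF assms Qp_power[OF Qp_of_nat]] by (auto simp: Zp_def)
qed

end

section \<open>Finitely generated modules over the p-adic integers\<close>

context padic_numbers
begin

definition lat :: "'k set \<Rightarrow> 'k set" where
 "lat B = {\<Sum>b\<in>B. c b * b | c. \<forall>b\<in>B. c b \<in> Zp}"

lemma latI: "(\<And>b. b \<in> B ==> c b \<in> Zp) ==> (\<Sum>b\<in>B. c b * b) \<in> lat B" by (auto simp: lat_def)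

lemma latE: assumes "x \<in> lat B" obtains c where "x = (\<Sum>b\<in>B. c b * b)" "\<And>b. b \<in> B ==> c b \<in> Zp"
 using assms by (auto simp: lat_def)

lemma lat_zero: "0 \<in> lat B" using latI[of B "\<lambda>_. 0"] by simp

lemma lat_add: "x \<in> lat B ==> y \<in> lat B ==> x + y \<in> lat B"
proof -
 assume "x \<in> lat B" "y \<in> lat B"
 then obtain c d where "x = (\<Sum>b\<in>B. c b * b)" "\<And>b. b \<in> B ==> c b \<in> Zp"
  "y = (\<Sum>b\<in>B. d b * b)" "\<And>b. b \<in> B ==> d b \<in> Zp" unfolding lat_def by blast
 then show ?thesis using latI[of B "\<lambda>b. c b + d b"] by (simp add: Zp_add distrib_right sum.distrib)
qed

lemma lat_scale: "x \<in> lat B ==> z \<in> Zp ==> z * x \<in> lat B"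
proof -
 assume "x \<in> lat B" and z: "z \<in> Zp"
 then obtain c where "x = (\<Sum>b\<in>B. c b * b)" "\<And>b. b \<in> B ==> c b \<in> Zp" by (metis latE)
 then show ?thesis using latI[of B "\<lambda>b. z * c b"] z by (simp add: Zp_mult sum_distrib_left mult.assoc)
qed

lemma lat_minus: "x \<in> lat B ==> - x \<in> lat B" using lat_scale[of x B "-1"] Zp_minus[of 1] by simp

lemma lat_diff: "x \<in> lat B ==> y \<in> lat B ==> x - y \<in> lat B" using lat_add[OF _ lat_minus] by fastforce

lemma lat_sum: "(\<And>i. i \<in> I ==> f i \<in> lat B) ==> sum f I \<in> lat B"
 by (induction I rule: infinite_finite_induct) (auto simp: lat_zero lat_add)

lemma lat_insert: "finite B ==> b \<notin> B ==> lat (insert b B) = {z * b + y | z y. z \<in> Zp \<and> y \<in> lat B}"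
proof (intro equalityI subsetI)
 fix x assume f: "finite B" "b \<notin> B" and "x \<in> lat (insert b B)"
 then obtain c where "x = (\<Sum>b\<in>insert b B. c b * b)" "\<And>a. a \<in> insert b B ==> c a \<in> Zp" by (metis latE)
 then show "x \<in> {z * b + y | z y. z \<in> Zp \<and> y \<in> lat B}" using f latI[of B c] by auto
next
 fix x assume f: "finite B" "b \<notin> B" and "x \<in> {z * b + y | z y. z \<in> Zp \<and> y \<in> lat B}"
 then obtain z y where zy: "x = z * b + y" "z \<in> Zp" "y \<in> lat B" by blast
 obtain c where "y = (\<Sum>b\<in>B. c b * b)" "\<And>a. a \<in> B ==> c a \<in> Zp" using latE[OF zy(3)] by blast
 with zy have *: "x = z * b + (\<Sum>b\<in>B. c b * b)" "z \<in> Zp" "\<And>a. a \<in> B ==> c a \<in> Zp" by auto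
 have "(\<Sum>a\<in>insert b B. (c(b := z)) a * a) = z * b + (\<Sum>b\<in>B. c b * b)" using f by (simp) (rule sum.cong, auto)
 then show "x \<in> lat (insert b B)" using latI[of "insert b B" "c(b := z)"] * by (metis fun_upd_apply insertE)
qed

text \<open>Induction on the generators: a submodule is controlled by its intersection with
  \<open>lat B\<close> and by the ideal of coefficients of the new generator \<open>b\<close>. The
  generators may be dependent, so this coefficient is not a function of the element, and
  \<open>I i\<close> asks for the existence of a partner \<open>y\<close>.\<close>

lemma lat_noetherian:
 assumes "finite B" and "\<And>i. M i \<subseteq> lat B" and "\<And>i. M i \<subseteq> M (Suc i)" and "\<And>i. 0 \<in> M i"
  and "\<And>i x y. x \<in> M i ==> y \<in> M i ==> x + y \<in> M i" and "\<And>i z x. x \<in> M i ==> z \<in> Zp ==> z * x \<in> M i"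
 shows "\<exists>N. \<forall>i\<ge>N. M i = M N" using assms
proof (induction B arbitrary: M rule: finite_induct)
 case empty
 then have "M i = {0}" for i by (auto simp: lat_def)
 then show ?case by auto
next
 case (insert b B)
 note M = insert.prems
 have Mmono: "i \<le> j ==> M i \<subseteq> M j" for i j using M(2) by (simp add: lift_Suc_mono_le)
 have Mdiff: "x \<in> M i ==> y \<in> M i ==> x - y \<in> M i" for x y i using M(4)[of x i "- y"] M(5)[of y i "-1"] Zp_minus[of 1] by simp
 have "\<exists>N. \<forall>i\<ge>N. M i \<inter> lat B = M N \<inter> lat B" by (rule insert.IH) (use M lat_zero lat_add lat_scale in auto)
 then obtain N1 where N1: "\<And>i. i \<ge> N1 ==> M i \<inter> lat B = M N1 \<inter> lat B" by blast
 define I where "I i = {z \<in> Zp. \<exists>y\<in>lat B. z * b + y \<in> M i}" for i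
 have Imono: "i \<le> j ==> I i \<subseteq> I j" for i j using Mmono[of i j] by (auto simp: I_def)
 have Iscale: "u * z \<in> I i" if zI: "z \<in> I i" and uZ: "u \<in> Zp" for u z i
 proof -
  obtain y where y: "y \<in> lat B" "z * b + y \<in> M i" "z \<in> Zp" using zI unfolding I_def by blast
  have "u * (z * b + y) \<in> M i" using M(5)[OF y(2) uZ] .
  then have "u * z * b + u * y \<in> M i" by (simp add: algebra_simps)
  then show ?thesis using lat_scale[OF y(1) uZ] Zp_mult[OF uZ y(3)] by (auto simp: I_def)
 qed
 have "\<exists>N. \<forall>i\<ge>N. I i = I N"
 proof (cases "\<forall>i. I i \<subseteq> {0}")
  case True
  have "0 \<in> I i" for i using M(3) lat_zero by (auto simp: I_def intro!: bexI[of _ 0])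
  with True have "I i = {0}" for i by auto
  then show ?thesis by auto
 next
  case False
  \<comment> \<open>The least such \<open>k\<close> singles out an element of maximal absolute value
    in the union of all \<open>I i\<close>. It divides every other element, so the
    \<open>I i\<close> containing it is already the whole union.\<close>
  define P where "P k \<longleftrightarrow> (\<exists>i z. z \<in> I i \<and> z \<noteq> 0 \<and> z / of_nat p ^ k \<notin> Zp)" for k
  obtain i0 z0 where z0: "z0 \<in> I i0" "z0 \<noteq> 0" using False by auto
  have "\<exists>k. z0 / of_nat p ^ k \<notin> Zp" using Zp_hausdorff[of z0] z0 by (auto simp: I_def Zp_Qp)
  then have "\<exists>k. P k" using z0 unfolding P_def by blast
  define k where "k = (LEAST k. P k)"
  have "P k" unfolding k_def using \<open>\<exists>k. P k\<close> by (rule LeastI_ex)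
  then obtain i z where z: "z \<in> I i" "z \<noteq> 0" "z / of_nat p ^ k \<notin> Zp" by (auto simp: P_def)
  have "I j \<subseteq> I i" if "j \<ge> i" for j
  proof
   fix y assume y: "y \<in> I j"
   have zQ: "z \<in> Qp" "y \<in> Qp" using z(1) y by (auto simp: I_def Zp_Qp)
   have "k \<noteq> 0" using z by (intro notI) (auto simp: I_def)
   then obtain k' where k': "k = Suc k'" by (cases k) auto
   then have "\<not> P k'" using not_less_Least[of k' P] by (simp add: k_def)
   then have "y / of_nat p ^ k' \<in> Zp" using y Zp_0 unfolding P_def by (cases "y = 0") auto
   then have "absp y \<le> 1 / real p ^ k'" using Zp_p_power zQ by blast
   moreover have "absp (z / of_nat p ^ k') \<ge> 1"
   proof (rule ccontr)
    assume "\<not> ?thesis"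
    then have "absp (z / of_nat p ^ k' / of_nat p) \<le> 1" using zQ(1) by (intro abs_lt_1 Qp_divide Qp_power Qp_of_nat) auto
    then show False using z(3) k' zQ(1) Qp_divide[OF zQ(1) Qp_power[OF Qp_of_nat], of p k] by (simp add: Zp_def mult.commute)
   qed
   then have "absp z \<ge> 1 / real p ^ k'" using zQ(1) p_gt1 by (simp add: abs_divide Qp_power Qp_of_nat abs_p_power field_simps)
   ultimately have "absp y \<le> absp z" by linarith
   moreover have "absp z > 0" using abs_0_iff[OF zQ(1)] abs_nonneg[OF zQ(1)] z(2) by simp
   ultimately have "y / z \<in> Zp" using abs_divide[OF zQ(2,1)] Qp_divide[OF zQ(2,1)] by (simp add: Zp_def)
   then show "y \<in> I i" using Iscale[OF z(1), of "y / z"] z(2) by simp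
  qed
  then show ?thesis using Imono[of i] by (intro exI[of _ i]) blast
 qed
 then obtain N2 where N2: "\<And>i. i \<ge> N2 ==> I i = I N2" by blast
 define N where "N = max N1 N2"
 have "M i \<subseteq> M N" if i: "i \<ge> N" for i
 proof
  fix m assume m: "m \<in> M i"
  then obtain z y where zy: "m = z * b + y" "z \<in> Zp" "y \<in> lat B" using M(1)[of i] lat_insert[OF insert.hyps] by auto
  have "z \<in> I i" using m zy by (auto simp: I_def)
  then have "z \<in> I N" using N2[of i] N2[of N] i by (simp add: N_def)
  then obtain y' where y': "y' \<in> lat B" "z * b + y' \<in> M N" by (auto simp: I_def)
  then have "m - (z * b + y') \<in> M i" using Mdiff m Mmono[OF i] by blast
  moreover have "m - (z * b + y') = y - y'" using zy by simp
  ultimately have "y - y' \<in> M i \<inter> lat B" using lat_diff zy y' by auto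
  then have "y - y' \<in> M N" using N1[of i] N1[of N] i by (auto simp: N_def)
  then have "(z * b + y') + (y - y') \<in> M N" using M(4) y' by blast
  then show "m \<in> M N" using zy by simp
 qed
 then have "\<forall>i\<ge>N. M i = M N" using Mmono by blast
 then show ?case by blast
qed

end

locale padic_field_ext = padic_numbers p Qp absp for p and Qp :: "'k::field_char_0 set" and absp +
 assumes finite_ext: "\<exists>B. finite B \<and> (\<forall>x. \<exists>c. (\<forall>b\<in>B. c b \<in> Qp) \<and> x = (\<Sum>b\<in>B. c b * b))"
begin

text \<open>A spanning set of least cardinality is independent, since a relation would eliminate one
  of its elements.\<close>

lemma basis_exists:
 "\<exists>B. finite B \<and> (\<forall>x. \<exists>c. (\<forall>b\<in>B. c b \<in> Qp) \<and> x = (\<Sum>b\<in>B. c b * b)) \<and>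
  (\<forall>c. (\<forall>b\<in>B. c b \<in> Qp) --> (\<Sum>b\<in>B. c b * b) = 0 --> (\<forall>b\<in>B. c b = 0))"
proof -
 define spans where "spans B \<longleftrightarrow> finite B \<and> (\<forall>x. \<exists>c. (\<forall>b\<in>B. c b \<in> Qp) \<and> x = (\<Sum>b\<in>B. c b * b))" for B :: "'k set"
 have "\<exists>B. spans B" using finite_ext by (simp add: spans_def)
 then obtain B where B: "spans B" "\<And>B'. spans B' ==> card B \<le> card B'" using ex_has_least_nat[of spans _ card] by metis
 have fB: "finite B" using B(1) by (simp add: spans_def)
 have "\<forall>b\<in>B. c b = 0" if c: "\<And>b. b \<in> B ==> c b \<in> Qp" "(\<Sum>b\<in>B. c b * b) = 0" for c
 proof (rule ccontr)
  assume "\<not> ?thesis"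
  then obtain b0 where b0: "b0 \<in> B" "c b0 \<noteq> 0" by blast
  have "c b0 * b0 + (\<Sum>b\<in>B - {b0}. c b * b) = 0" using c(2) b0(1) fB by (simp add: sum.remove)
  then have b0eq: "b0 = (\<Sum>b\<in>B - {b0}. - (c b / c b0) * b)"
   using b0(2) by (simp add: sum_negf sum_divide_distrib[symmetric] field_simps eq_neg_iff_add_eq_0)
  have "spans (B - {b0})" unfolding spans_def
  proof (intro conjI allI)
   fix x
   obtain d where d: "\<forall>b\<in>B. d b \<in> Qp" "x = (\<Sum>b\<in>B. d b * b)" using B(1) by (auto simp: spans_def)
   have "x = d b0 * b0 + (\<Sum>b\<in>B - {b0}. d b * b)" using d(2) b0(1) fB by (simp add: sum.remove)
   also have "d b0 * b0 = (\<Sum>b\<in>B - {b0}. - (d b0 * c b / c b0) * b)" by (subst b0eq) (simp add: sum_distrib_left algebra_simps)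
   finally have "x = (\<Sum>b\<in>B - {b0}. (- (d b0 * c b / c b0) + d b) * b)" by (simp add: sum.distrib[symmetric] left_diff_distrib)
   moreover have "\<forall>b\<in>B-{b0}. - (d b0 * c b / c b0) + d b \<in> Qp"
    using d(1) c(1) b0(1) by (auto intro!: Qp_diff Qp_closed(5) Qp_divide)
   ultimately show "\<exists>c. (\<forall>b\<in>B - {b0}. c b \<in> Qp) \<and> x = (\<Sum>b\<in>B - {b0}. c b * b)"
    by (intro exI[of _ "\<lambda>b. - (d b0 * c b / c b0) + d b"] conjI)
  qed (use fB in simp)
  then have "card B \<le> card (B - {b0})" using B(2) by blast
  then show False using b0(1) fB by (metis card_Diff1_less not_le)
 qed
 then show ?thesis using B(1) by (intro exI[of _ B]) (auto simp: spans_def)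
qed

lemma lattice_exists:
 obtains B where "finite B" "compact_lattice p (lat B)"
proof -
 obtain B where B: "finite B" and spans: "\<And>x. \<exists>c. (\<forall>b\<in>B. c b \<in> Qp) \<and> x = (\<Sum>b\<in>B. c b * b)"
  and indep0: "\<forall>c. (\<forall>b\<in>B. c b \<in> Qp) --> (\<Sum>b\<in>B. c b * b) = 0 --> (\<forall>b\<in>B. c b = 0)"
  using basis_exists by (elim exE conjE) blast
 have indep: "b \<in> B ==> c b = 0" if "\<And>b. b \<in> B ==> c b \<in> Qp" "(\<Sum>b\<in>B. c b * b) = 0" for b c using indep0 that by blast
 let ?p = "of_nat p :: 'k"
 have p0: "?p \<noteq> 0" using p_gt1 by simp
 have cover: "\<exists>k. x * ?p ^ k \<in> lat B" for x
 proof -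
  obtain c where c: "\<forall>b\<in>B. c b \<in> Qp" "x = (\<Sum>b\<in>B. c b * b)" using spans[of x] by metis
  have "\<forall>b\<in>B. \<exists>k. c b * ?p ^ k \<in> Zp" using Zp_cover c by blast
  then obtain k where k: "\<And>b. b \<in> B ==> c b * ?p ^ k b \<in> Zp" by metis
  define K where "K = sum k B"
  have "c b * ?p ^ K \<in> Zp" if b: "b \<in> B" for b
  proof -
   have "k b \<le> K" using b B by (simp add: K_def member_le_sum)
   then have "c b * ?p ^ K = ?p ^ (K - k b) * (c b * ?p ^ k b)" by (simp flip: power_add)
   then show ?thesis using k[OF b] Zp_mult Zp_power Zp_of_nat by metis
  qed
  then have "(\<Sum>b\<in>B. c b * ?p ^ K * b) \<in> lat B" by (rule latI)
  moreover have "(\<Sum>b\<in>B. c b * ?p ^ K * b) = x * ?p ^ K" by (simp add: c(2) sum_distrib_right sum_distrib_left mult_ac)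
  ultimately show ?thesis by metis
 qed
 have "compact_lattice p (lat B)"
 proof
  show "p > 1" by (rule p_gt1)
  show "\<exists>k. x * ?p ^ k \<in> lat B" for x by (rule cover)
  show "x = 0" if x: "\<And>k. x / ?p ^ k \<in> lat B" for x
  proof -
   obtain c where c: "x = (\<Sum>b\<in>B. c b * b)" "\<And>b. b \<in> B ==> c b \<in> Zp" using latE[of x B] x[of 0] by auto
   have "c b = 0" if b: "b \<in> B" for b
   proof (rule Zp_hausdorff)
    show "c b \<in> Qp" using c b Zp_Qp by blast
    fix k
    obtain d where d: "x / ?p ^ k = (\<Sum>b\<in>B. d b * b)" "\<And>b. b \<in> B ==> d b \<in> Zp" using latE[OF x[of k]] by blast
    have "(\<Sum>b\<in>B. (c b - ?p ^ k * d b) * b) = x - ?p ^ k * (\<Sum>b\<in>B. d b * b)"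
     by (simp add: c(1) sum_distrib_left left_diff_distrib sum_subtractf mult.assoc)
    also have "... = 0" using p0 by (simp flip: d(1))
    finally have "(\<lambda>b. c b - ?p ^ k * d b) b = 0"
    proof (rule indep[rotated 1])
     show "c b' - ?p ^ k * d b' \<in> Qp" if "b' \<in> B" for b'
      using c(2)[OF that] d(2)[OF that] by (intro Qp_diff Qp_closed(5) Qp_power Qp_of_nat Zp_Qp)
    qed (rule b)
    then have "c b = ?p ^ k * d b" by simp
    then show "c b / ?p ^ k \<in> Zp" using d(2)[OF b] p0 by simp
   qed
   then show ?thesis by (simp add: c(1))
  qed
  show "\<exists>a. \<forall>x\<in>lat B. \<forall>y\<in>lat B. x * y * ?p ^ a \<in> lat B"
  proof -
   obtain k where k: "\<And>x. x * ?p ^ k x \<in> lat B" using cover by metis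
   \<comment> \<open>A common denominator for the structure constants \<open>b * b'\<close>; by
     bilinearity it serves all products.\<close>
   define K where "K = (\<Sum>b\<in>B. \<Sum>b'\<in>B. k (b * b'))"
   have K: "b * b' * ?p ^ K \<in> lat B" if b: "b \<in> B" "b' \<in> B" for b b'
   proof -
    have "k (b * b') \<le> (\<Sum>b'\<in>B. k (b * b'))" using b B by (intro member_le_sum[of _ _ "\<lambda>b'. k (b * b')"]) auto
    also have "... \<le> K" unfolding K_def using b B by (intro member_le_sum[of _ _ "\<lambda>b. \<Sum>b'\<in>B. k (b * b')"]) auto
    finally have "b * b' * ?p ^ K = ?p ^ (K - k (b * b')) * (b * b' * ?p ^ k (b * b'))" by (simp flip: power_add)
    then show ?thesis using lat_scale[OF k[of "b * b'"] Zp_power[OF Zp_of_nat]] by metis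
   qed
   have "x * y * ?p ^ K \<in> lat B" if xy: "x \<in> lat B" "y \<in> lat B" for x y
   proof -
    obtain c where c: "x = (\<Sum>b\<in>B. c b * b)" "\<And>b. b \<in> B ==> c b \<in> Zp" using latE[OF xy(1)] by blast
    obtain d where d: "y = (\<Sum>b\<in>B. d b * b)" "\<And>b. b \<in> B ==> d b \<in> Zp" using latE[OF xy(2)] by blast
    have "x * y * ?p ^ K = (\<Sum>b\<in>B. \<Sum>b'\<in>B. c b * d b' * (b * b' * ?p ^ K))"
     by (simp only: c(1) d(1) sum_product sum_distrib_right) (intro sum.cong refl, simp add: sum_distrib_left sum_distrib_right mult_ac)
    also have "... \<in> lat B" using c(2) d(2) by (intro lat_sum lat_scale[OF K] Zp_mult) auto
    finally show ?thesis .
   qed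
   then show ?thesis by blast
  qed
  show "\<exists>F. finite F \<and> F \<subseteq> lat B \<and> (\<forall>x\<in>lat B. \<exists>f\<in>F. (x - f) / ?p \<in> lat B)"
  proof -
   define F where "F = (\<lambda>c::'k \<Rightarrow> nat. \<Sum>b\<in>B. of_nat (c b) * b) ` (B \<rightarrow>\<^sub>E {..<p})"
   have "finite F" unfolding F_def using B by (intro finite_imageI finite_PiE) auto
   moreover have "F \<subseteq> lat B" unfolding F_def by (auto intro!: latI Zp_of_nat)
   moreover have "\<exists>f\<in>F. (x - f) / ?p \<in> lat B" if x: "x \<in> lat B" for x
   proof -
    obtain c where c: "x = (\<Sum>b\<in>B. c b * b)" "\<And>b. b \<in> B ==> c b \<in> Zp" using latE[OF x] by blast
    then have "\<forall>b\<in>B. \<exists>r<p. (c b - of_nat r) / ?p \<in> Zp" using Zp_residue by blast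
    then obtain r where r: "\<And>b. b \<in> B ==> r b < p \<and> (c b - of_nat (r b)) / ?p \<in> Zp" by metis
    let ?f = "\<Sum>b\<in>B. of_nat (restrict r B b) * b"
    have "?f \<in> F" unfolding F_def by (rule imageI) (use r in auto)
    moreover have "(x - ?f) / ?p = (\<Sum>b\<in>B. (c b - of_nat (r b)) / ?p * b)"
     by (simp add: c(1) sum_subtractf[symmetric] sum_divide_distrib left_diff_distrib)
    then have "(x - ?f) / ?p \<in> lat B" using latI[of B "\<lambda>b. (c b - of_nat (r b)) / ?p"] r by simp
    ultimately show ?thesis by blast
   qed
   ultimately show ?thesis by (intro exI[of _ F]) blast
  qed
  show "\<exists>x. \<forall>i. (x - X i) / ?p ^ i \<in> lat B"
   if X: "\<And>i. X i \<in> lat B" "\<And>i. (X (Suc i) - X i) / ?p ^ i \<in> lat B" for X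
  proof -
   have "\<forall>i. \<exists>d. (X (Suc i) - X i) / ?p ^ i = (\<Sum>b\<in>B. d b * b) \<and> (\<forall>b\<in>B. d b \<in> Zp)"
    using X(2) by (simp add: lat_def)
   then obtain d where d: "\<And>i. (X (Suc i) - X i) / ?p ^ i = (\<Sum>b\<in>B. d i b * b)" "\<And>i b. b \<in> B ==> d i b \<in> Zp" by metis
   obtain c0 where c0: "X 0 = (\<Sum>b\<in>B. c0 b * b)" "\<And>b. b \<in> B ==> c0 b \<in> Zp" using latE[OF X(1)[of 0]] by blast
   \<comment> \<open>The coordinates are built up from those of the scaled increments, which makes
     each coordinate sequence visibly convergent.\<close>
   define c where "c i b = c0 b + (\<Sum>l<i. ?p ^ l * d l b)" for i b
   have cX: "X i = (\<Sum>b\<in>B. c i b * b)" for i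
   proof (induction i)
    case (Suc i)
    have "X (Suc i) = X i + ?p ^ i * (\<Sum>b\<in>B. d i b * b)" using p0 by (simp flip: d(1))
    also have "... = (\<Sum>b\<in>B. (c i b + ?p ^ i * d i b) * b)" by (simp add: Suc sum_distrib_left distrib_right sum.distrib mult.assoc)
    finally show ?case by (simp add: c_def add.assoc)
   qed (simp add: c_def c0)
   have cZ: "c i b \<in> Zp" if "b \<in> B" for i b
    using that by (induction i) (auto simp: c_def c0 d add.assoc[symmetric] intro!: Zp_add Zp_mult Zp_power Zp_of_nat)
   have "\<forall>b\<in>B. \<exists>x\<in>Zp. \<forall>i. (x - c i b) / ?p ^ i \<in> Zp"
   proof
    fix b assume b: "b \<in> B"
    show "\<exists>x\<in>Zp. \<forall>i. (x - c i b) / ?p ^ i \<in> Zp"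
     by (rule Zp_complete) (use cZ[OF b] d(2)[OF b] p0 in \<open>auto simp: c_def\<close>)
   qed
   then obtain x where x: "\<And>b i. b \<in> B ==> (x b - c i b) / ?p ^ i \<in> Zp" by metis
   have "((\<Sum>b\<in>B. x b * b) - X i) / ?p ^ i = (\<Sum>b\<in>B. (x b - c i b) / ?p ^ i * b)" for i
    by (simp add: cX sum_subtractf[symmetric] sum_divide_distrib left_diff_distrib)
   then have "((\<Sum>b\<in>B. x b * b) - X i) / ?p ^ i \<in> lat B" for i using latI[of B "\<lambda>b. (x b - c i b) / ?p ^ i"] x by simp
   then show ?thesis by blast
  qed
 qed (use lat_zero lat_add lat_minus in auto)
 then show ?thesis using that B by blast
qed

text \<open>A monic equation of degree d reduces every power to the powers below d, which bounds
  them all. Conversely, if the powers of x are bounded, the spans of 1, x, ..., x^(i-1) lie in one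
  lattice up to a scalar; this ascending chain stops, and where it stops there is a monic
  equation.\<close>

lemma integers_powerbounded:
 assumes B: "finite B" "compact_lattice p (lat B)"
 shows "integers_of Qp absp = compact_lattice.powerbounded p (lat B)"
proof -
 interpret compact_lattice p "lat B" by fact
 have scale: "z * x \<in> Lk k" if "x \<in> Lk k" "z \<in> Zp" for z x k using lat_scale that by (auto simp: Lk_def mult.assoc)
 show ?thesis
 proof (intro equalityI subsetI)
  fix x assume "x \<in> integers_of Qp absp"
  then obtain f where f: "lead_coeff f = 1" "\<And>i. Polynomial.coeff f i \<in> Zp" "poly f x = 0" by (auto simp: integers_of_def Zp_def)
  define d where "d = degree f"
  have d: "x ^ d = - (\<Sum>j<d. Polynomial.coeff f j * x ^ j)"
  proof -
   have "poly f x = (\<Sum>j<d. Polynomial.coeff f j * x ^ j) + x ^ d" using f(1) by (simp add: poly_altdef d_def lessThan_Suc_atMost[symmetric])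
   then show ?thesis using f(3) by (simp add: eq_neg_iff_add_eq_0 add.commute)
  qed
  obtain k where k: "\<And>y. y \<in> Lk (k y)" using Lk_cover by metis
  obtain N where N: "\<And>j. j < d ==> N \<le> k (x ^ j)"
   using bdd_below_finite[of "(\<lambda>j. k (x ^ j)) ` {..<d}"] by (auto simp: bdd_below_def)
  have "x ^ i \<in> Lk N" for i
  proof (induction i rule: less_induct)
   case (less i)
   show ?case
   proof (cases "i < d")
    case True then show ?thesis using k[of "x ^ i"] Lk_mono[OF N] by blast
   next
    case False
    have "x ^ i = x ^ (i - d) * x ^ d" using False by (simp flip: power_add)
    also have "... = - (\<Sum>j<d. Polynomial.coeff f j * x ^ (i - d + j))" by (simp add: d sum_distrib_left power_add algebra_simps)
    finally show ?thesis using less False f(2) by (auto intro!: Lk_minus Lk_sum scale)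
   qed
  qed
  then show "x \<in> powerbounded" by (auto simp: powerbounded_def)
 next
  fix x assume "x \<in> powerbounded"
  then obtain N where N: "\<And>i. x ^ i \<in> Lk N" by (auto simp: powerbounded_def)
  \<comment> \<open>The scalar moves all powers of \<open>x\<close> from \<open>Lk N\<close> into
    the lattice; it cancels from the relation that is found.\<close>
  let ?u = "pp powi (-N)"
  define M where "M i = {?u * (\<Sum>j<i. c j * x ^ j) | c. \<forall>j. c j \<in> Zp}" for i
  have "\<exists>N. \<forall>i\<ge>N. M i = M N"
  proof (rule lat_noetherian[OF B(1)])
   show "M i \<subseteq> lat B" for i using N by (auto simp: M_def sum_distrib_left Lk_def intro!: lat_sum)
     (metis lat_scale mult.assoc mult.commute)
   show "M i \<subseteq> M (Suc i)" for i
   proof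
    fix y assume "y \<in> M i"
    then obtain c where c: "y = ?u * (\<Sum>j<i. c j * x ^ j)" "\<forall>j. c j \<in> Zp" by (auto simp: M_def)
    have "y = ?u * (\<Sum>j<Suc i. (c(i := 0)) j * x ^ j)" by (simp add: c(1))
    then show "y \<in> M (Suc i)" using c(2) unfolding M_def by (auto intro!: exI[of _ "c(i := 0)"])
   qed
   show "0 \<in> M i" for i unfolding M_def by (auto intro!: exI[of _ "\<lambda>_. 0"])
   show "y + z \<in> M i" if yz: "y \<in> M i" "z \<in> M i" for y z i
   proof -
    obtain c d where "y = ?u * (\<Sum>j<i. c j * x ^ j)" "\<forall>j. c j \<in> Zp"
     "z = ?u * (\<Sum>j<i. d j * x ^ j)" "\<forall>j. d j \<in> Zp" using yz by (auto simp: M_def)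
    then show ?thesis unfolding M_def by (auto simp: distrib_right sum.distrib distrib_left Zp_add intro!: exI[of _ "\<lambda>j. c j + d j"])
   qed
   show "z * y \<in> M i" if y: "y \<in> M i" and z: "z \<in> Zp" for y z i
   proof -
    obtain c where "y = ?u * (\<Sum>j<i. c j * x ^ j)" "\<forall>j. c j \<in> Zp" using y by (auto simp: M_def)
    then show ?thesis unfolding M_def using z by (auto simp: sum_distrib_left algebra_simps Zp_mult intro!: exI[of _ "\<lambda>j. z * c j"])
   qed
  qed
  then obtain i where i: "M (Suc i) = M i" by (metis le_SucI order_refl)
  have "?u * x ^ i \<in> M (Suc i)" unfolding M_def by (auto intro!: exI[of _ "\<lambda>j. if j = i then 1 else 0"] simp: if_distrib cong: if_cong)
  then obtain c where c: "?u * x ^ i = ?u * (\<Sum>j<i. c j * x ^ j)" "\<And>j. c j \<in> Zp" unfolding i by (auto simp: M_def)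
  then have xi: "x ^ i = (\<Sum>j<i. c j * x ^ j)" using p_gt1 by simp
  define g where "g = (\<Sum>j<i. Polynomial.monom (c j) j)"
  define f where "f = Polynomial.monom 1 i - g"
  have cg: "Polynomial.coeff g j = (if j < i then c j else 0)" for j
   by (auto simp: g_def coeff_sum if_distrib[of "\<lambda>x. _ * x"] sum.delta cong: if_cong)
  have cf: "Polynomial.coeff f j = (if j = i then 1 else if j < i then - c j else 0)" for j by (auto simp: f_def cg)
  have deg: "degree f = i"
  proof (rule antisym)
   show "degree f \<le> i" by (rule degree_le) (simp add: cf)
   show "i \<le> degree f" by (rule le_degree) (simp add: cf)
  qed
  have "poly f x = 0" by (simp add: f_def g_def poly_sum poly_monom xi)
  moreover have "lead_coeff f = 1" by (simp add: deg cf)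
  moreover have "Polynomial.coeff f j \<in> Zp" for j using c(2) by (auto simp: cf Zp_minus)
  ultimately show "x \<in> integers_of Qp absp" unfolding integers_of_def Zp_def[symmetric] by blast
 qed
qed

theorem integers_complete_dvr:
 obtains w where "complete_dvr (integers_of Qp absp) w
   (card ((\<lambda>x. {y \<in> integers_of Qp absp. (y - x) / w \<in> integers_of Qp absp}) ` integers_of Qp absp))"
  "\<And>x. x \<in> integers_of Qp absp ==> x = 0 \<or> inverse x \<notin> integers_of Qp absp ==> x / w \<in> integers_of Qp absp"
proof -
 obtain B where B: "finite B" "compact_lattice p (lat B)" by (rule lattice_exists)
 show ?thesis using compact_lattice.pb_complete_dvr[OF B(2)] that unfolding integers_powerbounded[OF B] by blast
qed

end

section \<open>Fractional ideals and representatives modulo the ring\<close>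

context complete_dvr
begin

text \<open>The fractional ideal generated by the \<open>k\<close>-th power of \<open>w\<close>.
  Negative \<open>k\<close> are needed for the matrices that parametrize characters, which have
  denominators.\<close>

definition pw :: "int \<Rightarrow> 'k set" where "pw k = {x. x * w powi (-k) \<in> S}"

lemma w_add: "w powi (k + l) = w powi k * w powi l" by (simp add: power_int_add)

lemma pw_0: "pw 0 = S" by (simp add: pw_def)

lemma pw_nat: "x \<in> pw (int k) \<longleftrightarrow> x / w ^ k \<in> S" by (simp add: pw_def power_int_minus divide_inverse)

lemma pw_neg: "x \<in> pw (- int k) \<longleftrightarrow> x * w ^ k \<in> S" by (simp add: pw_def)

lemma S_diff: "x \<in> S ==> y \<in> S ==> x - y \<in> S" using S_add[OF _ S_minus] by fastforce

lemma pw_zero [simp]: "0 \<in> pw k" by (simp add: pw_def)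

lemma pw_add: "x \<in> pw k ==> y \<in> pw k ==> x + y \<in> pw k" by (simp add: pw_def S_add distrib_right)

lemma pw_minus: "x \<in> pw k ==> - x \<in> pw k" using S_minus[of "x * w powi (-k)"] by (simp add: pw_def)

lemma pw_minus_iff [simp]: "- x \<in> pw k \<longleftrightarrow> x \<in> pw k" using pw_minus[of x k] pw_minus[of "- x" k] by auto

lemma pw_diff: "x \<in> pw k ==> y \<in> pw k ==> x - y \<in> pw k" using pw_add[OF _ pw_minus] by fastforce

lemma pw_diff_commute: "x - y \<in> pw k \<longleftrightarrow> y - x \<in> pw k" using pw_minus_iff[of "x - y" k] by simp

lemma pw_sum: "(\<And>i. i \<in> I ==> f i \<in> pw k) ==> sum f I \<in> pw k" by (induction I rule: infinite_finite_induct) (auto simp: pw_add)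

lemma pw_mult: "x \<in> pw k ==> y \<in> pw l ==> x * y \<in> pw (k + l)"
proof -
 assume "x \<in> pw k" "y \<in> pw l"
 then have "x * w powi (-k) * (y * w powi (-l)) \<in> S" by (auto simp: pw_def intro: S_mult)
 moreover have "x * w powi (-k) * (y * w powi (-l)) = x * y * w powi (-(k + l))" using w_add[of "-k" "-l"] by simp
 ultimately show ?thesis by (simp add: pw_def)
qed

lemma pw_mult_S: "x \<in> pw k ==> y \<in> S ==> x * y \<in> pw k" "y \<in> S ==> x \<in> pw k ==> y * x \<in> pw k"
 using pw_mult[of x k y 0] pw_mult[of y 0 x k] by (auto simp: pw_0)

lemma pw_shift: "x * w powi j \<in> pw (k + j) \<longleftrightarrow> x \<in> pw k"
proof -
 have "x * w powi j * w powi (- (k + j)) = x * w powi (-k)"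
  by (simp add: mult.assoc w_add[symmetric])
 then show ?thesis by (simp only: pw_def mem_Collect_eq)
qed

lemma pw_w: "x * w \<in> pw (k + 1) \<longleftrightarrow> x \<in> pw k" "w * x \<in> pw (k + 1) \<longleftrightarrow> x \<in> pw k"
 using pw_shift[of x 1 k] by (auto simp: mult.commute)

lemma S_power: "x \<in> S ==> x ^ i \<in> S" by (induction i) (auto intro: S_mult)

lemma pw_mono: assumes "k \<le> l" shows "pw l \<subseteq> pw k"
proof
 fix x assume "x \<in> pw l"
 then have "x * w powi (-l) * w ^ nat (l - k) \<in> S" by (auto simp: pw_def intro: S_mult S_power w_S)
 moreover have "w powi (-k) = w powi (-l) * w ^ nat (l - k)" using w_add[of "-l" "l - k"] assms by (simp add: power_int_def)
 ultimately show "x \<in> pw k" by (simp add: pw_def mult.assoc)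
qed

lemma pw_S: "k \<ge> 0 ==> x \<in> pw k ==> x \<in> S" using pw_mono[of 0 k] by (auto simp: pw_0)

lemma one_notin_pw1: "1 \<notin> pw 1" using w_nonunit by (simp add: pw_def power_int_minus)

lemma S_unit: assumes "x \<in> S" "x \<notin> pw 1" shows "x \<noteq> 0" "inverse x \<in> S"
proof -
 show nz: "x \<noteq> 0" using assms(2) by auto
 obtain u k where u: "x = u * w powi k" "u \<in> S" "inverse u \<in> S" using valuation[OF nz] by blast
 have u0: "u \<noteq> 0" using nz u(1) by auto
 have "\<not> k \<ge> 1"
 proof
  assume "k \<ge> 1"
  then have "x \<in> pw 1" using pw_shift[of u k 0] u pw_mono[of 1 k] by (auto simp: pw_0)
  then show False using assms(2) by blast
 qed
 moreover have "\<not> k < 0"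
 proof
  assume "k < 0"
  have "x * inverse u \<in> S" using S_mult assms(1) u(3) by blast
  then have "w powi k \<in> S" using u(1) u0 by (simp add: field_simps)
  then have "w powi k * w ^ nat (-k - 1) \<in> S" using S_mult S_power w_S by blast
  moreover have "w powi k * w ^ nat (-k - 1) = inverse w" using w_add[of k "-k - 1"] \<open>k < 0\<close> by (simp add: power_int_def)
  ultimately show False using w_nonunit by simp
 qed
 ultimately have "k = 0" by linarith
 then show "inverse x \<in> S" using u by simp
qed

lemma pw_cover: "\<exists>k::nat. x \<in> pw (- int k)"
proof (cases "x = 0")
 case False
 then obtain u k where u: "x = u * w powi k" "u \<in> S" using valuation[OF False] by blast
 then have "x \<in> pw k" using pw_shift[of u k 0] by (simp add: pw_0)
 then have "x \<in> pw (- int (nat (-k)))" using pw_mono[of "- int (nat (- k))" k] by auto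
 then show ?thesis ..
qed auto

text \<open>A representative of the coset modulo \<open>S\<close>. The predicate depends on the
  coset only, so congruent elements receive the same one; \<open>red 0\<close> is some element of
  \<open>S\<close> and need not be 0.\<close>

definition red :: "'k \<Rightarrow> 'k" where "red x = (SOME y. y - x \<in> S)"

lemma red_diff: "red x - x \<in> S" unfolding red_def by (rule someI[of _ x]) simp

lemma red_diff': "x - red x \<in> S" using S_minus[OF red_diff[of x]] by simp

lemma red_eq: "red x = red y \<longleftrightarrow> x - y \<in> S"
proof
 assume "red x = red y"
 then show "x - y \<in> S" using S_add[OF red_diff'[of x] red_diff[of y]] by simp
next
 assume xy: "x - y \<in> S"
 have "z - x \<in> S \<longleftrightarrow> z - y \<in> S" for z using S_add[OF _ xy, of "z - x"] S_diff[OF _ xy, of "z - y"] by auto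
 then show "red x = red y" by (simp add: red_def)
qed

lemma red_red [simp]: "red (red x) = red x" by (simp add: red_eq red_diff)

lemma red_pw: "k \<le> 0 ==> red x \<in> pw k \<longleftrightarrow> x \<in> pw k"
 using pw_mono[of k 0] red_diff[of x] red_diff'[of x] pw_add[of "red x - x" k x] pw_add[of "x - red x" k "red x"] by (auto simp: pw_0)

definition Rk :: "nat \<Rightarrow> 'k set" where "Rk k = {x. red x = x \<and> x \<in> pw (- int k)}"

lemma Rk_0: "Rk 0 = {red 0}"
proof -
 have "x \<in> Rk 0 \<longleftrightarrow> x = red 0" for x
  using red_eq[of x 0] red_diff[of 0] by (auto simp: Rk_def pw_0)
 then show ?thesis by blast
qed

text \<open>Multiplication by \<open>w\<close> maps the classes with a pole of order at most
  \<open>k + 1\<close> onto those with a pole of order at most \<open>k\<close>;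
  \<open>z / w\<close> picks a preimage of \<open>z\<close>, and \<open>e\<close> runs through the
  kernel.\<close>

lemma Rk_Suc_bij: "bij_betw (\<lambda>(z, e). red (z / w + e)) (Rk k \<times> Rk 1) (Rk (Suc k))"
proof -
 have zw: "z / w \<in> pw (- int (Suc k)) \<longleftrightarrow> z \<in> pw (- int k)" for z k using pw_w(1)[of "z / w" "- int (Suc k)"] by simp
 show ?thesis
 proof (rule bij_betwI')
  fix x y assume x: "x \<in> Rk k \<times> Rk 1" and y: "y \<in> Rk k \<times> Rk 1"
  obtain z e where ze: "x = (z, e)" by fastforce
  obtain z' e' where ze': "y = (z', e')" by fastforce
  have r: "red z = z" "red z' = z'" "red e = e" "red e' = e'" "e \<in> pw (-1)" "e' \<in> pw (-1)" using x y ze ze' by (auto simp: Rk_def)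
  have "z = z' \<and> e = e'" if "red (z / w + e) = red (z' / w + e')"
  proof -
   have 1: "z / w + e - (z' / w + e') \<in> S" using that red_eq by blast
   then have "w * (z / w + e - (z' / w + e')) \<in> S" using S_mult w_S by blast
   moreover have "w * (e' - e) \<in> S" using pw_w(2)[of "e' - e" "-1"] pw_diff r by (simp add: pw_0)
   ultimately have "w * (z / w + e - (z' / w + e')) + w * (e' - e) \<in> S" using S_add by blast
   moreover have "w * (z / w + e - (z' / w + e')) + w * (e' - e) = z - z'" by (simp add: field_simps)
   ultimately have "z = z'" using red_eq[of z z'] r by simp
   then have "e - e' \<in> S" using 1 by simp
   then show ?thesis using red_eq[of e e'] r \<open>z = z'\<close> by simp
  qed
  then show "((\<lambda>(z, e). red (z / w + e)) x = (\<lambda>(z, e). red (z / w + e)) y) = (x = y)" using ze ze' by auto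
 next
  fix x assume "x \<in> Rk k \<times> Rk 1"
  then obtain z e where ze: "x = (z, e)" "z \<in> pw (- int k)" "e \<in> pw (-1)" by (auto simp: Rk_def)
  have "e \<in> pw (- int (Suc k))" using ze(3) pw_mono[of "- int (Suc k)" "-1"] by auto
  then have "z / w + e \<in> pw (- int (Suc k))" using zw[of z k] ze(2) pw_add by blast
  then show "(\<lambda>(z, e). red (z / w + e)) x \<in> Rk (Suc k)" using ze(1) red_pw by (simp add: Rk_def)
 next
  fix x assume x: "x \<in> Rk (Suc k)"
  define z where "z = red (w * x)"
  define e where "e = red (x - z / w)"
  have "w * x \<in> pw (- int k)" using x pw_w(2)[of x "- int (Suc k)"] by (simp add: Rk_def)
  then have "z \<in> Rk k" by (simp add: z_def Rk_def red_pw)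
  moreover have "x - z / w \<in> pw (-1)" using red_diff'[of "w * x"] pw_w(2)[of "x - z / w" "-1"] by (simp add: z_def pw_0 right_diff_distrib)
  then have "e \<in> Rk 1" using red_pw[of "-1"] by (simp add: e_def Rk_def)
  moreover have "red (z / w + e) = red x" using red_eq[of "z / w + e" x] red_diff[of "x - z / w"] by (simp add: e_def algebra_simps)
  then have "x = red (z / w + e)" using x by (simp add: Rk_def)
  ultimately show "\<exists>y\<in>Rk k \<times> Rk 1. x = (\<lambda>(z, e). red (z / w + e)) y" by (intro bexI[of _ "(z, e)"]) auto
 qed
qed

text \<open>Multiplication by \<open>w\<close> identifies the classes with at most a simple pole
  with the residue classes of \<open>S\<close>.\<close>

lemma Rk_1_bij: "bij_betw (\<lambda>x. {y \<in> S. (y - w * x) / w \<in> S}) (Rk 1) ((\<lambda>x. {y \<in> S. (y - x) / w \<in> S}) ` S)"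
proof (rule bij_betwI')
 fix x y assume "x \<in> Rk 1" "y \<in> Rk 1"
 then have xy: "red x = x" "red y = y" "w * x \<in> S" "w * y \<in> S" by (auto simp: Rk_def pw_def mult.commute)
 have "x = y" if eq: "{z \<in> S. (z - w * x) / w \<in> S} = {z \<in> S. (z - w * y) / w \<in> S}"
 proof -
  have "w * x \<in> {z \<in> S. (z - w * x) / w \<in> S}" using xy by simp
  then have "(w * x - w * y) / w \<in> S" using eq by blast
  then have "x - y \<in> S" by (simp add: right_diff_distrib[symmetric])
  then show ?thesis using red_eq[of x y] xy by simp
 qed
 then show "({z \<in> S. (z - w * x) / w \<in> S} = {z \<in> S. (z - w * y) / w \<in> S}) = (x = y)" by blast
next
 fix x assume "x \<in> Rk 1"
 then have "w * x \<in> S" by (auto simp: Rk_def pw_def mult.commute)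
 then show "{y \<in> S. (y - w * x) / w \<in> S} \<in> (\<lambda>x. {y \<in> S. (y - x) / w \<in> S}) ` S" by blast
next
 fix A assume "A \<in> (\<lambda>x. {y \<in> S. (y - x) / w \<in> S}) ` S"
 then obtain x where x: "x \<in> S" "A = {y \<in> S. (y - x) / w \<in> S}" by blast
 have d: "(x - w * red (x / w)) / w \<in> S" using red_diff'[of "x / w"] by (simp add: diff_divide_distrib)
 have "(y - x) / w \<in> S \<longleftrightarrow> (y - w * red (x / w)) / w \<in> S" for y
  using S_add[OF d, of "(y - x) / w"] S_diff[OF _ d, of "(y - w * red (x / w)) / w"] by (auto simp: diff_divide_distrib)
 then have "A = {y \<in> S. (y - w * red (x / w)) / w \<in> S}" using x by auto
 moreover have "x / w \<in> pw (-1)" using x(1) by (simp add: pw_def)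
 then have "red (x / w) \<in> Rk 1" using red_pw[of "-1" "x / w"] by (simp add: Rk_def)
 ultimately show "\<exists>x\<in>Rk 1. A = {y \<in> S. (y - w * x) / w \<in> S}" by blast
qed

lemma Rk_card: "finite (Rk k) \<and> card (Rk k) = q ^ k"
proof -
 have 1: "finite (Rk 1)" "card (Rk 1) = q" using Rk_1_bij finite_residues q_eq bij_betw_finite bij_betw_same_card by fastforce+
 show ?thesis
 proof (induction k)
  case 0 show ?case by (simp add: Rk_0)
 next
  case (Suc k)
  then show ?case using bij_betw_finite[OF Rk_Suc_bij, of k] bij_betw_same_card[OF Rk_Suc_bij, of k] 1
   by (simp add: card_cartesian_product mult.commute)
 qed
qed

lemmas Rk_finite = conjunct1[OF Rk_card] and card_Rk = conjunct2[OF Rk_card]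

lemma q_gt_1: "q > 1"
proof -
 have "red (1 / w) \<in> Rk 1" "red 0 \<in> Rk 1" using red_pw[of "-1" "1/w"] red_pw[of "-1" 0] by (auto simp: Rk_def pw_def)
 then have "card {red (1 / w), red 0} \<le> card (Rk 1)" by (intro card_mono Rk_finite) auto
 moreover have "red (1 / w) \<noteq> red 0" using w_nonunit by (simp add: red_eq divide_inverse)
 then have "card {red (1 / w), red 0} = 2" by simp
 ultimately show ?thesis using card_Rk[of 1] by simp
qed

end

section \<open>Matrices over a complete discrete valuation ring\<close>

declare minus_carrier_mat [simp]

lemma card_mat_entrywise:
 assumes "\<And>i j. i < a ==> j < b ==> finite (F i j)"
 shows "finite {A \<in> carrier_mat a b. \<forall>i<a. \<forall>j<b. A $$ (i, j) \<in> F i j}"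
  and "card {A \<in> carrier_mat a b. \<forall>i<a. \<forall>j<b. A $$ (i, j) \<in> F i j} =
   (\<Prod>(i, j)\<in>{..<a} \<times> {..<b}. card (F i j))"
proof -
 let ?I = "{..<a} \<times> {..<b}"
 have bij: "bij_betw (\<lambda>f. mat a b f) (\<Pi>\<^sub>E (i, j)\<in>?I. F i j) {A \<in> carrier_mat a b. \<forall>i<a. \<forall>j<b. A $$ (i, j) \<in> F i j}"
 proof (rule bij_betwI')
  fix f g assume f: "f \<in> (\<Pi>\<^sub>E (i, j)\<in>?I. F i j)" and g: "g \<in> (\<Pi>\<^sub>E (i, j)\<in>?I. F i j)"
  show "(mat a b f = mat a b g) = (f = g)"
  proof
   assume eq: "mat a b f = mat a b g"
   show "f = g"
   proof (rule PiE_ext[OF f g])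
    fix x assume "x \<in> ?I"
    then obtain i j where "x = (i, j)" "i < a" "j < b" by auto
    then show "f x = g x" using arg_cong[OF eq, of "\<lambda>A. A $$ (i, j)"] by simp
   qed
  qed simp
 next
  fix f assume "f \<in> (\<Pi>\<^sub>E (i, j)\<in>?I. F i j)"
  then show "mat a b f \<in> {A \<in> carrier_mat a b. \<forall>i<a. \<forall>j<b. A $$ (i, j) \<in> F i j}" by (auto dest: PiE_mem)
 next
  fix A assume A: "A \<in> {A \<in> carrier_mat a b. \<forall>i<a. \<forall>j<b. A $$ (i, j) \<in> F i j}"
  let ?f = "\<lambda>x\<in>?I. A $$ x"
  have "?f \<in> (\<Pi>\<^sub>E (i, j)\<in>?I. F i j)" using A by auto
  moreover have "A = mat a b ?f" using A by (intro eq_matI) auto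
  ultimately show "\<exists>f\<in>\<Pi>\<^sub>E (i, j)\<in>?I. F i j. A = mat a b f" by blast
 qed
 have fin: "finite (\<Pi>\<^sub>E (i, j)\<in>?I. F i j)" using assms by (intro finite_PiE) auto
 then show "finite {A \<in> carrier_mat a b. \<forall>i<a. \<forall>j<b. A $$ (i, j) \<in> F i j}" using bij_betw_finite[OF bij] by blast
 have "card (\<Pi>\<^sub>E (i, j)\<in>?I. F i j) = (\<Prod>(i, j)\<in>?I. card (F i j))" by (subst card_PiE) (auto intro!: prod.cong)
 then show "card {A \<in> carrier_mat a b. \<forall>i<a. \<forall>j<b. A $$ (i, j) \<in> F i j} = (\<Prod>(i, j)\<in>?I. card (F i j))"
  using bij_betw_same_card[OF bij] by simp
qed

context complete_dvr
begin

definition pm :: "nat \<Rightarrow> nat \<Rightarrow> int \<Rightarrow> 'k mat set" where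
 "pm a b k = {A \<in> carrier_mat a b. \<forall>i<a. \<forall>j<b. A $$ (i, j) \<in> pw k}"

lemma pmI: "A \<in> carrier_mat a b ==> (\<And>i j. i < a ==> j < b ==> A $$ (i, j) \<in> pw k) ==> A \<in> pm a b k" by (simp add: pm_def)

lemma pmD: "A \<in> pm a b k ==> i < a ==> j < b ==> A $$ (i, j) \<in> pw k" by (simp add: pm_def)

lemma pm_carrier: "A \<in> pm a b k ==> A \<in> carrier_mat a b" by (simp add: pm_def)

lemma pm_zero [simp]: "0\<^sub>m a b \<in> pm a b k" by (simp add: pm_def)

lemma pm_add: "A \<in> pm a b k ==> B \<in> pm a b k ==> A + B \<in> pm a b k" by (auto simp: pm_def pw_add)

lemma pm_minus: "A \<in> pm a b k ==> - A \<in> pm a b k" by (auto simp: pm_def)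

lemma pm_diff: "A \<in> pm a b k ==> B \<in> pm a b k ==> A - B \<in> pm a b k" by (auto simp: pm_def pw_diff)

lemma pm_mult: "A \<in> pm a b k ==> B \<in> pm b c l ==> A * B \<in> pm a c (k + l)" by (auto simp: pm_def scalar_prod_def intro!: pw_sum pw_mult)

lemma pm_mult_S: "A \<in> pm a b 0 ==> B \<in> pm b c k ==> A * B \<in> pm a c k"
  "B \<in> pm b c k ==> C \<in> pm c d 0 ==> B * C \<in> pm b d k" using pm_mult[of A a b 0 B c k] pm_mult[of B b c k C d 0] by auto

lemma pm_mono: "k \<le> l ==> A \<in> pm a b l ==> A \<in> pm a b k" using pw_mono[of k l] by (auto simp: pm_def)

lemma pm_smult: "A \<in> pm a b k ==> c \<in> pw l ==> c \<cdot>\<^sub>m A \<in> pm a b (l + k)" by (auto simp: pm_def pw_mult)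

lemma pm_w: "A \<in> carrier_mat a b ==> w \<cdot>\<^sub>m A \<in> pm a b (k + 1) \<longleftrightarrow> A \<in> pm a b k" by (auto simp: pm_def pw_w)

lemma pm_wpow: "A \<in> carrier_mat a b ==> w powi l \<cdot>\<^sub>m A \<in> pm a b (k + l) \<longleftrightarrow> A \<in> pm a b k"
proof -
 have "w powi l * x \<in> pw (k + l) \<longleftrightarrow> x \<in> pw k" for x using pw_shift[of x l k] by (simp add: mult.commute)
 then show "A \<in> carrier_mat a b ==> ?thesis" by (auto simp: pm_def)
qed

lemma one_pm [simp]: "1\<^sub>m a \<in> pm a a 0" by (auto simp: pm_def pw_0)

lemma pm_diff_commute: "A \<in> carrier_mat a b ==> B \<in> carrier_mat a b ==> A - B \<in> pm a b k \<longleftrightarrow> B - A \<in> pm a b k"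
 by (auto simp: pm_def pw_diff_commute)

lemma pm_diff_trans:
 assumes "A - B \<in> pm a b k" "B - C \<in> pm a b k" "A \<in> carrier_mat a b" "B \<in> carrier_mat a b" "C \<in> carrier_mat a b"
 shows "A - C \<in> pm a b k"
proof -
 have "A - C = (A - B) + (B - C)" using assms(3-5) by (intro eq_matI) auto
 then show ?thesis using pm_add[OF assms(1,2)] by simp
qed

definition redm :: "'k mat \<Rightarrow> 'k mat" where "redm = map_mat red"

lemma redm_carrier [simp]: "redm A \<in> carrier_mat a b \<longleftrightarrow> A \<in> carrier_mat a b" by (simp add: redm_def)

lemma redm_dim [simp]: "dim_row (redm A) = dim_row A" "dim_col (redm A) = dim_col A" by (simp_all add: redm_def)

lemma redm_eq: "A \<in> carrier_mat a b ==> B \<in> carrier_mat a b ==> redm A = redm B \<longleftrightarrow> A - B \<in> pm a b 0"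
proof
 assume AB: "A \<in> carrier_mat a b" "B \<in> carrier_mat a b" and eq: "redm A = redm B"
 have "red (A $$ (i, j)) = red (B $$ (i, j))" if "i < a" "j < b" for i j
  using arg_cong[OF eq, of "\<lambda>X. X $$ (i, j)"] AB that by (simp add: redm_def)
 then show "A - B \<in> pm a b 0" using AB by (auto simp: pm_def pw_0 red_eq)
next
 assume AB: "A \<in> carrier_mat a b" "B \<in> carrier_mat a b" and "A - B \<in> pm a b 0"
 then have "red (A $$ (i, j)) = red (B $$ (i, j))" if "i < a" "j < b" for i j using that by (auto simp: pm_def pw_0 red_eq)
 then show "redm A = redm B" using AB by (intro eq_matI) (auto simp: redm_def)
qed

lemma redm_diff: "A \<in> carrier_mat a b ==> redm A - A \<in> pm a b 0" "A \<in> carrier_mat a b ==> A - redm A \<in> pm a b 0"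
 by (auto simp: pm_def redm_def pw_0 red_diff red_diff')

lemma redm_redm [simp]: "redm (redm A) = redm A" by (intro eq_matI) (auto simp: redm_def)

lemma redm_pm: "k \<le> 0 ==> redm A \<in> pm a b k \<longleftrightarrow> A \<in> pm a b k" by (auto simp: pm_def redm_def red_pw)

definition Ys :: "nat \<Rightarrow> nat \<Rightarrow> 'k mat set" where
 "Ys a b = {Y \<in> carrier_mat a b. redm Y = Y}"

text \<open>The finite layer of classes killed by the \<open>k\<close>-th power of \<open>w\<close>;
  these layers exhaust \<open>Ys\<close>, and sums over them are the partial sums of the zeta
  function.\<close>

definition Yk :: "nat \<Rightarrow> nat \<Rightarrow> nat \<Rightarrow> 'k mat set" where
 "Yk a b k = {Y \<in> pm a b (- int k). redm Y = Y}"

lemma Ys_carrier: "Y \<in> Ys a b ==> Y \<in> carrier_mat a b" by (simp add: Ys_def)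

lemma Yk_carrier: "Y \<in> Yk a b k ==> Y \<in> carrier_mat a b" unfolding Yk_def using pm_carrier by blast

lemma Yk_Ys: "Yk a b k \<subseteq> Ys a b" by (auto simp: Yk_def Ys_def pm_carrier)

lemma redm_Ys [simp]: "A \<in> carrier_mat a b ==> redm A \<in> Ys a b" by (simp add: Ys_def)

lemma redm_Yk: "A \<in> carrier_mat a b ==> redm A \<in> Yk a b k \<longleftrightarrow> A \<in> pm a b (- int k)" by (simp add: Yk_def redm_pm)

lemma Yk_mono: "k \<le> l ==> Yk a b k \<subseteq> Yk a b l" using pm_mono[of "- int l" "- int k"] by (auto simp: Yk_def)

lemma pm_cover: assumes "A \<in> carrier_mat a b" shows "\<exists>k::nat. A \<in> pm a b (- int k)"
proof -
 obtain f where f: "\<And>x. x \<in> pw (- int (f x))" using pw_cover by metis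
 let ?I = "{..<a} \<times> {..<b}"
 define K where "K = (\<Sum>x\<in>?I. f (A $$ x))"
 have "A $$ (i, j) \<in> pw (- int K)" if "i < a" "j < b" for i j
 proof -
  have "f (A $$ (i, j)) \<le> K" unfolding K_def using that by (intro member_le_sum[of _ _ "\<lambda>x. f (A $$ x)"]) auto
  then show ?thesis using f[of "A $$ (i, j)"] pw_mono[of "- int K" "- int (f (A $$ (i, j)))"] by auto
 qed
 then show ?thesis using assms by (auto simp: pm_def)
qed

lemma Ys_eq: "Ys a b = (\<Union>k. Yk a b k)" using pm_cover by (auto simp: Ys_def Yk_def pm_carrier)

lemma Yk_entrywise: "Yk a b k = {A \<in> carrier_mat a b. \<forall>i<a. \<forall>j<b. A $$ (i, j) \<in> Rk k}"
proof -
 have "redm A = A \<longleftrightarrow> (\<forall>i<a. \<forall>j<b. red (A $$ (i, j)) = A $$ (i, j))" if A: "A \<in> carrier_mat a b" for A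
 proof
  assume eq: "redm A = A"
  show "\<forall>i<a. \<forall>j<b. red (A $$ (i, j)) = A $$ (i, j)" using arg_cong[OF eq, of "\<lambda>X. X $$ (_, _)"] A by (auto simp: redm_def)
    (metis carrier_matD(1) carrier_matD(2) eq index_map_mat(1) redm_def)
 next
  assume "\<forall>i<a. \<forall>j<b. red (A $$ (i, j)) = A $$ (i, j)"
  then show "redm A = A" using A by (intro eq_matI) (auto simp: redm_def)
 qed
 then show ?thesis by (auto simp: Yk_def pm_def Rk_def)
qed

lemma Yk_finite: "finite (Yk a b k)" unfolding Yk_entrywise by (rule card_mat_entrywise) (rule Rk_finite)

lemma card_Yk: "card (Yk a b k) = q ^ (k * (a * b))" unfolding Yk_entrywise by (subst card_mat_entrywise(2)) (auto simp: Rk_finite card_Rk power_mult)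

lemma Yk_0: "Yk a b 0 = {redm (0\<^sub>m a b)}"
proof -
 have "card (Yk a b 0) = 1" by (simp add: card_Yk)
 moreover have "redm (0\<^sub>m a b) \<in> Yk a b 0" by (simp add: redm_Yk)
 ultimately show ?thesis by (metis card_1_singletonE singletonD)
qed

definition lower_block :: "nat \<Rightarrow> nat \<Rightarrow> 'k mat \<Rightarrow> 'k mat" where
 "lower_block i j A = mat (dim_row A - i) (dim_col A - j) (\<lambda>(r, c). A $$ (r + i, c + j))"

lemma lower_block_Yk: "A \<in> Yk a b k ==> lower_block i j A \<in> Yk (a - i) (b - j) k" unfolding Yk_entrywise by (auto simp: lower_block_def)

text \<open>Each entry outside the lower right block is free and contributes a factor
  \<open>q ^ k\<close>.\<close>

lemma card_lower_block:
 assumes ij: "i \<le> a" "j \<le> b" and B: "\<B> \<subseteq> Yk (a - i) (b - j) k"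
 shows "card {A \<in> Yk a b k. lower_block i j A \<in> \<B>} = q ^ (k * (a * b - (a - i) * (b - j))) * card \<B>"
proof -
 have fib: "card {A \<in> Yk a b k. lower_block i j A = B0} = q ^ (k * (a * b - (a - i) * (b - j)))"
  if B0: "B0 \<in> Yk (a - i) (b - j) k" for B0
 proof -
  define F where "F r c = (if i \<le> r \<and> j \<le> c then {B0 $$ (r - i, c - j)} else Rk k)" for r c
  have B0c: "B0 \<in> carrier_mat (a - i) (b - j)" using B0 Yk_carrier by blast
  have B0R: "B0 $$ (r, c) \<in> Rk k" if "r < a - i" "c < b - j" for r c using B0 that unfolding Yk_entrywise by auto
  have eq: "{A \<in> Yk a b k. lower_block i j A = B0} = {A \<in> carrier_mat a b. \<forall>r<a. \<forall>c<b. A $$ (r, c) \<in> F r c}"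
  proof (intro equalityI subsetI)
   fix A assume "A \<in> {A \<in> Yk a b k. lower_block i j A = B0}"
   then have A: "A \<in> carrier_mat a b" "\<And>r c. r < a ==> c < b ==> A $$ (r, c) \<in> Rk k" "lower_block i j A = B0"
    unfolding Yk_entrywise by auto
   have "A $$ (r, c) = B0 $$ (r - i, c - j)" if "r < a" "c < b" "i \<le> r" "j \<le> c" for r c
    using A(1) that by (auto simp: A(3)[symmetric] lower_block_def)
   then show "A \<in> {A \<in> carrier_mat a b. \<forall>r<a. \<forall>c<b. A $$ (r, c) \<in> F r c}" using A(1,2) by (auto simp: F_def)
  next
   fix A assume "A \<in> {A \<in> carrier_mat a b. \<forall>r<a. \<forall>c<b. A $$ (r, c) \<in> F r c}"
   then have A: "A \<in> carrier_mat a b" "\<And>r c. r < a ==> c < b ==> A $$ (r, c) \<in> F r c" by auto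
   have "A $$ (r, c) \<in> Rk k" if "r < a" "c < b" for r c using A(2)[OF that] B0R[of "r - i" "c - j"] that by (auto simp: F_def split: if_splits)
   moreover have "lower_block i j A = B0" using A(1) B0c A(2)[of "_ + i" "_ + j"] ij by (intro eq_matI) (auto simp: lower_block_def F_def)
   ultimately show "A \<in> {A \<in> Yk a b k. lower_block i j A = B0}" using A(1) unfolding Yk_entrywise by auto
  qed
  have "card {A \<in> Yk a b k. lower_block i j A = B0} = (\<Prod>(r, c)\<in>{..<a} \<times> {..<b}. card (F r c))"
   unfolding eq by (rule card_mat_entrywise(2)) (simp add: F_def Rk_finite)
  also have "... = (\<Prod>x\<in>{..<a} \<times> {..<b}. if x \<in> {i..<a} \<times> {j..<b} then 1 else q ^ k)"
   by (rule prod.cong[OF refl]) (clarsimp simp: F_def card_Rk)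
  also have "... = (q ^ k) ^ card ({..<a} \<times> {..<b} - {i..<a} \<times> {j..<b})" by (subst prod.If_cases) (auto simp: Diff_eq)
  also have "card ({..<a} \<times> {..<b} - {i..<a} \<times> {j..<b}) = a * b - (a - i) * (b - j)"
   by (subst card_Diff_subset) (auto simp: card_cartesian_product)
  finally show ?thesis by (simp add: power_mult)
 qed
 have fB: "finite \<B>" using B Yk_finite finite_subset by blast
 have "{A \<in> Yk a b k. lower_block i j A \<in> \<B>} = (\<Union>B0\<in>\<B>. {A \<in> Yk a b k. lower_block i j A = B0})" by blast
 also have "card ... = (\<Sum>B0\<in>\<B>. card {A \<in> Yk a b k. lower_block i j A = B0})"
  using fB by (intro card_UN_disjoint) (auto simp: Yk_finite)
 also have "... = (\<Sum>B0\<in>\<B>. q ^ (k * (a * b - (a - i) * (b - j))))" using B fib by (intro sum.cong) auto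
 finally show ?thesis by simp
qed

definition Gl :: "nat \<Rightarrow> 'k mat set" where
 "Gl a = {K \<in> pm a a 0. \<exists>K'\<in>pm a a 0. K * K' = 1\<^sub>m a \<and> K' * K = 1\<^sub>m a}"

lemma Gl_pm: "K \<in> Gl a ==> K \<in> pm a a 0" by (simp add: Gl_def)

lemma Gl_carrier: "K \<in> Gl a ==> K \<in> carrier_mat a a" using Gl_pm pm_carrier by blast

lemma GlE: assumes "K \<in> Gl a" obtains K' where "K' \<in> Gl a" "K * K' = 1\<^sub>m a" "K' * K = 1\<^sub>m a" using assms by (auto simp: Gl_def)

lemma GlI: "K \<in> pm a a 0 ==> K' \<in> pm a a 0 ==> K * K' = 1\<^sub>m a ==> K' * K = 1\<^sub>m a ==> K \<in> Gl a" by (auto simp: Gl_def)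

lemma Gl_one [simp]: "1\<^sub>m a \<in> Gl a" by (rule GlI[of _ _ "1\<^sub>m a"]) auto

lemma Gl_mult: assumes "K \<in> Gl a" "L \<in> Gl a" shows "K * L \<in> Gl a"
proof -
 obtain K' where K: "K' \<in> Gl a" "K * K' = 1\<^sub>m a" "K' * K = 1\<^sub>m a" using GlE[OF assms(1)] .
 obtain L' where L: "L' \<in> Gl a" "L * L' = 1\<^sub>m a" "L' * L = 1\<^sub>m a" using GlE[OF assms(2)] .
 note c = Gl_carrier[OF assms(1)] Gl_carrier[OF assms(2)] Gl_carrier[OF K(1)] Gl_carrier[OF L(1)]
 show ?thesis
 proof (rule GlI)
  show "K * L \<in> pm a a 0" "L' * K' \<in> pm a a 0" using assms K(1) L(1) Gl_pm pm_mult_S by blast+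
  have "K * L * (L' * K') = K * (L * L') * K'" using c by (simp add: assoc_mult_mat[of _ a a _ a _ a])
  then show "K * L * (L' * K') = 1\<^sub>m a" using c K L by simp
  have "L' * K' * (K * L) = L' * (K' * K) * L" using c by (simp add: assoc_mult_mat[of _ a a _ a _ a])
  then show "L' * K' * (K * L) = 1\<^sub>m a" using c K L by simp
 qed
qed

lemma Gl_cancel_left: assumes K: "K \<in> Gl a" and X: "X \<in> carrier_mat a b"
 shows "K * X \<in> pm a b k \<longleftrightarrow> X \<in> pm a b k"
proof
 obtain K' where K': "K' \<in> Gl a" "K' * K = 1\<^sub>m a" using GlE[OF K] .
 assume "K * X \<in> pm a b k"
 then have "K' * (K * X) \<in> pm a b k" using K' Gl_pm pm_mult_S by blast
 moreover have "K' * (K * X) = X" using K' X Gl_carrier[OF K] Gl_carrier[OF K'(1)] by (simp flip: assoc_mult_mat)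
 ultimately show "X \<in> pm a b k" by simp
qed (use K Gl_pm pm_mult_S in blast)

lemma Gl_cancel_right: assumes L: "L \<in> Gl b" and X: "X \<in> carrier_mat a b"
 shows "X * L \<in> pm a b k \<longleftrightarrow> X \<in> pm a b k"
proof
 obtain L' where L': "L' \<in> Gl b" "L * L' = 1\<^sub>m b" using GlE[OF L] .
 assume "X * L \<in> pm a b k"
 then have "X * L * L' \<in> pm a b k" using L' Gl_pm pm_mult_S by blast
 moreover have "X * L * L' = X" using L' X Gl_carrier[OF L] Gl_carrier[OF L'(1)] by (simp add: assoc_mult_mat[of _ a b _ b _ b])
 ultimately show "X \<in> pm a b k" by simp
qed (use L Gl_pm pm_mult_S in blast)

lemma Yk_affine_bij:
 assumes K: "K \<in> Gl a" and L: "L \<in> Gl b" and M: "M \<in> pm a b (- int k)"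
 shows "bij_betw (\<lambda>E. redm (K * E * L + M)) (Yk a b k) (Yk a b k)"
proof -
 note c = Gl_carrier[OF K] Gl_carrier[OF L] pm_carrier[OF M]
 have inj: "inj_on (\<lambda>E. redm (K * E * L + M)) (Yk a b k)"
 proof (rule inj_onI)
  fix E E' assume E: "E \<in> Yk a b k" "E' \<in> Yk a b k" and eq: "redm (K * E * L + M) = redm (K * E' * L + M)"
  note c' = Yk_carrier[OF E(1)] Yk_carrier[OF E(2)]
  have "K * E * L + M - (K * E' * L + M) \<in> pm a b 0" using eq c c' by (subst redm_eq[symmetric]) auto
  moreover have "K * E * L + M - (K * E' * L + M) = K * (E - E') * L"
  proof -
   have "K * (E - E') * L = K * E * L - K * E' * L" using c c' by (simp add: mult_minus_distrib_mat[of _ a a] minus_mult_distrib_mat[of _ a b])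
   then show ?thesis using c c' by (simp, intro eq_matI) auto
  qed
  ultimately have "E - E' \<in> pm a b 0" using Gl_cancel_right[OF L, of "K * (E - E')" a 0] Gl_cancel_left[OF K, of "E - E'" b 0] c c' by auto
  then show "E = E'" using redm_eq[OF c'] E by (simp add: Yk_def)
 qed
 moreover have "(\<lambda>E. redm (K * E * L + M)) ` Yk a b k \<subseteq> Yk a b k"
 proof (rule image_subsetI)
  fix E assume E: "E \<in> Yk a b k"
  have "E \<in> pm a b (- int k)" using E by (simp add: Yk_def)
  then have "K * E * L + M \<in> pm a b (- int k)" using K L M Gl_pm by (intro pm_add pm_mult_S)
  then show "redm (K * E * L + M) \<in> Yk a b k" by (simp add: redm_Yk[OF pm_carrier])
 qed
 ultimately show ?thesis using Yk_finite endo_inj_surj by (metis bij_betw_def)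
qed

lemma Ys_scale: "Y \<in> Yk a b (Suc k) ==> redm (w \<cdot>\<^sub>m Y) \<in> Yk a b k"
 using pm_w[of Y a b "- int (Suc k)"] Yk_carrier[of Y a b "Suc k"] redm_Yk[of "w \<cdot>\<^sub>m Y" a b k] by (auto simp: Yk_def)

text \<open>The lifts of \<open>Z\<close> along multiplication by \<open>w\<close> are a torsor
  under \<open>Yk a b 1\<close>, with Z divided by w as base point.\<close>

lemma Yk_lift_bij:
 assumes Z: "Z \<in> Yk a b k"
 shows "bij_betw (\<lambda>E. redm ((1 / w) \<cdot>\<^sub>m Z + E)) (Yk a b 1) {Y \<in> Yk a b (Suc k). redm (w \<cdot>\<^sub>m Y) = Z}"
proof (rule bij_betwI')
 note cZ = Yk_carrier[OF Z]
 fix E E' assume E: "E \<in> Yk a b 1" "E' \<in> Yk a b 1"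
 note c = Yk_carrier[OF E(1)] Yk_carrier[OF E(2)]
 have "(1 / w) \<cdot>\<^sub>m Z + E - ((1 / w) \<cdot>\<^sub>m Z + E') = E - E'" using cZ c by (intro eq_matI) auto
 then show "(redm ((1 / w) \<cdot>\<^sub>m Z + E) = redm ((1 / w) \<cdot>\<^sub>m Z + E')) = (E = E')"
  using redm_eq[OF c] redm_eq[of "(1 / w) \<cdot>\<^sub>m Z + E" a b "(1 / w) \<cdot>\<^sub>m Z + E'"] cZ c E by (auto simp: Yk_def)
next
 note cZ = Yk_carrier[OF Z]
 fix E assume E: "E \<in> Yk a b 1"
 note c = Yk_carrier[OF E]
 let ?Y = "(1 / w) \<cdot>\<^sub>m Z + E"
 have wZ: "w \<cdot>\<^sub>m ((1 / w) \<cdot>\<^sub>m Z) = Z" using cZ by (intro eq_matI) auto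
 have "(1 / w) \<cdot>\<^sub>m Z \<in> pm a b (- int (Suc k))"
  using pm_w[of "(1 / w) \<cdot>\<^sub>m Z" a b "- int (Suc k)"] wZ Z cZ by (auto simp: Yk_def)
 moreover have "E \<in> pm a b (- int (Suc k))" using E pm_mono[of "- int (Suc k)" "-1"] by (auto simp: Yk_def)
 ultimately have Y: "redm ?Y \<in> Yk a b (Suc k)" using redm_Yk[of ?Y a b "Suc k"] pm_add cZ c by auto
 have "w \<cdot>\<^sub>m E \<in> pm a b 0" using pm_w[OF c, of "-1"] E by (auto simp: Yk_def)
 moreover have "w \<cdot>\<^sub>m (redm ?Y - ?Y) \<in> pm a b 0"
  using redm_diff(1)[of ?Y a b] pm_smult[of "redm ?Y - ?Y" a b 0 w 0] cZ c w_S by (auto simp: pw_0)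
 ultimately have "w \<cdot>\<^sub>m (redm ?Y - ?Y) + w \<cdot>\<^sub>m E \<in> pm a b 0" using pm_add by blast
 moreover have "w \<cdot>\<^sub>m (redm ?Y - ?Y) + w \<cdot>\<^sub>m E = w \<cdot>\<^sub>m redm ?Y - Z"
  using cZ c by (intro eq_matI) (auto simp: algebra_simps)
 ultimately have "redm (w \<cdot>\<^sub>m redm ?Y) = redm Z" using redm_eq[of "w \<cdot>\<^sub>m redm ?Y" a b Z] cZ c by auto
 then show "redm ?Y \<in> {Y \<in> Yk a b (Suc k). redm (w \<cdot>\<^sub>m Y) = Z}" using Y Z by (simp add: Yk_def)
next
 note cZ = Yk_carrier[OF Z]
 fix Y assume "Y \<in> {Y \<in> Yk a b (Suc k). redm (w \<cdot>\<^sub>m Y) = Z}"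
 then have Y: "Y \<in> Yk a b (Suc k)" "redm (w \<cdot>\<^sub>m Y) = Z" by auto
 note c = Yk_carrier[OF Y(1)]
 let ?D = "Y - (1 / w) \<cdot>\<^sub>m Z"
 have "w \<cdot>\<^sub>m Y - Z \<in> pm a b 0" using redm_diff(2)[of "w \<cdot>\<^sub>m Y" a b] Y(2) c by auto
 moreover have "w \<cdot>\<^sub>m Y - Z = w \<cdot>\<^sub>m ?D" using cZ c by (intro eq_matI) (auto simp: algebra_simps)
 ultimately have "?D \<in> pm a b (-1)" using pm_w[of ?D a b "-1"] c cZ by auto
 then have E: "redm ?D \<in> Yk a b 1" using redm_Yk[of ?D a b 1] c cZ by auto
 have "(1 / w) \<cdot>\<^sub>m Z + redm ?D - Y = redm ?D - ?D" using cZ c redm_carrier[of ?D a b] by (intro eq_matI) (auto simp: redm_def)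
 then have "redm ((1 / w) \<cdot>\<^sub>m Z + redm ?D) = redm Y"
  using redm_eq[of "(1 / w) \<cdot>\<^sub>m Z + redm ?D" a b Y] redm_diff(1)[of ?D a b] cZ c by auto
 then have "Y = redm ((1 / w) \<cdot>\<^sub>m Z + redm ?D)" using Y(1) by (simp add: Yk_def)
 then show "\<exists>E\<in>Yk a b 1. Y = redm ((1 / w) \<cdot>\<^sub>m Z + E)" using E by blast
qed

definition cg :: "nat \<Rightarrow> nat \<Rightarrow> 'k mat set" where
 "cg a k = {A \<in> carrier_mat a a. A - 1\<^sub>m a \<in> pm a a (int k)}"

lemma cg_carrier: "A \<in> cg a k ==> A \<in> carrier_mat a a" by (simp add: cg_def)

lemma cg_pm: "A \<in> cg a k ==> A \<in> pm a a 0"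
proof -
 assume A: "A \<in> cg a k"
 have "(A - 1\<^sub>m a) + 1\<^sub>m a \<in> pm a a 0" using A by (intro pm_add) (auto simp: cg_def intro: pm_mono[of 0 "int k"])
 moreover have "(A - 1\<^sub>m a) + 1\<^sub>m a = A" using cg_carrier[OF A] by (intro eq_matI) auto
 ultimately show ?thesis by simp
qed

lemma det_cong:
 assumes A: "A \<in> cg a (Suc k)"
 shows "det A - 1 \<in> pw 1"
proof -
 have ent: "A $$ (i, j) - (1\<^sub>m a :: 'k mat) $$ (i, j) \<in> pw 1" if "i < a" "j < a" for i j
  using A that pmD[of "A - 1\<^sub>m a" a a "int (Suc k)" i j] pw_mono[of 1 "int (Suc k)"] by (auto simp: cg_def)
 have A_S: "A $$ (i, j) \<in> S" if "i < a" "j < a" for i j using pmD[OF cg_pm[OF A] that] by (simp add: pw_0)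
 have I_S: "(1\<^sub>m a :: 'k mat) $$ (i, j) \<in> S" if "i < a" "j < a" for i j using that by auto
 have prod: "prod f I - prod g I \<in> pw 1" if "\<And>i. i \<in> I ==> f i - g i \<in> pw 1"
  "\<And>i. i \<in> I ==> f i \<in> S" "\<And>i. i \<in> I ==> g i \<in> S" for f g :: "nat \<Rightarrow> 'k" and I
 proof -
  have "prod f I - prod g I \<in> pw 1 \<and> prod f I \<in> S \<and> prod g I \<in> S" using that
  proof (induction I rule: infinite_finite_induct)
   case (insert i I)
   then have IH: "prod f I - prod g I \<in> pw 1" "prod f I \<in> S" "prod g I \<in> S" and fg: "f i - g i \<in> pw 1" "f i \<in> S" "g i \<in> S"
    by auto
   have "f i * (prod f I - prod g I) + (f i - g i) * prod g I \<in> pw 1" using IH fg by (intro pw_add pw_mult_S)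
   then show ?case using insert.hyps IH fg by (simp add: S_mult algebra_simps)
  qed auto
  then show ?thesis by blast
 qed
 have sg: "signof p * x \<in> pw 1" if "x \<in> pw 1" for p x using that by (auto simp: sign_def)
 have "det A - det (1\<^sub>m a :: 'k mat) =
  (\<Sum>p\<in>{p. p permutes {0..<a}}. signof p * ((\<Prod>i=0..<a. A $$ (i, p i)) - (\<Prod>i=0..<a. (1\<^sub>m a) $$ (i, p i))))"
  using cg_carrier[OF A] by (simp add: det_def sum_subtractf right_diff_distrib)
 also have "... \<in> pw 1"
 proof (intro pw_sum sg prod)
  fix p i assume "p \<in> {p. p permutes {0..<a}}" "i \<in> {0..<a}"
  then have "i < a" "p i < a" using permutes_in_image[of p "{0..<a}" i] by auto
  then show "A $$ (i, p i) - (1\<^sub>m a) $$ (i, p i) \<in> pw 1" "A $$ (i, p i) \<in> S" "(1\<^sub>m a) $$ (i, p i) \<in> S"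
   using ent A_S I_S by blast+
 qed
 finally show ?thesis by simp
qed

lemma S_det: assumes "A \<in> pm a a 0" shows "det A \<in> S"
proof -
 have pr: "prod f I \<in> S" if "\<And>i. i \<in> I ==> f i \<in> S" for f and I :: "nat set"
  using that by (induction I rule: infinite_finite_induct) (auto intro: S_mult)
 have "(\<Sum>p\<in>{p. p permutes {0..<a}}. signof p * (\<Prod>i=0..<a. A $$ (i, p i))) \<in> pw 0"
 proof (rule pw_sum)
  fix p assume p: "p \<in> {p. p permutes {0..<a}}"
  have "(\<Prod>i=0..<a. A $$ (i, p i)) \<in> S"
  proof (rule pr)
   fix i assume "i \<in> {0..<a}"
   then have "i < a" "p i < a" using p permutes_in_image[of p "{0..<a}" i] by auto
   then show "A $$ (i, p i) \<in> S" using pmD[OF assms, of i "p i"] by (simp add: pw_0)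
  qed
  then show "signof p * (\<Prod>i=0..<a. A $$ (i, p i)) \<in> pw 0" by (auto simp: pw_0 sign_def S_minus)
 qed
 then show ?thesis using pm_carrier[OF assms] by (simp add: det_def pw_0)
qed

text \<open>The determinant is congruent to 1 modulo \<open>w\<close>, hence a unit, so the adjugate
  yields an integral inverse B. The identity B - 1 = -B (A - 1) then keeps the congruence
  level.\<close>

lemma cg_inverse:
 assumes A: "A \<in> cg a k" and k: "k \<ge> 1"
 obtains B where "B \<in> cg a k" "A * B = 1\<^sub>m a" "B * A = 1\<^sub>m a"
proof -
 note c = cg_carrier[OF A]
 have "det A - 1 \<in> pw 1" using det_cong[of A a "k - 1"] A k by simp
 moreover have "det A \<notin> pw 1"
 proof
  assume "det A \<in> pw 1"
  then have "det A - (det A - 1) \<in> pw 1" using \<open>det A - 1 \<in> pw 1\<close> pw_diff by blast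
  then show False using one_notin_pw1 by simp
 qed
 ultimately have dS: "det A \<in> S" "det A \<noteq> 0" "inverse (det A) \<in> S" using S_det[OF cg_pm[OF A]] S_unit by blast+
 let ?B = "inverse (det A) \<cdot>\<^sub>m adj_mat A"
 have cB: "?B \<in> carrier_mat a a" using adj_mat(1)[OF c] by simp
 have adjS: "adj_mat A \<in> pm a a 0"
 proof (rule pmI[OF adj_mat(1)[OF c]])
  fix i j assume ij: "i < a" "j < a"
  have "mat_delete A j i \<in> pm (a - 1) (a - 1) 0"
  proof (rule pmI)
   show "mat_delete A j i \<in> carrier_mat (a - 1) (a - 1)" by (rule mat_delete_carrier[OF c])
   fix r s assume "r < a - 1" "s < a - 1"
   then show "mat_delete A j i $$ (r, s) \<in> pw 0" using c pmD[OF cg_pm[OF A]] by (auto simp: mat_delete_def)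
  qed
  then have "det (mat_delete A j i) \<in> S" by (rule S_det)
  then have "(-1) ^ (j + i) * det (mat_delete A j i) \<in> S" by (cases "even (j + i)") (auto simp: S_minus)
  then show "adj_mat A $$ (i, j) \<in> pw 0" using c ij by (simp add: adj_mat_def cofactor_def pw_0)
 qed
 have BS: "?B \<in> pm a a 0" using pm_smult[OF adjS, of "inverse (det A)" 0] dS by (simp add: pw_0)
 have AB: "A * ?B = 1\<^sub>m a" using adj_mat[OF c] c dS(2) by (subst mult_smult_distrib[of _ a a _ a]) (auto intro!: eq_matI)
 have BA: "?B * A = 1\<^sub>m a" using adj_mat[OF c] c dS(2) by (subst mult_smult_assoc_mat[of _ a a _ a]) (auto intro!: eq_matI)
 define B where "B = ?B"
 note B = cB[folded B_def] BS[folded B_def] BA[folded B_def]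
 have "- (B * (A - 1\<^sub>m a)) \<in> pm a a (int k)" using A B(2) by (intro pm_minus pm_mult_S) (auto simp: cg_def)
 moreover have "- (B * (A - 1\<^sub>m a)) = B - 1\<^sub>m a"
 proof -
  have "B * (A - 1\<^sub>m a) = 1\<^sub>m a - B" using c B by (simp add: mult_minus_distrib_mat[of _ a a])
  then show ?thesis using B by (simp, intro eq_matI) auto
 qed
 ultimately have "B - 1\<^sub>m a \<in> pm a a (int k)" by simp
 then have "?B \<in> cg a k" using cB by (simp add: cg_def B_def)
 then show ?thesis using that AB BA by blast
qed

lemma cg_Gl: "A \<in> cg a k ==> k \<ge> 1 ==> A \<in> Gl a" using cg_inverse[of A a k] GlI[OF cg_pm] cg_pm by metis

end

lemma bij_betw_filter:
 assumes "bij_betw f A B" "\<And>x. x \<in> A ==> P x \<longleftrightarrow> Q (f x)"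
 shows "bij_betw f {x \<in> A. P x} {y \<in> B. Q y}"
proof (rule bij_betw_imageI)
 show "inj_on f {x \<in> A. P x}" using assms(1) by (auto simp: bij_betw_def inj_on_def)
 show "f ` {x \<in> A. P x} = {y \<in> B. Q y}" using bij_betw_imp_surj_on[OF assms(1)] assms(2) by auto
qed

lemmas card_filter_bij = bij_betw_same_card[OF bij_betw_filter]

lemma smult_smult_mat: "a \<cdot>\<^sub>m (b \<cdot>\<^sub>m A) = (a * b :: 'a::semigroup_mult) \<cdot>\<^sub>m A"
 by (intro eq_matI) (auto simp: mult.assoc)

lemma uminus_zero_mat [simp]: "- 0\<^sub>m a b = (0\<^sub>m a b :: 'a::ring mat)" by (intro eq_matI) auto

lemma add_uminus_mat [simp]: "A \<in> carrier_mat a b ==> A + - A = (0\<^sub>m a b :: 'a::ring mat)" by (intro eq_matI) auto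

section \<open>Ranks of matrices modulo integral matrices\<close>

context complete_dvr
begin

lemma pm_four_block:
 assumes "A \<in> carrier_mat a1 b1" "B \<in> carrier_mat a1 b2" "C \<in> carrier_mat a2 b1" "D \<in> carrier_mat a2 b2"
 shows "four_block_mat A B C D \<in> pm (a1 + a2) (b1 + b2) k \<longleftrightarrow>
  A \<in> pm a1 b1 k \<and> B \<in> pm a1 b2 k \<and> C \<in> pm a2 b1 k \<and> D \<in> pm a2 b2 k"
proof
 assume L: "four_block_mat A B C D \<in> pm (a1 + a2) (b1 + b2) k"
 have 1: "A $$ (i, j) \<in> pw k" if "i < a1" "j < b1" for i j using pmD[OF L, of i j] that assms by auto
 have 2: "B $$ (i, j) \<in> pw k" if "i < a1" "j < b2" for i j using pmD[OF L, of i "j + b1"] that assms by auto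
 have 3: "C $$ (i, j) \<in> pw k" if "i < a2" "j < b1" for i j using pmD[OF L, of "i + a1" j] that assms by auto
 have 4: "D $$ (i, j) \<in> pw k" if "i < a2" "j < b2" for i j using pmD[OF L, of "i + a1" "j + b1"] that assms by auto
 show "A \<in> pm a1 b1 k \<and> B \<in> pm a1 b2 k \<and> C \<in> pm a2 b1 k \<and> D \<in> pm a2 b2 k" using assms 1 2 3 4 by (simp add: pm_def)
next
 assume "A \<in> pm a1 b1 k \<and> B \<in> pm a1 b2 k \<and> C \<in> pm a2 b1 k \<and> D \<in> pm a2 b2 k"
 then show "four_block_mat A B C D \<in> pm (a1 + a2) (b1 + b2) k" using assms by (auto simp: pm_def)
qed

lemma block_decomp:
 assumes "E \<in> carrier_mat (a1 + a2) (b1 + b2)"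
 obtains A B C where "A \<in> carrier_mat a1 b1" "B \<in> carrier_mat a1 b2" "C \<in> carrier_mat a2 b1"
  "lower_block a1 b1 E \<in> carrier_mat a2 b2" "E = four_block_mat A B C (lower_block a1 b1 E)"
proof -
 let ?A = "mat a1 b1 (\<lambda>(i, j). E $$ (i, j))" and ?B = "mat a1 b2 (\<lambda>(i, j). E $$ (i, j + b1))"
  and ?C = "mat a2 b1 (\<lambda>(i, j). E $$ (i + a1, j))"
 have "E = four_block_mat ?A ?B ?C (lower_block a1 b1 E)" using assms by (intro eq_matI) (auto simp: lower_block_def)
 moreover have "lower_block a1 b1 E \<in> carrier_mat a2 b2" using assms by (simp add: lower_block_def)
 ultimately show ?thesis using that[of ?A ?B ?C] by simp
qed

definition dg :: "nat \<Rightarrow> nat \<Rightarrow> nat \<Rightarrow> 'k mat \<Rightarrow> 'k mat" where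
 "dg a b j Dl = four_block_mat Dl (0\<^sub>m j (b - j)) (0\<^sub>m (a - j) j) (0\<^sub>m (a - j) (b - j))"

lemma dg_carrier: "Dl \<in> carrier_mat j j ==> j \<le> a ==> j \<le> b ==> dg a b j Dl \<in> carrier_mat a b"
 using four_block_carrier_mat[of Dl j j "0\<^sub>m (a - j) (b - j)" "a - j" "b - j"] by (simp add: dg_def)

text \<open>The number of invariant factors of a matrix \<open>Y\<close> over the fraction field that are not
 integral, i.e. the minimal number of generators of the module spanned by the columns of \<open>Y\<close>
 modulo integral vectors.\<close>

definition rank_is :: "nat \<Rightarrow> nat \<Rightarrow> 'k mat \<Rightarrow> nat \<Rightarrow> bool" where
 "rank_is a b Y j \<longleftrightarrow> j \<le> a \<and> j \<le> b \<and> (\<exists>K\<in>Gl a. \<exists>L\<in>Gl b. \<exists>Dl\<in>carrier_mat j j. \<exists>Dl'\<in>pm j j 1.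
  Dl * Dl' = 1\<^sub>m j \<and> Dl' * Dl = 1\<^sub>m j \<and> K * Y * L - dg a b j Dl \<in> pm a b 0)"

lemma rank_isE:
 assumes "rank_is a b Y j"
 obtains K L Dl Dl' where "j \<le> a" "j \<le> b" "K \<in> Gl a" "L \<in> Gl b" "Dl \<in> carrier_mat j j" "Dl' \<in> pm j j 1"
  "Dl * Dl' = 1\<^sub>m j" "Dl' * Dl = 1\<^sub>m j" "K * Y * L - dg a b j Dl \<in> pm a b 0" using assms unfolding rank_is_def by blast

lemma rank_isI:
 assumes "j \<le> a" "j \<le> b" "K \<in> Gl a" "L \<in> Gl b" "Dl \<in> carrier_mat j j" "Dl' \<in> pm j j 1"
  "Dl * Dl' = 1\<^sub>m j" "Dl' * Dl = 1\<^sub>m j" "K * Y * L - dg a b j Dl \<in> pm a b 0"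
 shows "rank_is a b Y j" using assms unfolding rank_is_def by blast

lemma rank_is_cong:
 assumes Y: "Y \<in> carrier_mat a b" "Y' \<in> carrier_mat a b" "Y - Y' \<in> pm a b 0" and r: "rank_is a b Y j"
 shows "rank_is a b Y' j" using r
proof (rule rank_isE)
 fix K L Dl Dl'
 assume *: "j \<le> a" "j \<le> b" "K \<in> Gl a" "L \<in> Gl b" "Dl \<in> carrier_mat j j" "Dl' \<in> pm j j 1"
  "Dl * Dl' = 1\<^sub>m j" "Dl' * Dl = 1\<^sub>m j" "K * Y * L - dg a b j Dl \<in> pm a b 0"
 note c = Gl_carrier[OF *(3)] Gl_carrier[OF *(4)] dg_carrier[OF *(5,1,2)] Y(1,2)
 have "K * (Y - Y') * L \<in> pm a b 0" using Y(3) Gl_pm *(3,4) by (intro pm_mult_S)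
 then have "(K * Y * L - dg a b j Dl) - K * (Y - Y') * L \<in> pm a b 0" using *(9) pm_diff by blast
 moreover have "K * (Y - Y') * L = K * Y * L - K * Y' * L" using c by (simp add: mult_minus_distrib_mat[of _ a a] minus_mult_distrib_mat[of _ a b])
 then have "(K * Y * L - dg a b j Dl) - K * (Y - Y') * L = K * Y' * L - dg a b j Dl"
  using c by (simp del: assoc_mult_mat, intro eq_matI) (auto simp del: assoc_mult_mat)
 ultimately show ?thesis using * rank_isI by metis
qed

lemma rank_is_Gl:
 assumes K0: "K0 \<in> Gl a" and L0: "L0 \<in> Gl b" and Y: "Y \<in> carrier_mat a b" and r: "rank_is a b (K0 * Y * L0) j"
 shows "rank_is a b Y j" using r
proof (rule rank_isE)
 fix K L Dl Dl'
 assume *: "j \<le> a" "j \<le> b" "K \<in> Gl a" "L \<in> Gl b" "Dl \<in> carrier_mat j j" "Dl' \<in> pm j j 1"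
  "Dl * Dl' = 1\<^sub>m j" "Dl' * Dl = 1\<^sub>m j" "K * (K0 * Y * L0) * L - dg a b j Dl \<in> pm a b 0"
 note c = Gl_carrier[OF *(3)] Gl_carrier[OF *(4)] Gl_carrier[OF K0] Gl_carrier[OF L0] Y
 have "K * (K0 * Y * L0) * L = (K * K0) * Y * (L0 * L)"
  using c by (simp add: assoc_mult_mat[of _ a a _ a _ b] assoc_mult_mat[of _ a a _ b _ b] assoc_mult_mat[of _ a b _ b _ b])
 with * show ?thesis using Gl_mult[OF *(3) K0] Gl_mult[OF L0 *(4)] rank_isI by metis
qed

lemma Gl_conj_cancel:
 fixes K K' L L' Y :: "'k mat"
 assumes K: "K' * K = 1\<^sub>m a" "K \<in> carrier_mat a a" "K' \<in> carrier_mat a a"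
  and L: "L * L' = 1\<^sub>m b" "L \<in> carrier_mat b b" "L' \<in> carrier_mat b b" and Y: "Y \<in> carrier_mat a b"
 shows "K' * (K * Y * L) * L' = Y"
proof -
 have "K' * (K * Y * L) * L' = (K' * K) * Y * (L * L')"
  using assms(2,3,5,6,7) by (simp add: assoc_mult_mat[of _ a a _ a _ b] assoc_mult_mat[of _ a a _ b _ b] assoc_mult_mat[of _ a b _ b _ b])
 then show ?thesis using K(1) L(1) Y by simp
qed

lemma rank_is_Gl_iff:
 assumes K0: "K0 \<in> Gl a" and L0: "L0 \<in> Gl b" and Y: "Y \<in> carrier_mat a b"
 shows "rank_is a b (K0 * Y * L0) j \<longleftrightarrow> rank_is a b Y j"
proof
 obtain K where K: "K \<in> Gl a" "K * K0 = 1\<^sub>m a" using GlE[OF K0] .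
 obtain L where L: "L \<in> Gl b" "L0 * L = 1\<^sub>m b" using GlE[OF L0] .
 note c = Gl_carrier[OF K(1)] Gl_carrier[OF L(1)] Gl_carrier[OF K0] Gl_carrier[OF L0] Y
 assume "rank_is a b Y j"
 moreover have "K * (K0 * Y * L0) * L = Y" using c K L by (intro Gl_conj_cancel)
 ultimately have r': "rank_is a b (K * (K0 * Y * L0) * L) j" by simp
 have "K0 * Y * L0 \<in> carrier_mat a b" using c by auto
 then show "rank_is a b (K0 * Y * L0) j" by (rule rank_is_Gl[OF K(1) L(1) _ r'])
qed (use rank_is_Gl assms in blast)

text \<open>Modulo integral matrices, \<open>E\<close> is tangent at \<open>Y\<close> to the orbit
  of \<open>Y\<close> under multiplication from both sides. The number of such \<open>E\<close> in
  \<open>Yk a b 1\<close> is an invariant that detects the rank, and it reappears as the size of the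
  fibres of orbits.\<close>

definition Jrel :: "nat \<Rightarrow> nat \<Rightarrow> 'k mat \<Rightarrow> 'k mat \<Rightarrow> bool" where
 "Jrel a b Y E \<longleftrightarrow> (\<exists>D\<in>pm a a 0. \<exists>A\<in>pm b b 0. E - (D * Y - Y * A) \<in> pm a b 0)"

lemma Jrel_cong:
 assumes "E \<in> carrier_mat a b" "E' \<in> carrier_mat a b" "E - E' \<in> pm a b 0"
  "Y \<in> carrier_mat a b" "Y' \<in> carrier_mat a b" "Y - Y' \<in> pm a b 0" and J: "Jrel a b Y E"
 shows "Jrel a b Y' E'"
proof -
 obtain D A where DA: "D \<in> pm a a 0" "A \<in> pm b b 0" "E - (D * Y - Y * A) \<in> pm a b 0" using J by (auto simp: Jrel_def)
 note c = pm_carrier[OF DA(1)] pm_carrier[OF DA(2)] assms(1,2,4,5)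
 have h: "D * (Y - Y') \<in> pm a b 0" "(Y - Y') * A \<in> pm a b 0" using assms DA by (auto intro: pm_mult_S)
 have "D * (Y - Y') - (Y - Y') * A + (E - (D * Y - Y * A)) - (E - E') \<in> pm a b 0" by (rule pm_diff[OF pm_add[OF pm_diff[OF h] DA(3)] assms(3)])
 moreover have "D * (Y - Y') - (Y - Y') * A + (E - (D * Y - Y * A)) - (E - E') = E' - (D * Y' - Y' * A)"
  using c by (simp add: mult_minus_distrib_mat[of _ a a _ b] minus_mult_distrib_mat[of _ a b _ _ b])
   (intro eq_matI, auto)
 ultimately show ?thesis using DA by (auto simp: Jrel_def)
qed

lemma Jrel_Gl:
 assumes K: "K \<in> Gl a" and L: "L \<in> Gl b" and c: "E \<in> carrier_mat a b" "Y \<in> carrier_mat a b" and J: "Jrel a b Y E"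
 shows "Jrel a b (K * Y * L) (K * E * L)"
proof -
 obtain D A where DA: "D \<in> pm a a 0" "A \<in> pm b b 0" "E - (D * Y - Y * A) \<in> pm a b 0" using J by (auto simp: Jrel_def)
 obtain K' where K': "K' \<in> Gl a" "K' * K = 1\<^sub>m a" using GlE[OF K] .
 obtain L' where L': "L' \<in> Gl b" "L * L' = 1\<^sub>m b" using GlE[OF L] .
 note c = c pm_carrier[OF DA(1)] pm_carrier[OF DA(2)] Gl_carrier[OF K] Gl_carrier[OF L] Gl_carrier[OF K'(1)] Gl_carrier[OF L'(1)]
 have "K * (E - (D * Y - Y * A)) * L \<in> pm a b 0" using DA K L Gl_pm by (intro pm_mult_S) auto
 moreover have "K * (E - (D * Y - Y * A)) * L = K * E * L - (K * D * Y * L - K * Y * A * L)"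
  using c by (simp add: mult_minus_distrib_mat[of _ a a _ b] minus_mult_distrib_mat[of _ a b _ _ b]
    assoc_mult_mat[of _ a a _ a _ b] assoc_mult_mat[of _ a a _ b _ b] assoc_mult_mat[of _ a b _ b _ b])
 moreover have "K * D * Y * L = K * D * K' * (K * Y * L)"
 proof -
  have "K * D * K' * (K * Y * L) = K * D * (K' * K) * Y * L"
   using c by (simp add: assoc_mult_mat[of _ a a _ a _ b] assoc_mult_mat[of _ a a _ a _ a] assoc_mult_mat[of _ a a _ b _ b])
  then show ?thesis using c K'(2) by simp
 qed
 moreover have "K * Y * A * L = K * Y * L * (L' * A * L)"
 proof -
  have "K * Y * L * (L' * A * L) = K * Y * (L * L') * A * L"
   using c by (simp add: assoc_mult_mat[of _ a b _ b _ b] assoc_mult_mat[of _ b b _ b _ b] assoc_mult_mat[of _ a a _ b _ b])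
  then show ?thesis using c L'(2) by simp
 qed
 moreover have "K * D * K' \<in> pm a a 0" "L' * A * L \<in> pm b b 0" using DA K L K' L' Gl_pm by (auto intro!: pm_mult_S)
 ultimately show ?thesis unfolding Jrel_def by metis
qed

lemma Jrel_Gl_iff:
 assumes K: "K \<in> Gl a" and L: "L \<in> Gl b" and c: "E \<in> carrier_mat a b" "Y \<in> carrier_mat a b"
 shows "Jrel a b (K * Y * L) (K * E * L) \<longleftrightarrow> Jrel a b Y E"
proof
 obtain K' where K': "K' \<in> Gl a" "K' * K = 1\<^sub>m a" using GlE[OF K] .
 obtain L' where L': "L' \<in> Gl b" "L * L' = 1\<^sub>m b" using GlE[OF L] .
 note c' = c Gl_carrier[OF K] Gl_carrier[OF L] Gl_carrier[OF K'(1)] Gl_carrier[OF L'(1)]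
 assume "Jrel a b (K * Y * L) (K * E * L)"
 from Jrel_Gl[OF K'(1) L'(1) _ _ this] have "Jrel a b (K' * (K * Y * L) * L') (K' * (K * E * L) * L')" using c' by auto
 then show "Jrel a b Y E" using Gl_conj_cancel[OF K'(2) _ _ L'(2)] c' by simp
qed (use Jrel_Gl assms in blast)

text \<open>For the normal form, the products \<open>D * Y\<close> and \<open>Y * A\<close> vanish
  in the lower right block and fill the other three. Solvability there holds because
  \<open>Dl'\<close> is divisible by \<open>w\<close> and cancels the simple poles of
  \<open>E\<close>.\<close>

lemma Jrel_dg:
 assumes Dl: "Dl \<in> carrier_mat j j" "Dl' \<in> pm j j 1" "Dl * Dl' = 1\<^sub>m j" "Dl' * Dl = 1\<^sub>m j"
  and E: "E \<in> Yk (j + a) (j + b) 1"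
 shows "Jrel (j + a) (j + b) (dg (j + a) (j + b) j Dl) E \<longleftrightarrow> lower_block j j E \<in> Yk a b 0"
proof -
 let ?Y = "dg (j + a) (j + b) j Dl"
 note cE = Yk_carrier[OF E]
 have Y: "?Y = four_block_mat Dl (0\<^sub>m j b) (0\<^sub>m a j) (0\<^sub>m a b)" by (simp add: dg_def)
 have cDl': "Dl' \<in> carrier_mat j j" using Dl(2) pm_carrier by blast
 obtain E1 E2 E3 where E1: "E1 \<in> carrier_mat j j" and E2: "E2 \<in> carrier_mat j b" and E3: "E3 \<in> carrier_mat a j"
  and E4: "lower_block j j E \<in> carrier_mat a b" and Eeq: "E = four_block_mat E1 E2 E3 (lower_block j j E)" using block_decomp[OF cE] .
 have Epm: "E1 \<in> pm j j (-1)" "E2 \<in> pm j b (-1)" "E3 \<in> pm a j (-1)"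
  using E pm_four_block[OF E1 E2 E3 E4, of "-1"] Eeq by (auto simp: Yk_def)
 have red: "lower_block j j E \<in> Yk a b 0 \<longleftrightarrow> lower_block j j E \<in> pm a b 0"
  using lower_block_Yk[OF E, of j j] by (auto simp: Yk_def)
 show ?thesis unfolding red
 proof
  assume "Jrel (j + a) (j + b) ?Y E"
  then obtain D A where DA: "D \<in> pm (j + a) (j + a) 0" "A \<in> pm (j + b) (j + b) 0" "E - (D * ?Y - ?Y * A) \<in> pm (j + a) (j + b) 0"
   by (auto simp: Jrel_def)
  note c = pm_carrier[OF DA(1)] pm_carrier[OF DA(2)]
  obtain D1 D2 D3 where D: "D1 \<in> carrier_mat j j" "D2 \<in> carrier_mat j a" "D3 \<in> carrier_mat a j"
   "lower_block j j D \<in> carrier_mat a a" "D = four_block_mat D1 D2 D3 (lower_block j j D)" using block_decomp[OF c(1)] .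
  obtain A1 A2 A3 where A: "A1 \<in> carrier_mat j j" "A2 \<in> carrier_mat j b" "A3 \<in> carrier_mat b j"
   "lower_block j j A \<in> carrier_mat b b" "A = four_block_mat A1 A2 A3 (lower_block j j A)" using block_decomp[OF c(2)] .
  have DY: "D * ?Y = four_block_mat (D1 * Dl) (0\<^sub>m j b) (D3 * Dl) (0\<^sub>m a b)"
   unfolding Y by (subst D(5), subst mult_four_block_mat[OF D(1-4) Dl(1)]) (use D(1-4) Dl(1) in auto)
  have YA: "?Y * A = four_block_mat (Dl * A1) (Dl * A2) (0\<^sub>m a j) (0\<^sub>m a b)"
   unfolding Y by (subst A(5), subst mult_four_block_mat[OF Dl(1) _ _ _ A(1-4)]) (use A(1-4) Dl(1) in auto)
  have "lower_block j j E $$ (r, s) \<in> pw 0" if rs: "r < a" "s < b" for r s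
  proof -
   have "(E - (D * ?Y - ?Y * A)) $$ (r + j, s + j) \<in> pw 0" using pmD[OF DA(3)] rs by simp
   moreover have "(E - (D * ?Y - ?Y * A)) $$ (r + j, s + j) = E $$ (r + j, s + j)" using rs D(1-4) A(1-4) Dl(1) cE unfolding DY YA by simp
   ultimately show ?thesis using cE rs by (simp add: lower_block_def)
  qed
  then show "lower_block j j E \<in> pm a b 0" using E4 by (simp add: pm_def)
 next
  assume E4pm: "lower_block j j E \<in> pm a b 0"
  \<comment> \<open>\<open>?D\<close> produces the first block column of \<open>E\<close>; the rest
    of the first block row is left to \<open>?A\<close>.\<close>
  let ?D = "four_block_mat (E1 * Dl') (0\<^sub>m j a) (E3 * Dl') (0\<^sub>m a a)"
  let ?A = "four_block_mat (0\<^sub>m j j) (- (Dl' * E2)) (0\<^sub>m b j) (0\<^sub>m b b)"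
  have D: "?D \<in> pm (j + a) (j + a) 0" using pm_mult[OF Epm(1) Dl(2)] pm_mult[OF Epm(3) Dl(2)] by (subst pm_four_block) (use E1 E3 cDl' in auto)
  have A: "?A \<in> pm (j + b) (j + b) 0" using pm_minus[OF pm_mult[OF Dl(2) Epm(2)]] by (subst pm_four_block) (use E2 cDl' in auto)
  have DY: "?D * ?Y = four_block_mat E1 (0\<^sub>m j b) E3 (0\<^sub>m a b)" unfolding Y by (subst mult_four_block_mat[OF _ _ _ _ Dl(1)])
   (use E1 E3 cDl' Dl in \<open>auto simp: assoc_mult_mat[of _ j j _ j _ j] assoc_mult_mat[of _ a j _ j _ j]\<close>)
  have "Dl * (Dl' * E2) = E2" using Dl(1,3) cDl' E2 by (simp flip: assoc_mult_mat[of _ j j _ j _ b])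
  then have YA: "?Y * ?A = four_block_mat (0\<^sub>m j j) (- E2) (0\<^sub>m a j) (0\<^sub>m a b)"
   unfolding Y by (subst mult_four_block_mat[OF Dl(1)]) (use E2 cDl' Dl(1) in auto)
  have "E - (?D * ?Y - ?Y * ?A) = four_block_mat (0\<^sub>m j j) (0\<^sub>m j b) (0\<^sub>m a j) (lower_block j j E)"
   unfolding DY YA by (subst Eeq, rule eq_matI) (use E1 E2 E3 E4 in auto)
  also have "... \<in> pm (j + a) (j + b) 0" by (subst pm_four_block) (use E4 E4pm in auto)
  finally show "Jrel (j + a) (j + b) ?Y E" using D A unfolding Jrel_def by blast
 qed
qed

lemma card_Jrel:
 assumes Y: "Y \<in> carrier_mat a b" and r: "rank_is a b Y j"
 shows "card {E \<in> Yk a b 1. Jrel a b Y E} = q ^ (a * b - (a - j) * (b - j))" using r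
proof (rule rank_isE)
 fix K L Dl Dl'
 assume *: "j \<le> a" "j \<le> b" "K \<in> Gl a" "L \<in> Gl b" "Dl \<in> carrier_mat j j" "Dl' \<in> pm j j 1"
  "Dl * Dl' = 1\<^sub>m j" "Dl' * Dl = 1\<^sub>m j" "K * Y * L - dg a b j Dl \<in> pm a b 0"
 note c = Gl_carrier[OF *(3)] Gl_carrier[OF *(4)] dg_carrier[OF *(5,1,2)] Y
 have "card {E \<in> Yk a b 1. Jrel a b Y E} = card {E \<in> Yk a b 1. Jrel a b (dg a b j Dl) E}"
 proof (rule card_filter_bij)
  show "bij_betw (\<lambda>E. redm (K * E * L + 0\<^sub>m a b)) (Yk a b 1) (Yk a b 1)" by (rule Yk_affine_bij) (use * in auto)
  fix E assume E: "E \<in> Yk a b 1"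
  note cE = Yk_carrier[OF E]
  have KEL: "K * E * L + 0\<^sub>m a b = K * E * L" using c cE by (intro right_add_zero_mat) auto
  have "Jrel a b Y E \<longleftrightarrow> Jrel a b (K * Y * L) (K * E * L)" using Jrel_Gl_iff[OF *(3,4) cE Y] by simp
  also have "... \<longleftrightarrow> Jrel a b (dg a b j Dl) (redm (K * E * L))"
  proof
   assume "Jrel a b (K * Y * L) (K * E * L)"
   then show "Jrel a b (dg a b j Dl) (redm (K * E * L))" by (rule Jrel_cong[rotated 6]) (use c cE *(9) redm_diff(2)[of "K * E * L" a b] in auto)
  next
   assume "Jrel a b (dg a b j Dl) (redm (K * E * L))"
   then show "Jrel a b (K * Y * L) (K * E * L)" by (rule Jrel_cong[rotated 6])
     (use c cE *(9) redm_diff(1)[of "K * E * L" a b] pm_diff_commute[of "K * Y * L" a b "dg a b j Dl" 0] in auto)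
  qed
  finally show "Jrel a b Y E \<longleftrightarrow> Jrel a b (dg a b j Dl) (redm (K * E * L + 0\<^sub>m a b))" by (simp only: KEL)
 qed
 also have "{E \<in> Yk a b 1. Jrel a b (dg a b j Dl) E} = {E \<in> Yk a b 1. lower_block j j E \<in> Yk (a - j) (b - j) 0}"
  using Jrel_dg[OF *(5-8), of _ "a - j" "b - j"] *(1,2) by auto
 also have "card ... = q ^ (a * b - (a - j) * (b - j))"
  using *(1,2) by (subst card_lower_block) (auto simp: card_Yk intro: subsetD[OF Yk_mono[of 0 "Suc 0"]])
 finally show ?thesis .
qed

lemma rank_exponent:
 fixes a b j :: nat
 assumes "j \<le> a" "j \<le> b"
 shows "a * b - (a - j) * (b - j) = j * (a + b - j)"
proof -
 have "int (a * b) - int (a - j) * int (b - j) = int j * int (a + b - j)" using assms by (simp add: of_nat_diff algebra_simps)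
 moreover have "(a - j) * (b - j) \<le> a * b" by (intro mult_le_mono) auto
 ultimately have "int (a * b - (a - j) * (b - j)) = int (j * (a + b - j))" by (simp only: of_nat_diff of_nat_mult)
 then show ?thesis by linarith
qed

text \<open>The count in \<open>card_Jrel\<close> depends on \<open>Y\<close> alone, and its
  exponent \<open>j * (a + b - j)\<close> increases strictly as long as \<open>j\<close> is at most
  \<open>a\<close> and \<open>b\<close>.\<close>

lemma rank_unique:
 assumes Y: "Y \<in> carrier_mat a b" and "rank_is a b Y i" "rank_is a b Y j"
 shows "i = j"
proof -
 have le: "i \<le> a" "i \<le> b" "j \<le> a" "j \<le> b" using assms by (auto simp: rank_is_def)
 have "q ^ (i * (a + b - i)) = q ^ (j * (a + b - j))" using card_Jrel[OF assms(1,2)] card_Jrel[OF assms(1,3)] le by (simp add: rank_exponent)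
 then have eq: "i * (a + b - i) = j * (a + b - j)" using q_gt_1 by simp
 have mono: "i * (a + b - i) < j * (a + b - j)" if "i < j" "j \<le> a" "j \<le> b" for i j
 proof -
  have "int j * int (a + b - j) - int i * int (a + b - i) = (int j - int i) * (int a + int b - int i - int j)"
   using that by (simp add: of_nat_diff algebra_simps)
  moreover have "... > 0" using that by (intro mult_pos_pos) auto
  ultimately have "int i * int (a + b - i) < int j * int (a + b - j)" by linarith
  then show ?thesis by (metis of_nat_less_iff of_nat_mult)
 qed
 show ?thesis using mono[of i j] mono[of j i] eq le by (metis less_irrefl linorder_neqE_nat)
qed

lemma Gl_diag: assumes "K \<in> Gl a" shows "four_block_mat (1\<^sub>m i) (0\<^sub>m i a) (0\<^sub>m a i) K \<in> Gl (i + a)"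
proof -
 obtain K' where K': "K' \<in> Gl a" "K * K' = 1\<^sub>m a" "K' * K = 1\<^sub>m a" using GlE[OF assms] .
 note c = Gl_carrier[OF assms] Gl_carrier[OF K'(1)]
 show ?thesis
 proof (rule GlI)
  show "four_block_mat (1\<^sub>m i) (0\<^sub>m i a) (0\<^sub>m a i) K \<in> pm (i + a) (i + a) 0"
   "four_block_mat (1\<^sub>m i) (0\<^sub>m i a) (0\<^sub>m a i) K' \<in> pm (i + a) (i + a) 0"
   by (subst pm_four_block, use c Gl_pm[OF assms] Gl_pm[OF K'(1)] in auto)+
  show "four_block_mat (1\<^sub>m i) (0\<^sub>m i a) (0\<^sub>m a i) K * four_block_mat (1\<^sub>m i) (0\<^sub>m i a) (0\<^sub>m a i) K' = 1\<^sub>m (i + a)"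
   by (subst mult_four_block_mat[of _ i i _ a _ a]) (use c K' in auto)
  show "four_block_mat (1\<^sub>m i) (0\<^sub>m i a) (0\<^sub>m a i) K' * four_block_mat (1\<^sub>m i) (0\<^sub>m i a) (0\<^sub>m a i) K = 1\<^sub>m (i + a)"
   by (subst mult_four_block_mat[of _ i i _ a _ a]) (use c K' in auto)
 qed
qed

lemma Gl_lower: assumes X: "X \<in> pm a i 0" shows "four_block_mat (1\<^sub>m i) (0\<^sub>m i a) X (1\<^sub>m a) \<in> Gl (i + a)"
proof (rule GlI)
 note c = pm_carrier[OF X]
 show "four_block_mat (1\<^sub>m i) (0\<^sub>m i a) X (1\<^sub>m a) \<in> pm (i + a) (i + a) 0"
  "four_block_mat (1\<^sub>m i) (0\<^sub>m i a) (- X) (1\<^sub>m a) \<in> pm (i + a) (i + a) 0"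
  by (subst pm_four_block, use c X pm_minus[OF X] in auto)+
 show "four_block_mat (1\<^sub>m i) (0\<^sub>m i a) X (1\<^sub>m a) * four_block_mat (1\<^sub>m i) (0\<^sub>m i a) (- X) (1\<^sub>m a) = 1\<^sub>m (i + a)"
  by (subst mult_four_block_mat[of _ i i _ a _ a]) (use c in auto)
 show "four_block_mat (1\<^sub>m i) (0\<^sub>m i a) (- X) (1\<^sub>m a) * four_block_mat (1\<^sub>m i) (0\<^sub>m i a) X (1\<^sub>m a) = 1\<^sub>m (i + a)"
  by (subst mult_four_block_mat[of _ i i _ a _ a]) (use c in auto)
qed

lemma Gl_upper: assumes X: "X \<in> pm i a 0" shows "four_block_mat (1\<^sub>m i) X (0\<^sub>m a i) (1\<^sub>m a) \<in> Gl (i + a)"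
proof (rule GlI)
 note c = pm_carrier[OF X]
 show "four_block_mat (1\<^sub>m i) X (0\<^sub>m a i) (1\<^sub>m a) \<in> pm (i + a) (i + a) 0"
  "four_block_mat (1\<^sub>m i) (- X) (0\<^sub>m a i) (1\<^sub>m a) \<in> pm (i + a) (i + a) 0"
  by (subst pm_four_block, use c X pm_minus[OF X] in auto)+
 show "four_block_mat (1\<^sub>m i) X (0\<^sub>m a i) (1\<^sub>m a) * four_block_mat (1\<^sub>m i) (- X) (0\<^sub>m a i) (1\<^sub>m a) = 1\<^sub>m (i + a)"
  by (subst mult_four_block_mat[of _ i i _ a _ a]) (use c in auto)
 show "four_block_mat (1\<^sub>m i) (- X) (0\<^sub>m a i) (1\<^sub>m a) * four_block_mat (1\<^sub>m i) X (0\<^sub>m a i) (1\<^sub>m a) = 1\<^sub>m (i + a)"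
  by (subst mult_four_block_mat[of _ i i _ a _ a]) (use c in auto)
qed

text \<open>Block elimination: the factors that clear \<open>B\<close> and \<open>C\<close> are
  integral by assumption and so lie in \<open>Gl\<close>. The rank splits into \<open>i\<close> for
  the block \<open>Dl\<close> and the rank of the Schur complement.\<close>

lemma rank_is_schur:
 assumes Dl: "Dl \<in> carrier_mat i i" "Dl' \<in> pm i i 1" "Dl * Dl' = 1\<^sub>m i" "Dl' * Dl = 1\<^sub>m i"
  and B: "B \<in> carrier_mat i b" and C: "C \<in> carrier_mat a i" and E: "E \<in> carrier_mat a b"
  and B': "Dl' * B \<in> pm i b 0" and C': "C * Dl' \<in> pm a i 0"
  and r: "rank_is a b (E - C * Dl' * B) k"
 shows "rank_is (i + a) (i + b) (four_block_mat Dl B C E) (i + k)" using r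
proof (rule rank_isE)
 fix K L \<Gamma> \<Gamma>'
 assume *: "k \<le> a" "k \<le> b" "K \<in> Gl a" "L \<in> Gl b" "\<Gamma> \<in> carrier_mat k k" "\<Gamma>' \<in> pm k k 1"
  "\<Gamma> * \<Gamma>' = 1\<^sub>m k" "\<Gamma>' * \<Gamma> = 1\<^sub>m k" "K * (E - C * Dl' * B) * L - dg a b k \<Gamma> \<in> pm a b 0"
 define Es where "Es = E - C * Dl' * B"
 let ?M = "four_block_mat Dl B C E"
 let ?K1 = "four_block_mat (1\<^sub>m i) (0\<^sub>m i a) (- (C * Dl')) (1\<^sub>m a)"
 let ?L1 = "four_block_mat (1\<^sub>m i) (- (Dl' * B)) (0\<^sub>m b i) (1\<^sub>m b)"
 let ?K2 = "four_block_mat (1\<^sub>m i) (0\<^sub>m i a) (0\<^sub>m a i) K"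
 let ?L2 = "four_block_mat (1\<^sub>m i) (0\<^sub>m i b) (0\<^sub>m b i) L"
 have cDl': "Dl' \<in> carrier_mat i i" and c\<Gamma>': "\<Gamma>' \<in> carrier_mat k k" using Dl(2) *(6) pm_carrier by blast+
 note cK = Gl_carrier[OF *(3)] and cL = Gl_carrier[OF *(4)]
 have cE: "Es \<in> carrier_mat a b" using C cDl' B E by (auto simp: Es_def)
 note r9 = *(9)[folded Es_def]
 have K1: "?K1 \<in> Gl (i + a)" by (rule Gl_lower[OF pm_minus[OF C']])
 have L1: "?L1 \<in> Gl (i + b)" by (rule Gl_upper[OF pm_minus[OF B']])
 have K2: "?K2 \<in> Gl (i + a)" by (rule Gl_diag[OF *(3)])
 have L2: "?L2 \<in> Gl (i + b)" by (rule Gl_diag[OF *(4)])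
 have e1: "C * Dl' * Dl = C" using C cDl' Dl by (simp add: assoc_mult_mat[of _ a i _ i _ i])
 have e2: "Dl * (Dl' * B) = B" using B cDl' Dl by (simp flip: assoc_mult_mat[of _ i i _ i _ b])
 have "?K1 * ?M = four_block_mat Dl B (0\<^sub>m a i) Es"
 proof -
  have "- (C * Dl') * Dl = - C" by (subst uminus_mult_left_mat) (use C cDl' Dl(1) e1 in auto)
  then have "- (C * Dl') * Dl + 1\<^sub>m a * C = 0\<^sub>m a i" using C by simp
  moreover have "- X + 1\<^sub>m a * E = E - X" if "X \<in> carrier_mat a b" for X using E that by (intro eq_matI) auto
  then have "- (C * Dl' * B) + 1\<^sub>m a * E = Es" using C cDl' B by (simp add: Es_def)
  moreover have "- (C * Dl') * B = - (C * Dl' * B)" by (subst uminus_mult_left_mat) (use C cDl' B in auto)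
  ultimately show ?thesis by (subst mult_four_block_mat[of _ i i _ a _ a]) (use Dl(1) B C E cDl' in auto)
 qed
 moreover have "four_block_mat Dl B (0\<^sub>m a i) Es * ?L1 = four_block_mat Dl (0\<^sub>m i b) (0\<^sub>m a i) Es"
 proof -
  have "Dl * - (Dl' * B) = - B" by (subst uminus_mult_right_mat) (use B cDl' Dl(1) e2 in auto)
  then have "Dl * - (Dl' * B) + B * 1\<^sub>m b = 0\<^sub>m i b" using B by simp
  moreover have "0\<^sub>m a i * - (Dl' * B) + Es * 1\<^sub>m b = Es" "Dl * 1\<^sub>m i + B * 0\<^sub>m b i = Dl" "0\<^sub>m a i * 1\<^sub>m i + Es * 0\<^sub>m b i = 0\<^sub>m a i"
   using B cDl' cE Dl(1) by auto
  ultimately show ?thesis by (subst mult_four_block_mat[of _ i i _ b _ a]) (use Dl(1) B cE cDl' in auto)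
 qed
 ultimately have red: "?K1 * ?M * ?L1 = four_block_mat Dl (0\<^sub>m i b) (0\<^sub>m a i) Es" by simp
 have "?K2 * four_block_mat Dl (0\<^sub>m i b) (0\<^sub>m a i) Es = four_block_mat Dl (0\<^sub>m i b) (0\<^sub>m a i) (K * Es)"
  by (subst mult_four_block_mat[of _ i i _ a _ a]) (use Dl(1) cE cK in auto)
 moreover have "four_block_mat Dl (0\<^sub>m i b) (0\<^sub>m a i) (K * Es) * ?L2 = four_block_mat Dl (0\<^sub>m i b) (0\<^sub>m a i) (K * Es * L)"
  by (subst mult_four_block_mat[of _ i i _ b _ a]) (use Dl(1) cE cK cL in auto)
 ultimately have red2: "?K2 * four_block_mat Dl (0\<^sub>m i b) (0\<^sub>m a i) Es * ?L2 = four_block_mat Dl (0\<^sub>m i b) (0\<^sub>m a i) (K * Es * L)"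
  by simp
 let ?\<Theta> = "four_block_mat Dl (0\<^sub>m i k) (0\<^sub>m k i) \<Gamma>"
 let ?\<Theta>' = "four_block_mat Dl' (0\<^sub>m i k) (0\<^sub>m k i) \<Gamma>'"
 have cM: "?M \<in> carrier_mat (i + a) (i + b)" using Dl(1) E by simp
 have "rank_is (i + a) (i + b) (four_block_mat Dl (0\<^sub>m i b) (0\<^sub>m a i) Es) (i + k)"
 proof (rule rank_isI[OF _ _ K2 L2])
  show "i + k \<le> i + a" "i + k \<le> i + b" using * by auto
  show "?\<Theta> \<in> carrier_mat (i + k) (i + k)" using Dl(1) *(5) by simp
  show "?\<Theta>' \<in> pm (i + k) (i + k) 1" by (subst pm_four_block) (use Dl(2) *(6) cDl' c\<Gamma>' in auto)
  show "?\<Theta> * ?\<Theta>' = 1\<^sub>m (i + k)" by (subst mult_four_block_mat[of _ i i _ k _ k]) (use Dl(1,3) *(5,7) cDl' c\<Gamma>' in auto)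
  show "?\<Theta>' * ?\<Theta> = 1\<^sub>m (i + k)" by (subst mult_four_block_mat[of _ i i _ k _ k]) (use Dl(1,4) *(5,8) cDl' c\<Gamma>' in auto)
  have dgeq: "dg (i + a) (i + b) (i + k) ?\<Theta> = four_block_mat Dl (0\<^sub>m i b) (0\<^sub>m a i) (dg a b k \<Gamma>)"
   using Dl(1) *(1,2,5) by (intro eq_matI) (auto simp: dg_def)
  have "four_block_mat Dl (0\<^sub>m i b) (0\<^sub>m a i) (K * Es * L) - four_block_mat Dl (0\<^sub>m i b) (0\<^sub>m a i) (dg a b k \<Gamma>)
   = four_block_mat (0\<^sub>m i i) (0\<^sub>m i b) (0\<^sub>m a i) (K * Es * L - dg a b k \<Gamma>)"
   using Dl(1) cK cL cE dg_carrier[OF *(5,1,2)] by (intro eq_matI) auto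
  also have "... \<in> pm (i + a) (i + b) 0" by (subst pm_four_block) (use r9 cK cL cE dg_carrier[OF *(5,1,2)] in auto)
  finally show "?K2 * four_block_mat Dl (0\<^sub>m i b) (0\<^sub>m a i) Es * ?L2 - dg (i + a) (i + b) (i + k) ?\<Theta> \<in> pm (i + a) (i + b) 0"
   unfolding red2 dgeq .
 qed
 then show ?thesis using rank_is_Gl[OF K1 L1 cM] unfolding red by blast
qed

end

lemma Vq_Suc: "Vq q (Suc m) = Vq q m * (1 - 1 / real q ^ Suc m)" by (simp add: Vq_def power_int_minus divide_inverse flip: power_Suc)

lemma Vq_0 [simp]: "Vq q 0 = 1" by (simp add: Vq_def)

lemma Vq_pos: assumes "q > 1" shows "Vq q m > 0"
proof (induction m)
 case (Suc m)
 have "real q ^ Suc m > 1" using assms by (intro one_less_power) auto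
 then have "1 - 1 / real q ^ Suc m > 0" by (simp add: divide_less_eq del: power_Suc)
 then show ?case unfolding Vq_Suc using Suc by (rule mult_pos_pos[rotated])
qed simp

section \<open>Counting matrices of given rank over the residue field\<close>

context complete_dvr
begin

lemma rank_is_0: assumes "Z \<in> pm a b 0" shows "rank_is a b Z 0"
proof (rule rank_isI[of 0 a b "1\<^sub>m a" "1\<^sub>m b" "0\<^sub>m 0 0" "0\<^sub>m 0 0"])
 have "1\<^sub>m a * Z * 1\<^sub>m b - dg a b 0 (0\<^sub>m 0 0) = Z" using pm_carrier[OF assms] by (intro eq_matI) (auto simp: dg_def)
 then show "1\<^sub>m a * Z * 1\<^sub>m b - dg a b 0 (0\<^sub>m 0 0) \<in> pm a b 0" using assms by simp
qed (auto intro!: eq_matI)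

text \<open>The matrix with first column \<open>c\<close> followed by \<open>E\<close>; the empty
  lower blocks make block multiplication applicable.\<close>

definition hc :: "'k mat \<Rightarrow> 'k mat \<Rightarrow> 'k mat" where
 "hc c E = four_block_mat c E (0\<^sub>m 0 1) (0\<^sub>m 0 (dim_col E))"

lemma hc_carrier: "c \<in> carrier_mat a 1 ==> E \<in> carrier_mat a b ==> hc c E \<in> carrier_mat a (1 + b)"
 using four_block_carrier_mat[of c a 1 "0\<^sub>m 0 b" 0 b E "0\<^sub>m 0 1"] by (simp add: hc_def)

lemma hc_index: "c \<in> carrier_mat a 1 ==> E \<in> carrier_mat a b ==> i < a ==> j < 1 + b ==>
  hc c E $$ (i, j) = (if j = 0 then c $$ (i, 0) else E $$ (i, j - 1))" by (auto simp: hc_def)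

lemma hc_pm: "c \<in> carrier_mat a 1 ==> E \<in> carrier_mat a b ==> hc c E \<in> pm a (1 + b) k \<longleftrightarrow> c \<in> pm a 1 k \<and> E \<in> pm a b k"
 using pm_four_block[of c a 1 E b "0\<^sub>m 0 1" 0 "0\<^sub>m 0 b" k] by (simp add: hc_def)

lemma hc_mult_left:
 assumes K: "K \<in> carrier_mat a a" and c: "c \<in> carrier_mat a 1" and E: "E \<in> carrier_mat a b"
 shows "K * hc c E = hc (K * c) (K * E)"
proof -
 have "K = four_block_mat K (0\<^sub>m a 0) (0\<^sub>m 0 a) (0\<^sub>m 0 0)" using K by (intro eq_matI) auto
 then have "K * hc c E = four_block_mat K (0\<^sub>m a 0) (0\<^sub>m 0 a) (0\<^sub>m 0 0) * four_block_mat c E (0\<^sub>m 0 1) (0\<^sub>m 0 b)"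
  using E by (simp add: hc_def)
 also have "... = four_block_mat (K * c + 0\<^sub>m a 0 * 0\<^sub>m 0 1) (K * E + 0\<^sub>m a 0 * 0\<^sub>m 0 b)
   (0\<^sub>m 0 a * c + 0\<^sub>m 0 0 * 0\<^sub>m 0 1) (0\<^sub>m 0 a * E + 0\<^sub>m 0 0 * 0\<^sub>m 0 b)"
  by (rule mult_four_block_mat) (use K c E in auto)
 also have "... = hc (K * c) (K * E)" unfolding hc_def using K c E by (intro eq_matI) auto
 finally show ?thesis .
qed

lemma hc_mult_right:
 assumes L: "L \<in> carrier_mat b b" and c: "c \<in> carrier_mat a 1" and E: "E \<in> carrier_mat a b"
 shows "hc c E * four_block_mat (1\<^sub>m 1) (0\<^sub>m 1 b) (0\<^sub>m b 1) L = hc c (E * L)"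
proof -
 have "hc c E * four_block_mat (1\<^sub>m 1) (0\<^sub>m 1 b) (0\<^sub>m b 1) L
  = four_block_mat c E (0\<^sub>m 0 1) (0\<^sub>m 0 b) * four_block_mat (1\<^sub>m 1) (0\<^sub>m 1 b) (0\<^sub>m b 1) L"
  using E by (simp add: hc_def)
 also have "... = four_block_mat (c * 1\<^sub>m 1 + E * 0\<^sub>m b 1) (c * 0\<^sub>m 1 b + E * L)
   (0\<^sub>m 0 1 * 1\<^sub>m 1 + 0\<^sub>m 0 b * 0\<^sub>m b 1) (0\<^sub>m 0 1 * 0\<^sub>m 1 b + 0\<^sub>m 0 b * L)"
  by (rule mult_four_block_mat) (use L c E in auto)
 also have "... = hc c (E * L)" unfolding hc_def using L c E by (intro eq_matI) auto
 finally show ?thesis .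
qed

text \<open>The permutation matrix that moves the first column to the end, where an integral column
  does not disturb the normal form.\<close>

definition cyc :: "nat \<Rightarrow> 'k mat" where
 "cyc b = four_block_mat (0\<^sub>m 1 b) (1\<^sub>m 1) (1\<^sub>m b) (0\<^sub>m b 1)"

lemma cyc_Gl: "cyc b \<in> Gl (1 + b)"
proof (rule GlI)
 let ?P = "four_block_mat (0\<^sub>m b 1) (1\<^sub>m b) (1\<^sub>m 1) (0\<^sub>m 1 b) :: 'k mat"
 show "cyc b \<in> pm (1 + b) (1 + b) 0"
  using pm_four_block[of "0\<^sub>m 1 b" 1 b "1\<^sub>m 1" 1 "1\<^sub>m b" b "0\<^sub>m b 1" 0] by (simp add: cyc_def add.commute[of b 1])
 show "?P \<in> pm (1 + b) (1 + b) 0"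
  using pm_four_block[of "0\<^sub>m b 1" b 1 "1\<^sub>m b" b "1\<^sub>m 1" 1 "0\<^sub>m 1 b" 0] by (simp add: add.commute[of b 1])
 have "cyc b * ?P = four_block_mat (0\<^sub>m 1 b * 0\<^sub>m b 1 + 1\<^sub>m 1 * 1\<^sub>m 1) (0\<^sub>m 1 b * 1\<^sub>m b + 1\<^sub>m 1 * 0\<^sub>m 1 b)
   (1\<^sub>m b * 0\<^sub>m b 1 + 0\<^sub>m b 1 * 1\<^sub>m 1) (1\<^sub>m b * 1\<^sub>m b + 0\<^sub>m b 1 * 0\<^sub>m 1 b)"
  unfolding cyc_def by (rule mult_four_block_mat) auto
 also have "... = four_block_mat (1\<^sub>m 1) (0\<^sub>m 1 b) (0\<^sub>m b 1) (1\<^sub>m b)" by simp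
 also have "... = 1\<^sub>m (1 + b)" by (rule four_block_one_mat)
 finally show "cyc b * ?P = 1\<^sub>m (1 + b)" .
 have "?P * cyc b = four_block_mat (0\<^sub>m b 1 * 0\<^sub>m 1 b + 1\<^sub>m b * 1\<^sub>m b) (0\<^sub>m b 1 * 1\<^sub>m 1 + 1\<^sub>m b * 0\<^sub>m b 1)
   (1\<^sub>m 1 * 0\<^sub>m 1 b + 0\<^sub>m 1 b * 1\<^sub>m b) (1\<^sub>m 1 * 1\<^sub>m 1 + 0\<^sub>m 1 b * 0\<^sub>m b 1)"
  unfolding cyc_def by (rule mult_four_block_mat) auto
 also have "... = four_block_mat (1\<^sub>m b) (0\<^sub>m b 1) (0\<^sub>m 1 b) (1\<^sub>m 1)" by simp
 also have "... = 1\<^sub>m (b + 1)" by (rule four_block_one_mat)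
 finally show "?P * cyc b = 1\<^sub>m (1 + b)" by (simp add: add.commute)
qed

lemma hc_cyc:
 assumes c: "c \<in> carrier_mat a 1" and E: "E \<in> carrier_mat a b"
 shows "hc c E * cyc b = four_block_mat E c (0\<^sub>m 0 b) (0\<^sub>m 0 1)"
proof -
 have "hc c E * cyc b = four_block_mat c E (0\<^sub>m 0 1) (0\<^sub>m 0 b) * four_block_mat (0\<^sub>m 1 b) (1\<^sub>m 1) (1\<^sub>m b) (0\<^sub>m b 1)"
  using E by (simp add: hc_def cyc_def)
 also have "... = four_block_mat (c * 0\<^sub>m 1 b + E * 1\<^sub>m b) (c * 1\<^sub>m 1 + E * 0\<^sub>m b 1)
   (0\<^sub>m 0 1 * 0\<^sub>m 1 b + 0\<^sub>m 0 b * 1\<^sub>m b) (0\<^sub>m 0 1 * 1\<^sub>m 1 + 0\<^sub>m 0 b * 0\<^sub>m b 1)"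
  by (rule mult_four_block_mat) (use c E in auto)
 also have "... = four_block_mat E c (0\<^sub>m 0 b) (0\<^sub>m 0 1)" using c E by (intro cong_four_block_mat) auto
 finally show ?thesis .
qed

lemma rank_hc_zero:
 assumes c: "c \<in> pm a 1 0" and E: "E \<in> carrier_mat a b" and r: "rank_is a b E k"
 shows "rank_is a (1 + b) (hc c E) k" using r
proof (rule rank_isE)
 fix K L Dl Dl'
 assume *: "k \<le> a" "k \<le> b" "K \<in> Gl a" "L \<in> Gl b" "Dl \<in> carrier_mat k k" "Dl' \<in> pm k k 1"
  "Dl * Dl' = 1\<^sub>m k" "Dl' * Dl = 1\<^sub>m k" "K * E * L - dg a b k Dl \<in> pm a b 0"
 note cc = pm_carrier[OF c] Gl_carrier[OF *(3)] Gl_carrier[OF *(4)] dg_carrier[OF *(5,1,2)]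
 let ?L1 = "four_block_mat (1\<^sub>m 1) (0\<^sub>m 1 b) (0\<^sub>m b 1) L"
 have L1: "?L1 \<in> Gl (1 + b)" by (rule Gl_diag[OF *(4)])
 have cKc: "K * c \<in> carrier_mat a 1" and cKEL: "K * E * L \<in> carrier_mat a b" and cKE: "K * E \<in> carrier_mat a b" using cc E by auto
 have Kc: "K * c \<in> pm a 1 0" using pm_mult_S(1)[OF Gl_pm[OF *(3)] c] .
 note ch = hc_carrier[OF cc(1) E]
 have "K * hc c E * (?L1 * cyc b) = K * hc c E * ?L1 * cyc b"
  by (rule assoc_mult_mat[symmetric]) (use ch cc Gl_carrier[OF L1] Gl_carrier[OF cyc_Gl[of b]] in auto)
 also have "... = hc (K * c) (K * E * L) * cyc b" unfolding hc_mult_left[OF cc(2,1) E] hc_mult_right[OF cc(3) cKc cKE] ..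
 also have "... = four_block_mat (K * E * L) (K * c) (0\<^sub>m 0 b) (0\<^sub>m 0 1)" by (rule hc_cyc[OF cKc cKEL])
 finally have eq: "K * hc c E * (?L1 * cyc b) = four_block_mat (K * E * L) (K * c) (0\<^sub>m 0 b) (0\<^sub>m 0 1)" .
 have dgeq: "dg a (1 + b) k Dl = four_block_mat (dg a b k Dl) (0\<^sub>m a 1) (0\<^sub>m 0 b) (0\<^sub>m 0 1)"
  using *(1,2,5) cc(4) by (intro eq_matI) (auto simp: dg_def)
 have "K * hc c E * (?L1 * cyc b) - dg a (1 + b) k Dl = four_block_mat (K * E * L - dg a b k Dl) (K * c) (0\<^sub>m 0 b) (0\<^sub>m 0 1)"
 proof -
  have "four_block_mat X y (0\<^sub>m 0 b) (0\<^sub>m 0 1) - four_block_mat D (0\<^sub>m a 1) (0\<^sub>m 0 b) (0\<^sub>m 0 1)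
   = four_block_mat (X - D) y (0\<^sub>m 0 b) (0\<^sub>m 0 1)"
   if "X \<in> carrier_mat a b" "y \<in> carrier_mat a 1" "D \<in> carrier_mat a b" for X y D :: "'k mat" using that by (intro eq_matI) auto
  from this[OF cKEL cKc cc(4)] show ?thesis unfolding eq dgeq .
 qed
 also have "... \<in> pm (a + 0) (b + 1) 0" by (subst pm_four_block) (use cKc cKEL cc(4) *(9) Kc in auto)
 finally have "K * hc c E * (?L1 * cyc b) - dg a (1 + b) k Dl \<in> pm a (1 + b) 0" by (simp add: add.commute)
 then show ?thesis using rank_isI[OF _ _ *(3) Gl_mult[OF L1 cyc_Gl] *(5-8)] *(1,2) by simp
qed

definition e0w :: "nat \<Rightarrow> 'k mat" where
 "e0w a = mat a 1 (\<lambda>(i, _). if i = 0 then 1 / w else 0)"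

lemma swaprows_Gl: assumes "k < a" "l < a" shows "swaprows_mat a k l \<in> Gl a"
proof (rule GlI)
 show "swaprows_mat a k l \<in> pm a a 0" by (auto simp: pm_def swaprows_mat_def pw_0)
 then show "swaprows_mat a k l \<in> pm a a 0" .
qed (use swaprows_mat_inv assms in blast)+

text \<open>Bring an entry with a pole to the top, scale it by a unit to 1/w and clear the column
  below it. The clearing factors are integral because no pole is worse than simple.\<close>

lemma column_to_e0:
 assumes c: "c \<in> pm (Suc a) 1 (-1)" and nz: "c \<notin> pm (Suc a) 1 0"
 obtains K where "K \<in> Gl (Suc a)" "K * c = e0w (Suc a)"
proof -
 note cc = pm_carrier[OF c]
 obtain i where i: "i < Suc a" "c $$ (i, 0) \<notin> S" using nz cc by (auto simp: pm_def pw_0)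
 define P where "P = (swaprows_mat (Suc a) 0 i :: 'k mat)"
 have P: "P \<in> Gl (Suc a)" unfolding P_def by (rule swaprows_Gl) (use i in auto)
 define d where "d = P * c"
 have dc: "d \<in> carrier_mat (1 + a) 1" using Gl_carrier[OF P] cc by (simp add: d_def)
 have dpm: "d \<in> pm (1 + a) 1 (-1)" using pm_mult_S(1)[OF Gl_pm[OF P] c] by (simp add: d_def)
 have "d = swaprows 0 i c" unfolding d_def P_def using swaprows_mat[OF cc, of 0 i] i by simp
 then have d0: "d $$ (0, 0) = c $$ (i, 0)" using cc i by simp
 \<comment> \<open>The unit by which the chosen pole differs from 1/w.\<close>
 define u where "u = w * d $$ (0, 0)"
 have "u \<in> S" using pmD[OF dpm, of 0 0] pw_w(2)[of "d $$ (0,0)" "-1"] by (simp add: u_def pw_0)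
 moreover have "u \<notin> pw 1" using i(2) d0 pw_w(2)[of "d $$ (0,0)" 0] by (simp add: u_def pw_0)
 ultimately have u: "u \<noteq> 0" "inverse u \<in> S" "u \<in> S" using S_unit by auto
 let ?t = "mat a 1 (\<lambda>(r, _). d $$ (r + 1, 0))"
 let ?D = "four_block_mat (mat 1 1 (\<lambda>_. inverse u)) (0\<^sub>m 1 a) (0\<^sub>m a 1) (1\<^sub>m a)"
 let ?D' = "four_block_mat (mat 1 1 (\<lambda>_. u)) (0\<^sub>m 1 a) (0\<^sub>m a 1) (1\<^sub>m a)"
 have m11: "mat 1 1 (\<lambda>_. x) * mat 1 b f = mat 1 b (\<lambda>(i, j). x * f (0, j))" for x :: 'k and f b
  by (intro eq_matI) (auto simp: scalar_prod_def)
 have D: "?D \<in> Gl (1 + a)"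
 proof (rule GlI)
  show "?D \<in> pm (1 + a) (1 + a) 0" "?D' \<in> pm (1 + a) (1 + a) 0" by (subst pm_four_block, use u in \<open>auto simp: pm_def pw_0\<close>)+
  have one: "mat 1 1 (\<lambda>_. inverse u) * mat 1 1 (\<lambda>_. u) = 1\<^sub>m 1" "mat 1 1 (\<lambda>_. u) * mat 1 1 (\<lambda>_. inverse u) = 1\<^sub>m 1"
   using u by (intro eq_matI; auto simp: scalar_prod_def)+
  show "?D * ?D' = 1\<^sub>m (1 + a)" by (subst mult_four_block_mat[of _ 1 1 _ a _ a]) (use one in auto)
  show "?D' * ?D = 1\<^sub>m (1 + a)" by (subst mult_four_block_mat[of _ 1 1 _ a _ a]) (use one in auto)
 qed
 let ?X = "mat a 1 (\<lambda>(r, _). - (w * d $$ (r + 1, 0)))"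
 have X: "?X \<in> pm a 1 0" using pmD[OF dpm, of "_ + 1" 0] pw_w(2)[of _ "-1"] by (auto simp: pm_def)
 let ?N = "four_block_mat (1\<^sub>m 1) (0\<^sub>m 1 a) ?X (1\<^sub>m a)"
 have N: "?N \<in> Gl (1 + a)" by (rule Gl_lower[OF X])
 have deq: "d = four_block_mat (mat 1 1 (\<lambda>_. d $$ (0, 0))) (0\<^sub>m 1 0) ?t (0\<^sub>m a 0)" using dc by (intro eq_matI) auto
 have "?D * d = four_block_mat (mat 1 1 (\<lambda>_. 1 / w)) (0\<^sub>m 1 0) ?t (0\<^sub>m a 0)"
 proof -
  have d00: "d $$ (0, 0) \<noteq> 0" using u(1) by (simp add: u_def)
  have "mat 1 1 (\<lambda>_. inverse u) * mat 1 1 (\<lambda>_. d $$ (0, 0)) = mat 1 1 (\<lambda>_. 1 / w)"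
   unfolding m11 by (intro eq_matI) (use d00 in \<open>auto simp: u_def field_simps\<close>)
  then show ?thesis by (subst deq, subst mult_four_block_mat[of _ 1 1 _ a _ a _ _ 1 _ 0]) auto
 qed
 moreover have "?N * four_block_mat (mat 1 1 (\<lambda>_. 1 / w)) (0\<^sub>m 1 0) ?t (0\<^sub>m a 0) = e0w (1 + a)"
 proof -
  have "?X * mat 1 1 (\<lambda>_. 1 / w) + ?t = 0\<^sub>m a 1" by (intro eq_matI) (auto simp: scalar_prod_def)
  then have "?N * four_block_mat (mat 1 1 (\<lambda>_. 1 / w)) (0\<^sub>m 1 0) ?t (0\<^sub>m a 0)
   = four_block_mat (mat 1 1 (\<lambda>_. 1 / w)) (0\<^sub>m 1 0) (0\<^sub>m a 1) (0\<^sub>m a 0)"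
   by (subst mult_four_block_mat[of _ 1 1 _ a _ a _ _ 1 _ 0]) auto
  also have "... = e0w (1 + a)" by (intro eq_matI) (auto simp: e0w_def)
  finally show ?thesis .
 qed
 moreover have "?N * ?D * P * c = ?N * (?D * d)" using Gl_carrier[OF N] Gl_carrier[OF D] Gl_carrier[OF P] cc
  by (simp add: d_def assoc_mult_mat[of _ "Suc a" "Suc a" _ "Suc a" _ 1] assoc_mult_mat[of _ "Suc a" "Suc a" _ "Suc a" _ "Suc a"])
 ultimately have "?N * ?D * P * c = e0w (Suc a)" by simp
 moreover have "?N * ?D * P \<in> Gl (Suc a)" using Gl_mult[OF Gl_mult[OF N D]] P by simp
 ultimately show ?thesis using that by blast
qed

text \<open>The case of \<open>rank_is_schur\<close> with corner 1/w and zeros below it, so the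
  Schur complement is \<open>F\<close> without its first row.\<close>

lemma rank_hc_e0w:
 assumes F: "F \<in> pm (1 + a) b (-1)" and r: "rank_is a b (lower_block 1 0 F) k"
 shows "rank_is (1 + a) (1 + b) (hc (e0w (1 + a)) F) (1 + k)"
proof -
 note cF = pm_carrier[OF F]
 let ?B = "mat 1 b (\<lambda>(i, j). F $$ (0, j))"
 have eq: "hc (e0w (1 + a)) F = four_block_mat (mat 1 1 (\<lambda>_. 1 / w)) ?B (0\<^sub>m a 1) (lower_block 1 0 F)"
  using cF by (intro eq_matI) (auto simp: hc_def e0w_def lower_block_def)
 have cl: "lower_block 1 0 F \<in> carrier_mat a b" using cF by (auto simp: lower_block_def)
 have "rank_is (1 + a) (1 + b) (four_block_mat (mat 1 1 (\<lambda>_. 1 / w)) ?B (0\<^sub>m a 1) (lower_block 1 0 F)) (1 + k)"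
 proof (rule rank_is_schur[where Dl' = "mat 1 1 (\<lambda>_. w)"])
  show "mat 1 1 (\<lambda>_. w) \<in> pm 1 1 1" using w_S pw_w(2)[of 1 0] by (auto simp: pm_def pw_0)
  show "mat 1 1 (\<lambda>_. 1 / w) * mat 1 1 (\<lambda>_. w) = 1\<^sub>m 1" "mat 1 1 (\<lambda>_. w) * mat 1 1 (\<lambda>_. 1 / w) = 1\<^sub>m 1"
   by (intro eq_matI; auto simp: scalar_prod_def)+
  have "mat 1 1 (\<lambda>_. w) * ?B = w \<cdot>\<^sub>m ?B" by (intro eq_matI) (auto simp: scalar_prod_def)
  moreover have "?B \<in> pm 1 b (-1)" using pmD[OF F, of 0] by (auto simp: pm_def)
  ultimately show "mat 1 1 (\<lambda>_. w) * ?B \<in> pm 1 b 0" using pm_w[of ?B 1 b "-1"] by simp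
  have "lower_block 1 0 F - 0\<^sub>m a 1 * mat 1 1 (\<lambda>_. w) * ?B = lower_block 1 0 F" using cl by (intro eq_matI) auto
  then show "rank_is a b (lower_block 1 0 F - 0\<^sub>m a 1 * mat 1 1 (\<lambda>_. w) * ?B) k" using r by simp
 qed (use cl in auto)
 then show ?thesis using eq by simp
qed

lemma lower_block_Yk': "F \<in> Yk (1 + a) b k ==> lower_block 1 0 F \<in> Yk a b k" using lower_block_Yk[of F "1 + a" b k 1 0] by simp

lemma hc_bij: "bij_betw (\<lambda>(c, E). hc c E) (Yk a 1 k \<times> Yk a b k) (Yk a (1 + b) k)"
proof (rule bij_betwI')
 fix x y assume xy: "x \<in> Yk a 1 k \<times> Yk a b k" "y \<in> Yk a 1 k \<times> Yk a b k"
 obtain c E c' E' where eq: "x = (c, E)" "y = (c', E')" by fastforce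
 have cc: "c \<in> carrier_mat a 1" "c' \<in> carrier_mat a 1" "E \<in> carrier_mat a b" "E' \<in> carrier_mat a b" using xy eq Yk_carrier by auto
 have "c = c' \<and> E = E'" if h: "hc c E = hc c' E'"
 proof
  show "c = c'"
  proof (rule eq_matI)
   fix i j assume "i < dim_row c'" "j < dim_col c'"
   then show "c $$ (i, j) = c' $$ (i, j)" using arg_cong[OF h, of "\<lambda>X. X $$ (i, 0)"] cc by (simp add: hc_def)
  qed (use cc in auto)
  show "E = E'"
  proof (rule eq_matI)
   fix i j assume "i < dim_row E'" "j < dim_col E'"
   then show "E $$ (i, j) = E' $$ (i, j)" using arg_cong[OF h, of "\<lambda>X. X $$ (i, Suc j)"] cc by (simp add: hc_def)
  qed (use cc in auto)
 qed
 then show "((\<lambda>(c, E). hc c E) x = (\<lambda>(c, E). hc c E) y) = (x = y)" using eq by auto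
next
 fix x assume x: "x \<in> Yk a 1 k \<times> Yk a b k"
 obtain c E where eq: "x = (c, E)" by fastforce
 have cc: "c \<in> carrier_mat a 1" "E \<in> carrier_mat a b" using x eq Yk_carrier by auto
 have "hc c E $$ (i, j) \<in> Rk k" if "i < a" "j < 1 + b" for i j using x eq that unfolding hc_index[OF cc that] Yk_entrywise by (cases j) auto
 then show "(\<lambda>(c, E). hc c E) x \<in> Yk a (1 + b) k" using eq hc_carrier[OF cc] unfolding Yk_entrywise by auto
next
 fix Y assume Y: "Y \<in> Yk a (1 + b) k"
 let ?c = "mat a 1 (\<lambda>(i, j). Y $$ (i, 0))" and ?E = "mat a b (\<lambda>(i, j). Y $$ (i, j + 1))"
 have "Y = hc ?c ?E" using Yk_carrier[OF Y] by (intro eq_matI) (auto simp: hc_def)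
 moreover have "?c \<in> Yk a 1 k" "?E \<in> Yk a b k" using Y unfolding Yk_entrywise by auto
 ultimately show "\<exists>x\<in>Yk a 1 k \<times> Yk a b k. Y = (\<lambda>(c, E). hc c E) x" by (intro bexI[of _ "(?c, ?E)"]) auto
qed

lemma rank_hc_reduce:
 assumes K: "K \<in> Gl a" and c: "c \<in> carrier_mat a 1" and E: "E \<in> carrier_mat a b"
 shows "rank_is a (1 + b) (hc c E) k \<longleftrightarrow> rank_is a (1 + b) (hc (K * c) (redm (K * E))) k"
proof -
 have cc: "K * c \<in> carrier_mat a 1" "K * E \<in> carrier_mat a b" using Gl_carrier[OF K] c E by auto
 have "rank_is a (1 + b) (hc c E) k \<longleftrightarrow> rank_is a (1 + b) (K * hc c E * 1\<^sub>m (1 + b)) k"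
  by (rule rank_is_Gl_iff[symmetric]) (use K hc_carrier[OF c E] in auto)
 also have "K * hc c E * 1\<^sub>m (1 + b) = hc (K * c) (K * E)" using hc_mult_left[OF Gl_carrier[OF K] c E] hc_carrier[OF cc] by simp
 also have "rank_is a (1 + b) (hc (K * c) (K * E)) k \<longleftrightarrow> rank_is a (1 + b) (hc (K * c) (redm (K * E))) k"
 proof -
  have ch: "hc (K * c) (K * E) \<in> carrier_mat a (1 + b)" "hc (K * c) (redm (K * E)) \<in> carrier_mat a (1 + b)"
   using hc_carrier[OF cc] hc_carrier[OF cc(1), of "redm (K * E)" b] cc by auto
  have "hc c1 E1 - hc c1 E2 = hc (0\<^sub>m a 1) (E1 - E2)"
   if "c1 \<in> carrier_mat a 1" "E1 \<in> carrier_mat a b" "E2 \<in> carrier_mat a b" for c1 E1 E2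
   using that by (intro eq_matI) (auto simp: hc_def)
  from this[OF cc, of "redm (K * E)"] cc
  have "hc (K * c) (K * E) - hc (K * c) (redm (K * E)) = hc (0\<^sub>m a 1) (K * E - redm (K * E))" by simp
  also have "... \<in> pm a (1 + b) 0" using redm_diff(2)[OF cc(2)] cc by (subst hc_pm) auto
  finally have 1: "hc (K * c) (K * E) - hc (K * c) (redm (K * E)) \<in> pm a (1 + b) 0" .
  then have 2: "hc (K * c) (redm (K * E)) - hc (K * c) (K * E) \<in> pm a (1 + b) 0" using pm_diff_commute ch by blast
  show ?thesis using rank_is_cong[OF ch 1] rank_is_cong[OF ch(2,1) 2] by blast
 qed
 finally show ?thesis .
qed

lemma rank_exists_1: "E \<in> Yk a b 1 ==> \<exists>k. rank_is a b E k"
proof (induction b arbitrary: a E)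
 case 0
 have "E \<in> pm a 0 0" using Yk_carrier[OF 0] by (simp add: pm_def)
 then show ?case using rank_is_0 by blast
next
 case (Suc b)
 obtain c F where cF: "c \<in> Yk a 1 1" "F \<in> Yk a b 1" "E = hc c F" using bij_betw_imp_surj_on[OF hc_bij[of a 1 b]] Suc.prems by force
 note cc = Yk_carrier[OF cF(1)] Yk_carrier[OF cF(2)]
 show ?case
 proof (cases "c \<in> pm a 1 0")
  case True
  then show ?thesis using Suc.IH[OF cF(2)] rank_hc_zero[OF True cc(2)] cF(3) by auto
 next
  case False
  then obtain a' where a: "a = Suc a'" by (cases a) (use cc in \<open>auto simp: pm_def\<close>)
  obtain K where K: "K \<in> Gl a" "K * c = e0w a" using column_to_e0[of c a'] False cF(1) a by (auto simp: Yk_def)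
  have KF: "redm (K * F) \<in> Yk (1 + a') b 1" using redm_Yk[of "K * F" a b 1] pm_mult_S(1)[OF Gl_pm[OF K(1)], of F b "-1"] cF(2) pm_carrier a
   by (auto simp: Yk_def)
  obtain k where "rank_is a' b (lower_block 1 0 (redm (K * F))) k" using Suc.IH[OF lower_block_Yk'[OF KF]] by blast
  then have "rank_is (1 + a') (1 + b) (hc (e0w (1 + a')) (redm (K * F))) (1 + k)" using KF by (intro rank_hc_e0w) (auto simp: Yk_def)
  then show ?thesis using rank_hc_reduce[OF K(1) cc] K(2) a cF(3) by auto
 qed
qed

text \<open>Multiplication by \<open>w\<close> turns \<open>Yk a b 1\<close> into the matrices over
  the residue field, so this counts the matrices of rank \<open>k\<close> over a field with
  \<open>q\<close> elements.\<close>

definition Rc :: "nat \<Rightarrow> nat \<Rightarrow> nat \<Rightarrow> nat" where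
 "Rc a b k = card {E \<in> Yk a b 1. rank_is a b E k}"

text \<open>When the source matrix has a rank, uniqueness of ranks turns a one-sided implication
  between ranks into an equivalence.\<close>

lemma rank_transfer:
 assumes "\<And>k. rank_is a b E k ==> rank_is a' b' E' (f k)" "\<exists>k. rank_is a b E k" "E \<in> carrier_mat a b" "E' \<in> carrier_mat a' b'"
 shows "rank_is a' b' E' l \<longleftrightarrow> (\<exists>k. rank_is a b E k \<and> l = f k)" using assms rank_unique by metis

text \<open>Split by the first column. An integral one does not affect the rank; each of the
  \<open>q ^ Suc a - 1\<close> other classes can be moved to \<open>e0w\<close>, after which the
  rest of the first row is free and the remaining block has rank one less.\<close>

lemma Rc_Suc:
 "Rc (Suc a) (Suc b) k = Rc (Suc a) b k + (if k = 0 then 0 else (q ^ Suc a - 1) * (q ^ b * Rc a b (k - 1)))"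
 "Rc 0 (Suc b) k = Rc 0 b k"
proof -
 have split: "Rc a (1 + b) k = Rc a b k + (\<Sum>c\<in>Yk a 1 1 - {redm (0\<^sub>m a 1)}. card {E \<in> Yk a b 1. rank_is a (1 + b) (hc c E) k})" for a k
 proof -
  have z: "redm (0\<^sub>m a 1) \<in> Yk a 1 1" by (simp add: redm_Yk)
  have zpm: "redm (0\<^sub>m a 1) \<in> pm a 1 0" by (simp add: redm_pm)
  have "bij_betw (\<lambda>(c, E). hc c E) {x \<in> Yk a 1 1 \<times> Yk a b 1. rank_is a (1 + b) (hc (fst x) (snd x)) k} {E \<in> Yk a (1 + b) 1. rank_is a (1 + b) E k}"
   by (rule bij_betw_filter[OF hc_bij]) (simp add: case_prod_unfold)
  then have "Rc a (1 + b) k = card {x \<in> Yk a 1 1 \<times> Yk a b 1. rank_is a (1 + b) (hc (fst x) (snd x)) k}"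
   unfolding Rc_def using bij_betw_same_card by fastforce
  also have "{x \<in> Yk a 1 1 \<times> Yk a b 1. rank_is a (1 + b) (hc (fst x) (snd x)) k}
   = Sigma (Yk a 1 1) (\<lambda>c. {E \<in> Yk a b 1. rank_is a (1 + b) (hc c E) k})" by auto
  also have "card ... = (\<Sum>c\<in>Yk a 1 1. card {E \<in> Yk a b 1. rank_is a (1 + b) (hc c E) k})" by (rule card_SigmaI) (auto simp: Yk_finite)
  also have "... = card {E \<in> Yk a b 1. rank_is a (1 + b) (hc (redm (0\<^sub>m a 1)) E) k}
    + (\<Sum>c\<in>Yk a 1 1 - {redm (0\<^sub>m a 1)}. card {E \<in> Yk a b 1. rank_is a (1 + b) (hc c E) k})"
   using z by (simp add: sum.remove Yk_finite)
  also have "{E \<in> Yk a b 1. rank_is a (1 + b) (hc (redm (0\<^sub>m a 1)) E) k} = {E \<in> Yk a b 1. rank_is a b E k}"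
  proof -
   have "rank_is a (1 + b) (hc (redm (0\<^sub>m a 1)) E) k \<longleftrightarrow> rank_is a b E k" if E: "E \<in> Yk a b 1" for E
    using rank_transfer[of a b E a "1 + b" "hc (redm (0\<^sub>m a 1)) E" id k] rank_hc_zero[OF zpm Yk_carrier[OF E]]
     rank_exists_1[OF E] Yk_carrier[OF E] hc_carrier[OF pm_carrier[OF zpm] Yk_carrier[OF E]] by auto
   then show ?thesis by blast
  qed
  finally show ?thesis by (simp add: Rc_def)
 qed
 have notpm: "c \<notin> pm a 1 0" if "c \<in> Yk a 1 1 - {redm (0\<^sub>m a 1)}" for c a
 proof
  assume "c \<in> pm a 1 0"
  then have "redm c = redm (0\<^sub>m a 1)" using pm_carrier pm_diff[OF _ pm_zero] by (subst redm_eq[of c a 1]) auto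
  then show False using that by (auto simp: Yk_def)
 qed
 show "Rc 0 (Suc b) k = Rc 0 b k"
 proof -
  have "c \<in> pm 0 1 0" if "c \<in> Yk 0 1 1" for c using Yk_carrier[OF that] by (simp add: pm_def)
  then have empty: "Yk 0 1 1 - {redm (0\<^sub>m 0 1)} = {}" using notpm[where a = 0] by blast
  then show ?thesis using split[of 0 k] unfolding empty by simp
 qed
 have "card {E \<in> Yk (Suc a) b 1. rank_is (Suc a) (1 + b) (hc c E) k} = (if k = 0 then 0 else q ^ b * Rc a b (k - 1))"
  if c: "c \<in> Yk (Suc a) 1 1 - {redm (0\<^sub>m (Suc a) 1)}" for c
 proof -
  have c1: "c \<in> pm (Suc a) 1 (-1)" using c by (auto simp: Yk_def)
  obtain K where K: "K \<in> Gl (Suc a)" "K * c = e0w (Suc a)" using column_to_e0[OF c1 notpm[OF c]] .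
  have "card {E \<in> Yk (Suc a) b 1. rank_is (Suc a) (1 + b) (hc c E) k}
    = card {F \<in> Yk (Suc a) b 1. \<exists>k'. rank_is a b (lower_block 1 0 F) k' \<and> k = 1 + k'}"
  proof (rule card_filter_bij)
   show "bij_betw (\<lambda>E. redm (K * E * 1\<^sub>m b + 0\<^sub>m (Suc a) b)) (Yk (Suc a) b 1) (Yk (Suc a) b 1)"
    by (rule Yk_affine_bij) (use K in auto)
   fix E assume E: "E \<in> Yk (Suc a) b 1"
   note cE = Yk_carrier[OF E]
   have eq: "K * E * 1\<^sub>m b + 0\<^sub>m (Suc a) b = K * E" using Gl_carrier[OF K(1)] cE by (intro eq_matI) auto
   have F: "redm (K * E) \<in> Yk (1 + a) b 1"
    using redm_Yk[of "K * E" "Suc a" b 1] pm_mult_S(1)[OF Gl_pm[OF K(1)], of E b "-1"] E pm_carrier by (auto simp: Yk_def)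
   have F1: "redm (K * E) \<in> pm (1 + a) b (-1)" using F by (simp add: Yk_def)
   have "rank_is (Suc a) (1 + b) (hc c E) k \<longleftrightarrow> rank_is (1 + a) (1 + b) (hc (e0w (1 + a)) (redm (K * E))) k"
    using rank_hc_reduce[OF K(1) pm_carrier[OF c1] cE] K(2) by simp
   also have "... \<longleftrightarrow> (\<exists>k'. rank_is a b (lower_block 1 0 (redm (K * E))) k' \<and> k = 1 + k')"
   proof (rule rank_transfer[OF rank_hc_e0w[OF F1] rank_exists_1[OF lower_block_Yk'[OF F]] Yk_carrier[OF lower_block_Yk'[OF F]]])
    show "hc (e0w (1 + a)) (redm (K * E)) \<in> carrier_mat (1 + a) (1 + b)"
     by (rule hc_carrier) (use Yk_carrier[OF F] in \<open>auto simp: e0w_def\<close>)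
   qed
   finally show "rank_is (Suc a) (1 + b) (hc c E) k \<longleftrightarrow>
    (\<exists>k'. rank_is a b (lower_block 1 0 (redm (K * E * 1\<^sub>m b + 0\<^sub>m (Suc a) b))) k' \<and> k = 1 + k')" unfolding eq .
  qed
  also have "... = (if k = 0 then 0 else q ^ b * Rc a b (k - 1))"
  proof (cases k)
   case (Suc k')
   have "{F \<in> Yk (Suc a) b 1. \<exists>k'. rank_is a b (lower_block 1 0 F) k' \<and> k = 1 + k'}
    = {F \<in> Yk (Suc a) b 1. lower_block 1 0 F \<in> {E \<in> Yk a b 1. rank_is a b E k'}}" using lower_block_Yk'[of _ a b 1] Suc by auto
   then show ?thesis using card_lower_block[of 1 "Suc a" 0 b "{E \<in> Yk a b 1. rank_is a b E k'}" 1] Suc by (simp add: Rc_def)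
  qed simp
  finally show ?thesis .
 qed
 then have "(\<Sum>c\<in>Yk (Suc a) 1 1 - {redm (0\<^sub>m (Suc a) 1)}. card {E \<in> Yk (Suc a) b 1. rank_is (Suc a) (1 + b) (hc c E) k})
  = card (Yk (Suc a) 1 1 - {redm (0\<^sub>m (Suc a) 1)}) * (if k = 0 then 0 else q ^ b * Rc a b (k - 1))" by simp
 also have "card (Yk (Suc a) 1 1 - {redm (0\<^sub>m (Suc a) 1)}) = q ^ Suc a - 1" by (subst card_Diff_subset) (auto simp: card_Yk redm_Yk)
 finally show "Rc (Suc a) (Suc b) k = Rc (Suc a) b k + (if k = 0 then 0 else (q ^ Suc a - 1) * (q ^ b * Rc a b (k - 1)))"
  using split[of "Suc a" k] by simp
qed

lemma Rc_zero_col: "Rc a 0 k = (if k = 0 then 1 else 0)"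
proof -
 have "rank_is a 0 E 0" if "E \<in> Yk a 0 1" for E using Yk_carrier[OF that] by (intro rank_is_0) (simp add: pm_def)
 moreover have "\<not> rank_is a 0 E k" if "k \<noteq> 0" for E using that by (simp add: rank_is_def)
 ultimately have "{E \<in> Yk a 0 1. rank_is a 0 E k} = (if k = 0 then Yk a 0 1 else {})" by auto
 then show ?thesis by (simp add: Rc_def card_Yk)
qed

lemma Rc_zero_row: "Rc 0 b k = (if k = 0 then 1 else 0)" by (induction b) (simp_all add: Rc_zero_col Rc_Suc(2))

text \<open>Induction with \<open>Rc_Suc\<close>, which amounts to a Pascal rule for Gaussian
  binomials. The case \<open>k = Suc b\<close> is separate, because there the first summand of the
  recursion vanishes.\<close>

lemma Rc_value:
 "real (Rc a b k) = (if k \<le> a \<and> k \<le> b then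
  real q ^ (k * (a + b - k)) * Vq q a * Vq q b / (Vq q (a - k) * Vq q (b - k) * Vq q k) else 0)"
proof (induction b arbitrary: a k)
 case 0
 show ?case using Vq_pos[OF q_gt_1, of a] by (simp add: Rc_zero_col)
next
 case (Suc b)
 note Vp = Vq_pos[OF q_gt_1]
 have q0: "real q > 0" using q_gt_1 by simp
 show ?case
 proof (cases a)
  case 0
  then show ?thesis using Vp[of "Suc b"] by (auto simp: Rc_zero_row)
 next
  case a: (Suc a')
  show ?thesis
  proof (cases k)
   case 0
   have "real (Rc a b 0) = 1" using Suc.IH[of a 0] Vp[of a] Vp[of b] by simp
   then show ?thesis using 0 a Vp[of a] Vp[of "Suc b"] Rc_Suc(1)[of a' b 0] by simp
  next
   case k: (Suc k')
   have rec: "real (Rc a (Suc b) k) = real (Rc a b k) + (real q ^ a - 1) * (real q ^ b * real (Rc a' b k'))"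
    using Rc_Suc(1)[of a' b k] a k q_gt_1 by (simp add: of_nat_diff)
   consider "k > a \<or> k > Suc b" | "k \<le> a" "k = Suc b" | "k \<le> a" "k \<le> b" by linarith
   then show ?thesis
   proof cases
    case 1
    then show ?thesis using rec Suc.IH[of a k] Suc.IH[of a' k'] a k by auto
   next
    case 2
    then have kb: "k' = b" "b \<le> a'" using a k by auto
    have r0: "real (Rc a b k) = 0" using Suc.IH[of a k] 2 by simp
    have r1: "real (Rc a' b k') = real q ^ (b * a') * Vq q a' / Vq q (a' - b)" using Suc.IH[of a' k'] kb Vp[of b] by simp
    have "(real q ^ a - 1) = real q ^ a * (1 - 1 / real q ^ a)" using q0 by (simp add: field_simps)
    then have Vfact: "(real q ^ a - 1) * Vq q a' = real q ^ a * Vq q a" using a by (simp add: Vq_Suc)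
    then have "(real q ^ a - 1) * (real q ^ b * (real q ^ (b * a') * Vq q a' / Vq q (a' - b)))
     = real q ^ a * real q ^ b * real q ^ (b * a') * Vq q a / Vq q (a' - b)"
    proof -
     have "(real q ^ a - 1) * (real q ^ b * (real q ^ (b * a') * Vq q a' / Vq q (a' - b)))
      = ((real q ^ a - 1) * Vq q a') * (real q ^ b * real q ^ (b * a') / Vq q (a' - b))" by (simp add: mult_ac)
     then show ?thesis by (simp only: Vfact) (simp add: mult_ac)
    qed
    also have "real q ^ a * real q ^ b * real q ^ (b * a') = real q ^ (k * (a + Suc b - k))"
     using 2 a by (simp add: power_add[symmetric] algebra_simps)
    finally show ?thesis using rec r0 r1 2 a Vp[of "Suc b"] Vp[of k] by simp
   next
    case 3
    define A where "A = Vq q a" define B where "B = Vq q b" define C where "C = Vq q (a - k)"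
    define D where "D = Vq q (b - k)" define X where "X = Vq q k'" define Q where "Q = real q ^ (k' * (a + b - k))"
    have pos: "A > 0" "B > 0" "C > 0" "D > 0" "X > 0" "Q > 0" using Vp q0 by (auto simp: A_def B_def C_def D_def X_def Q_def)
    have Va: "A = Vq q a' * (1 - 1 / real q ^ a)" using a by (simp add: A_def Vq_Suc)
    have Vk: "Vq q k = X * (1 - 1 / real q ^ k)" using k by (simp add: X_def Vq_Suc)
    have Vb: "Vq q (Suc b) = B * (1 - 1 / real q ^ Suc b)" by (simp add: B_def Vq_Suc)
    have Vbk: "Vq q (Suc b - k) = D * (1 - 1 / real q ^ (Suc b - k))" using 3 by (simp add: D_def Suc_diff_le Vq_Suc)
    have q1: "real q ^ j > 1" if "j > 0" for j using q_gt_1 that by (intro one_less_power) auto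
    define x where "x = real q ^ k" define y where "y = real q ^ (Suc b - k)" define z where "z = real q ^ a"
    have xyz: "x > 1" "y > 1" "z > 1" unfolding x_def y_def z_def by (rule q1, use 3 a k in simp)+
    have e1: "real q ^ (k * (a + b - k)) = Q * (z * y * x / (real q * x))"
    proof -
     have "k * (a + b - k) = k' * (a + b - k) + (a + (b - k))" using k 3 by simp
     moreover have "y = real q * real q ^ (b - k)" using 3 by (simp add: y_def Suc_diff_le)
     ultimately show ?thesis using q0 xyz by (simp add: Q_def z_def power_add)
    qed
    have e2: "real q ^ (k * (a + Suc b - k)) = Q * (z * y * x / real q)"
    proof -
     have "k * (a + Suc b - k) = k * (a + b - k) + k" using 3 by (simp add: Suc_diff_le)
     then show ?thesis using e1 q0 xyz by (simp add: power_add x_def)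
    qed
    have e3: "real q ^ Suc b = x * y"
    proof -
     have "Suc b = k + (Suc b - k)" using 3 by simp
     then show ?thesis unfolding x_def y_def by (metis power_add)
    qed
    have r1: "real (Rc a b k) = Q * (z * y * x / (real q * x)) * A * B / (C * D * (X * (1 - 1 / x)))"
     using Suc.IH[of a k] 3 e1 Vk by (simp add: A_def B_def C_def D_def x_def)
    have r2: "real (Rc a' b k') = Q * (A / (1 - 1 / z)) * B / (C * (D * (1 - 1 / y)) * X)"
    proof -
     have "a' + b - k' = a + b - k" "a' - k' = a - k" "b - k' = Suc b - k" using a k 3 by auto
     moreover have "Vq q a' = A / (1 - 1 / z)" using Va xyz by (simp add: z_def field_simps)
     ultimately show ?thesis using Suc.IH[of a' k'] 3 a k Vbk by (simp add: B_def C_def X_def Q_def y_def)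
    qed
    have r3: "real q ^ b = x * y / real q" using e3 q0 by (simp add: field_simps)
    have "real (Rc a (Suc b) k) = Q * (z * y * x / real q) * A * (B * (1 - 1 / (x * y))) / (C * (D * (1 - 1 / y)) * (X * (1 - 1 / x)))"
    proof -
     define T where "T = Q * A * B / (C * D * X)"
     define u where "u = 1 - 1 / x" define v where "v = 1 - 1 / y" define s where "s = 1 - 1 / z"
     have uvs: "u \<noteq> 0" "v \<noteq> 0" "s \<noteq> 0" using xyz by (auto simp: u_def v_def s_def)
     have zs: "z - 1 = z * s" using xyz by (simp add: s_def field_simps)
     have 1: "real (Rc a b k) = T * (z * y / real q) / (1 - 1 / x)"
      unfolding r1 T_def u_def[symmetric] using pos xyz q0 uvs by (simp add: field_simps)
     have 2: "(real q ^ a - 1) * (real q ^ b * real (Rc a' b k')) = T * (z * x * y / real q) / (1 - 1 / y)"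
      unfolding r2 r3 T_def z_def[symmetric] zs u_def[symmetric] v_def[symmetric] s_def[symmetric]
      using pos xyz q0 uvs by (simp add: field_simps)
     have 3: "Q * (z * y * x / real q) * A * (B * (1 - 1 / (x * y))) / (C * (D * (1 - 1 / y)) * (X * (1 - 1 / x)))
      = T * (z * y * x / real q) * (1 - 1 / (x * y)) / ((1 - 1 / y) * (1 - 1 / x))"
      unfolding T_def u_def[symmetric] v_def[symmetric] by (simp add: mult_ac)
     \<comment> \<open>Without the common factor this is the identity 1/(1 - 1/x) + x/(1 - 1/y) = x
       (1 - 1/(xy)) / ((1 - 1/x)(1 - 1/y)).\<close>
     have 4: "(z * y / real q) / (1 - 1 / x) + (z * x * y / real q) / (1 - 1 / y)
      = (z * y * x / real q) * (1 - 1 / (x * y)) / ((1 - 1 / y) * (1 - 1 / x))"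
     proof -
      have nz: "x - 1 \<noteq> 0" "y - 1 \<noteq> 0" "x \<noteq> 0" "y \<noteq> 0" using xyz by auto
      have a1: "1 / (1 - 1 / x) = x / (x - 1)" "1 / (1 - 1 / y) = y / (y - 1)" using nz by (simp_all add: field_simps)
      have "(z * y / real q) / (1 - 1 / x) + (z * x * y / real q) / (1 - 1 / y)
       = (z * y / real q) * (x / (x - 1)) + (z * x * y / real q) * (y / (y - 1))" by (simp flip: a1)
      also have "... = (z * x * y / real q) * (1 / (x - 1) + y / (y - 1))" by (simp add: distrib_left mult_ac)
      also have "1 / (x - 1) + y / (y - 1) = (x * y - 1) / ((x - 1) * (y - 1))" using nz by (simp add: divide_simps) (simp add: algebra_simps)
      also have "... = (1 - 1 / (x * y)) * (x / (x - 1)) * (y / (y - 1))" using nz by (simp add: divide_simps)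
      finally show ?thesis by (simp flip: a1 add: mult_ac)
     qed
     show ?thesis unfolding rec 1 2 3 using arg_cong[OF 4, of "\<lambda>v. T * v"] by (simp add: distrib_left mult_ac)
    qed
    then show ?thesis using 3 e2 e3 Vb Vk Vbk by (simp add: A_def C_def x_def y_def)
   qed
  qed
 qed
qed

text \<open>In coordinates that put \<open>Z\<close> into normal form, a lift is the normal form
  divided by \<open>w\<close> plus an arbitrary \<open>F\<close> with simple poles. The upper left
  block dominates, and its Schur complement differs from the lower block of \<open>F\<close> by an
  integral matrix, so that block alone decides how much is added to \<open>i\<close>.\<close>

lemma card_lifts:
 assumes Z: "Z \<in> Yk a b l" and rZ: "rank_is a b Z i"
 shows "card {Y \<in> Yk a b (Suc l). redm (w \<cdot>\<^sub>m Y) = Z \<and> rank_is a b Y j} =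
  (if i \<le> j then q ^ (a * b - (a - i) * (b - i)) * Rc (a - i) (b - i) (j - i) else 0)"
  and "Y \<in> Yk a b (Suc l) ==> redm (w \<cdot>\<^sub>m Y) = Z ==> \<exists>j. rank_is a b Y j"
proof -
 obtain K L Dl Dl' where *: "i \<le> a" "i \<le> b" "K \<in> Gl a" "L \<in> Gl b" "Dl \<in> carrier_mat i i" "Dl' \<in> pm i i 1"
  "Dl * Dl' = 1\<^sub>m i" "Dl' * Dl = 1\<^sub>m i" "K * Z * L - dg a b i Dl \<in> pm a b 0" using rank_isE[OF rZ] .
 define a' where "a' = a - i" define b' where "b' = b - i"
 have ab: "a = i + a'" "b = i + b'" using *(1,2) by (auto simp: a'_def b'_def)
 note cZ = Yk_carrier[OF Z] and cK = Gl_carrier[OF *(3)] and cL = Gl_carrier[OF *(4)] and cD = dg_carrier[OF *(5,1,2)]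
 have cDl': "Dl' \<in> carrier_mat i i" using *(6) pm_carrier by blast
 \<comment> \<open>The integral error of the normal form of \<open>Z\<close> acquires a simple pole
   on division by \<open>w\<close>; it is absorbed into the translation of \<open>E\<close>.\<close>
 define M where "M = (1 / w) \<cdot>\<^sub>m (K * Z * L - dg a b i Dl)"
 have cM: "M \<in> carrier_mat a b" using cZ cK cL cD by (simp add: M_def)
 have "w \<cdot>\<^sub>m M = K * Z * L - dg a b i Dl" using cZ cK cL cD by (intro eq_matI) (auto simp: M_def)
 then have M: "M \<in> pm a b (-1)" using pm_w[OF cM, of "-1"] *(9) by simp
 let ?D0 = "(1 / w) \<cdot>\<^sub>m dg a b i Dl"
 have cD0: "?D0 \<in> carrier_mat a b" using cD by simp
 have schur: "rank_is a b (?D0 + F) (i + k)" if F: "F \<in> Yk a b 1" and r: "rank_is a' b' (lower_block i i F) k" for F k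
 proof -
  note cF = Yk_carrier[OF F]
  obtain F1 F2 F3 where F1: "F1 \<in> carrier_mat i i" and F2: "F2 \<in> carrier_mat i b'" and F3: "F3 \<in> carrier_mat a' i"
   and F4: "lower_block i i F \<in> carrier_mat a' b'" and Feq: "F = four_block_mat F1 F2 F3 (lower_block i i F)"
   using block_decomp[of F i a' i b'] cF ab by blast
  have Fpm: "F1 \<in> pm i i (-1)" "F2 \<in> pm i b' (-1)" "F3 \<in> pm a' i (-1)"
   using F pm_four_block[OF F1 F2 F3 F4, of "-1"] Feq ab by (auto simp: Yk_def)
  \<comment> \<open>\<open>\<Theta>\<close> below is \<open>Dl\<close> divided by \<open>w\<close>,
    times \<open>U\<close>. As \<open>U\<close> is congruent to 1 modulo \<open>w\<close>, this
    block is invertible.\<close>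
  define U where "U = 1\<^sub>m i + w \<cdot>\<^sub>m (Dl' * F1)"
  have cU: "U \<in> carrier_mat i i" using cDl' F1 by (simp add: U_def)
  have "U - 1\<^sub>m i = w \<cdot>\<^sub>m (Dl' * F1)" using cDl' F1 by (intro eq_matI) (auto simp: U_def)
  moreover have "w \<cdot>\<^sub>m (Dl' * F1) \<in> pm i i 1" using pm_w[of "Dl' * F1" i i 0] pm_mult[OF *(6) Fpm(1)] cDl' F1 by simp
  ultimately have "U \<in> cg i 1" using cU by (simp add: cg_def)
  then obtain U' where U': "U' \<in> cg i 1" "U * U' = 1\<^sub>m i" "U' * U = 1\<^sub>m i" using cg_inverse[of U i 1] by auto
  note cU' = cg_carrier[OF U'(1)]
  define \<Theta> where "\<Theta> = (1 / w) \<cdot>\<^sub>m Dl + F1"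
  define \<Theta>' where "\<Theta>' = w \<cdot>\<^sub>m (U' * Dl')"
  have c\<Theta>: "\<Theta> \<in> carrier_mat i i" "\<Theta>' \<in> carrier_mat i i" using *(5) F1 cU' cDl' by (auto simp: \<Theta>_def \<Theta>'_def)
  have \<Theta>U: "\<Theta> = (1 / w) \<cdot>\<^sub>m (Dl * U)"
  proof -
   have "Dl * U = Dl + w \<cdot>\<^sub>m (Dl * (Dl' * F1))"
    unfolding U_def using *(5) cDl' F1 by (simp add: mult_add_distrib_mat[of _ i i _ i] mult_smult_distrib[of _ i i _ i] del: assoc_mult_mat)
   also have "Dl * (Dl' * F1) = F1" using *(5,7) cDl' F1 by (simp flip: assoc_mult_mat[of _ i i _ i _ i])
   finally show ?thesis using *(5) F1 by (intro eq_matI) (auto simp: \<Theta>_def field_simps)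
  qed
  have 1: "\<Theta> * \<Theta>' = 1\<^sub>m i"
  proof -
   have "\<Theta> * \<Theta>' = (Dl * U) * (U' * Dl')" unfolding \<Theta>U \<Theta>'_def using *(5) cU cU' cDl'
    by (simp add: mult_smult_assoc_mat[of _ i i _ i] mult_smult_distrib[of _ i i _ i] smult_smult_mat del: assoc_mult_mat)
     (intro eq_matI, auto)
   also have "(Dl * U) * (U' * Dl') = Dl * (U * U') * Dl'" using *(5) cU cU' cDl' by (simp add: assoc_mult_mat[of _ i i _ i _ i])
   also have "... = 1\<^sub>m i" using *(5,7) U' by simp
   finally show ?thesis .
  qed
  have 2: "\<Theta>' * \<Theta> = 1\<^sub>m i"
  proof -
   have "\<Theta>' * \<Theta> = (U' * Dl') * (Dl * U)" unfolding \<Theta>U \<Theta>'_def using *(5) cU cU' cDl'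
    by (simp add: mult_smult_assoc_mat[of _ i i _ i] mult_smult_distrib[of _ i i _ i] smult_smult_mat del: assoc_mult_mat)
     (intro eq_matI, auto)
   also have "(U' * Dl') * (Dl * U) = U' * (Dl' * Dl) * U" using *(5) cU cU' cDl' by (simp add: assoc_mult_mat[of _ i i _ i _ i])
   also have "... = 1\<^sub>m i" using *(8) U' cU' by simp
   finally show ?thesis .
  qed
  \<comment> \<open>The inverse is divisible by the square of \<open>w\<close>, enough to cancel a
    simple pole on either side in \<open>F3 * \<Theta>' * F2\<close>.\<close>
  have \<Theta>2: "\<Theta>' \<in> pm i i 2" unfolding \<Theta>'_def
   using pm_w[of "U' * Dl'" i i 1] pm_mult_S(1)[OF cg_pm[OF U'(1)] *(6)] cU' cDl' by simp
  have eq: "?D0 + F = four_block_mat \<Theta> F2 F3 (lower_block i i F)"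
   by (subst Feq, rule eq_matI) (use *(5) F1 F2 F3 F4 ab in \<open>auto simp: dg_def \<Theta>_def\<close>)
  have "F3 * \<Theta>' * F2 \<in> pm a' b' 0" using pm_mult[OF pm_mult[OF Fpm(3) \<Theta>2] Fpm(2)] by simp
  moreover have "lower_block i i F - (lower_block i i F - F3 * \<Theta>' * F2) = F3 * \<Theta>' * F2"
   using F4 F3 F2 c\<Theta> by (intro eq_matI) auto
  ultimately have r': "rank_is a' b' (lower_block i i F - F3 * \<Theta>' * F2) k" using F4 F3 F2 c\<Theta> by (intro rank_is_cong[OF F4 _ _ r]) auto
  have "rank_is (i + a') (i + b') (four_block_mat \<Theta> F2 F3 (lower_block i i F)) (i + k)"
  proof (rule rank_is_schur[OF c\<Theta>(1) _ 1 2 F2 F3 F4 _ _ r'])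
   show "\<Theta>' \<in> pm i i 1" by (rule pm_mono[OF _ \<Theta>2]) simp
   show "\<Theta>' * F2 \<in> pm i b' 0" using pm_mult[OF \<Theta>2 Fpm(2)] pm_mono[of 0 1] by auto
   show "F3 * \<Theta>' \<in> pm a' i 0" using pm_mult[OF Fpm(3) \<Theta>2] pm_mono[of 0 1] by auto
  qed
  then show ?thesis using eq ab by simp
 qed
 have low: "lower_block i i F \<in> Yk a' b' 1" if "F \<in> Yk a b 1" for F using lower_block_Yk[OF that] by (simp add: a'_def b'_def)
 have main: "rank_is a b (redm ((1 / w) \<cdot>\<^sub>m Z + E)) j \<longleftrightarrow> (\<exists>k. rank_is a' b' (lower_block i i (redm (K * E * L + M))) k \<and> j = i + k)"
  if E: "E \<in> Yk a b 1" for E j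
 proof -
  note cE = Yk_carrier[OF E]
  let ?Y = "(1 / w) \<cdot>\<^sub>m Z + E"
  have cY: "?Y \<in> carrier_mat a b" using cZ cE by simp
  let ?F = "redm (K * E * L + M)"
  have "E \<in> pm a b (-1)" using E by (simp add: Yk_def)
  then have h: "K * E * L + M \<in> pm a b (-1)" using Gl_pm *(3,4) M by (intro pm_add pm_mult_S)
  have F: "?F \<in> Yk a b 1" by (subst redm_Yk[OF pm_carrier[OF h]]) (use h in simp)
  have cKEL: "K * E * L \<in> carrier_mat a b" using cK cE cL by auto
  have "rank_is a b (redm ?Y) j \<longleftrightarrow> rank_is a b ?Y j"
   using rank_is_cong[OF _ cY redm_diff(1)[OF cY]] rank_is_cong[OF cY _ redm_diff(2)[OF cY]] cY by auto
  also have "... \<longleftrightarrow> rank_is a b (K * ?Y * L) j" by (rule rank_is_Gl_iff[OF *(3,4) cY, symmetric])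
  also have "K * ?Y * L = ?D0 + (K * E * L + M)"
  proof -
   have "K * ?Y * L = (1 / w) \<cdot>\<^sub>m (K * Z * L) + K * E * L"
    using cK cL cZ cE by (simp add: mult_add_distrib_mat[of _ a a _ b] add_mult_distrib_mat[of _ a b _ _ b]
      mult_smult_distrib[of _ a a _ b] mult_smult_assoc_mat[of _ a b _ b] del: assoc_mult_mat)
   also have "... = ?D0 + (K * E * L + M)"
    using cKEL cD cZ cK cL by (intro eq_matI) (auto simp: M_def algebra_simps diff_divide_distrib simp del: assoc_mult_mat)
   finally show ?thesis .
  qed
  also have "rank_is a b (?D0 + (K * E * L + M)) j \<longleftrightarrow> rank_is a b (?D0 + ?F) j"
  proof -
   have c1: "?D0 + (K * E * L + M) \<in> carrier_mat a b" "?D0 + ?F \<in> carrier_mat a b" using cD cKEL cM Yk_carrier[OF F] by auto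
   have "?D0 + (K * E * L + M) - (?D0 + ?F) = (K * E * L + M) - ?F" using cD cKEL cM Yk_carrier[OF F] by (intro eq_matI) (auto simp del: assoc_mult_mat)
   then have d: "?D0 + (K * E * L + M) - (?D0 + ?F) \<in> pm a b 0" using redm_diff(2)[of "K * E * L + M" a b] cKEL cM by auto
   then show ?thesis using rank_is_cong[OF c1 d] rank_is_cong[OF c1(2,1)] pm_diff_commute[OF c1] by blast
  qed
  also have "... \<longleftrightarrow> (\<exists>k. rank_is a' b' (lower_block i i ?F) k \<and> j = i + k)"
   by (rule rank_transfer[OF schur[OF F] rank_exists_1[OF low[OF F]] Yk_carrier[OF low[OF F]]])
    (use cD Yk_carrier[OF F] in auto)
  finally show ?thesis .
 qed
 have bijF: "bij_betw (\<lambda>E. redm (K * E * L + M)) (Yk a b 1) (Yk a b 1)" by (rule Yk_affine_bij) (use *(3,4) M in auto)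
 note bijY = Yk_lift_bij[OF Z]
 show "\<exists>j. rank_is a b Y j" if Y: "Y \<in> Yk a b (Suc l)" "redm (w \<cdot>\<^sub>m Y) = Z" for Y
 proof -
  obtain E where E: "E \<in> Yk a b 1" "Y = redm ((1 / w) \<cdot>\<^sub>m Z + E)" using bij_betw_imp_surj_on[OF bijY] Y by blast
  have "redm (K * E * L + M) \<in> Yk a b 1" using bij_betwE[OF bijF] E(1) by blast
  then obtain k where "rank_is a' b' (lower_block i i (redm (K * E * L + M))) k" using rank_exists_1[OF low] by blast
  then show ?thesis using main[OF E(1)] E(2) by blast
 qed
 have "bij_betw (\<lambda>E. redm ((1 / w) \<cdot>\<^sub>m Z + E)) {E \<in> Yk a b 1. rank_is a b (redm ((1 / w) \<cdot>\<^sub>m Z + E)) j}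
   {Y \<in> Yk a b (Suc l). redm (w \<cdot>\<^sub>m Y) = Z \<and> rank_is a b Y j}"
  using bij_betw_filter[OF bijY, of "\<lambda>E. rank_is a b (redm ((1 / w) \<cdot>\<^sub>m Z + E)) j" "\<lambda>Y. rank_is a b Y j"] by (simp add: conj_assoc)
 then have "card {Y \<in> Yk a b (Suc l). redm (w \<cdot>\<^sub>m Y) = Z \<and> rank_is a b Y j}
   = card {E \<in> Yk a b 1. rank_is a b (redm ((1 / w) \<cdot>\<^sub>m Z + E)) j}" using bij_betw_same_card by fastforce
 also have "... = card {F \<in> Yk a b 1. \<exists>k. rank_is a' b' (lower_block i i F) k \<and> j = i + k}"
  by (rule card_filter_bij[OF bijF]) (rule main)
 also have "... = (if i \<le> j then q ^ (a * b - (a - i) * (b - i)) * Rc (a - i) (b - i) (j - i) else 0)"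
 proof (cases "i \<le> j")
  case True
  have "{F \<in> Yk a b 1. \<exists>k. rank_is a' b' (lower_block i i F) k \<and> j = i + k}
   = {F \<in> Yk a b 1. lower_block i i F \<in> {E \<in> Yk a' b' 1. rank_is a' b' E (j - i)}}" using low True by auto
  then show ?thesis using card_lower_block[OF *(1,2), of "{E \<in> Yk a' b' 1. rank_is a' b' E (j - i)}" 1] True by (simp add: Rc_def a'_def b'_def)
 qed auto
 finally show "card {Y \<in> Yk a b (Suc l). redm (w \<cdot>\<^sub>m Y) = Z \<and> rank_is a b Y j} =
  (if i \<le> j then q ^ (a * b - (a - i) * (b - i)) * Rc (a - i) (b - i) (j - i) else 0)" .
qed

lemma rank_exists: "Y \<in> Yk a b l ==> \<exists>j. rank_is a b Y j"
proof (induction l arbitrary: Y)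
 case 0
 then have "Y \<in> pm a b 0" by (simp add: Yk_def)
 then show ?case using rank_is_0 by blast
next
 case (Suc l)
 have Z: "redm (w \<cdot>\<^sub>m Y) \<in> Yk a b l" by (rule Ys_scale[OF Suc.prems])
 obtain i where "rank_is a b (redm (w \<cdot>\<^sub>m Y)) i" using Suc.IH[OF Z] by blast
 then show ?case using card_lifts(2)[OF Z _ Suc.prems] by blast
qed

definition rk :: "nat \<Rightarrow> nat \<Rightarrow> 'k mat \<Rightarrow> nat" where "rk a b Y = (THE j. rank_is a b Y j)"

lemma rk: assumes "Y \<in> Ys a b" shows "rank_is a b Y (rk a b Y)"
proof -
 have "\<exists>!j. rank_is a b Y j" using assms rank_exists rank_unique Ys_carrier unfolding Ys_eq by blast
 then show ?thesis unfolding rk_def by (rule theI')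
qed

lemma rk_eq: "Y \<in> Ys a b ==> rank_is a b Y j \<longleftrightarrow> rk a b Y = j" using rk rank_unique Ys_carrier by metis

lemma rk_le: "Y \<in> Ys a b ==> rk a b Y \<le> a \<and> rk a b Y \<le> b" using rk by (auto simp: rank_is_def)

end

section \<open>Additive characters\<close>

text \<open>Graph of a homomorphism from an additive subgroup to the nonzero complex numbers.\<close>

definition partial_char :: "('a::comm_ring_1 \<times> complex) set \<Rightarrow> bool" where
 "partial_char M \<longleftrightarrow> (0, 1) \<in> M \<and> (\<forall>x a y b. (x, a) \<in> M --> (y, b) \<in> M --> (x - y, a / b) \<in> M) \<and>
  (\<forall>a. (0, a) \<in> M --> a = 1) \<and> (\<forall>x a. (x, a) \<in> M --> a \<noteq> 0)"

lemma partial_charD: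
 assumes "partial_char M"
 shows "(0, 1) \<in> M" "(x, a) \<in> M ==> (y, b) \<in> M ==> (x - y, a / b) \<in> M" "(0, a) \<in> M ==> a = 1"
  "(x, a) \<in> M ==> a \<noteq> 0" using assms unfolding partial_char_def by blast+

lemma partial_char_minus: "partial_char M ==> (x, a) \<in> M ==> (- x, 1 / a) \<in> M"
 using partial_charD(2)[of M 0 1 x a] partial_charD(1)[of M] by simp

lemma partial_char_add: "partial_char M ==> (x, a) \<in> M ==> (y, b) \<in> M ==> (x + y, a * b) \<in> M"
 using partial_charD(2)[of M x a "- y" "1 / b"] partial_char_minus[of M y b] by simp

lemma partial_char_unique: "partial_char M ==> (x, a) \<in> M ==> (x, b) \<in> M ==> a = b"
 using partial_charD(2)[of M x a x b] partial_charD(3)[of M "a / b"] partial_charD(4)[of M x b] by simp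

lemma partial_char_mult_nat: "partial_char M ==> (x, a) \<in> M ==> (of_nat n * x, a ^ n) \<in> M"
proof (induction n)
 case (Suc n)
 then show ?case using partial_char_add[of M "of_nat n * x" "a ^ n" x a] by (simp add: algebra_simps)
qed (simp add: partial_charD)

lemma partial_char_mult_int: assumes "partial_char M" "(x, a) \<in> M" shows "(of_int k * x, a powi k) \<in> M"
proof (cases "k \<ge> 0")
 case True
 then show ?thesis using partial_char_mult_nat[OF assms, of "nat k"] by (simp add: power_int_def)
next
 case False
 then show ?thesis using partial_char_minus[OF assms(1) partial_char_mult_nat[OF assms, of "nat (-k)"]]
  by (simp add: power_int_def divide_inverse power_inverse)
qed

text \<open>For \<open>b = 1\<close> there are \<open>k\<close> roots, so one of them differs from
  1; this keeps an extended character nontrivial at the new point.\<close>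

lemma complex_root_not_1:
 assumes "b \<noteq> 0" "k \<ge> 2"
 obtains c :: complex where "c ^ k = b" "c \<noteq> 1" "c \<noteq> 0"
proof (cases "b = 1")
 case True
 have "card {z::complex. z ^ k = 1} = k" using assms(2) card_roots_unity_eq[of k] by simp
 then have "\<not> {z::complex. z ^ k = 1} \<subseteq> {1}" using assms(2) card_mono[of "{1}" "{z::complex. z ^ k = 1}"] by auto
 then obtain c :: complex where "c ^ k = 1" "c \<noteq> 1" by blast
 moreover have "c \<noteq> 0" using \<open>c ^ k = 1\<close> assms(2) by (intro notI) (simp add: power_0_left)
 ultimately show ?thesis using that True by blast
next
 case False
 obtain c where c: "b = c ^ k" using exists_complex_root[of k b] assms(2) by auto
 then have "c \<noteq> 1" "c \<noteq> 0" using False assms by (auto simp: power_0_left)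
 then show ?thesis using that c by blast
qed

text \<open>The integers k with kx in the domain form a proper ideal, generated by 0 or by some n at
  least 2. In the second case the value at \<open>x\<close> has to be an n-th root of the value
  already given at nx, and a root other than 1 exists; in the first case the value is free.\<close>

lemma partial_char_extend:
 assumes M: "partial_char M" and x: "x \<notin> fst ` M"
 obtains M' c where "partial_char M'" "M \<subseteq> M'" "(x, c) \<in> M'" "c \<noteq> 1"
proof -
 define I where "I = {k. of_int k * x \<in> fst ` M}"
 have I: "\<exists>b. (of_int k * x, b) \<in> M" if "k \<in> I" for k using that by (force simp: I_def)
 have II: "k \<in> I" if "(of_int k * x, b) \<in> M" for k b using that by (force simp: I_def)
 have Idiff: "k - l \<in> I" if "k \<in> I" "l \<in> I" for k l
 proof -
  obtain a b where "(of_int k * x, a) \<in> M" "(of_int l * x, b) \<in> M" using I \<open>k \<in> I\<close> \<open>l \<in> I\<close> by blast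
  then have "(of_int k * x - of_int l * x, a / b) \<in> M" using partial_charD(2)[OF M] by blast
  then show ?thesis by (intro II[of _ "a / b"]) (simp add: left_diff_distrib)
 qed
 have Imult: "k * l \<in> I" if "k \<in> I" for k l
 proof -
  obtain a where "(of_int k * x, a) \<in> M" using I \<open>k \<in> I\<close> by blast
  then have "(of_int l * (of_int k * x), a powi l) \<in> M" using partial_char_mult_int[OF M] by blast
  then show ?thesis by (intro II[of _ "a powi l"]) (simp add: mult_ac)
 qed
 have I1: "1 \<notin> I" using x by (simp add: I_def)
 have "\<exists>c. c \<noteq> 0 \<and> c \<noteq> 1 \<and> (\<forall>k\<in>I. (of_int k * x, c powi k) \<in> M)"
 proof (cases "I \<subseteq> {0}")
  case True
  \<comment> \<open>Any nonzero value other than 1 would do.\<close>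
  then show ?thesis using partial_charD(1)[OF M] by (intro exI[of _ "-1"]) auto
 next
  case False
  then obtain k1 where k1: "k1 \<in> I" "k1 \<noteq> 0" by blast
  have "- k1 \<in> I" using Imult[OF k1(1), of "-1"] by simp
  then have ex: "\<exists>n::nat. n > 0 \<and> int n \<in> I" using k1 by (intro exI[of _ "nat \<bar>k1\<bar>"]) (auto simp: abs_if)
  define n where "n = (LEAST n. n > 0 \<and> int n \<in> I)"
  have n: "n > 0" "int n \<in> I" using LeastI_ex[OF ex] by (auto simp: n_def)
  have n2: "n \<ge> 2" using n I1 by (cases "n = 1") auto
  obtain b where b: "(of_int (int n) * x, b) \<in> M" using I n(2) by blast
  obtain c where c: "c ^ n = b" "c \<noteq> 1" "c \<noteq> 0" using complex_root_not_1[OF partial_charD(4)[OF M b] n2] .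
  have "(of_int k * x, c powi k) \<in> M" if k: "k \<in> I" for k
  proof -
   have "k mod int n = k - int n * (k div int n)" by (simp add: minus_mult_div_eq_mod)
   then have km: "k mod int n \<in> I" using Idiff[OF k Imult[OF n(2)]] by simp
   have "k mod int n = 0"
   proof (rule ccontr)
    assume knz: "k mod int n \<noteq> 0"
    have "0 \<le> k mod int n" "k mod int n < int n" using n(1) by auto
    with knz have "nat (k mod int n) > 0" "nat (k mod int n) < n" by linarith+
    moreover have "int (nat (k mod int n)) \<in> I" using km \<open>0 \<le> k mod int n\<close> by simp
    ultimately have "nat (k mod int n) > 0 \<and> int (nat (k mod int n)) \<in> I" "nat (k mod int n) < n" by auto
    then show False using not_less_Least[of "nat (k mod int n)" "\<lambda>n. n > 0 \<and> int n \<in> I"] by (simp add: n_def)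
   qed
   then have "int n dvd k" by (rule mod_0_imp_dvd)
   then obtain l where l: "k = int n * l" by (rule dvdE)
   have "(of_int l * (of_int (int n) * x), b powi l) \<in> M" by (rule partial_char_mult_int[OF M b])
   moreover have "b powi l = c powi k" by (simp add: l c(1)[symmetric] power_int_mult)
   ultimately show ?thesis by (simp add: l mult_ac)
  qed
  then show ?thesis using c by blast
 qed
 then obtain c where c: "c \<noteq> 0" "c \<noteq> 1" "\<And>k. k \<in> I ==> (of_int k * x, c powi k) \<in> M" by blast
 define M' where "M' = {(y + of_int k * x, a * c powi k) | y a k. (y, a) \<in> M}"
 have MM': "(y + of_int k * x, a * c powi k) \<in> M'" if "(y, a) \<in> M" for y a k using that by (auto simp: M'_def)
 have "partial_char M'" unfolding partial_char_def
 proof (intro conjI allI impI)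
  show "(0, 1) \<in> M'" using MM'[OF partial_charD(1)[OF M], of 0] by simp
  show "a \<noteq> 0" if "(y, a) \<in> M'" for y a using that c partial_charD(4)[OF M] by (auto simp: M'_def)
  show "(y - z, a / b) \<in> M'" if ya: "(y, a) \<in> M'" and zb: "(z, b) \<in> M'" for y z a b
  proof -
   obtain y' a' k where y: "y = y' + of_int k * x" "a = a' * c powi k" "(y', a') \<in> M" using ya by (auto simp: M'_def)
   obtain z' b' l where z: "z = z' + of_int l * x" "b = b' * c powi l" "(z', b') \<in> M" using zb by (auto simp: M'_def)
   have "(y' - z' + of_int (k - l) * x, a' / b' * c powi (k - l)) \<in> M'" by (rule MM'[OF partial_charD(2)[OF M y(3) z(3)]])
   moreover have "y' - z' + of_int (k - l) * x = y - z" "a' / b' * c powi (k - l) = a / b"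
    using c(1) by (auto simp: y z algebra_simps power_int_diff)
   ultimately show ?thesis by simp
  qed
  show "a = 1" if a: "(0, a) \<in> M'" for a
  proof -
   obtain y b k where y: "0 = y + of_int k * x" "a = b * c powi k" "(y, b) \<in> M" using a by (auto simp: M'_def)
   have "of_int k * x = - y" using y(1) by (simp add: eq_neg_iff_add_eq_0 add.commute)
   then have 1: "(of_int k * x, 1 / b) \<in> M" using partial_char_minus[OF M y(3)] by simp
   then have "1 / b = c powi k" using partial_char_unique[OF M 1 c(3)[OF II[OF 1]]] by simp
   then show ?thesis using y(2) partial_charD(4)[OF M y(3)] by (simp add: divide_simps mult.commute)
  qed
 qed
 moreover have "M \<subseteq> M'"
 proof
  fix ya assume "ya \<in> M"
  then show "ya \<in> M'" using MM'[of "fst ya" "snd ya" 0] by (cases ya) simp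
 qed
 moreover have "(x, c) \<in> M'" using MM'[OF partial_charD(1)[OF M], of 1] by simp
 ultimately show ?thesis using that c(2) by blast
qed

text \<open>Nonzero complex numbers have roots of all orders, so the trivial character of
  \<open>S\<close> extends: first to \<open>z\<close> with a value other than 1, and then, by Zorn,
  to a maximal domain, which is everything.\<close>

lemma additive_char_exists:
 fixes S :: "'a::comm_ring_1 set"
 assumes S: "0 \<in> S" "\<And>x y. x \<in> S ==> y \<in> S ==> x - y \<in> S" and z: "z \<notin> S"
 obtains \<psi> :: "'a \<Rightarrow> complex" where "\<And>x y. \<psi> (x + y) = \<psi> x * \<psi> y" "\<And>x. \<psi> x \<noteq> 0" "\<And>x. x \<in> S ==> \<psi> x = 1" "\<psi> z \<noteq> 1"
proof -
 have "partial_char (S \<times> {1})" using S by (auto simp: partial_char_def)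
 moreover have "z \<notin> fst ` (S \<times> {1})" using z by auto
 ultimately obtain M c where M: "partial_char M" "S \<times> {1} \<subseteq> M" "(z, c) \<in> M" "c \<noteq> 1" by (rule partial_char_extend)
 define \<A> where "\<A> = {N. partial_char N \<and> M \<subseteq> N}"
 have "\<exists>N\<in>\<A>. \<forall>X\<in>\<A>. N \<subseteq> X --> X = N"
 proof (rule subset_Zorn_nonempty)
  show "\<A> \<noteq> {}" using M by (auto simp: \<A>_def)
  fix \<C> assume \<C>: "\<C> \<noteq> {}" "subset.chain \<A> \<C>"
  then have sub: "\<And>N. N \<in> \<C> ==> partial_char N \<and> M \<subseteq> N" and chain: "\<And>N N'. N \<in> \<C> ==> N' \<in> \<C> ==> N \<subseteq> N' \<or> N' \<subseteq> N"
   by (auto simp: \<A>_def subset_chain_def)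
  have "partial_char (\<Union>\<C>)" unfolding partial_char_def
  proof (intro conjI allI impI)
   show "(0, 1) \<in> \<Union>\<C>" using \<C>(1) sub partial_charD(1) by blast
   show "(x - y, a / b) \<in> \<Union>\<C>" if xy: "(x, a) \<in> \<Union>\<C>" "(y, b) \<in> \<Union>\<C>" for x y a b
   proof -
    obtain N1 N2 where N: "N1 \<in> \<C>" "(x, a) \<in> N1" "N2 \<in> \<C>" "(y, b) \<in> N2" using xy by blast
    obtain N where N': "N \<in> \<C>" "(x, a) \<in> N" "(y, b) \<in> N" using chain[OF N(1,3)] N by blast
    then have "(x - y, a / b) \<in> N" using sub partial_charD(2) by blast
    then show ?thesis using N'(1) by blast
   qed
   show "a = 1" if "(0, a) \<in> \<Union>\<C>" for a using that sub partial_charD(3) by blast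
   show "a \<noteq> 0" if "(x, a) \<in> \<Union>\<C>" for x a using that sub partial_charD(4) by blast
  qed
  then show "\<Union>\<C> \<in> \<A>" using \<C>(1) sub by (auto simp: \<A>_def)
 qed
 then obtain N where N: "partial_char N" "M \<subseteq> N" and max: "\<And>X. partial_char X ==> M \<subseteq> X ==> N \<subseteq> X ==> X = N"
  by (auto simp: \<A>_def)
 have dom: "\<exists>a. (x, a) \<in> N" for x
 proof (rule ccontr)
  assume neg: "\<nexists>a. (x, a) \<in> N"
  then have "x \<notin> fst ` N" by auto
  then obtain X d where X: "partial_char X" "N \<subseteq> X" "(x, d) \<in> X" "d \<noteq> 1" using partial_char_extend[OF N(1)] by metis
  then have "X = N" using max N(2) by blast
  then show False using neg X(3) by blast
 qed
 define \<psi> where "\<psi> x = (THE a. (x, a) \<in> N)" for x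
 have psi: "(x, a) \<in> N ==> \<psi> x = a" for x a unfolding \<psi>_def using partial_char_unique[OF N(1)] by blast
 have psiN: "(x, \<psi> x) \<in> N" for x using dom[of x] psi by blast
 show ?thesis
 proof (rule that[of \<psi>])
  show "\<psi> (x + y) = \<psi> x * \<psi> y" for x y using psi[OF partial_char_add[OF N(1) psiN psiN]] .
  show "\<psi> x \<noteq> 0" for x using partial_charD(4)[OF N(1) psiN] .
  show "\<psi> x = 1" if "x \<in> S" for x using psi that M(2) N(2) by blast
  show "\<psi> z \<noteq> 1" using psi M(3,4) N(2) by blast
 qed
qed

section \<open>Congruence subgroups and their topology\<close>

context complete_dvr
begin

lemma pw_1: "pw 1 = {x \<in> S. x / w \<in> S}" using pw_S[of 1] by (auto simp: pw_def power_int_minus divide_inverse)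

lemma ideal_prod_pw: "ideal_prod (ring_on S) (pw k) (pw 1) = pw (k + 1)"
proof (intro equalityI subsetI)
 fix x assume "x \<in> ideal_prod (ring_on S) (pw k) (pw 1)"
 then show "x \<in> pw (k + 1)" by induction (auto intro: pw_mult pw_add)
next
 fix x assume "x \<in> pw (k + 1)"
 then have "x / w \<in> pw k" using pw_w(1)[of "x / w" k] by simp
 moreover have "w \<in> pw 1" by (simp add: pw_def power_int_minus)
 ultimately have "x / w \<otimes>\<^bsub>ring_on S\<^esub> w \<in> ideal_prod (ring_on S) (pw k) (pw 1)" by (rule ideal_prod.prod)
 then show "x \<in> ideal_prod (ring_on S) (pw k) (pw 1)" by simp
qed

lemma ideal_power_pw: "ideal_power S (pw 1) k = pw (int k)"
proof (induction k)
 case 0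
 show ?case by (simp add: ideal_power_def ideals_set_def pw_0)
next
 case (Suc k)
 have "ideal_power S (pw 1) (Suc k) = ideal_prod (ring_on S) (ideal_power S (pw 1) k) (pw 1)" by (simp add: ideal_power_def ideals_set_def)
 then show ?case using ideal_prod_pw[of "int k"] by (simp add: Suc add.commute)
qed

lemma GL_grp_carrier: "carrier (GL_grp n S) = Gl n" by (auto simp: GL_grp_def units_of_def Units_def mat_monoid_def Gl_def pm_def pw_0)

lemma GL_grp_mult: "mult (GL_grp n S) = (*)" and GL_grp_one: "one (GL_grp n S) = 1\<^sub>m n" by (auto simp: GL_grp_def units_of_def mat_monoid_def)

lemma mat_cong_pm: "A \<in> carrier_mat n n ==> B \<in> carrier_mat n n ==>
  mat_cong n S (pw 1) k A B \<longleftrightarrow> A - B \<in> pm n n (int k)" by (auto simp: mat_cong_def ideal_power_pw pm_def)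

abbreviation (input) Gr where "Gr n r \<equiv> congruence_subgroup n S (pw 1) r"

lemma Gr_carrier: "r \<ge> 1 ==> carrier (Gr n r) = cg n r"
proof -
 assume r: "r \<ge> 1"
 have "A \<in> Gl n \<and> mat_cong n S (pw 1) r A (1\<^sub>m n) \<longleftrightarrow> A \<in> cg n r" for A
  using cg_Gl[OF _ r, of A n] Gl_carrier[of A n] mat_cong_pm[of A n "1\<^sub>m n" r] by (auto simp: cg_def)
 then show ?thesis by (auto simp: congruence_subgroup_def GL_grp_carrier)
qed

lemma Gr_mult [simp]: "mult (Gr n r) = (*)" and Gr_one [simp]: "one (Gr n r) = 1\<^sub>m n"
 by (simp_all add: congruence_subgroup_def GL_grp_mult GL_grp_one)

lemma one_cg [simp]: "1\<^sub>m a \<in> cg a k"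
proof -
 have "1\<^sub>m a - 1\<^sub>m a = (0\<^sub>m a a :: 'k mat)" by simp
 then show ?thesis by (simp add: cg_def del: minus_r_inv_mat)
qed

lemma cg_mult: assumes "A \<in> cg a k" "B \<in> cg a k" shows "A * B \<in> cg a k"
proof -
 note c = cg_carrier[OF assms(1)] cg_carrier[OF assms(2)]
 have "(A - 1\<^sub>m a) * B + (B - 1\<^sub>m a) \<in> pm a a (int k)" using assms cg_pm[OF assms(2)] by (intro pm_add pm_mult_S) (auto simp: cg_def)
 moreover have "(A - 1\<^sub>m a) * B + (B - 1\<^sub>m a) = A * B - 1\<^sub>m a"
  using c by (simp add: minus_mult_distrib_mat[of _ a a _ _ a]) (intro eq_matI, auto)
 ultimately show ?thesis using c by (simp add: cg_def)
qed

lemma cg_mono: "k \<le> l ==> cg a l \<subseteq> cg a k" using pm_mono[of "int k" "int l"] by (auto simp: cg_def)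

lemma cg_add: assumes "A \<in> cg a k" "E \<in> pm a a (int k)" shows "A + E \<in> cg a k" "A - E \<in> cg a k"
proof -
 note c = cg_carrier[OF assms(1)] pm_carrier[OF assms(2)]
 have "A + E - 1\<^sub>m a = (A - 1\<^sub>m a) + E" "A - E - 1\<^sub>m a = (A - 1\<^sub>m a) - E" using c by (auto intro!: eq_matI)
 then show "A + E \<in> cg a k" "A - E \<in> cg a k" using assms c by (auto simp: cg_def intro: pm_add pm_diff)
qed

text \<open>Additive closeness is turned into a right factor close to 1, the form in which
  \<open>cc_level\<close> and \<open>act_fix\<close> can be applied.\<close>

lemma cg_cong_mult:
 assumes x: "x \<in> cg a k" "k \<ge> 1" and y: "y \<in> carrier_mat a a" "y - x \<in> pm a a (int l)"
 obtains z where "z \<in> cg a l" "y = x * z"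
proof -
 obtain x' where x': "x' \<in> cg a k" "x * x' = 1\<^sub>m a" "x' * x = 1\<^sub>m a" using cg_inverse[OF x] .
 note c = cg_carrier[OF x(1)] cg_carrier[OF x'(1)] y(1)
 have "x' * (y - x) \<in> pm a a (int l)" using cg_pm[OF x'(1)] y(2) by (rule pm_mult_S)
 moreover have "x' * (y - x) = x' * y - 1\<^sub>m a" using c x' by (simp add: mult_minus_distrib_mat[of _ a a _ a])
 ultimately have "x' * y \<in> cg a l" using c by (simp add: cg_def)
 moreover have "x * (x' * y) = y" using c x' by (simp flip: assoc_mult_mat[of _ a a _ a _ a])
 ultimately show ?thesis using that by metis
qed

abbreviation (input) Tp where "Tp n r \<equiv> subtopology (GL_topology n S (pw 1)) (carrier (Gr n r))"

text \<open>Induction on the generation of the topology; a basic ball can be recentred at any of its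
  points. Together with \<open>Tp_openI\<close> this describes the open sets by congruences.\<close>

lemma Tp_open_ball:
 assumes r: "r \<ge> 1" and U: "openin (Tp n r) U" and x: "x \<in> U"
 shows "\<exists>k. \<forall>y\<in>cg n r. y - x \<in> pm n n (int k) --> y \<in> U"
proof -
 obtain V where V: "openin (GL_topology n S (pw 1)) V" "U = V \<inter> cg n r" using U unfolding openin_subtopology Gr_carrier[OF r] by blast
 let ?B = "{{B \<in> Gl n. mat_cong n S (pw 1) m B A} |A m. A \<in> Gl n}"
 have "generate_topology_on ?B V" using V(1) by (simp add: GL_topology_def openin_topology_generated_by_iff GL_grp_carrier)
 then have "\<forall>x\<in>V. x \<in> Gl n --> (\<exists>k. \<forall>y\<in>Gl n. y - x \<in> pm n n (int k) --> y \<in> V)"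
 proof induction
  case (Int a b)
  show ?case
  proof (intro ballI impI)
   fix x assume x: "x \<in> a \<inter> b" "x \<in> Gl n"
   obtain k where k: "\<And>y. y \<in> Gl n ==> y - x \<in> pm n n (int k) ==> y \<in> a" using Int.IH(1) x by blast
   obtain l where l: "\<And>y. y \<in> Gl n ==> y - x \<in> pm n n (int l) ==> y \<in> b" using Int.IH(2) x by blast
   show "\<exists>k. \<forall>y\<in>Gl n. y - x \<in> pm n n (int k) --> y \<in> a \<inter> b"
    using k l pm_mono[of "int k" "int (max k l)"] pm_mono[of "int l" "int (max k l)"] by (intro exI[of _ "max k l"]) auto
  qed
 next
  case (UN K)
  then show ?case by (meson Union_iff)
 next
  case (Basis s)
  then obtain A m where s: "s = {B \<in> Gl n. mat_cong n S (pw 1) m B A}" "A \<in> Gl n" by blast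
  show ?case
  proof (intro ballI impI exI[of _ m])
   fix x y assume xy: "x \<in> s" "y \<in> Gl n" "y - x \<in> pm n n (int m)"
   note c = Gl_carrier[OF s(2)] Gl_carrier[OF xy(2)]
   have x: "x \<in> carrier_mat n n" "x - A \<in> pm n n (int m)" using xy(1) s c mat_cong_pm Gl_carrier by auto
   have "y - A \<in> pm n n (int m)" using pm_diff_trans[OF xy(3) x(2)] c x by blast
   then show "y \<in> s" using s xy(2) mat_cong_pm c by auto
  qed
 qed auto
 moreover have "x \<in> V" "x \<in> Gl n" using x V(2) cg_Gl[OF _ r] by auto
 ultimately obtain k where k: "\<And>y. y \<in> Gl n ==> y - x \<in> pm n n (int k) ==> y \<in> V" by metis
 have "y \<in> U" if "y \<in> cg n r" "y - x \<in> pm n n (int k)" for y using k[OF cg_Gl[OF that(1) r] that(2)] that(1) V(2) by blast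
 then show ?thesis by blast
qed

lemma Tp_openI:
 assumes r: "r \<ge> 1" and U: "U \<subseteq> cg n r" "\<And>x. x \<in> U ==> \<exists>k. \<forall>y\<in>cg n r. y - x \<in> pm n n (int k) --> y \<in> U"
 shows "openin (Tp n r) U"
proof -
 obtain k where k: "\<And>x y. x \<in> U ==> y \<in> cg n r ==> y - x \<in> pm n n (int (k x)) ==> y \<in> U" using U(2) by metis
 define V where "V = (\<Union>x\<in>U. {B \<in> carrier (GL_grp n S). mat_cong n S (pw 1) (k x) B x})"
 have UG: "x \<in> Gl n" if "x \<in> U" for x using that U(1) cg_Gl r by blast
 have "openin (GL_topology n S (pw 1)) V" unfolding V_def
 proof (rule openin_Union, safe)
  fix x assume "x \<in> U"
  then show "openin (GL_topology n S (pw 1)) {B \<in> carrier (GL_grp n S). mat_cong n S (pw 1) (k x) B x}"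
   unfolding GL_topology_def openin_topology_generated_by_iff
   by (intro generate_topology_on.Basis) (use UG in \<open>auto simp: GL_grp_carrier\<close>)
 qed
 moreover have "U = V \<inter> cg n r"
 proof (intro equalityI subsetI)
  fix x assume x: "x \<in> U"
  have "x - x = 0\<^sub>m n n" using Gl_carrier[OF UG[OF x]] by simp
  then have "mat_cong n S (pw 1) (k x) x x" using mat_cong_pm Gl_carrier[OF UG[OF x]] by simp
  then show "x \<in> V \<inter> cg n r" using x U(1) UG by (auto simp: V_def GL_grp_carrier)
 next
  fix y assume "y \<in> V \<inter> cg n r"
  then obtain x where x: "x \<in> U" "mat_cong n S (pw 1) (k x) y x" "y \<in> cg n r" by (auto simp: V_def)
  then have "y - x \<in> pm n n (int (k x))" using mat_cong_pm Gl_carrier[OF UG[OF x(1)]] cg_carrier by blast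
  then show "y \<in> U" using k x by blast
 qed
 ultimately show ?thesis unfolding openin_subtopology Gr_carrier[OF r] by blast
qed

end

section \<open>Coordinates on the coset space\<close>

locale block_setting = complete_dvr S w q for S :: "'k::field set" and w q +
 fixes t m r :: nat
 assumes r1: "r \<ge> 1"
begin

definition bA :: "'k mat \<Rightarrow> 'k mat" where "bA x = mat t t (\<lambda>(i, j). x $$ (i, j))"
definition bB :: "'k mat \<Rightarrow> 'k mat" where "bB x = mat t m (\<lambda>(i, j). x $$ (i, j + t))"
definition bC :: "'k mat \<Rightarrow> 'k mat" where "bC x = mat m t (\<lambda>(i, j). x $$ (i + t, j))"
definition bD :: "'k mat \<Rightarrow> 'k mat" where "bD x = mat m m (\<lambda>(i, j). x $$ (i + t, j + t))"

lemma b_carrier [simp]: "bA x \<in> carrier_mat t t" "bB x \<in> carrier_mat t m" "bC x \<in> carrier_mat m t" "bD x \<in> carrier_mat m m"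
 by (auto simp: bA_def bB_def bC_def bD_def)

lemma b_dim [simp]:
 "dim_row (bA x) = t" "dim_col (bA x) = t" "dim_row (bB x) = t" "dim_col (bB x) = m"
 "dim_row (bC x) = m" "dim_col (bC x) = t" "dim_row (bD x) = m" "dim_col (bD x) = m" by (auto simp: bA_def bB_def bC_def bD_def)

lemma b_decomp: "x \<in> carrier_mat (t + m) (t + m) ==> x = four_block_mat (bA x) (bB x) (bC x) (bD x)"
 by (intro eq_matI) (auto simp: bA_def bB_def bC_def bD_def)

lemma b_four_block:
 assumes "A \<in> carrier_mat t t" "B \<in> carrier_mat t m" "C \<in> carrier_mat m t" "D \<in> carrier_mat m m"
 shows "bA (four_block_mat A B C D) = A" "bB (four_block_mat A B C D) = B"
  "bC (four_block_mat A B C D) = C" "bD (four_block_mat A B C D) = D" using assms by (auto intro!: eq_matI simp: bA_def bB_def bC_def bD_def)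

lemma b_mult:
 assumes "x \<in> carrier_mat (t + m) (t + m)" "y \<in> carrier_mat (t + m) (t + m)"
 shows "bA (x * y) = bA x * bA y + bB x * bC y" "bB (x * y) = bA x * bB y + bB x * bD y"
proof -
 have "x * y = four_block_mat (bA x) (bB x) (bC x) (bD x) * four_block_mat (bA y) (bB y) (bC y) (bD y)"
  using b_decomp[OF assms(1)] b_decomp[OF assms(2)] by simp
 also have "... = four_block_mat (bA x * bA y + bB x * bC y) (bA x * bB y + bB x * bD y)
   (bC x * bA y + bD x * bC y) (bC x * bB y + bD x * bD y)" by (rule mult_four_block_mat) (rule b_carrier)+
 finally have eq: "x * y = four_block_mat (bA x * bA y + bB x * bC y) (bA x * bB y + bB x * bD y)
   (bC x * bA y + bD x * bC y) (bC x * bB y + bD x * bD y)" .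
 have c: "bA x * bA y + bB x * bC y \<in> carrier_mat t t" "bA x * bB y + bB x * bD y \<in> carrier_mat t m"
  "bC x * bA y + bD x * bC y \<in> carrier_mat m t" "bC x * bB y + bD x * bD y \<in> carrier_mat m m"
  using mult_carrier_mat[OF b_carrier(3) b_carrier(1), of x y] mult_carrier_mat[OF b_carrier(4) b_carrier(3), of x y]
   mult_carrier_mat[OF b_carrier(3) b_carrier(2), of x y] mult_carrier_mat[OF b_carrier(4) b_carrier(4), of x y]
   mult_carrier_mat[OF b_carrier(1) b_carrier(1), of x y] mult_carrier_mat[OF b_carrier(2) b_carrier(3), of x y]
   mult_carrier_mat[OF b_carrier(1) b_carrier(2), of x y] mult_carrier_mat[OF b_carrier(2) b_carrier(4), of x y] by auto
 show "bA (x * y) = bA x * bA y + bB x * bC y" "bB (x * y) = bA x * bB y + bB x * bD y" unfolding eq by (rule b_four_block[OF c])+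
qed

lemma cg_blocks:
 "x \<in> cg (t + m) k \<longleftrightarrow> x \<in> carrier_mat (t + m) (t + m) \<and> bA x \<in> cg t k \<and> bB x \<in> pm t m (int k) \<and> bC x \<in> pm m t (int k) \<and> bD x \<in> cg m k"
proof (cases "x \<in> carrier_mat (t + m) (t + m)")
 case True
 have "x - 1\<^sub>m (t + m) = four_block_mat (bA x - 1\<^sub>m t) (bB x) (bC x) (bD x - 1\<^sub>m m)"
  using True by (intro eq_matI) (auto simp: bA_def bB_def bC_def bD_def)
 then have "x - 1\<^sub>m (t + m) \<in> pm (t + m) (t + m) (int k) \<longleftrightarrow>
  bA x - 1\<^sub>m t \<in> pm t t (int k) \<and> bB x \<in> pm t m (int k) \<and> bC x \<in> pm m t (int k) \<and> bD x - 1\<^sub>m m \<in> pm m m (int k)"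
  by (simp add: pm_four_block)
 then show ?thesis using True by (simp add: cg_def)
qed (auto simp: cg_def)

text \<open>The coordinate \<open>A\<^sup>-\<^sup>1 B\<close> on the quotient of the group by the block subgroup.\<close>

definition cc :: "'k mat \<Rightarrow> 'k mat" where
 "cc x = (THE X. X \<in> carrier_mat t m \<and> bA x * X = bB x)"

lemma cg_cancel:
 assumes A: "A \<in> cg a r" and X: "X \<in> carrier_mat a b" "Y \<in> carrier_mat a b" and eq: "A * X = A * Y"
 shows "X = Y"
proof -
 obtain A' where A': "A' \<in> cg a r" "A' * A = 1\<^sub>m a" using cg_inverse[OF A r1] .
 note c = cg_carrier[OF A] cg_carrier[OF A'(1)]
 have "A' * (A * X) = A' * (A * Y)" using eq by simp
 then show ?thesis using c A' X by (simp flip: assoc_mult_mat[of _ a a _ a _ b])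
qed

lemma ccI: assumes x: "x \<in> cg (t + m) r" and X: "X \<in> carrier_mat t m" "bA x * X = bB x" shows "cc x = X" unfolding cc_def
proof (rule the_equality)
 have A: "bA x \<in> cg t r" using x cg_blocks by blast
 show "Y = X" if "Y \<in> carrier_mat t m \<and> bA x * Y = bB x" for Y by (rule cg_cancel[OF A, where b = m]) (use that X in auto)
qed (use X in blast)

lemma cc: assumes x: "x \<in> cg (t + m) r" shows "cc x \<in> pm t m (int r)" "bA x * cc x = bB x"
proof -
 have A: "bA x \<in> cg t r" and B: "bB x \<in> pm t m (int r)" using x cg_blocks by auto
 obtain A' where A': "A' \<in> cg t r" "bA x * A' = 1\<^sub>m t" using cg_inverse[OF A r1] .
 have "bA x * (A' * bB x) = bB x" using A' cg_carrier[OF A'(1)] by (simp flip: assoc_mult_mat[of _ t t _ t _ m])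
 moreover have P: "A' * bB x \<in> pm t m (int r)" using cg_pm[OF A'(1)] B by (rule pm_mult_S)
 ultimately have "cc x = A' * bB x" using ccI[OF x] pm_carrier by blast
 then show "cc x \<in> pm t m (int r)" "bA x * cc x = bB x" using P \<open>bA x * (A' * bB x) = bB x\<close> by auto
qed

lemmas cc_carrier = pm_carrier[OF cc(1)]

text \<open>A section of the coordinate: the unipotent representative of the coset with coordinate
  \<open>X\<close>.\<close>

definition uu :: "'k mat \<Rightarrow> 'k mat" where "uu X = four_block_mat (1\<^sub>m t) X (0\<^sub>m m t) (1\<^sub>m m)"

lemma uu_blocks: "X \<in> carrier_mat t m ==> bA (uu X) = 1\<^sub>m t \<and> bB (uu X) = X \<and> bC (uu X) = 0\<^sub>m m t \<and> bD (uu X) = 1\<^sub>m m"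
 by (simp add: uu_def b_four_block)

lemma uu_cg: assumes "X \<in> pm t m (int r)" shows "uu X \<in> cg (t + m) r"
proof -
 note c = pm_carrier[OF assms]
 have "uu X \<in> carrier_mat (t + m) (t + m)" using c by (simp add: uu_def)
 then show ?thesis using uu_blocks[OF c] assms by (simp add: cg_blocks)
qed

lemma cc_uu: assumes "X \<in> pm t m (int r)" shows "cc (uu X) = X"
 using uu_blocks[OF pm_carrier[OF assms]] pm_carrier[OF assms] by (intro ccI[OF uu_cg[OF assms]]) auto

text \<open>The fractional linear action on coordinates, with its left denominator multiplied out;
  it comes from comparing the first block row of \<open>x * g\<close>.\<close>

lemma moebius:
 assumes x: "x \<in> cg (t + m) r" and g: "g \<in> cg (t + m) r"
 shows "(bA g + cc x * bC g) * cc (x * g) = bB g + cc x * bD g"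
  and "bA g + cc x * bC g \<in> cg t r"
proof -
 note cx = cc_carrier[OF x] and c = cg_carrier[OF x] cg_carrier[OF g]
 have A: "bA x \<in> cg t r" "bA g \<in> cg t r" "bC g \<in> pm m t (int r)" using x g cg_blocks by auto
 have xg: "x * g \<in> cg (t + m) r" using x g by (rule cg_mult)
 have p: "cc x * bC g \<in> pm t t (int r)" using pm_mult[OF cc(1)[OF x] A(3)] pm_mono[of "int r" "int r + int r"] by auto
 then show M: "bA g + cc x * bC g \<in> cg t r" by (rule cg_add(1)[OF A(2)])
 note cM = cg_carrier[OF M] and cxg = cc_carrier[OF xg]
 have eA: "bA (x * g) = bA x * (bA g + cc x * bC g)" using b_mult(1)[OF c] cc(2)[OF x] cx
  by (simp add: mult_add_distrib_mat[of _ t t _ t] pm_carrier[OF p] flip: assoc_mult_mat[of _ t t _ m _ t])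
 have eB: "bB (x * g) = bA x * (bB g + cc x * bD g)" using b_mult(2)[OF c] cc(2)[OF x] cx mult_carrier_mat[OF cx b_carrier(4)[of g]]
  by (simp add: mult_add_distrib_mat[of _ t t _ m] flip: assoc_mult_mat[of _ t t _ m _ m])
 have eq: "bA x * ((bA g + cc x * bC g) * cc (x * g)) = bA x * (bB g + cc x * bD g)"
  using cc(2)[OF xg] cM cxg unfolding eA eB by (simp flip: assoc_mult_mat[of _ t t _ t _ m])
 show "(bA g + cc x * bC g) * cc (x * g) = bB g + cc x * bD g"
  by (rule cg_cancel[OF A(1) _ _ eq, where b = m]) (use cM cxg mult_carrier_mat[OF cx b_carrier(4)[of g]] in auto)
qed

text \<open>Differences of coordinates transform linearly under the fractional linear action; this is why
 the convolution operators below commute with the whole group.\<close>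

lemma cc_difference:
 assumes x: "x \<in> cg (t + m) r" and y: "y \<in> cg (t + m) r" and g: "g \<in> cg (t + m) r"
 obtains A D where "A \<in> cg t r" "D \<in> cg m r" "cc (x * g) - cc (y * g) = A * (cc x - cc y) * D"
proof -
 define X Y X' Y' where d: "X = cc x" "Y = cc y" "X' = cc (x * g)" "Y' = cc (y * g)"
 have xg: "x * g \<in> cg (t + m) r" "y * g \<in> cg (t + m) r" using x y g cg_mult by auto
 have c: "X \<in> carrier_mat t m" "Y \<in> carrier_mat t m" "X' \<in> carrier_mat t m" "Y' \<in> carrier_mat t m" using cc_carrier x y xg d by auto
 define Ag Bg Cg Dg where e: "Ag = bA g" "Bg = bB g" "Cg = bC g" "Dg = bD g"
 have ce: "Ag \<in> carrier_mat t t" "Bg \<in> carrier_mat t m" "Cg \<in> carrier_mat m t" "Dg \<in> carrier_mat m m" by (simp_all add: e)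
 define Mx where "Mx = Ag + X * Cg"
 have Mx: "Mx \<in> cg t r" and mx: "Mx * X' = Bg + X * Dg" and my: "(Ag + Y * Cg) * Y' = Bg + Y * Dg"
  using moebius[OF x g] moebius[OF y g] by (auto simp: Mx_def d e)
 obtain A where A: "A \<in> cg t r" "A * Mx = 1\<^sub>m t" using cg_inverse[OF Mx r1] .
 note cM = cg_carrier[OF Mx] cg_carrier[OF A(1)]
 \<comment> \<open>Subtract \<open>Mx * Y'\<close> from the relation for \<open>X'\<close> and
   eliminate \<open>Bg\<close> by the relation for \<open>Y'\<close>: what remains is
   \<open>X - Y\<close> times exactly this factor.\<close>
 define D where "D = Dg - Cg * Y'"
 have "Cg * Y' \<in> pm m m (int r)"
 proof -
  have "Cg \<in> pm m t (int r)" using g by (simp add: e cg_blocks)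
  then have "Cg * Y' \<in> pm m m (int r + int r)" unfolding d(4) using cc(1)[OF xg(2)] by (rule pm_mult)
  then show ?thesis by (rule pm_mono[rotated]) simp
 qed
 then have D: "D \<in> cg m r" unfolding D_def using g by (intro cg_add) (auto simp: e cg_blocks)
 have XC: "X * Cg \<in> carrier_mat t t" "Y * Cg \<in> carrier_mat t t" "X * Dg \<in> carrier_mat t m" "Y * Dg \<in> carrier_mat t m"
  "Cg * Y' \<in> carrier_mat m m" using c ce by auto
 have h1: "Mx * (X' - Y') = Bg + X * Dg - (Ag * Y' + X * Cg * Y')"
  using mult_minus_distrib_mat[OF cM(1) c(3,4)] mx add_mult_distrib_mat[OF ce(1) XC(1) c(4)] by (simp add: Mx_def del: assoc_mult_mat)
 have h2: "Ag * Y' + Y * Cg * Y' = Bg + Y * Dg" using my add_mult_distrib_mat[OF ce(1) XC(2) c(4)] by simp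
 have h3: "(X - Y) * D = X * Dg - Y * Dg - (X * Cg * Y' - Y * Cg * Y')"
 proof -
  have "(X - Y) * D = X * (Dg - Cg * Y') - Y * (Dg - Cg * Y')" unfolding D_def by (rule minus_mult_distrib_mat) (use c ce XC in auto)
  also have "X * (Dg - Cg * Y') = X * Dg - X * Cg * Y'" using mult_minus_distrib_mat[OF c(1) ce(4) XC(5)] assoc_mult_mat[OF c(1) ce(3) c(4)] by simp
  also have "Y * (Dg - Cg * Y') = Y * Dg - Y * Cg * Y'" using mult_minus_distrib_mat[OF c(2) ce(4) XC(5)] assoc_mult_mat[OF c(2) ce(3) c(4)] by simp
  finally have "(X - Y) * D = X * Dg - X * Cg * Y' - (Y * Dg - Y * Cg * Y')" .
  moreover have "M1 - M2 - (M3 - M4) = M1 - M3 - (M2 - M4)"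
   if "M1 \<in> carrier_mat t m" "M2 \<in> carrier_mat t m" "M3 \<in> carrier_mat t m" "M4 \<in> carrier_mat t m"
   for M1 M2 M3 M4 :: "'k mat" using that by (intro eq_matI) auto
  from this[OF XC(3) mult_carrier_mat[OF XC(1) c(4)] XC(4) mult_carrier_mat[OF XC(2) c(4)]]
  have "X * Dg - X * Cg * Y' - (Y * Dg - Y * Cg * Y') = X * Dg - Y * Dg - (X * Cg * Y' - Y * Cg * Y')" .
  ultimately show ?thesis by simp
 qed
 have "Mx * (X' - Y') = (X - Y) * D"
 proof -
  define P1 P2 P3 where P: "P1 = Ag * Y'" "P2 = Y * Cg * Y'" "P3 = X * Cg * Y'"
  define Q1 Q2 where Q: "Q1 = X * Dg" "Q2 = Y * Dg"
  have cP: "P1 \<in> carrier_mat t m" "P2 \<in> carrier_mat t m" "P3 \<in> carrier_mat t m" "Q1 \<in> carrier_mat t m" "Q2 \<in> carrier_mat t m"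
   using ce c XC unfolding P Q by auto
  have h2': "P1 + P2 = Bg + Q2" using h2 by (simp add: P Q)
  have "P1 $$ (i, j) + P2 $$ (i, j) = Bg $$ (i, j) + Q2 $$ (i, j)" if "i < t" "j < m" for i j
   using arg_cong[OF h2', of "\<lambda>M. M $$ (i, j)"] that cP ce by simp
  then have "Bg + Q1 - (P1 + P3) = Q1 - Q2 - (P3 - P2)" using cP ce by (intro eq_matI) (auto simp: algebra_simps eq_diff_eq)
  then show ?thesis unfolding h1 h3 P Q .
 qed
 then have "A * (Mx * (X' - Y')) = A * (X - Y) * D" using cM c cg_carrier[OF D] by (simp add: assoc_mult_mat[of _ t t _ m _ m])
 moreover have "A * (Mx * (X' - Y')) = X' - Y'" using A(2) cM c by (simp flip: assoc_mult_mat[of _ t t _ t _ m])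
 ultimately show ?thesis using that[OF A(1) D] by (simp add: d)
qed

text \<open>In the fractional linear formula for the difference every term contains a block of
  \<open>g\<close> minus the corresponding block of the identity. This is the source of
  smoothness.\<close>

lemma cc_level:
 assumes x: "x \<in> cg (t + m) r" and g: "g \<in> cg (t + m) k" and k: "k \<ge> r"
 shows "cc (x * g) - cc x \<in> pm t m (int k)"
proof -
 have g': "g \<in> cg (t + m) r" using g cg_mono[OF k] by blast
 have xg: "x * g \<in> cg (t + m) r" using x g' by (rule cg_mult)
 define X X' where d: "X = cc x" "X' = cc (x * g)"
 have c: "X \<in> carrier_mat t m" "X' \<in> carrier_mat t m" using cc_carrier x xg d by auto
 have XS: "X \<in> pm t m 0" using cc(1)[OF x] pm_mono[of 0 "int r"] by (auto simp: d)
 define Ag Bg Cg Dg where e: "Ag = bA g" "Bg = bB g" "Cg = bC g" "Dg = bD g"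
 have ce: "Ag \<in> carrier_mat t t" "Bg \<in> carrier_mat t m" "Cg \<in> carrier_mat m t" "Dg \<in> carrier_mat m m" by (simp_all add: e)
 have ge: "Ag - 1\<^sub>m t \<in> pm t t (int k)" "Bg \<in> pm t m (int k)" "Cg \<in> pm m t (int k)" "Dg - 1\<^sub>m m \<in> pm m m (int k)"
 proof -
  have "bA g \<in> cg t k \<and> bB g \<in> pm t m (int k) \<and> bC g \<in> pm m t (int k) \<and> bD g \<in> cg m k" using g cg_blocks by blast
  then show "Ag - 1\<^sub>m t \<in> pm t t (int k)" "Bg \<in> pm t m (int k)" "Cg \<in> pm m t (int k)" "Dg - 1\<^sub>m m \<in> pm m m (int k)"
   by (auto simp: e cg_def)
 qed
 define Mx where "Mx = Ag + X * Cg"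
 have Mx: "Mx \<in> cg t r" and mx: "Mx * X' = Bg + X * Dg" using moebius[OF x g'] by (auto simp: Mx_def d e)
 have XC: "X * Cg \<in> carrier_mat t t" using c ce by auto
 have "Mx * (X' - X) = Bg + X * Dg - (Ag * X + X * Cg * X)"
  using mult_minus_distrib_mat[OF cg_carrier[OF Mx] c(2,1)] mx add_mult_distrib_mat[OF ce(1) XC c(1)] by (simp add: Mx_def del: assoc_mult_mat)
 also have "... = Bg + X * (Dg - 1\<^sub>m m) - ((Ag - 1\<^sub>m t) * X + X * Cg * X)"
 proof -
  define P1 P2 P3 where P: "P1 = X * Dg" "P2 = Ag * X" "P3 = X * Cg * X"
  have cP: "P1 \<in> carrier_mat t m" "P2 \<in> carrier_mat t m" "P3 \<in> carrier_mat t m" using c ce XC unfolding P by auto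
  have "X * (Dg - 1\<^sub>m m) = P1 - X" "(Ag - 1\<^sub>m t) * X = P2 - X"
   using c ce by (auto simp: P mult_minus_distrib_mat[of _ t m _ m] minus_mult_distrib_mat[of _ t t _ _ m])
  then show ?thesis unfolding P[symmetric] using cP c ce by (simp add: P(3)[symmetric] del: assoc_mult_mat) (intro eq_matI, auto)
 qed
 also have "... \<in> pm t m (int k)" using ge XS pm_mult_S(2)[OF pm_mult_S(1)[OF XS ge(3)] XS] by (intro pm_diff pm_add) (auto intro: pm_mult_S)
 finally have "Mx * (X' - X) \<in> pm t m (int k)" .
 then show ?thesis using Gl_cancel_left[OF cg_Gl[OF Mx r1]] c by (simp add: d)
qed

lemma cc_block_left:
 assumes h: "h \<in> cg (t + m) r" "bB h = 0\<^sub>m t m" and x: "x \<in> cg (t + m) r"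
 shows "cc (h * x) = cc x"
proof (rule ccI[OF cg_mult[OF h(1) x] cc_carrier[OF x]])
 note c = cg_carrier[OF h(1)] cg_carrier[OF x]
 have "bA (h * x) = bA h * bA x" "bB (h * x) = bA h * bB x"
  using b_mult[OF c] h(2) mult_carrier_mat[OF b_carrier(1) b_carrier(1), of h x] mult_carrier_mat[OF b_carrier(1) b_carrier(2), of h x] by auto
 then show "bA (h * x) * cc x = bB (h * x)" using cc(2)[OF x] cc_carrier[OF x] by (simp add: assoc_mult_mat[of _ t t _ t _ m])
qed

text \<open>Multiply both elements by the inverse of \<open>x\<close>: by
  \<open>cc_difference\<close> the coordinate of \<open>h\<close> equals that of the identity, which
  is 0, and a zero coordinate means a zero upper right block.\<close>

lemma cc_eq_block:
 assumes x: "x \<in> cg (t + m) r" and y: "y \<in> cg (t + m) r" and eq: "cc x = cc y"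
 obtains h where "h \<in> cg (t + m) r" "bB h = 0\<^sub>m t m" "y = h * x"
proof -
 obtain x' where x': "x' \<in> cg (t + m) r" "x * x' = 1\<^sub>m (t + m)" "x' * x = 1\<^sub>m (t + m)" using cg_inverse[OF x r1] .
 define h where "h = y * x'"
 have h: "h \<in> cg (t + m) r" unfolding h_def using y x'(1) by (rule cg_mult)
 have one: "cc (1\<^sub>m (t + m)) = 0\<^sub>m t m" by (rule ccI) (auto intro!: eq_matI simp: bA_def bB_def)
 obtain A D where AD: "A \<in> cg t r" "D \<in> cg m r" "cc (y * x') - cc (x * x') = A * (cc y - cc x) * D" using cc_difference[OF y x x'(1)] .
 have "cc y - cc x = 0\<^sub>m t m" using eq cc_carrier[OF y] by simp
 then have "cc h - 0\<^sub>m t m = 0\<^sub>m t m" using AD cg_carrier[OF AD(1)] cg_carrier[OF AD(2)] x'(2) one by (simp add: h_def)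
 moreover have "cc h - 0\<^sub>m t m = cc h" using cc_carrier[OF h] by (intro eq_matI) auto
 ultimately have "cc h = 0\<^sub>m t m" by simp
 then have "bB h = 0\<^sub>m t m" using cc(2)[OF h] right_mult_zero_mat[OF b_carrier(1)] by metis
 moreover have "y = h * x" using x' cg_carrier[OF x] cg_carrier[OF x'(1)] cg_carrier[OF y]
  by (simp add: h_def assoc_mult_mat[of _ "t + m" "t + m" _ "t + m" _ "t + m"])
 ultimately show ?thesis using that h by blast
qed

text \<open>Unipotent elements act on coordinates by translations, which makes characters their
  eigenvectors; block-diagonal elements act linearly and move the characters.\<close>

lemma cc_uu_right:
 assumes x: "x \<in> cg (t + m) r" and X: "X \<in> pm t m (int r)"
 shows "cc (x * uu X) = cc x + X"
proof (rule ccI[OF cg_mult[OF x uu_cg[OF X]]])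
 note cX = pm_carrier[OF X] and c = cc_carrier[OF x]
 show "cc x + X \<in> carrier_mat t m" using c cX by simp
 note b = b_mult[OF cg_carrier[OF x] cg_carrier[OF uu_cg[OF X]]] and u = uu_blocks[OF cX]
 have "bA (x * uu X) = bA x" "bB (x * uu X) = bA x * X + bB x" using b u right_mult_zero_mat[OF b_carrier(2), of x t] by auto
 then show "bA (x * uu X) * (cc x + X) = bB (x * uu X)" using cc(2)[OF x] c cX mult_carrier_mat[OF b_carrier(1) cX, of x]
  by (simp add: mult_add_distrib_mat[of _ t t _ m]) (rule comm_add_mat[of _ t m], auto)
qed

definition lv :: "'k mat \<Rightarrow> 'k mat \<Rightarrow> 'k mat" where "lv A D = four_block_mat A (0\<^sub>m t m) (0\<^sub>m m t) D"

lemma lv_cg: assumes "A \<in> cg t r" "D \<in> cg m r" shows "lv A D \<in> cg (t + m) r"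
 using assms cg_carrier[OF assms(1)] cg_carrier[OF assms(2)] by (simp add: cg_blocks lv_def b_four_block)

lemma cc_lv:
 assumes x: "x \<in> cg (t + m) r" and A: "A \<in> cg t r" "A' \<in> cg t r" "A * A' = 1\<^sub>m t" and D: "D \<in> cg m r"
 shows "cc (x * lv A D) = A' * cc x * D"
proof (rule ccI[OF cg_mult[OF x lv_cg[OF A(1) D]]])
 note c = cc_carrier[OF x] cg_carrier[OF A(1)] cg_carrier[OF A(2)] cg_carrier[OF D]
 show "A' * cc x * D \<in> carrier_mat t m" using c by auto
 note b = b_mult[OF cg_carrier[OF x] cg_carrier[OF lv_cg[OF A(1) D]]]
 have l: "bA (lv A D) = A" "bB (lv A D) = 0\<^sub>m t m" "bC (lv A D) = 0\<^sub>m m t" "bD (lv A D) = D"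
  using c by (simp_all add: lv_def b_four_block)
 have e: "bA (x * lv A D) = bA x * A" "bB (x * lv A D) = bB x * D"
  using b l c right_mult_zero_mat[OF b_carrier(2), of x t] right_mult_zero_mat[OF b_carrier(1), of x m]
   mult_carrier_mat[OF b_carrier(1) c(2), of x] mult_carrier_mat[OF b_carrier(2) c(4), of x] by auto
 have "bA x * A * (A' * cc x * D) = bA x * (A * A') * cc x * D"
  using c by (simp add: assoc_mult_mat[of _ t t _ t _ m] assoc_mult_mat[of _ t t _ m _ m] assoc_mult_mat[of _ t t _ t _ t])
 also have "... = bB x * D" using A(3) cc(2)[OF x] by (simp del: assoc_mult_mat add: right_mult_one_mat[OF b_carrier(1)])
 finally show "bA (x * lv A D) * (A' * cc x * D) = bB (x * lv A D)" unfolding e .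
qed

end

text \<open>The usual vanishing of a character sum, applied below with translations on which the
  character is not 1.\<close>

lemma sum_zero_of_translation:
 fixes F :: "'a \<Rightarrow> complex"
 assumes "bij_betw f A A" "\<And>x. x \<in> A ==> F (f x) = c * F x" "c \<noteq> 1"
 shows "sum F A = 0"
proof -
 have "sum F A = (\<Sum>x\<in>A. F (f x))" using sum.reindex_bij_betw[OF assms(1), of F] by simp
 also have "... = c * sum F A" using assms(2) by (simp add: sum_distrib_left)
 finally have "(c - 1) * sum F A = 0" by (simp add: left_diff_distrib)
 then show ?thesis using assms(3) by simp
qed

section \<open>The trace pairing and finite Fourier analysis\<close>

locale char_setting = block_setting S w q t m r for S :: "'k::field set" and w q t m r +
 fixes \<psi> :: "'k \<Rightarrow> complex"
 assumes psi_add: "\<psi> (x + y) = \<psi> x * \<psi> y"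
  and psi_nz [simp]: "\<psi> x \<noteq> 0"
  and psi_S: "x \<in> S ==> \<psi> x = 1"
  and psi_w: "\<psi> (1 / w) \<noteq> 1"
begin

lemma psi_0 [simp]: "\<psi> 0 = 1" by (rule psi_S) simp

lemma psi_minus: "\<psi> (- x) = 1 / \<psi> x" using psi_add[of x "- x"] by (simp add: field_simps)

text \<open>The trace of \<open>X * Y\<close>; \<open>bil_move\<close> is its invariance under
  cyclic permutation.\<close>

definition bil :: "'k mat \<Rightarrow> 'k mat \<Rightarrow> 'k" where
 "bil X Y = (\<Sum>i<t. \<Sum>j<m. X $$ (i, j) * Y $$ (j, i))"

lemma bil_add_left: "X \<in> carrier_mat t m ==> X' \<in> carrier_mat t m ==> bil (X + X') Y = bil X Y + bil X' Y"
 by (simp add: bil_def distrib_right sum.distrib)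

lemma bil_minus_left: "X \<in> carrier_mat t m ==> bil (- X) Y = - bil X Y" by (simp add: bil_def sum_negf)

lemma bil_add_right: "Y \<in> carrier_mat m t ==> Y' \<in> carrier_mat m t ==> bil X (Y + Y') = bil X Y + bil X Y'"
 by (simp add: bil_def distrib_left sum.distrib)

lemma bil_minus_right: "Y \<in> carrier_mat m t ==> bil X (- Y) = - bil X Y" by (simp add: bil_def sum_negf)

lemma bil_pw: "X \<in> pm t m k ==> Y \<in> pm m t l ==> bil X Y \<in> pw (k + l)" unfolding bil_def by (intro pw_sum pw_mult) (auto intro: pmD)

lemma bil_move:
 assumes A: "A \<in> carrier_mat t t" and X: "X \<in> carrier_mat t m" and D: "D \<in> carrier_mat m m" and Y: "Y \<in> carrier_mat m t"
 shows "bil (A * X * D) Y = bil X (D * Y * A)"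
proof -
 have 1: "bil (A * X) Y = bil X (Y * A)" if X: "X \<in> carrier_mat t m" and Y: "Y \<in> carrier_mat m t" for X Y
 proof -
  have "bil (A * X) Y = (\<Sum>i<t. \<Sum>j<m. \<Sum>k<t. A $$ (i, k) * X $$ (k, j) * Y $$ (j, i))"
   unfolding bil_def using A X by (intro sum.cong refl) (simp add: scalar_prod_def sum_distrib_right lessThan_atLeast0)
  also have "... = (\<Sum>i<t. \<Sum>k<t. \<Sum>j<m. A $$ (i, k) * X $$ (k, j) * Y $$ (j, i))" by (intro sum.cong refl sum.swap)
  also have "... = (\<Sum>k<t. \<Sum>i<t. \<Sum>j<m. A $$ (i, k) * X $$ (k, j) * Y $$ (j, i))" by (rule sum.swap)
  also have "... = (\<Sum>k<t. \<Sum>j<m. \<Sum>i<t. A $$ (i, k) * X $$ (k, j) * Y $$ (j, i))" by (intro sum.cong refl sum.swap)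
  also have "... = bil X (Y * A)"
   unfolding bil_def using A Y by (intro sum.cong refl) (simp add: scalar_prod_def sum_distrib_left lessThan_atLeast0 mult_ac)
  finally show ?thesis .
 qed
 have "bil (A * X * D) Y = bil (A * (X * D)) Y" using assms by (simp add: assoc_mult_mat[of _ t t _ m _ m])
 also have "... = bil (X * D) (Y * A)" by (rule 1) (use assms in auto)
 also have "... = bil X (D * (Y * A))"
 proof -
  have "bil (X * D) Z = bil X (D * Z)" if Z: "Z \<in> carrier_mat m t" for Z
  proof -
   have "bil (X * D) Z = (\<Sum>i<t. \<Sum>j<m. \<Sum>k<m. X $$ (i, k) * D $$ (k, j) * Z $$ (j, i))"
    unfolding bil_def using D X by (intro sum.cong refl) (simp add: scalar_prod_def sum_distrib_right lessThan_atLeast0)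
   also have "... = (\<Sum>i<t. \<Sum>k<m. \<Sum>j<m. X $$ (i, k) * D $$ (k, j) * Z $$ (j, i))" by (intro sum.cong refl sum.swap)
   also have "... = bil X (D * Z)"
    unfolding bil_def using D Z by (intro sum.cong refl) (simp add: scalar_prod_def sum_distrib_left lessThan_atLeast0 mult_ac)
   finally show ?thesis .
  qed
  then show ?thesis using A Y by auto
 qed
 finally show ?thesis using assms by (simp add: assoc_mult_mat[of _ m m _ t _ t])
qed

text \<open>The pairing identifying matrices \<open>Y\<close> over the fraction field, modulo integral ones, with the
 characters of the additive group of \<open>t \<times> m\<close> matrices over the \<open>r\<close>-th power of the maximal ideal.\<close>

definition ev :: "'k mat \<Rightarrow> 'k mat \<Rightarrow> complex" where
 "ev X Y = \<psi> (w powi (- int r) * bil X Y)"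

lemma ev_nz [simp]: "ev X Y \<noteq> 0" by (simp add: ev_def)

lemma ev_add_left: "X \<in> carrier_mat t m ==> X' \<in> carrier_mat t m ==> ev (X + X') Y = ev X Y * ev X' Y"
 by (simp add: ev_def bil_add_left distrib_left psi_add)

lemma ev_minus_left: "X \<in> carrier_mat t m ==> ev (- X) Y = 1 / ev X Y" by (simp add: ev_def bil_minus_left psi_minus)

lemma ev_diff_left: "X \<in> carrier_mat t m ==> X' \<in> carrier_mat t m ==> ev (X - X') Y = ev X Y * ev (- X') Y"
 using ev_add_left[of X "- X'" Y] add_uminus_minus_mat[of X t m X'] by simp

lemma ev_add_right: "Y \<in> carrier_mat m t ==> Y' \<in> carrier_mat m t ==> ev X (Y + Y') = ev X Y * ev X Y'"
 by (simp add: ev_def bil_add_right distrib_left psi_add)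

lemma ev_minus_right: "Y \<in> carrier_mat m t ==> ev X (- Y) = 1 / ev X Y" by (simp add: ev_def bil_minus_right psi_minus)

lemma ev_diff_right: "Y \<in> carrier_mat m t ==> Y' \<in> carrier_mat m t ==> ev X (Y - Y') = ev X Y / ev X Y'"
 using ev_add_right[of Y "- Y'" X] add_uminus_minus_mat[of Y m t Y'] ev_minus_right[of Y' X] by simp

lemma ev_move: "A \<in> carrier_mat t t ==> X \<in> carrier_mat t m ==> D \<in> carrier_mat m m ==> Y \<in> carrier_mat m t ==>
  ev (A * X * D) Y = ev X (D * Y * A)" by (simp only: ev_def bil_move)

lemma ev_1: assumes "X \<in> pm t m k" "Y \<in> pm m t l" "k + l \<ge> int r" shows "ev X Y = 1"
proof -
 have "bil X Y \<in> pw (int r)" using bil_pw[OF assms(1,2)] pw_mono[OF assms(3)] by blast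
 then have "w powi (- int r) * bil X Y \<in> S" by (simp add: pw_def mult.commute)
 then show ?thesis by (simp add: ev_def psi_S)
qed

lemma ev_cong_left: assumes "X - X' \<in> pm t m k" "Y \<in> pm m t l" "k + l \<ge> int r" "X \<in> carrier_mat t m" "X' \<in> carrier_mat t m"
 shows "ev X Y = ev X' Y" using ev_1[OF assms(1-3)] ev_diff_left[OF assms(4,5), of Y] ev_minus_left[OF assms(5), of Y] by simp

lemma ev_cong_right: assumes "Y - Y' \<in> pm m t l" "X \<in> pm t m k" "k + l \<ge> int r" "Y \<in> carrier_mat m t" "Y' \<in> carrier_mat m t"
 shows "ev X Y = ev X Y'" using ev_1[OF assms(2,1,3)] ev_diff_right[OF assms(4,5), of X] by simp

lemma ev_redm: "X \<in> pm t m (int r) ==> Y \<in> carrier_mat m t ==> ev X (redm Y) = ev X Y"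
 using redm_diff(1)[of Y m t] by (intro ev_cong_right[of _ _ 0 _ "int r"]) auto

lemma quotient_in_S: assumes "y \<notin> pw (k + 1)" "z \<in> pw k" shows "z / y \<in> S"
proof -
 have y0: "y \<noteq> 0" using assms(1) by auto
 obtain u l where u: "y = u * w powi l" "u \<in> S" "inverse u \<in> S" using valuation[OF y0] by blast
 have "y \<in> pw l" using pw_shift[of u l 0] u by (simp add: pw_0)
 then have "l \<le> k" using assms(1) pw_mono[of "k + 1" l] by force
 then have "z \<in> pw l" using assms(2) pw_mono by blast
 then have "z * w powi (- l) * inverse u \<in> S" using u(3) by (auto simp: pw_def intro: S_mult)
 then show ?thesis by (simp add: u(1) divide_inverse power_int_minus mult_ac)
qed

lemma w1_pw: "1 / w \<in> pw (-1)" by (simp add: pw_def)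

text \<open>A matrix with one nonzero entry, placed opposite a nonintegral entry of
  \<open>Y\<close>, can be scaled so that the normalized pairing is exactly 1/w, where
  \<open>\<psi>\<close> is not 1.\<close>

lemma ev_nondeg_right:
 assumes Y: "Y \<in> carrier_mat m t" "Y \<notin> pm m t 0"
 obtains X where "X \<in> pm t m (int r)" "ev X Y \<noteq> 1"
proof -
 obtain j i where ij: "j < m" "i < t" "Y $$ (j, i) \<notin> pw 0" using Y by (auto simp: pm_def)
 define x where "x = w ^ r * ((1 / w) / Y $$ (j, i))"
 have y0: "Y $$ (j, i) \<noteq> 0" using ij(3) by auto
 have "(1 / w) / Y $$ (j, i) \<in> S" using quotient_in_S[of "Y $$ (j, i)" "-1" "1 / w"] ij(3) w1_pw by simp
 then have x: "x \<in> pw (int r)" by (simp add: x_def pw_nat)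
 define X where "X = mat t m (\<lambda>(a, b). if a = i \<and> b = j then x else 0)"
 have "X \<in> pm t m (int r)" using x by (auto simp: X_def pm_def)
 moreover have "bil X Y = x * Y $$ (j, i)"
 proof -
  have "bil X Y = (\<Sum>a<t. \<Sum>b<m. if a = i \<and> b = j then x * Y $$ (b, a) else 0)"
   unfolding bil_def by (intro sum.cong refl) (auto simp: X_def)
  also have "... = (\<Sum>a<t. if a = i then x * Y $$ (j, a) else 0)" using ij(1) by (intro sum.cong refl) (auto simp: sum.delta)
  also have "... = x * Y $$ (j, i)" using ij(2) by simp
  finally show ?thesis .
 qed
 then have "w powi (- int r) * bil X Y = 1 / w" using y0 by (simp add: x_def power_int_minus)
 then have "ev X Y \<noteq> 1" using psi_w by (simp add: ev_def)
 ultimately show ?thesis using that by blast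
qed

lemma ev_nondeg_left:
 assumes X: "X \<in> carrier_mat t m" "X \<notin> pm t m (int (r + N))"
 obtains Y where "Y \<in> pm m t (- int N)" "ev X Y \<noteq> 1"
proof -
 obtain i j where ij: "i < t" "j < m" "X $$ (i, j) \<notin> pw (int (r + N))" using X by (auto simp: pm_def)
 define z where "z = w ^ r / w"
 define y where "y = z / X $$ (i, j)"
 have x0: "X $$ (i, j) \<noteq> 0" using ij(3) by auto
 have zN: "z * w ^ N \<in> pw (int (r + N) - 1)"
 proof -
  have "w powi int (r + N) = w ^ (r + N)" by (rule power_int_of_nat)
  then have "z * w ^ N = (1 / w) * w powi int (r + N)" by (simp add: z_def power_add)
  then show ?thesis using pw_shift[of "1 / w" "int (r + N)" "-1"] w1_pw by (simp add: algebra_simps)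
 qed
 then have "z * w ^ N / X $$ (i, j) \<in> S" using quotient_in_S[of "X $$ (i, j)" "int (r + N) - 1"] ij(3) by simp
 then have y: "y \<in> pw (- int N)" by (simp add: y_def pw_neg)
 define Y where "Y = mat m t (\<lambda>(b, a). if a = i \<and> b = j then y else 0)"
 have "Y \<in> pm m t (- int N)" using y by (auto simp: Y_def pm_def)
 moreover have "bil X Y = X $$ (i, j) * y"
 proof -
  have "bil X Y = (\<Sum>a<t. \<Sum>b<m. if a = i \<and> b = j then X $$ (a, b) * y else 0)"
   unfolding bil_def by (intro sum.cong refl) (auto simp: Y_def)
  also have "... = (\<Sum>a<t. if a = i then X $$ (a, j) * y else 0)" using ij(2) by (intro sum.cong refl) (auto simp: sum.delta)
  also have "... = X $$ (i, j) * y" using ij(1) by simp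
  finally show ?thesis .
 qed
 then have "w powi (- int r) * bil X Y = 1 / w" using x0 by (simp add: y_def z_def power_int_minus)
 then have "ev X Y \<noteq> 1" using psi_w by (simp add: ev_def)
 ultimately show ?thesis using that by blast
qed

text \<open>Reduction modulo level \<open>r + N\<close>, obtained by rescaling from reduction modulo
  \<open>S\<close>.\<close>

definition rd :: "nat \<Rightarrow> 'k mat \<Rightarrow> 'k mat" where
 "rd N X = w powi int (r + N) \<cdot>\<^sub>m redm (w powi (- int (r + N)) \<cdot>\<^sub>m X)"

text \<open>Representatives of level \<open>r\<close> modulo level \<open>r + N\<close>: a finite
  group in duality with the one represented by \<open>Yk m t N\<close>.\<close>

definition Xr :: "nat \<Rightarrow> 'k mat set" where "Xr N = rd N ` pm t m (int r)"

lemma w_cancel: "w powi k \<cdot>\<^sub>m (w powi (- k) \<cdot>\<^sub>m X) = (X :: 'k mat)" "w powi (- k) \<cdot>\<^sub>m (w powi k \<cdot>\<^sub>m X) = (X :: 'k mat)"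
 by (intro eq_matI; simp add: smult_smult_mat power_int_minus)+

lemma rd_carrier [simp]: "rd N X \<in> carrier_mat a b \<longleftrightarrow> X \<in> carrier_mat a b"
 unfolding rd_def carrier_mat_def by (simp only: mem_Collect_eq index_smult_mat(2,3) redm_dim)

lemma rd_diff: assumes "X \<in> carrier_mat a b" shows "rd N X - X \<in> pm a b (int (r + N))"
proof -
 let ?k = "int (r + N)" and ?Z = "w powi (- int (r + N)) \<cdot>\<^sub>m X"
 have Z: "?Z \<in> carrier_mat a b" using assms by simp
 have "w powi ?k \<cdot>\<^sub>m (redm ?Z - ?Z) \<in> pm a b (0 + ?k)" using redm_diff(1)[OF Z] Z by (subst pm_wpow) auto
 moreover have "w powi ?k \<cdot>\<^sub>m (redm ?Z - ?Z) = rd N X - w powi ?k \<cdot>\<^sub>m ?Z"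
  unfolding rd_def using Z by (intro eq_matI) (auto simp: algebra_simps)
 moreover have "w powi ?k \<cdot>\<^sub>m ?Z = X" by (rule w_cancel(1))
 ultimately show ?thesis by (metis add_0)
qed

lemma rd_eq: assumes "X \<in> carrier_mat a b" "X' \<in> carrier_mat a b"
 shows "rd N X = rd N X' \<longleftrightarrow> X - X' \<in> pm a b (int (r + N))"
proof -
 let ?k = "int (r + N)"
 have "rd N X = rd N X' \<longleftrightarrow> redm (w powi (- ?k) \<cdot>\<^sub>m X) = redm (w powi (- ?k) \<cdot>\<^sub>m X')"
  unfolding rd_def using w_cancel(2) by metis
 also have "... \<longleftrightarrow> w powi (- ?k) \<cdot>\<^sub>m X - w powi (- ?k) \<cdot>\<^sub>m X' \<in> pm a b 0" using assms by (intro redm_eq) auto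
 also have "w powi (- ?k) \<cdot>\<^sub>m X - w powi (- ?k) \<cdot>\<^sub>m X' = w powi (- ?k) \<cdot>\<^sub>m (X - X')"
  using assms by (intro eq_matI) (auto simp: algebra_simps)
 also have "... \<in> pm a b 0 \<longleftrightarrow> X - X' \<in> pm a b ?k" using pm_wpow[of "X - X'" a b "- ?k" ?k] assms by simp
 finally show ?thesis .
qed

lemma rd_pm: assumes "X \<in> pm t m (int r)" shows "rd N X \<in> pm t m (int r)"
proof -
 note c = pm_carrier[OF assms]
 have "(rd N X - X) + X \<in> pm t m (int r)" using pm_mono[OF _ rd_diff[OF c, of N], of "int r"] assms by (intro pm_add) auto
 moreover have "(rd N X - X) + X = rd N X" using c by (intro eq_matI) auto
 ultimately show ?thesis by simp
qed

lemma rd_rd: "X \<in> carrier_mat a b ==> rd N (rd N X) = rd N X" using rd_eq[of "rd N X" a b X N] rd_diff by simp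

lemma Xr_pm: "X \<in> Xr N ==> X \<in> pm t m (int r)" using rd_pm by (auto simp: Xr_def)

lemma Xr_carrier: "X \<in> Xr N ==> X \<in> carrier_mat t m" using Xr_pm pm_carrier by blast

lemma Xr_rd: "X \<in> Xr N ==> rd N X = X" by (auto simp: Xr_def intro: rd_rd[OF pm_carrier])

lemma rd_Xr: "X \<in> pm t m (int r) ==> rd N X \<in> Xr N" by (simp add: Xr_def)

lemma Xr_card: "finite (Xr N)" "card (Xr N) = q ^ (N * (t * m))"
proof -
 let ?k = "int (r + N)"
 have "bij_betw (\<lambda>E. w powi ?k \<cdot>\<^sub>m E) (Yk t m N) (Xr N)"
 proof (rule bij_betwI')
  show "(w powi ?k \<cdot>\<^sub>m E = w powi ?k \<cdot>\<^sub>m E') = (E = E')" for E E' :: "'k mat" using w_cancel(2) by metis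
  fix E assume E: "E \<in> Yk t m N"
  have "w powi ?k \<cdot>\<^sub>m E \<in> pm t m (int r)" using pm_wpow[of E t m ?k "- int N"] E Yk_carrier[OF E] by (auto simp: Yk_def)
  moreover have "rd N (w powi ?k \<cdot>\<^sub>m E) = w powi ?k \<cdot>\<^sub>m E"
   unfolding rd_def w_cancel using E by (simp only: Yk_def mem_Collect_eq)
  ultimately show "w powi ?k \<cdot>\<^sub>m E \<in> Xr N" using rd_Xr[of "w powi ?k \<cdot>\<^sub>m E" N] by (simp only:)
 next
  fix X assume X: "X \<in> Xr N"
  define E where "E = w powi (- ?k) \<cdot>\<^sub>m X"
  have "E \<in> pm t m (- int N)" using pm_wpow[of X t m "- ?k" "int r"] Xr_pm[OF X] Xr_carrier[OF X] by (simp add: E_def)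
  then have "redm E \<in> Yk t m N" using redm_Yk[OF pm_carrier] by blast
  moreover have "X = w powi ?k \<cdot>\<^sub>m redm E" using Xr_rd[OF X] unfolding rd_def E_def by (rule sym)
  ultimately show "\<exists>E\<in>Yk t m N. X = w powi ?k \<cdot>\<^sub>m E" by (rule bexI[rotated])
 qed
 then show "finite (Xr N)" "card (Xr N) = q ^ (N * (t * m))"
  using bij_betw_finite[of _ "Yk t m N" "Xr N"] bij_betw_same_card[of _ "Yk t m N" "Xr N"] Yk_finite[of t m N] card_Yk[of t m N] by (simp_all only:)
qed

text \<open>One of the two orthogonality relations; nondegeneracy of the pairing supplies the
  translation that makes the sum vanish.\<close>

lemma ev_sum_Y:
 assumes X: "X \<in> pm t m (int r)"
 shows "(\<Sum>Y\<in>Yk m t N. ev X Y) = (if X \<in> pm t m (int (r + N)) then of_nat (q ^ (N * (t * m))) else 0)"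
proof (cases "X \<in> pm t m (int (r + N))")
 case True
 have "ev X Y = 1" if "Y \<in> Yk m t N" for Y using that True by (intro ev_1[of X "int (r + N)" Y "- int N"]) (auto simp: Yk_def)
 then show ?thesis using True by (simp add: card_Yk mult.commute[of m t])
next
 case False
 obtain Y0 where Y0: "Y0 \<in> pm m t (- int N)" "ev X Y0 \<noteq> 1" using ev_nondeg_left[OF pm_carrier[OF X] False] .
 note c0 = pm_carrier[OF Y0(1)]
 have "(\<Sum>Y\<in>Yk m t N. ev X Y) = 0"
 proof (rule sum_zero_of_translation[OF _ _ Y0(2)])
  show "bij_betw (\<lambda>E. redm (1\<^sub>m m * E * 1\<^sub>m t + Y0)) (Yk m t N) (Yk m t N)" by (rule Yk_affine_bij) (use Y0 in auto)
  fix Y assume "Y \<in> Yk m t N"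
  note c = Yk_carrier[OF this]
  have "redm (1\<^sub>m m * Y * 1\<^sub>m t + Y0) = redm (Y + Y0)" using c by simp
  then show "ev X (redm (1\<^sub>m m * Y * 1\<^sub>m t + Y0)) = ev X Y0 * ev X Y" using ev_redm[OF X, of "Y + Y0"] c c0 by (simp add: ev_add_right)
 qed
 then show ?thesis using False by simp
qed

lemma ev_sum_X:
 assumes Y: "Y \<in> pm m t (- int N)"
 shows "(\<Sum>X\<in>Xr N. ev X Y) = (if Y \<in> pm m t 0 then of_nat (q ^ (N * (t * m))) else 0)"
proof (cases "Y \<in> pm m t 0")
 case True
 have "ev X Y = 1" if "X \<in> Xr N" for X using that True Xr_pm by (intro ev_1[of X "int r" Y 0]) auto
 then show ?thesis using True by (simp add: Xr_card)
next
 case False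
 obtain X0 where X0: "X0 \<in> pm t m (int r)" "ev X0 Y \<noteq> 1" using ev_nondeg_right[OF pm_carrier[OF Y] False] .
 note c0 = pm_carrier[OF X0(1)]
 have "(\<Sum>X\<in>Xr N. ev X Y) = 0"
 proof (rule sum_zero_of_translation[OF _ _ X0(2)])
  have inj: "inj_on (\<lambda>X. rd N (X + X0)) (Xr N)"
  proof (rule inj_onI)
   fix X X' assume X: "X \<in> Xr N" "X' \<in> Xr N" and eq: "rd N (X + X0) = rd N (X' + X0)"
   note c = Xr_carrier[OF X(1)] Xr_carrier[OF X(2)]
   have "X + X0 - (X' + X0) = X - X'" using c c0 by (intro eq_matI) auto
   then have "rd N X = rd N X'" using eq rd_eq[of "X + X0" t m "X' + X0" N] rd_eq[OF c] c c0 by simp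
   then show "X = X'" using Xr_rd X by simp
  qed
  have "(\<lambda>X. rd N (X + X0)) ` Xr N \<subseteq> Xr N" using X0(1) Xr_pm rd_Xr pm_add by blast
  then show "bij_betw (\<lambda>X. rd N (X + X0)) (Xr N) (Xr N)" using inj Xr_card(1) endo_inj_surj by (metis bij_betw_def)
  fix X assume X: "X \<in> Xr N"
  note c = Xr_carrier[OF X]
  have "ev (rd N (X + X0)) Y = ev (X + X0) Y" using rd_diff[of "X + X0" t m N] c c0 Y by (intro ev_cong_left[of _ _ "int (r + N)" _ "- int N"]) auto
  then show "ev (rd N (X + X0)) Y = ev X0 Y * ev X Y" using c c0 by (simp add: ev_add_left)
 qed
 then show ?thesis using False by simp
qed

definition chi :: "'k mat \<Rightarrow> 'k mat \<Rightarrow> complex" where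
 "chi Y x = (if x \<in> cg (t + m) r then ev (cc x) Y else 0)"

definition act :: "'k mat \<Rightarrow> ('k mat \<Rightarrow> complex) \<Rightarrow> 'k mat \<Rightarrow> complex" where
 "act g f x = (if x \<in> cg (t + m) r then f (x * g) else 0)"

text \<open>The orbit of the character of \<open>Y\<close> under the block-diagonal elements of the
  group; both factors are congruent to 1 at level \<open>r\<close>.\<close>

definition orb :: "'k mat \<Rightarrow> 'k mat set" where
 "orb Y = {redm (D * Y * A) | D A. D \<in> cg m r \<and> A \<in> cg t r}"

lemma orbI: "Y' = redm (D * Y * A) ==> D \<in> cg m r ==> A \<in> cg t r ==> Y' \<in> orb Y" unfolding orb_def by blast

lemma orbE: assumes "Y' \<in> orb Y" obtains D A where "Y' = redm (D * Y * A)" "D \<in> cg m r" "A \<in> cg t r"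
proof -
 have "\<exists>D A. Y' = redm (D * Y * A) \<and> D \<in> cg m r \<and> A \<in> cg t r" using assms unfolding orb_def mem_Collect_eq .
 then show thesis by (elim exE conjE) (rule that)
qed

lemma orb_carrier: assumes "Y \<in> carrier_mat m t" "Y' \<in> orb Y" shows "Y' \<in> carrier_mat m t"
proof -
 obtain D A where "Y' = redm (D * Y * A)" "D \<in> cg m r" "A \<in> cg t r" using orbE[OF assms(2)] .
 then show ?thesis using assms(1) cg_carrier[of D m r] cg_carrier[of A t r] by auto
qed

lemma orb_Yk: assumes "Y \<in> Yk m t N" shows "orb Y \<subseteq> Yk m t N"
proof
 fix Y' assume "Y' \<in> orb Y"
 then obtain D A where *: "Y' = redm (D * Y * A)" "D \<in> cg m r" "A \<in> cg t r" by (rule orbE)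
 have "Y \<in> pm m t (- int N)" using assms by (simp add: Yk_def)
 then have P: "D * Y * A \<in> pm m t (- int N)" using cg_pm * by (intro pm_mult_S)
 show "Y' \<in> Yk m t N" unfolding *(1) by (subst redm_Yk[OF pm_carrier[OF P]]) (rule P)
qed

lemma orb_finite: "Y \<in> Ys m t ==> finite (orb Y)" using orb_Yk Yk_finite finite_subset unfolding Ys_eq by blast

lemma orb_self: assumes "Y \<in> Ys m t" shows "Y \<in> orb Y"
proof -
 have "redm (1\<^sub>m m * Y * 1\<^sub>m t) = Y" using Ys_carrier[OF assms] assms by (simp add: Ys_def)
 then show ?thesis using orbI[of Y "1\<^sub>m m" Y "1\<^sub>m t"] by simp
qed

lemma redm_conj:
 assumes D: "D \<in> cg m r" and A: "A \<in> cg t r" and Y: "Y \<in> carrier_mat m t"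
 shows "redm (D * redm Y * A) = redm (D * Y * A)"
proof -
 note c = cg_carrier[OF D] cg_carrier[OF A] Y
 have "D * (redm Y - Y) * A \<in> pm m t 0" using redm_diff(1)[OF Y] cg_pm D A by (intro pm_mult_S)
 moreover have "D * (redm Y - Y) * A = D * redm Y * A - D * Y * A"
  using c by (simp add: mult_minus_distrib_mat[of _ m m _ t] minus_mult_distrib_mat[of _ m t _ _ t])
 ultimately show ?thesis using c by (subst redm_eq) auto
qed

lemma orb_trans: assumes Y: "Y \<in> carrier_mat m t" and Y': "Y' \<in> orb Y" and Y'': "Y'' \<in> orb Y'" shows "Y'' \<in> orb Y"
proof -
 obtain D A where 1: "Y' = redm (D * Y * A)" "D \<in> cg m r" "A \<in> cg t r" using orbE[OF Y'] .
 obtain D' A' where 2: "Y'' = redm (D' * Y' * A')" "D' \<in> cg m r" "A' \<in> cg t r" using orbE[OF Y''] .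
 note c = cg_carrier[OF 1(2)] cg_carrier[OF 1(3)] cg_carrier[OF 2(2)] cg_carrier[OF 2(3)] Y
 have "Y'' = redm (D' * (D * Y * A) * A')" unfolding 2(1) 1(1) by (rule redm_conj) (use 2 c in auto)
 also have "D' * (D * Y * A) * A' = (D' * D) * Y * (A * A')"
  using c by (simp add: assoc_mult_mat[of _ m m _ m _ t] assoc_mult_mat[of _ m m _ t _ t] assoc_mult_mat[of _ m t _ t _ t])
 finally show ?thesis using cg_mult[OF 2(2) 1(2)] cg_mult[OF 1(3) 2(3)] by (rule orbI)
qed

lemma orb_sym: assumes Y: "Y \<in> Ys m t" and Y': "Y' \<in> orb Y" shows "Y \<in> orb Y'"
proof -
 obtain D A where 1: "Y' = redm (D * Y * A)" "D \<in> cg m r" "A \<in> cg t r" using orbE[OF Y'] .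
 obtain D' where D': "D' \<in> cg m r" "D' * D = 1\<^sub>m m" using cg_inverse[OF 1(2) r1] .
 obtain A' where A': "A' \<in> cg t r" "A * A' = 1\<^sub>m t" using cg_inverse[OF 1(3) r1] .
 note c = cg_carrier[OF 1(2)] cg_carrier[OF 1(3)] cg_carrier[OF D'(1)] cg_carrier[OF A'(1)] Ys_carrier[OF Y]
 have "redm (D' * Y' * A') = redm (D' * (D * Y * A) * A')" unfolding 1(1) by (rule redm_conj) (use D' A' c in auto)
 also have "D' * (D * Y * A) * A' = Y" by (rule Gl_conj_cancel) (use c D' A' in auto)
 finally have "Y = redm (D' * Y' * A')" using Y by (simp add: Ys_def)
 then show ?thesis using D'(1) A'(1) by (rule orbI)
qed

lemma orb_eq: assumes Y: "Y \<in> Ys m t" and Y': "Y' \<in> orb Y" shows "orb Y' = orb Y"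
 using orb_trans[OF Ys_carrier[OF Y] Y'] orb_trans[OF orb_carrier[OF Ys_carrier[OF Y] Y'] orb_sym[OF Y Y']] by blast

lemma orb_bij:
 assumes Y: "Y \<in> Ys m t" and D: "D \<in> cg m r" and A: "A \<in> cg t r"
 shows "bij_betw (\<lambda>Z. redm (D * Z * A)) (orb Y) (orb Y)"
proof -
 obtain N where N: "Y \<in> Yk m t N" using Y by (auto simp: Ys_eq)
 have "bij_betw (\<lambda>E. redm (D * E * A + 0\<^sub>m m t)) (Yk m t N) (Yk m t N)" by (rule Yk_affine_bij) (use D A cg_Gl r1 in auto)
 then have "inj_on (\<lambda>E. redm (D * E * A + 0\<^sub>m m t)) (orb Y)" using orb_Yk[OF N] by (meson bij_betw_imp_inj_on inj_on_subset)
 moreover have "redm (D * E * A + 0\<^sub>m m t) = redm (D * E * A)" if "E \<in> orb Y" for E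
 proof -
  have "D * E * A \<in> carrier_mat m t" using orb_carrier[OF Ys_carrier[OF Y] that] cg_carrier[OF D] cg_carrier[OF A] by auto
  then have "D * E * A + 0\<^sub>m m t = D * E * A" by (rule right_add_zero_mat)
  then show ?thesis by simp
 qed
 ultimately have inj: "inj_on (\<lambda>E. redm (D * E * A)) (orb Y)" by (simp add: inj_on_def)
 have "redm (D * E * A) \<in> orb Y" if E: "E \<in> orb Y" for E
 proof -
  have "redm (D * E * A) \<in> orb E" using refl D A by (rule orbI)
  then show ?thesis using orb_eq[OF Y E] by simp
 qed
 then have "(\<lambda>E. redm (D * E * A)) ` orb Y \<subseteq> orb Y" by blast
 then show ?thesis using inj orb_finite[OF Y] endo_inj_surj by (metis bij_betw_def)
qed

end

lemma sum_fun_apply: "(\<Sum>i\<in>A. F i) x = (\<Sum>i\<in>A. F i x)" for F :: "'i \<Rightarrow> 'a \<Rightarrow> 'b::comm_monoid_add"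
proof (induction A rule: infinite_finite_induct)
 case (insert i A)
 show ?case unfolding sum.insert[OF insert.hyps(1,2)] plus_fun_def insert.IH ..
qed simp_all

section \<open>Representations\<close>

lemma linear_betwD:
 assumes "linear_betw V W f"
 shows "u \<in> V ==> v \<in> V ==> f (u + v) = f u + f v" "v \<in> V ==> f (cscale c v) = cscale c (f v)" "v \<in> V ==> f v \<in> W"
proof -
 note f = assms[unfolded linear_betw_def]
 show "u \<in> V ==> v \<in> V ==> f (u + v) = f u + f v" using f by blast
 show "v \<in> V ==> f (cscale c v) = cscale c (f v)" using f by blast
 show "v \<in> V ==> f v \<in> W" using f by blast
qed

lemma linear_betwI:
 assumes "\<And>v. v \<in> V ==> f v \<in> W" "\<And>u v. u \<in> V ==> v \<in> V ==> f (u + v) = f u + f v"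
  "\<And>c v. v \<in> V ==> f (cscale c v) = cscale c (f v)"
 shows "linear_betw V W f" unfolding linear_betw_def using assms by blast

lemma linear_betw_0:
 assumes f: "linear_betw V W f" and V: "cfun.subspace V"
 shows "f 0 = 0"
proof -
 have "f (cscale 0 0) = cscale 0 (f 0)" using f cfun.subspace_0[OF V] by (rule linear_betwD(2))
 then show ?thesis unfolding cfun.scale_zero_left .
qed

lemma linear_betw_sum:
 assumes f: "linear_betw V W f" and V: "cfun.subspace V" and v: "\<And>i. i \<in> A ==> v i \<in> V"
 shows "f (\<Sum>i\<in>A. cscale (a i) (v i)) = (\<Sum>i\<in>A. cscale (a i) (f (v i)))" using v
proof (induction A rule: infinite_finite_induct)
 case (insert i A)
 have "cscale (a i) (v i) \<in> V" "(\<Sum>i\<in>A. cscale (a i) (v i)) \<in> V"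
  using insert.prems V by (auto intro: cfun.subspace_scale cfun.subspace_sum)
 then have "f (cscale (a i) (v i) + (\<Sum>i\<in>A. cscale (a i) (v i))) = cscale (a i) (f (v i)) + f (\<Sum>i\<in>A. cscale (a i) (v i))"
  using linear_betwD(1)[OF f] linear_betwD(2)[OF f, of "v i" "a i"] insert.prems by (simp only: insertI1)
 moreover have "f (\<Sum>i\<in>A. cscale (a i) (v i)) = (\<Sum>i\<in>A. cscale (a i) (f (v i)))" by (rule insert.IH) (rule insert.prems, simp)
 ultimately show ?case unfolding sum.insert[OF insert.hyps(1,2)] by (simp only:)
qed (use linear_betw_0[OF f V] in auto)

lemma dim_bij_betw:
 assumes f: "linear_betw V W f" and V: "cfun.subspace V" and bij: "bij_betw f V W"
 shows "cfun.dim V = cfun.dim W"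
proof -
 obtain B where B: "B \<subseteq> V" "cfun.independent B" "V \<subseteq> cfun.span B" "card B = cfun.dim V" using cfun.basis_exists by blast
 have inj: "inj_on f V" and img: "f ` V = W" using bij by (auto simp: bij_betw_def)
 have "cfun.dim W = card (f ` B)"
 proof (rule cfun.dim_unique)
  show "f ` B \<subseteq> W" using B(1) img by blast
  show "W \<subseteq> cfun.span (f ` B)"
  proof
   fix y assume "y \<in> W"
   then obtain x where x: "x \<in> V" "y = f x" using img by blast
   then obtain A a where A: "finite A" "A \<subseteq> B" "x = (\<Sum>b\<in>A. cscale (a b) b)" using B(3) unfolding cfun.span_explicit by blast
   have "y = (\<Sum>b\<in>A. cscale (a b) (f b))" using linear_betw_sum[OF f V, of A "\<lambda>b. b" a] A B(1) x(2) by auto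
   also have "... \<in> cfun.span (f ` B)" using A(2) by (intro cfun.span_sum cfun.span_scale cfun.span_base) auto
   finally show "y \<in> cfun.span (f ` B)" .
  qed
  show "cfun.independent (f ` B)" unfolding cfun.independent_explicit_module
  proof (intro allI impI)
   fix A u y assume A: "finite A" "A \<subseteq> f ` B" "(\<Sum>v\<in>A. cscale (u v) v) = 0" "y \<in> A"
   obtain C where C: "C \<subseteq> B" "A = f ` C" using A(2) by (meson subset_imageE)
   have CV: "C \<subseteq> V" using C(1) B(1) by blast
   have injC: "inj_on f C" using inj CV inj_on_subset by blast
   have finC: "finite C" using A(1) C(2) injC finite_image_iff by blast
   have sumV: "(\<Sum>b\<in>C. cscale (u (f b)) b) \<in> V" using CV V by (auto intro!: cfun.subspace_sum cfun.subspace_scale)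
   have "f (\<Sum>b\<in>C. cscale (u (f b)) b) = (\<Sum>b\<in>C. cscale (u (f b)) (f b))"
    using linear_betw_sum[OF f V, of C "\<lambda>b. b" "\<lambda>b. u (f b)"] CV by auto
   also have "... = 0" using A(3) C(2) injC by (simp add: sum.reindex)
   also have "... = f 0" using linear_betw_0[OF f V] by simp
   finally have "(\<Sum>b\<in>C. cscale (u (f b)) b) = 0" using inj_onD[OF inj] sumV cfun.subspace_0[OF V] by blast
   moreover obtain c where c: "c \<in> C" "y = f c" using A(4) C(2) by blast
   ultimately show "u y = 0" using B(2)[unfolded cfun.independent_explicit_module, rule_format, of C "\<lambda>b. u (f b)" c] finC C(1) by simp
  qed
 qed simp
 then show ?thesis using B(4) card_image[OF inj_on_subset[OF inj B(1)]] by simp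
qed

lemma is_repD:
 assumes "is_rep G \<pi>"
 shows "cfun.subspace (fst \<pi>)" "g \<in> carrier G ==> linear_betw (fst \<pi>) (fst \<pi>) (snd \<pi> g)"
  "v \<in> fst \<pi> ==> snd \<pi> \<one>\<^bsub>G\<^esub> v = v"
  "g \<in> carrier G ==> h \<in> carrier G ==> v \<in> fst \<pi> ==> snd \<pi> (g \<otimes>\<^bsub>G\<^esub> h) v = snd \<pi> g (snd \<pi> h v)"
 using assms by (auto simp: is_rep_def case_prod_unfold)

lemma irreducibleD:
 assumes "irreducible_rep G \<pi>" "cfun.subspace W" "W \<subseteq> fst \<pi>" "\<And>g. g \<in> carrier G ==> snd \<pi> g ` W \<subseteq> W"
 shows "W = {0} \<or> W = fst \<pi>" using assms unfolding irreducible_rep_def case_prod_unfold by blast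

lemma rep_homD:
 assumes "f \<in> rep_hom G \<pi> \<rho>"
 shows "linear_betw (fst \<pi>) (fst \<rho>) f" "g \<in> carrier G ==> v \<in> fst \<pi> ==> f (snd \<pi> g v) = snd \<rho> g (f v)"
  "v \<notin> fst \<pi> ==> f v = 0" "v \<in> fst \<pi> ==> f v \<in> fst \<rho>"
 using assms linear_betwD(3)[of "fst \<pi>" "fst \<rho>" f v] unfolding rep_hom_def by blast+

lemma rep_iso_refl: "is_rep G \<pi> ==> rep_iso G \<pi> \<pi>"
proof -
 assume r: "is_rep G \<pi>"
 \<comment> \<open>\<open>rep_hom\<close> demands maps that vanish off the representation space, so
   the identity is cut off there.\<close>
 let ?f = "\<lambda>v. if v \<in> fst \<pi> then v else 0"
 have V: "u + v \<in> fst \<pi>" "cscale c u \<in> fst \<pi>" if "u \<in> fst \<pi>" "v \<in> fst \<pi>" for u v c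
  using that is_repD(1)[OF r] cfun.subspace_add cfun.subspace_scale by auto
 have V': "snd \<pi> g u \<in> fst \<pi>" if "g \<in> carrier G" "u \<in> fst \<pi>" for g u
  using linear_betwD(3)[OF is_repD(2)[OF r that(1)] that(2)] .
 have "?f \<in> rep_hom G \<pi> \<pi>" unfolding rep_hom_def linear_betw_def by (auto simp: V V')
 moreover have "bij_betw ?f (fst \<pi>) (fst \<pi>)" by (auto simp: bij_betw_def inj_on_def)
 ultimately show ?thesis unfolding rep_iso_def by blast
qed

lemma rep_iso_sym:
 assumes p: "is_rep G \<pi>" and iso: "rep_iso G \<pi> \<pi>'"
 shows "rep_iso G \<pi>' \<pi>"
proof -
 obtain f where f: "f \<in> rep_hom G \<pi> \<pi>'" "bij_betw f (fst \<pi>) (fst \<pi>')" using iso by (auto simp: rep_iso_def)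
 note V = is_repD(1)[OF p] and lin = rep_homD(1)[OF f(1)]
 define g where "g v = (if v \<in> fst \<pi>' then inv_into (fst \<pi>) f v else 0)" for v
 have g1: "g v \<in> fst \<pi>" "f (g v) = v" if "v \<in> fst \<pi>'" for v
  using that f(2) by (auto simp: g_def bij_betw_def inv_into_into f_inv_into_f)
 have g2: "g (f u) = u" if "u \<in> fst \<pi>" for u using that f(2) rep_homD(4)[OF f(1)] by (auto simp: g_def bij_betw_def)
 have "linear_betw (fst \<pi>') (fst \<pi>) g" unfolding linear_betw_def
 proof (intro conjI ballI allI)
  show "g ` fst \<pi>' \<subseteq> fst \<pi>" using g1 by blast
  fix u v assume uv: "u \<in> fst \<pi>'" "v \<in> fst \<pi>'"
  have "f (g u + g v) = u + v" using linear_betwD(1)[OF lin] g1 uv by simp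
  then show "g (u + v) = g u + g v" using g2[of "g u + g v"] cfun.subspace_add[OF V] g1 uv by simp
 next
  fix c v assume v: "v \<in> fst \<pi>'"
  have "f (cscale c (g v)) = cscale c v" using linear_betwD(2)[OF lin] g1 v by simp
  then show "g (cscale c v) = cscale c (g v)" using g2[of "cscale c (g v)"] cfun.subspace_scale[OF V] g1 v by simp
 qed
 moreover have "g (snd \<pi>' x v) = snd \<pi> x (g v)" if x: "x \<in> carrier G" and v: "v \<in> fst \<pi>'" for x v
 proof -
  have "f (snd \<pi> x (g v)) = snd \<pi>' x v" using rep_homD(2)[OF f(1) x] g1 v by simp
  then show ?thesis using g2[of "snd \<pi> x (g v)"] linear_betwD(3)[OF is_repD(2)[OF p x]] g1 v by simp
 qed
 ultimately have "g \<in> rep_hom G \<pi>' \<pi>" by (auto simp: rep_hom_def g_def)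
 moreover have "bij_betw g (fst \<pi>') (fst \<pi>)" by (rule bij_betw_byWitness[of _ f]) (use g1 g2 rep_homD(4)[OF f(1)] in auto)
 ultimately show ?thesis unfolding rep_iso_def by blast
qed

lemma rep_iso_trans:
 assumes "rep_iso G \<pi> \<pi>'" "rep_iso G \<pi>' \<pi>''" and r: "is_rep G \<pi>"
 shows "rep_iso G \<pi> \<pi>''"
proof -
 obtain f where f: "f \<in> rep_hom G \<pi> \<pi>'" "bij_betw f (fst \<pi>) (fst \<pi>')" using assms(1) by (auto simp: rep_iso_def)
 obtain g where g: "g \<in> rep_hom G \<pi>' \<pi>''" "bij_betw g (fst \<pi>') (fst \<pi>'')" using assms(2) by (auto simp: rep_iso_def)
 let ?h = "\<lambda>v. if v \<in> fst \<pi> then g (f v) else 0"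
 have st: "u + v \<in> fst \<pi>" "cscale c v \<in> fst \<pi>" if "u \<in> fst \<pi>" "v \<in> fst \<pi>" "cfun.subspace (fst \<pi>)" for u v c
  using that cfun.subspace_add cfun.subspace_scale by blast+
 have hom: "?h \<in> rep_hom G \<pi> \<pi>''"
  using st is_repD(1)[OF r] linear_betwD(3)[OF is_repD(2)[OF r]] rep_homD[OF f(1)] rep_homD[OF g(1)] linear_betwD[OF rep_homD(1)[OF f(1)]] linear_betwD[OF rep_homD(1)[OF g(1)]]
  by (auto simp: rep_hom_def linear_betw_def)
 have bij: "bij_betw ?h (fst \<pi>) (fst \<pi>'')" using bij_betw_trans[OF f(2) g(2)] by (rule bij_betw_cong[THEN iffD1, rotated]) simp
 show ?thesis using hom bij unfolding rep_iso_def by blast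
qed

section \<open>The induced representation in coordinates\<close>

context char_setting
begin

abbreviation (input) GG where "GG \<equiv> congruence_subgroup (t + m) S (pw 1) r"
abbreviation (input) TT where "TT \<equiv> subtopology (GL_topology (t + m) S (pw 1)) (carrier GG)"
definition HH where "HH = block_subgroup (t + m) t S \<inter> carrier GG"
definition VV where "VV = ind_space GG TT HH"

lemma HH_iff: "h \<in> HH \<longleftrightarrow> h \<in> cg (t + m) r \<and> bB h = 0\<^sub>m t m"
proof -
 have "(\<forall>i j. i < t \<and> t \<le> j \<and> j < t + m --> h $$ (i, j) = 0) \<longleftrightarrow> (\<forall>i<t. \<forall>j<m. h $$ (i, j + t) = 0)"
 proof safe
  fix i j assume a: "\<forall>i<t. \<forall>j<m. h $$ (i, j + t) = 0" and j: "i < t" "t \<le> j" "j < t + m"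
  have "j - t < m" using j by simp
  then have "h $$ (i, j - t + t) = 0" using a j(1) by blast
  then show "h $$ (i, j) = 0" using j by simp
 qed simp
 also have "... \<longleftrightarrow> bB h = 0\<^sub>m t m" by (auto simp: bB_def mat_eq_iff)
 finally show ?thesis unfolding HH_def block_subgroup_def Gr_carrier[OF r1] GL_grp_carrier using cg_Gl[OF _ r1] by blast
qed

lemma uu_cc: assumes "x \<in> cg (t + m) r" shows "uu (cc x) \<in> cg (t + m) r" "cc (uu (cc x)) = cc x" using uu_cg cc_uu cc(1)[OF assms] by auto

lemma uu_close: assumes "X \<in> carrier_mat t m" "X' \<in> carrier_mat t m" "X' - X \<in> pm t m k"
 shows "uu X' - uu X \<in> pm (t + m) (t + m) k"
proof (rule pmI)
 show "uu X' - uu X \<in> carrier_mat (t + m) (t + m)" using assms by (simp add: uu_def)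
 fix i j assume ij: "i < t + m" "j < t + m"
 show "(uu X' - uu X) $$ (i, j) \<in> pw k"
 proof (cases "i < t \<and> t \<le> j")
  case True
  then have j: "j - t < m" using ij by arith
  then have "(uu X' - uu X) $$ (i, j) = (X' - X) $$ (i, j - t)" using True assms(1,2) ij by (simp add: uu_def)
  then show ?thesis using pmD[OF assms(3), of i "j - t"] True j by simp
 next
  case False
  then have "(uu X' - uu X) $$ (i, j) = 0" using assms(1,2) ij by (auto simp: uu_def)
  then show ?thesis by simp
 qed
qed

lemma cc_pair:
 assumes x: "x \<in> cg (t + m) r" and y: "y \<in> cg (t + m) r" and g: "g \<in> cg (t + m) r"
 shows "cc (x * g) - cc (y * g) \<in> pm t m k \<longleftrightarrow> cc x - cc y \<in> pm t m k"
  and "cc x = cc y ==> cc (x * g) = cc (y * g)"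
proof -
 obtain A D where AD: "A \<in> cg t r" "D \<in> cg m r" "cc (x * g) - cc (y * g) = A * (cc x - cc y) * D" using cc_difference[OF x y g] .
 note c = cc_carrier[OF x] cc_carrier[OF y] cg_carrier[OF AD(1)] cg_carrier[OF AD(2)]
 have "A * (cc x - cc y) * D \<in> pm t m k \<longleftrightarrow> A * (cc x - cc y) \<in> pm t m k"
  using c by (intro Gl_cancel_right[OF cg_Gl[OF AD(2) r1]]) auto
 also have "... \<longleftrightarrow> cc x - cc y \<in> pm t m k" using c by (intro Gl_cancel_left[OF cg_Gl[OF AD(1) r1]]) auto
 finally show "cc (x * g) - cc (y * g) \<in> pm t m k \<longleftrightarrow> cc x - cc y \<in> pm t m k" unfolding AD(3) .
 assume "cc x = cc y"
 then have "cc (x * g) - cc (y * g) = 0\<^sub>m t m" using AD(3) c by simp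
 then have "(cc (x * g) - cc (y * g)) $$ (i, j) = 0" if "i < t" "j < m" for i j using that by simp
 then have "cc (x * g) $$ (i, j) = cc (y * g) $$ (i, j)" if "i < t" "j < m" for i j
  using that cc_carrier[OF cg_mult[OF x g]] cc_carrier[OF cg_mult[OF y g]] by fastforce
 then show "cc (x * g) = cc (y * g)" using cc_carrier[OF cg_mult[OF x g]] cc_carrier[OF cg_mult[OF y g]] by (intro eq_matI) auto
qed

text \<open>Uniform local constancy in the coordinate. \<open>N\<close> plays the part of a
  conductor: it cuts the Fourier expansion off at \<open>Yk m t N\<close>.\<close>

definition level :: "nat \<Rightarrow> ('k mat \<Rightarrow> complex) \<Rightarrow> bool" where
 "level N f \<longleftrightarrow> (\<forall>X\<in>pm t m (int r). \<forall>X'\<in>pm t m (int r). X - X' \<in> pm t m (int (r + N)) --> f (uu X) = f (uu X'))"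

lemma level_mono: "level N f ==> N \<le> M ==> level M f" using pm_mono[of "int (r + N)" "int (r + M)"] unfolding level_def by auto

lemma matrix_limit:
 assumes X: "\<And>k. X k \<in> pm t m (int r)" "\<And>k. X (Suc k) - X k \<in> pm t m (int (r + k))"
 obtains L where "L \<in> pm t m (int r)" "\<And>k. L - X k \<in> pm t m (int k)"
proof -
 have "\<exists>l\<in>S. \<forall>k. l - X k $$ (i, j) \<in> pw (int k)" if "i < t" "j < m" for i j unfolding pw_nat
 proof (rule complete)
  fix k
  show "X k $$ (i, j) \<in> S" using pmD[OF X(1) that] pw_S[of "int r"] by simp
  have "X (Suc k) $$ (i, j) - X k $$ (i, j) = (X (Suc k) - X k) $$ (i, j)" using pm_carrier[OF X(1)[of k]] that by simp
  also have "... \<in> pw (int (r + k))" using pmD[OF X(2) that] .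
  finally show "(X (Suc k) $$ (i, j) - X k $$ (i, j)) / w ^ k \<in> S" using pw_mono[of "int k" "int (r + k)"] unfolding pw_nat[symmetric] by auto
 qed
 then obtain l where l: "\<And>i j k. i < t ==> j < m ==> l i j - X k $$ (i, j) \<in> pw (int k)" by metis
 define L where "L = mat t m (\<lambda>(i, j). l i j)"
 have d: "L - X k \<in> pm t m (int k)" for k using l pm_carrier[OF X(1)[of k]] by (intro pmI) (auto simp: L_def)
 have cL: "L \<in> carrier_mat t m" by (simp add: L_def)
 have "(L - X r) + X r \<in> pm t m (int r)" using d X(1) by (rule pm_add)
 moreover have "(L - X r) + X r = L" using cL pm_carrier[OF X(1)[of r]] by (intro eq_matI) auto
 ultimately have "L \<in> pm t m (int r)" by simp
 then show ?thesis using d that by blast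
qed

text \<open>Compactness of the coordinate space. If uniformity failed, then by finiteness of
  \<open>Xr\<close> it would fail on each of a nested sequence of balls, and local constancy at
  their limit gives a contradiction.\<close>

lemma level_exists:
 assumes loc: "\<And>X. X \<in> pm t m (int r) ==> \<exists>k. \<forall>X'\<in>pm t m (int r). X' - X \<in> pm t m (int k) --> f (uu X') = f (uu X)"
 shows "\<exists>N. level N f"
proof (rule ccontr)
 assume no: "\<nexists>N. level N f"
 \<comment> \<open>Uniform local constancy on the ball of level \<open>r + k\<close> around
   \<open>X\<close>.\<close>
 define good where "good X k \<longleftrightarrow> (\<exists>N. \<forall>X'\<in>pm t m (int r). \<forall>X''\<in>pm t m (int r).
  X' - X \<in> pm t m (int (r + k)) --> X' - X'' \<in> pm t m (int (r + N)) --> f (uu X') = f (uu X''))" for X k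
 have start: "\<not> good (0\<^sub>m t m) 0"
 proof
  assume "good (0\<^sub>m t m) 0"
  then obtain N where N: "\<And>X' X''. X' \<in> pm t m (int r) ==> X'' \<in> pm t m (int r) ==> X' - 0\<^sub>m t m \<in> pm t m (int (r + 0)) ==>
   X' - X'' \<in> pm t m (int (r + N)) ==> f (uu X') = f (uu X'')" unfolding good_def by blast
  have "X' - 0\<^sub>m t m = X'" if "X' \<in> pm t m (int r)" for X' using pm_carrier[OF that] by (intro eq_matI) auto
  then have "level N f" using N unfolding level_def by simp
  then show False using no by blast
 qed
 have step: "\<exists>X1. (X1 \<in> pm t m (int r) \<and> \<not> good X1 (Suc k)) \<and> X1 - X \<in> pm t m (int (r + k))"
  if X: "X \<in> pm t m (int r) \<and> \<not> good X k" for X k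
 proof (rule ccontr)
  assume c: "\<not> ?thesis"
  have "\<forall>X1. \<exists>N. X1 \<in> pm t m (int r) --> X1 - X \<in> pm t m (int (r + k)) --> (\<forall>X'\<in>pm t m (int r). \<forall>X''\<in>pm t m (int r).
   X' - X1 \<in> pm t m (int (r + Suc k)) --> X' - X'' \<in> pm t m (int (r + N)) --> f (uu X') = f (uu X''))" using c unfolding good_def by blast
  then obtain Nf where Nf: "\<And>X1 X' X''. X1 \<in> pm t m (int r) ==> X1 - X \<in> pm t m (int (r + k)) ==> X' \<in> pm t m (int r) ==>
   X'' \<in> pm t m (int r) ==> X' - X1 \<in> pm t m (int (r + Suc k)) ==> X' - X'' \<in> pm t m (int (r + Nf X1)) ==> f (uu X') = f (uu X'')"
   by metis
  \<comment> \<open>The sum over the finitely many smaller balls dominates each of their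
    moduli.\<close>
  define M where "M = (\<Sum>Z\<in>Xr (Suc k). Nf Z)"
  have "f (uu X') = f (uu X'')" if X': "X' \<in> pm t m (int r)" and X'': "X'' \<in> pm t m (int r)"
   and d1: "X' - X \<in> pm t m (int (r + k))" and d2: "X' - X'' \<in> pm t m (int (r + M))" for X' X''
  proof -
   define X1 where "X1 = rd (Suc k) X'"
   note cX = pm_carrier[OF X'] pm_carrier[OF conjunct1[OF X]]
   have X1: "X1 \<in> Xr (Suc k)" using rd_Xr[OF X'] by (simp add: X1_def)
   have e: "X1 - X' \<in> pm t m (int (r + Suc k))" using rd_diff[OF cX(1)] unfolding X1_def .
   have e': "X' - X1 \<in> pm t m (int (r + Suc k))" using e pm_diff_commute[OF Xr_carrier[OF X1] cX(1)] by blast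
   have "X1 - X' \<in> pm t m (int (r + k))" by (rule pm_mono[OF _ e]) simp
   then have "X1 - X \<in> pm t m (int (r + k))" using d1 Xr_carrier[OF X1] cX by (rule pm_diff_trans)
   moreover have "Nf X1 \<le> M" unfolding M_def using Xr_card(1) X1 by (intro member_le_sum) auto
   then have "X' - X'' \<in> pm t m (int (r + Nf X1))" by (intro pm_mono[OF _ d2]) simp
   ultimately show ?thesis using Nf Xr_pm[OF X1] X' X'' e' by blast
  qed
  then have "good X k" unfolding good_def by blast
  then show False using X by blast
 qed
 obtain X where X: "\<And>k. X k \<in> pm t m (int r) \<and> \<not> good (X k) k" "\<And>k. X (Suc k) - X k \<in> pm t m (int (r + k))"
  using dependent_nat_choice[of "\<lambda>k X. X \<in> pm t m (int r) \<and> \<not> good X k" "\<lambda>k X X1. X1 - X \<in> pm t m (int (r + k))"]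
   start step pm_zero by blast
 obtain L where L: "L \<in> pm t m (int r)" "\<And>k. L - X k \<in> pm t m (int k)" using matrix_limit[of X] X by blast
 obtain k where k: "\<And>X'. X' \<in> pm t m (int r) ==> X' - L \<in> pm t m (int k) ==> f (uu X') = f (uu L)" using loc[OF L(1)] by blast
 have "good (X k) k" unfolding good_def
 proof (intro exI[of _ k] ballI impI)
  fix X' X'' assume X': "X' \<in> pm t m (int r)" and X'': "X'' \<in> pm t m (int r)"
   and d: "X' - X k \<in> pm t m (int (r + k))" "X' - X'' \<in> pm t m (int (r + k))"
  note c = pm_carrier[OF X'] pm_carrier[OF X''] pm_carrier[OF L(1)] pm_carrier[OF conjunct1[OF X(1)[of k]]]
  have d': "X' - X k \<in> pm t m (int k)" "X' - X'' \<in> pm t m (int k)" by (rule pm_mono[rotated, OF d(1)] pm_mono[rotated, OF d(2)]; simp)+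
  have 1: "X' - L \<in> pm t m (int k)"  using pm_diff_trans[OF d'(1) _ c(1,4,3)] L(2)[of k] pm_diff_commute[OF c(3,4)] by blast
  have "X'' - X' \<in> pm t m (int k)" using d'(2) pm_diff_commute[OF c(1,2)] by blast
  then have "X'' - L \<in> pm t m (int k)" using 1 c(2,1,3) by (rule pm_diff_trans)
  then show "f (uu X') = f (uu X'')" using k[OF X' 1] k[OF X''] by simp
 qed
 then show False using X(1) by blast
qed

text \<open>Left invariance makes \<open>f\<close> a function of the coordinate alone, and
  compactness makes it one of finite level. Conversely, a function of finite level is constant on
  sets defined by a congruence of coordinates, and these are open.\<close>

lemma VV_char:
 "f \<in> VV \<longleftrightarrow> (\<forall>x. x \<notin> cg (t + m) r --> f x = 0) \<and> (\<forall>x\<in>cg (t + m) r. f x = f (uu (cc x))) \<and> (\<exists>N. level N f)"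
  (is "_ \<longleftrightarrow> ?R")
proof
 assume "f \<in> VV"
 then have loc: "\<And>x. x \<in> cg (t + m) r ==> \<exists>U. openin TT U \<and> x \<in> U \<and> (\<forall>y\<in>U. f y = f x)"
  and inv: "\<And>h x. h \<in> HH ==> x \<in> cg (t + m) r ==> f (h * x) = f x"
  and out: "\<And>x. x \<notin> cg (t + m) r ==> f x = 0" unfolding VV_def ind_space_def mem_Collect_eq Gr_carrier[OF r1] Gr_mult by simp_all
 have "f x = f (uu (cc x))" if x: "x \<in> cg (t + m) r" for x
 proof -
  obtain h where "h \<in> cg (t + m) r" "bB h = 0\<^sub>m t m" "x = h * uu (cc x)"  using cc_eq_block[OF uu_cc(1)[OF x] x uu_cc(2)[OF x]] .
  then show ?thesis using inv[of h "uu (cc x)"] HH_iff uu_cc(1)[OF x] by simp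
 qed
 moreover have "\<exists>N. level N f"
 proof (rule level_exists)
  fix X assume X: "X \<in> pm t m (int r)"
  obtain U where U: "openin TT U" "uu X \<in> U" "\<And>y. y \<in> U ==> f y = f (uu X)" using loc[OF uu_cg[OF X]] by blast
  obtain k where k: "\<And>y. y \<in> cg (t + m) r ==> y - uu X \<in> pm (t + m) (t + m) (int k) ==> y \<in> U"
   using Tp_open_ball[OF r1 U(1,2)] by blast
  have "f (uu X') = f (uu X)" if "X' \<in> pm t m (int r)" "X' - X \<in> pm t m (int k)" for X'
   using U(3) k uu_cg[OF that(1)] uu_close[OF pm_carrier[OF X] pm_carrier[OF that(1)] that(2)] by blast
  then show "\<exists>k. \<forall>X'\<in>pm t m (int r). X' - X \<in> pm t m (int k) --> f (uu X') = f (uu X)" by blast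
 qed
 ultimately show ?R using out by blast
next
 assume R: ?R
 then obtain N where N: "level N f" by blast
 have fx: "f x = f (uu (cc x))" if "x \<in> cg (t + m) r" for x using R that by blast
 have "\<exists>U. openin TT U \<and> x \<in> U \<and> (\<forall>y\<in>U. f y = f x)" if x: "x \<in> cg (t + m) r" for x
 proof (intro exI conjI ballI)
  let ?U = "{y \<in> cg (t + m) r. cc y - cc x \<in> pm t m (int (r + N))}"
  show "x \<in> ?U" using x cc_carrier[OF x] by simp
  show "f y = f x" if "y \<in> ?U" for y
  proof -
   have y: "y \<in> cg (t + m) r" "cc y - cc x \<in> pm t m (int (r + N))" using that by auto
   show ?thesis using fx[OF x] fx[OF y(1)] N cc(1)[OF x] cc(1)[OF y(1)] y(2) unfolding level_def by simp
  qed
  show "openin TT ?U"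
  proof (rule Tp_openI[OF r1])
   fix y assume "y \<in> ?U"
   then have y: "y \<in> cg (t + m) r" "cc y - cc x \<in> pm t m (int (r + N))" by auto
   have "z \<in> ?U" if z: "z \<in> cg (t + m) r" "z - y \<in> pm (t + m) (t + m) (int (r + N))" for z
   proof -
    obtain g where g: "g \<in> cg (t + m) (r + N)" "z = y * g" using cg_cong_mult[OF y(1) r1 cg_carrier[OF z(1)] z(2)] .
    have "cc z - cc y \<in> pm t m (int (r + N))" using cc_level[OF y(1) g(1)] by (simp add: g(2))
    then have "cc z - cc x \<in> pm t m (int (r + N))" by (rule pm_diff_trans[OF _ y(2) cc_carrier[OF z(1)] cc_carrier[OF y(1)] cc_carrier[OF x]])
    then show ?thesis using z(1) by blast
   qed
   then show "\<exists>k. \<forall>z\<in>cg (t + m) r. z - y \<in> pm (t + m) (t + m) (int k) --> z \<in> ?U" by blast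
  qed blast
 qed
 moreover have "f (h * x) = f x" if "h \<in> HH" "x \<in> cg (t + m) r" for h x
  using that fx[of x] fx[of "h * x"] cc_block_left[of h x] cg_mult[of h "t + m" r x] HH_iff by simp
 ultimately show "f \<in> VV" unfolding VV_def ind_space_def mem_Collect_eq Gr_carrier[OF r1] Gr_mult using R by blast
qed

lemma VVI: "(\<And>x. x \<notin> cg (t + m) r ==> f x = 0) ==> (\<And>x. x \<in> cg (t + m) r ==> f x = f (uu (cc x))) ==> level N f ==> f \<in> VV"
 using VV_char by blast

lemma VV_out: "f \<in> VV ==> x \<notin> cg (t + m) r ==> f x = 0" using VV_char by blast

lemma VV_uu: "f \<in> VV ==> x \<in> cg (t + m) r ==> f x = f (uu (cc x))" using VV_char by blast

lemma VV_level: assumes "f \<in> VV" obtains N where "level N f" using assms VV_char by blast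

lemma VV_eqI: assumes f: "f \<in> VV" and g: "g \<in> VV" and eq: "\<And>X. X \<in> pm t m (int r) ==> f (uu X) = g (uu X)" shows "f = g"
proof
 fix x show "f x = g x"
  using VV_out[OF f, of x] VV_out[OF g, of x] VV_uu[OF f, of x] VV_uu[OF g, of x] eq[OF cc(1), of x] by (cases "x \<in> cg (t + m) r") auto
qed

lemma VV_subspace: "cfun.subspace VV"
proof (rule cfun.subspaceI)
 show "0 \<in> VV" by (rule VVI[of _ 0]) (auto simp: level_def)
 show "f + g \<in> VV" if f: "f \<in> VV" and g: "g \<in> VV" for f g
 proof -
  obtain M N where MN: "level M f" "level N g" using VV_level[OF f] VV_level[OF g] by metis
  have "level (max M N) f" "level (max M N) g" using level_mono[OF MN(1)] level_mono[OF MN(2)] by auto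
  then have "level (max M N) (f + g)" unfolding level_def plus_fun_def by metis
  then show ?thesis by (rule VVI[rotated 2]) (simp_all add: VV_out[OF f] VV_out[OF g] flip: VV_uu[OF f] VV_uu[OF g])
 qed
 show "cscale c f \<in> VV" if f: "f \<in> VV" for c f
 proof -
  obtain N where N: "level N f" using VV_level[OF f] .
  then have "level N (cscale c f)" unfolding level_def cscale_def by metis
  then show ?thesis by (rule VVI[rotated 2]) (simp_all add: cscale_def VV_out[OF f] flip: VV_uu[OF f])
 qed
qed

text \<open>Right translation changes differences of coordinates by invertible factors only, so it
  preserves each level.\<close>

lemma act_VV: assumes g: "g \<in> cg (t + m) r" and f: "f \<in> VV" shows "act g f \<in> VV"
proof -
 obtain N where N: "level N f" using VV_level[OF f] .
 have 1: "f (x * g) = f (y * g)" if "x \<in> cg (t + m) r" "y \<in> cg (t + m) r" "cc x - cc y \<in> pm t m (int (r + N))" for x y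
 proof -
  have d: "cc (x * g) - cc (y * g) \<in> pm t m (int (r + N))" using cc_pair(1)[OF that(1,2) g] that(3) by blast
  note xg = cg_mult[OF that(1) g] cg_mult[OF that(2) g]
  show ?thesis using VV_uu[OF f xg(1)] VV_uu[OF f xg(2)] N d cc(1)[OF xg(1)] cc(1)[OF xg(2)] unfolding level_def by simp
 qed
 show ?thesis
 proof (rule VVI[of _ N])
  show "act g f x = act g f (uu (cc x))" if x: "x \<in> cg (t + m) r" for x
   using 1[OF x uu_cc(1)[OF x]] x uu_cc[OF x] cc_carrier[OF x] by (simp add: act_def)
  show "level N (act g f)" unfolding level_def act_def using 1 uu_cg cc_uu by simp
 qed (simp add: act_def)
qed

lemma act_one: assumes "f \<in> VV" shows "act (1\<^sub>m (t + m)) f = f"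
proof
 fix x show "act (1\<^sub>m (t + m)) f x = f x"
  using VV_out[OF assms, of x] cg_carrier[of x "t + m" r] by (cases "x \<in> cg (t + m) r") (auto simp: act_def)
qed

lemma act_mult: assumes "g \<in> cg (t + m) r" "h \<in> cg (t + m) r" shows "act (g * h) f = act g (act h f)"
proof
 fix x
 show "act (g * h) f x = act g (act h f) x"
  using cg_mult[of x "t + m" r g] assms cg_carrier[of x "t + m" r] cg_carrier[OF assms(1)] cg_carrier[OF assms(2)]
  by (simp add: act_def assoc_mult_mat[of _ "t + m" "t + m" _ "t + m" _ "t + m"])
qed

lemma act_add: "act g (f + f') = act g f + act g f'" by (auto simp: act_def)

lemma act_scale: "act g (cscale c f) = cscale c (act g f)" by (auto simp: act_def cscale_def)

lemma act_sum: "act g (\<Sum>i\<in>I. F i) = (\<Sum>i\<in>I. act g (F i))" by (rule ext) (simp add: act_def sum_fun_apply)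

lemma rho_eq: "ind_trivial GG TT HH = (VV, act)" unfolding ind_trivial_def VV_def act_def[abs_def] Gr_carrier[OF r1] Gr_mult ..

lemma rho_rep: "is_rep GG (VV, act)" unfolding is_rep_def prod.case linear_betw_def Gr_carrier[OF r1] Gr_mult Gr_one
 using VV_subspace act_VV act_one act_mult act_add act_scale by blast

lemma act_fix: assumes "f \<in> VV" "level N f" "g \<in> cg (t + m) (r + N)" shows "act g f = f"
proof -
 have g: "g \<in> cg (t + m) r" using assms(3) cg_mono[of r "r + N"] by auto
 show ?thesis
 proof
  fix x show "act g f x = f x"
  proof (cases "x \<in> cg (t + m) r")
   case True
   note xg = cg_mult[OF True g]
   have "cc (x * g) - cc x \<in> pm t m (int (r + N))" using cc_level[OF True assms(3)] by simp
   then have "f (x * g) = f x" using VV_uu[OF assms(1) True] VV_uu[OF assms(1) xg] assms(2) cc(1)[OF True] cc(1)[OF xg] unfolding level_def by simp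
   then show ?thesis using True by (simp add: act_def)
  qed (simp add: act_def VV_out[OF assms(1)])
 qed
qed

lemma smooth_sub: assumes W: "is_rep GG (W, act)" "W \<subseteq> VV" shows "smooth_rep GG TT (W, act)"
proof -
 have "openin TT {g \<in> carrier GG. act g f = f}" if "f \<in> W" for f unfolding Gr_carrier[OF r1]
 proof (rule Tp_openI[OF r1, unfolded Gr_carrier[OF r1]])
  have f: "f \<in> VV" using that W by blast
  obtain N where N: "level N f" using VV_level[OF f] .
  fix x assume "x \<in> {g \<in> cg (t + m) r. act g f = f}"
  then have x: "x \<in> cg (t + m) r" "act x f = f" by auto
  have "y \<in> {g \<in> cg (t + m) r. act g f = f}"
   if y: "y \<in> cg (t + m) r" "y - x \<in> pm (t + m) (t + m) (int (r + N))" for y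
  proof -
   obtain g where g: "g \<in> cg (t + m) (r + N)" "y = x * g" using cg_cong_mult[OF x(1) r1 cg_carrier[OF y(1)] y(2)] .
   have "g \<in> cg (t + m) r" using g(1) cg_mono[of r "r + N"] by auto
   then have "act y f = f" using act_mult[OF x(1), of g f] act_fix[OF f N g(1)] x(2) g(2) by simp
   then show ?thesis using y(1) by blast
  qed
  then show "\<exists>k. \<forall>y\<in>cg (t + m) r. y - x \<in> pm (t + m) (t + m) (int k) --> y \<in> {g \<in> cg (t + m) r. act g f = f}" by blast
 qed blast
 then show ?thesis using W(1) unfolding smooth_rep_def by blast
qed

end

section \<open>Characters and orbit spaces\<close>

context char_setting
begin

lemma chi_uu: "X \<in> pm t m (int r) ==> chi Y (uu X) = ev X Y" by (simp add: chi_def uu_cg cc_uu)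

lemma chi_VV: assumes "Y \<in> Ys m t" shows "chi Y \<in> VV"
proof -
 obtain N where N: "Y \<in> Yk m t N" using assms unfolding Ys_eq by blast
 show ?thesis
 proof (rule VVI[of _ N])
  show "level N (chi Y)" unfolding level_def
  proof (intro ballI impI)
   fix X X' assume X: "X \<in> pm t m (int r)" "X' \<in> pm t m (int r)" "X - X' \<in> pm t m (int (r + N))"
   have "ev X Y = ev X' Y" using N by (intro ev_cong_left[OF X(3), of Y "- int N"]) (auto simp: Yk_def pm_carrier[OF X(1)] pm_carrier[OF X(2)])
   then show "chi Y (uu X) = chi Y (uu X')" using X by (simp add: chi_uu)
  qed
 qed (simp_all add: chi_def uu_cc)
qed

lemma chi_inj: "inj_on chi (Ys m t)"
proof (rule inj_onI, rule ccontr)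
 fix Y Z assume Y: "Y \<in> Ys m t" and Z: "Z \<in> Ys m t" and eq: "chi Y = chi Z" and ne: "Y \<noteq> Z"
 note c = Ys_carrier[OF Y] Ys_carrier[OF Z]
 have "Y - Z \<notin> pm m t 0" using redm_eq[OF c] Y Z ne by (simp add: Ys_def)
 then obtain X where X: "X \<in> pm t m (int r)" "ev X (Y - Z) \<noteq> 1" using ev_nondeg_right[of "Y - Z"] c by auto
 have "ev X Y = ev X Z" using chi_uu[OF X(1), of Y] chi_uu[OF X(1), of Z] eq by simp
 then show False using X(2) ev_diff_right[OF c, of X] by simp
qed

lemma act_uu_chi: assumes X: "X \<in> pm t m (int r)" shows "act (uu X) (chi Y) = cscale (ev X Y) (chi Y)"
proof
 fix x
 show "act (uu X) (chi Y) x = cscale (ev X Y) (chi Y) x"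
 proof (cases "x \<in> cg (t + m) r")
  case True
  then show ?thesis using cg_mult[OF True uu_cg[OF X]] cc_uu_right[OF True X] ev_add_left[OF cc_carrier[OF True] pm_carrier[OF X], of Y]
   by (simp add: act_def chi_def cscale_def)
 qed (simp add: act_def chi_def cscale_def)
qed

text \<open>A block-diagonal element moves the character through the pairing. Its upper left block
  acts on coordinates by its inverse, hence the inverse \<open>B\<close> of \<open>A\<close> in the
  element used.\<close>

lemma orb_translate: assumes Y: "Y \<in> Ys m t" and Y': "Y' \<in> orb Y"
 obtains g where "g \<in> cg (t + m) r" "act g (chi Y) = chi Y'"
proof -
 obtain D A where DA: "Y' = redm (D * Y * A)" "D \<in> cg m r" "A \<in> cg t r" using orbE[OF Y'] .
 obtain B where B: "B \<in> cg t r" "A * B = 1\<^sub>m t" "B * A = 1\<^sub>m t" using cg_inverse[OF DA(3) r1] .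
 have g: "lv B D \<in> cg (t + m) r" using lv_cg[OF B(1) DA(2)] .
 have "act (lv B D) (chi Y) x = chi Y' x" for x
 proof (cases "x \<in> cg (t + m) r")
  case True
  have "ev (cc (x * lv B D)) Y = ev (A * cc x * D) Y" using cc_lv[OF True B(1) DA(3) B(3) DA(2)] by simp
  also have "... = ev (cc x) (D * Y * A)" using ev_move[OF cg_carrier[OF DA(3)] cc_carrier[OF True] cg_carrier[OF DA(2)] Ys_carrier[OF Y]] .
  also have "... = ev (cc x) Y'"
   unfolding DA(1) using cg_carrier[OF DA(3)] cg_carrier[OF DA(2)] Ys_carrier[OF Y] by (intro ev_redm[symmetric] cc(1) True) auto
  finally show ?thesis using True cg_mult[OF True g] by (simp add: act_def chi_def)
 qed (simp add: act_def chi_def)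
 then have "act (lv B D) (chi Y) = chi Y'" by (rule ext)
 then show thesis using that g by blast
qed

definition qN :: "nat \<Rightarrow> complex" where "qN N = of_nat (q ^ (N * (t * m)))"

lemma qN_nz [simp]: "qN N \<noteq> 0" using q_gt_1 by (simp add: qN_def)

lemma ev_sum_orthogonal:
 assumes Y: "Y \<in> Yk m t N" and Z: "Z \<in> Yk m t N"
 shows "(\<Sum>X\<in>Xr N. ev X Y * ev (- X) Z) = (if Y = Z then qN N else 0)"
proof -
 note c = Yk_carrier[OF Y] Yk_carrier[OF Z]
 have "(\<Sum>X\<in>Xr N. ev X Y * ev (- X) Z) = (\<Sum>X\<in>Xr N. ev X (Y - Z))"
  using c by (intro sum.cong refl) (simp add: ev_diff_right ev_minus_left[OF Xr_carrier])
 also have "... = (if Y - Z \<in> pm m t 0 then qN N else 0)" unfolding qN_def using Y Z by (intro ev_sum_X pm_diff) (auto simp: Yk_def)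
 also have "Y - Z \<in> pm m t 0 \<longleftrightarrow> Y = Z" using redm_eq[OF c] Y Z by (simp add: Yk_def)
 finally show ?thesis .
qed

lemma coefficient:
 assumes F: "F \<subseteq> Yk m t N" and Z: "Z \<in> Yk m t N"
 shows "(\<Sum>X\<in>Xr N. (\<Sum>Y\<in>F. a Y * ev X Y) * ev (- X) Z) = (if Z \<in> F then qN N * a Z else 0)"
proof -
 have fin: "finite F" using F Yk_finite finite_subset by blast
 have "(\<Sum>X\<in>Xr N. (\<Sum>Y\<in>F. a Y * ev X Y) * ev (- X) Z) = (\<Sum>X\<in>Xr N. \<Sum>Y\<in>F. a Y * (ev X Y * ev (- X) Z))"
  by (simp add: sum_distrib_right mult.assoc)
 also have "... = (\<Sum>Y\<in>F. a Y * (\<Sum>X\<in>Xr N. ev X Y * ev (- X) Z))" by (subst sum.swap) (simp add: sum_distrib_left)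
 also have "... = (\<Sum>Y\<in>F. if Y = Z then qN N * a Z else 0)" using F by (intro sum.cong refl) (auto simp: ev_sum_orthogonal[OF _ Z])
 also have "... = (if Z \<in> F then qN N * a Z else 0)" using fin by simp
 finally show ?thesis .
qed

text \<open>Fourier inversion on the finite group represented by \<open>Xr N\<close>: a function of
  level \<open>N\<close> is a function on that group, and its dual is
  \<open>Yk m t N\<close>.\<close>

lemma expansion:
 assumes f: "f \<in> VV" and N: "level N f"
 obtains a where "f = (\<Sum>Y\<in>Yk m t N. cscale (a Y) (chi Y))"
proof -
 define a where "a Y = (\<Sum>X\<in>Xr N. f (uu X) * ev (- X) Y) / qN N" for Y
 have "f = (\<Sum>Y\<in>Yk m t N. cscale (a Y) (chi Y))"
 proof (rule VV_eqI[OF f])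
  show "(\<Sum>Y\<in>Yk m t N. cscale (a Y) (chi Y)) \<in> VV"
   using chi_VV Yk_Ys by (intro cfun.subspace_sum[OF VV_subspace] cfun.subspace_scale[OF VV_subspace]) blast
  fix X assume X: "X \<in> pm t m (int r)"
  note cX = pm_carrier[OF X]
  have "(\<Sum>Y\<in>Yk m t N. cscale (a Y) (chi Y)) (uu X) = (\<Sum>Y\<in>Yk m t N. a Y * ev X Y)"
   by (simp add: sum_fun_apply cscale_def chi_uu[OF X])
  also have "... = (\<Sum>Y\<in>Yk m t N. \<Sum>X'\<in>Xr N. f (uu X') / qN N * ev (X - X') Y)" unfolding a_def
   by (intro sum.cong refl) (simp add: sum_divide_distrib sum_distrib_right sum_distrib_left ev_diff_left[OF cX Xr_carrier] mult_ac)
  also have "... = (\<Sum>X'\<in>Xr N. f (uu X') / qN N * (\<Sum>Y\<in>Yk m t N. ev (X - X') Y))" by (subst sum.swap) (simp add: sum_distrib_left)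
  also have "... = (\<Sum>X'\<in>Xr N. if X' = rd N X then f (uu X') else 0)"
  proof (intro sum.cong refl)
   fix X' assume X': "X' \<in> Xr N"
   have "X - X' \<in> pm t m (int (r + N)) \<longleftrightarrow> rd N X = rd N X'" using rd_eq[OF cX Xr_carrier[OF X']] by blast
   also have "... \<longleftrightarrow> X' = rd N X" using Xr_rd[OF X'] by auto
   finally show "f (uu X') / qN N * (\<Sum>Y\<in>Yk m t N. ev (X - X') Y) = (if X' = rd N X then f (uu X') else 0)"
    using ev_sum_Y[OF pm_diff[OF X Xr_pm[OF X']], of N] qN_nz[of N] by (simp add: qN_def)
  qed
  also have "... = f (uu (rd N X))" using Xr_card(1) rd_Xr[OF X] by simp
  also have "... = f (uu X)" using N rd_pm[OF X] X rd_diff[OF cX] unfolding level_def by blast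
  finally show "f (uu X) = (\<Sum>Y\<in>Yk m t N. cscale (a Y) (chi Y)) (uu X)" by simp
 qed
 then show thesis by (rule that)
qed

definition WW :: "'k mat set \<Rightarrow> ('k mat \<Rightarrow> complex) set" where "WW Q = cfun.span (chi ` Q)"

lemma WW_elem: assumes "Q \<subseteq> Yk m t N" "f \<in> WW Q" obtains a where "f = (\<Sum>Y\<in>Q. cscale (a Y) (chi Y))"
proof -
 have fin: "finite Q" using assms(1) Yk_finite finite_subset by blast
 have inj: "inj_on chi Q" using inj_on_subset[OF chi_inj] assms(1) Yk_Ys by blast
 obtain u where "f = (\<Sum>v\<in>chi ` Q. cscale (u v) v)" using assms(2) unfolding WW_def cfun.span_finite[OF finite_imageI[OF fin]] by blast
 then have "f = (\<Sum>Y\<in>Q. cscale (u (chi Y)) (chi Y))" using inj by (simp add: sum.reindex)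
 then show thesis by (rule that)
qed

lemma WW_sum: "(\<Sum>Y\<in>Q. cscale (a Y) (chi Y)) \<in> WW Q" unfolding WW_def by (intro cfun.span_sum cfun.span_scale cfun.span_base) auto

lemma WW_subspace: "cfun.subspace (WW Q)" by (simp add: WW_def cfun.subspace_span)

lemma WW_VV: "Q \<subseteq> Ys m t ==> WW Q \<subseteq> VV" unfolding WW_def using chi_VV VV_subspace by (intro cfun.span_minimal) auto

lemma sum_chi_uu: "X \<in> pm t m (int r) ==> (\<Sum>Y\<in>F. cscale (a Y) (chi Y)) (uu X) = (\<Sum>Y\<in>F. a Y * ev X Y)"
 by (simp add: sum_fun_apply cscale_def chi_uu)

lemma WW_dim: assumes "Q \<subseteq> Yk m t N" shows "cfun.dim (WW Q) = card Q"
proof -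
 have fin: "finite Q" using assms(1) Yk_finite finite_subset by blast
 have inj: "inj_on chi Q" using inj_on_subset[OF chi_inj] assms(1) Yk_Ys by blast
 have "cfun.independent (chi ` Q)"
 proof (rule cfun.independent_if_scalars_zero)
  fix u v assume eq: "(\<Sum>v\<in>chi ` Q. cscale (u v) v) = 0" and "v \<in> chi ` Q"
  then obtain Z where Z: "Z \<in> Q" "v = chi Z" by blast
  have "(\<Sum>Y\<in>Q. cscale (u (chi Y)) (chi Y)) = 0" using eq inj by (simp add: sum.reindex)
  then have "(\<Sum>Y\<in>Q. u (chi Y) * ev X Y) = 0" if "X \<in> Xr N" for X
   using sum_chi_uu[OF Xr_pm[OF that], of "\<lambda>Y. u (chi Y)" Q] by simp
  then have "(\<Sum>X\<in>Xr N. (\<Sum>Y\<in>Q. u (chi Y) * ev X Y) * ev (- X) Z) = 0" by simp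
  then show "u v = 0" using coefficient[OF assms, of Z "\<lambda>Y. u (chi Y)"] Z assms by auto
 qed (simp add: fin)
 then have "cfun.dim (WW Q) = card (chi ` Q)" unfolding WW_def by (rule cfun.dim_span_eq_card_independent)
 then show ?thesis using card_image[OF inj] by simp
qed

text \<open>Averaging against the inverse character over the translations \<open>uu X\<close> projects onto the line of \<open>chi Z\<close>.\<close>

lemma chi_mem_stable:
 assumes U: "cfun.subspace U" "\<And>X u. X \<in> pm t m (int r) ==> u \<in> U ==> act (uu X) u \<in> U"
  and f: "f \<in> U" "f = (\<Sum>Y\<in>F. cscale (a Y) (chi Y))" and F: "F \<subseteq> Yk m t N" and Z: "Z \<in> F" "a Z \<noteq> 0"
 shows "chi Z \<in> U"
proof -
 define g where "g = (\<Sum>X\<in>Xr N. cscale (ev (- X) Z) (act (uu X) f))"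
 have g: "g \<in> U" unfolding g_def using U f(1) Xr_pm by (intro cfun.subspace_sum cfun.subspace_scale) auto
 have Zk: "Z \<in> Yk m t N" using F Z by blast
 have "g x = cscale (qN N * a Z) (chi Z) x" for x
 proof -
  have act: "act (uu X) f x = (\<Sum>Y\<in>F. (a Y * chi Y x) * ev X Y)" if "X \<in> Xr N" for X
   unfolding f(2) act_sum act_scale act_uu_chi[OF Xr_pm[OF that]] by (simp add: sum_fun_apply cscale_def mult_ac)
  have "g x = (\<Sum>X\<in>Xr N. act (uu X) f x * ev (- X) Z)" by (simp add: g_def sum_fun_apply cscale_def mult.commute)
  also have "... = (\<Sum>X\<in>Xr N. (\<Sum>Y\<in>F. (a Y * chi Y x) * ev X Y) * ev (- X) Z)" using act by (intro sum.cong refl) simp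
  also have "... = qN N * (a Z * chi Z x)" using coefficient[OF F Zk, of "\<lambda>Y. a Y * chi Y x"] Z(1) by simp
  finally show ?thesis by (simp add: cscale_def)
 qed
 then have "g = cscale (qN N * a Z) (chi Z)" by (rule ext)
 then have "chi Z = cscale (1 / (qN N * a Z)) g" using Z(2) qN_nz[of N] by (simp add: cscale_def)
 then show ?thesis using cfun.subspace_scale[OF U(1) g] by simp
qed

text \<open>The group preserves congruence of coordinates modulo level \<open>r + N\<close>, so it
  permutes the classes; \<open>rd\<close> returns to representatives.\<close>

lemma level_bij:
 assumes g: "g \<in> cg (t + m) r"
 shows "bij_betw (\<lambda>X. rd N (cc (uu X * g))) (Xr N) (Xr N)"
proof -
 have ug: "uu X * g \<in> cg (t + m) r" if "X \<in> Xr N" for X using cg_mult[OF uu_cg[OF Xr_pm[OF that]] g] .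
 have "inj_on (\<lambda>X. rd N (cc (uu X * g))) (Xr N)"
 proof (rule inj_onI)
  fix X X' assume X: "X \<in> Xr N" "X' \<in> Xr N" and eq: "rd N (cc (uu X * g)) = rd N (cc (uu X' * g))"
  have "cc (uu X * g) - cc (uu X' * g) \<in> pm t m (int (r + N))" using eq rd_eq[OF cc_carrier[OF ug[OF X(1)]] cc_carrier[OF ug[OF X(2)]]] by blast
  then have "cc (uu X) - cc (uu X') \<in> pm t m (int (r + N))" using cc_pair(1)[OF uu_cg[OF Xr_pm[OF X(1)]] uu_cg[OF Xr_pm[OF X(2)]] g] by blast
  then have "X - X' \<in> pm t m (int (r + N))" unfolding cc_uu[OF Xr_pm[OF X(1)]] cc_uu[OF Xr_pm[OF X(2)]] .
  then show "X = X'" using rd_eq[OF Xr_carrier[OF X(1)] Xr_carrier[OF X(2)]] Xr_rd[OF X(1)] Xr_rd[OF X(2)] by metis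
 qed
 moreover have "(\<lambda>X. rd N (cc (uu X * g))) ` Xr N \<subseteq> Xr N" using rd_Xr cc(1) ug by blast
 ultimately show ?thesis using Xr_card(1) endo_inj_surj by (metis bij_betw_def)
qed

text \<open>The factors move across the pairing to \<open>Y\<close>, where they merely permute the
  orbit.\<close>

lemma kernel_invariant:
 assumes Y0: "Y0 \<in> Ys m t" and A: "A \<in> cg t r" and D: "D \<in> cg m r" and X: "X \<in> pm t m (int r)"
 shows "(\<Sum>Y\<in>orb Y0. ev (A * X * D) Y) = (\<Sum>Y\<in>orb Y0. ev X Y)"
proof -
 have "(\<Sum>Y\<in>orb Y0. ev (A * X * D) Y) = (\<Sum>Y\<in>orb Y0. ev X (redm (D * Y * A)))"
 proof (intro sum.cong refl)
  fix Y assume "Y \<in> orb Y0"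
  then have Y: "Y \<in> carrier_mat m t" using orb_carrier[OF Ys_carrier[OF Y0]] by blast
  have DYA: "D * Y * A \<in> carrier_mat m t" using Y cg_carrier[OF A] cg_carrier[OF D] by auto
  show "ev (A * X * D) Y = ev X (redm (D * Y * A))" using ev_move[OF cg_carrier[OF A] pm_carrier[OF X] cg_carrier[OF D] Y] ev_redm[OF X DYA] by simp
 qed
 also have "... = (\<Sum>Y\<in>orb Y0. ev X Y)" by (rule sum.reindex_bij_betw[OF orb_bij[OF Y0 D A]])
 finally show ?thesis .
qed

text \<open>The translates of the orbit kernel \<open>k X = \<Sum>Y\<in>orb Y0. ev X Y\<close> span the same space as the characters of the
 orbit, and the kernel is invariant under \<open>X \<mapsto> A * X * D\<close>, through which the group acts on differences.\<close>

lemma orbit_space_stable: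
 assumes Y0: "Y0 \<in> Ys m t" and Y: "Y \<in> orb Y0" and g: "g \<in> cg (t + m) r"
 shows "act g (chi Y) \<in> WW (orb Y0)"
proof -
 obtain N where N: "Y0 \<in> Yk m t N" using Y0 unfolding Ys_eq by blast
 have Q: "orb Y0 \<subseteq> Yk m t N" using orb_Yk[OF N] .
 have Yk: "Y \<in> Yk m t N" using Y Q by blast
 define k where "k X = (\<Sum>Y'\<in>orb Y0. ev X Y')" for X
 define h where "h X = rd N (cc (uu X * g))" for X
 define b where "b Y' = (\<Sum>X\<in>Xr N. ev (- X) Y' * ev (h X) Y) / qN N" for Y'
 have fin: "finite (orb Y0)" using orb_finite[OF Y0] .
 \<comment> \<open>Convolution with the orbit kernel multiplies each character of the orbit by
   \<open>qN N\<close>, so it reproduces \<open>chi Y\<close> up to that scalar.\<close>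
 have conv: "(\<Sum>X\<in>Xr N. k (X0 - X) * ev X Y) = qN N * ev X0 Y" if X0: "X0 \<in> carrier_mat t m" for X0
 proof -
  have "(\<Sum>X\<in>Xr N. k (X0 - X) * ev X Y) = (\<Sum>X\<in>Xr N. \<Sum>Y'\<in>orb Y0. ev X0 Y' * (ev X Y * ev (- X) Y'))"
   unfolding k_def by (intro sum.cong refl) (simp add: sum_distrib_right sum_distrib_left ev_diff_left[OF X0 Xr_carrier] mult_ac)
  also have "... = (\<Sum>Y'\<in>orb Y0. ev X0 Y' * (\<Sum>X\<in>Xr N. ev X Y * ev (- X) Y'))" by (subst sum.swap) (simp add: sum_distrib_left)
  also have "... = (\<Sum>Y'\<in>orb Y0. if Y = Y' then ev X0 Y' * qN N else 0)"
   using Q by (intro sum.cong refl) (auto simp: ev_sum_orthogonal[OF Yk])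
  also have "... = qN N * ev X0 Y" using fin Y by (simp add: mult.commute)
  finally show ?thesis .
 qed
 have "act g (chi Y) x = (\<Sum>Y'\<in>orb Y0. cscale (b Y') (chi Y')) x" for x
 proof (cases "x \<in> cg (t + m) r")
  case True
  have xg: "x * g \<in> cg (t + m) r" using cg_mult[OF True g] .
  \<comment> \<open>The substitution \<open>h\<close> follows translation by \<open>g\<close>. Up to
    an error that characters of level \<open>N\<close> do not see, it changes the difference of
    coordinates by block factors, and the kernel ignores those.\<close>
  have kh: "k (cc (x * g) - h X) = k (cc x - X)" if X: "X \<in> Xr N" for X
  proof -
   note u = uu_cg[OF Xr_pm[OF X]]
   have ug: "uu X * g \<in> cg (t + m) r" using cg_mult[OF u g] .
   define C where "C = cc (uu X * g)"
   have C: "C \<in> carrier_mat t m" using cc_carrier[OF ug] by (simp add: C_def)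
   have hX: "h X \<in> carrier_mat t m" "h X - C \<in> pm t m (int (r + N))" using C rd_diff[OF C] by (simp_all add: h_def C_def)
   have "cc (x * g) - C - (cc (x * g) - h X) = h X - C" using C hX(1) cc_carrier[OF xg] by (intro eq_matI) auto
   then have d: "cc (x * g) - C - (cc (x * g) - h X) \<in> pm t m (int (r + N))" using hX(2) by simp
   have "ev (cc (x * g) - C) Y' = ev (cc (x * g) - h X) Y'" if "Y' \<in> orb Y0" for Y'
    using Q that C hX(1) cc_carrier[OF xg] by (intro ev_cong_left[OF d, of _ "- int N"]) (auto simp: Yk_def)
   then have "k (cc (x * g) - h X) = k (cc (x * g) - C)" unfolding k_def by simp
   also have "... = k (cc x - X)"
   proof -
    obtain A D where AD: "A \<in> cg t r" "D \<in> cg m r" "cc (x * g) - cc (uu X * g) = A * (cc x - cc (uu X)) * D"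
     using cc_difference[OF True u g] .
    have "cc x - X \<in> pm t m (int r)" using cc(1)[OF True] Xr_pm[OF X] by (rule pm_diff)
    then show ?thesis using kernel_invariant[OF Y0 AD(1,2)] unfolding k_def C_def AD(3) cc_uu[OF Xr_pm[OF X]] by blast
   qed
   finally show ?thesis .
  qed
  have "qN N * ev (cc (x * g)) Y = (\<Sum>X\<in>Xr N. k (cc (x * g) - X) * ev X Y)" using conv[OF cc_carrier[OF xg]] by simp
  also have "... = (\<Sum>X\<in>Xr N. k (cc (x * g) - h X) * ev (h X) Y)"
   unfolding h_def by (rule sum.reindex_bij_betw[OF level_bij[OF g], symmetric])
  also have "... = (\<Sum>X\<in>Xr N. k (cc x - X) * ev (h X) Y)" using kh by (intro sum.cong refl) simp
  also have "... = (\<Sum>X\<in>Xr N. \<Sum>Y'\<in>orb Y0. ev (cc x) Y' * (ev (- X) Y' * ev (h X) Y))"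
   unfolding k_def by (intro sum.cong refl) (simp add: sum_distrib_right sum_distrib_left ev_diff_left[OF cc_carrier[OF True] Xr_carrier] mult_ac)
  also have "... = (\<Sum>Y'\<in>orb Y0. ev (cc x) Y' * (\<Sum>X\<in>Xr N. ev (- X) Y' * ev (h X) Y))"
   by (subst sum.swap) (simp add: sum_distrib_left)
  also have "... = qN N * (\<Sum>Y'\<in>orb Y0. b Y' * ev (cc x) Y')"
   unfolding sum_distrib_left[of "qN N"] b_def by (intro sum.cong refl) (simp add: mult.commute)
  finally have "ev (cc (x * g)) Y = (\<Sum>Y'\<in>orb Y0. b Y' * ev (cc x) Y')" by simp
  then show ?thesis using True xg by (simp add: sum_fun_apply cscale_def act_def chi_def)
 qed (simp add: sum_fun_apply cscale_def act_def chi_def)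
 then have "act g (chi Y) = (\<Sum>Y'\<in>orb Y0. cscale (b Y') (chi Y'))" by (rule ext)
 then show ?thesis using WW_sum by simp
qed

end

section \<open>Homomorphisms and isomorphism classes\<close>

lemma rep_hom_subspace:
 assumes "is_rep G \<rho>" shows "chom.subspace (rep_hom G \<pi> \<rho>)"
proof (rule chom.subspaceI)
 note V = is_repD(1)[OF assms] and lin = is_repD(2)[OF assms]
 show "0 \<in> rep_hom G \<pi> \<rho>" unfolding rep_hom_def mem_Collect_eq
  by (intro conjI ballI linear_betwI) (use cfun.subspace_0[OF V] linear_betw_0[OF lin V] in simp_all)
 fix f g assume f: "f \<in> rep_hom G \<pi> \<rho>" and g: "g \<in> rep_hom G \<pi> \<rho>"
 note fD = rep_homD[OF f] linear_betwD[OF rep_homD(1)[OF f]]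
 note gD = rep_homD[OF g] linear_betwD[OF rep_homD(1)[OF g]]
 show "f + g \<in> rep_hom G \<pi> \<rho>" unfolding rep_hom_def mem_Collect_eq plus_fun_def[of f g] by (intro conjI ballI allI impI linear_betwI)
   (simp_all add: cfun.subspace_add[OF V] fD gD cfun.scale_right_distrib linear_betwD(1)[OF lin, symmetric] add_ac)
next
 fix c f assume f: "f \<in> rep_hom G \<pi> \<rho>"
 note V = is_repD(1)[OF assms] and lin = is_repD(2)[OF assms]
 note fD = rep_homD[OF f] linear_betwD[OF rep_homD(1)[OF f]]
 show "homscale c f \<in> rep_hom G \<pi> \<rho>" unfolding rep_hom_def mem_Collect_eq homscale_def by (intro conjI ballI allI impI linear_betwI)
   (simp_all add: cfun.subspace_scale[OF V] fD cfun.scale_right_distrib linear_betwD(2)[OF lin, symmetric] mult.commute)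
qed

lemma linear_betw_image:
 assumes f: "linear_betw V W f" and V: "cfun.subspace V" shows "cfun.subspace (f ` V)"
proof (rule cfun.subspaceI)
 show "0 \<in> f ` V" using linear_betw_0[OF f V] cfun.subspace_0[OF V] by (intro image_eqI[of _ _ 0]) simp_all
next
 fix x y assume "x \<in> f ` V" "y \<in> f ` V"
 then obtain u v where "u \<in> V" "v \<in> V" "x = f u" "y = f v" by blast
 then show "x + y \<in> f ` V" using linear_betwD(1)[OF f, of u v] cfun.subspace_add[OF V, of u v] by (intro image_eqI[of _ _ "u + v"]) simp_all
next
 fix c x assume "x \<in> f ` V"
 then obtain u where "u \<in> V" "x = f u" by blast
 then show "cscale c x \<in> f ` V"
  using linear_betwD(2)[OF f, of u c] cfun.subspace_scale[OF V, of u c] by (intro image_eqI[of _ _ "cscale c u"]) simp_all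
qed

lemma hom_kernel:
 assumes \<pi>: "irreducible_rep G \<pi>" and \<rho>: "is_rep G \<rho>" and f: "f \<in> rep_hom G \<pi> \<rho>"
  and v: "v \<in> fst \<pi>" "v \<noteq> 0" "f v = 0"
 shows "f = 0"
proof -
 have r: "is_rep G \<pi>" using \<pi> unfolding irreducible_rep_def by blast
 note V = is_repD(1)[OF r] and fD = rep_homD[OF f] linear_betwD[OF rep_homD(1)[OF f]]
 let ?K = "{u \<in> fst \<pi>. f u = 0}"
 have "?K = {0} \<or> ?K = fst \<pi>"
 proof (rule irreducibleD[OF \<pi>])
  show "cfun.subspace ?K" by (rule cfun.subspaceI)
    (use V linear_betw_0[OF fD(1) V] in \<open>simp_all add: cfun.subspace_0 cfun.subspace_add cfun.subspace_scale fD\<close>)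
  fix g assume g: "g \<in> carrier G"
  show "snd \<pi> g ` ?K \<subseteq> ?K"
   using linear_betwD(3)[OF is_repD(2)[OF r g]] linear_betw_0[OF is_repD(2)[OF \<rho> g] is_repD(1)[OF \<rho>]] fD(2)[OF g] by auto
 qed blast
 moreover have "v \<in> ?K" using v by simp
 ultimately have "?K = fst \<pi>" using v(2) by blast
 then have "f u = 0" for u using fD(3)[of u] by blast
 then show ?thesis by (simp add: fun_eq_iff)
qed

lemma hom_inj:
 assumes \<pi>: "irreducible_rep G \<pi>" and \<rho>: "is_rep G \<rho>" and f: "f \<in> rep_hom G \<pi> \<rho>" and nz: "f \<noteq> 0"
 shows "inj_on f (fst \<pi>)"
proof (rule inj_onI, rule ccontr)
 have r: "is_rep G \<pi>" using \<pi> unfolding irreducible_rep_def by blast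
 note V = is_repD(1)[OF r] and fD = rep_homD[OF f] linear_betwD[OF rep_homD(1)[OF f]]
 fix u v assume uv: "u \<in> fst \<pi>" "v \<in> fst \<pi>" "f u = f v" "u \<noteq> v"
 have v': "cscale (- 1) v \<in> fst \<pi>" using cfun.subspace_scale[OF V uv(2)] .
 have "f (u + cscale (- 1) v) = f u + cscale (- 1) (f v)" unfolding fD(5)[OF uv(1) v'] fD(6)[OF uv(2)] ..
 also have "... = 0" unfolding uv(3) cfun.scale_minus_left cfun.scale_one by simp
 finally have "f (u + cscale (- 1) v) = 0" .
 moreover have "u + cscale (- 1) v \<noteq> 0" using uv(4) unfolding cfun.scale_minus_left cfun.scale_one by simp
 ultimately show False using hom_kernel[OF \<pi> \<rho> f cfun.subspace_add[OF V uv(1) v']] nz by blast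
qed

lemma iso_equiv:
 "equiv (smooth_irreps G T) {(\<pi>, \<pi>'). \<pi> \<in> smooth_irreps G T \<and> \<pi>' \<in> smooth_irreps G T \<and> rep_iso G \<pi> \<pi>'}"
proof -
 have r: "is_rep G \<pi>" if "\<pi> \<in> smooth_irreps G T" for \<pi> using that by (simp add: smooth_irreps_def irreducible_rep_def)
 show ?thesis by (rule equivI)
   (auto simp: refl_on_def sym_def trans_def intro: rep_iso_refl rep_iso_sym rep_iso_trans r)
qed

lemma rep_of_class:
 assumes "C \<in> irr_classes G T"
 shows "rep_of C \<in> smooth_irreps G T" "\<pi> \<in> C ==> rep_iso G (rep_of C) \<pi>"
  "C = {(\<pi>, \<pi>'). \<pi> \<in> smooth_irreps G T \<and> \<pi>' \<in> smooth_irreps G T \<and> rep_iso G \<pi> \<pi>'} `` {rep_of C}"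
proof -
 let ?R = "{(\<pi>, \<pi>'). \<pi> \<in> smooth_irreps G T \<and> \<pi>' \<in> smooth_irreps G T \<and> rep_iso G \<pi> \<pi>'}"
 have C: "C \<in> smooth_irreps G T // ?R" using assms by (simp add: irr_classes_def)
 have "\<exists>\<pi>. \<pi> \<in> C" using in_quotient_imp_non_empty[OF iso_equiv C] by blast
 then have *: "rep_of C \<in> C" unfolding rep_of_def by (rule someI_ex)
 show 1: "rep_of C \<in> smooth_irreps G T" using in_quotient_imp_subset[OF iso_equiv C] * by blast
 show "\<pi> \<in> C ==> rep_iso G (rep_of C) \<pi>" using quotient_eq_iff[OF iso_equiv C C * , of \<pi>] by simp
 obtain \<pi>' where p: "C = ?R `` {\<pi>'}" using C by (rule quotientE)
 then have "(\<pi>', rep_of C) \<in> ?R" using * by blast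
 then show "C = ?R `` {rep_of C}" unfolding p by (rule equiv_class_eq[OF iso_equiv])
qed

section \<open>Orbits as the constituents of the induced representation\<close>

context char_setting
begin

abbreviation (input) rho where "rho \<equiv> (VV, act)"

definition Orb :: "'k mat set set" where "Orb = orb ` Ys m t"

lemma OrbE: assumes "Q \<in> Orb"
 obtains Y0 N where "Y0 \<in> Ys m t" "Q = orb Y0" "Q \<subseteq> Yk m t N"
proof -
 obtain Y0 where Y0: "Y0 \<in> Ys m t" "Q = orb Y0" using assms unfolding Orb_def by blast
 obtain N where "Y0 \<in> Yk m t N" using Y0(1) unfolding Ys_eq by blast
 then show thesis using that Y0 orb_Yk by blast
qed

lemma Orb_eq: assumes "Q \<in> Orb" "Y \<in> Q" shows "Q = orb Y" "Y \<in> Ys m t"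
proof -
 obtain Y0 N where Y0: "Y0 \<in> Ys m t" "Q = orb Y0" "Q \<subseteq> Yk m t N" using OrbE[OF assms(1)] .
 show "Q = orb Y" using orb_eq[OF Y0(1)] assms(2) Y0(2) by blast
 show "Y \<in> Ys m t" using Y0(3) assms(2) Yk_Ys by blast
qed

lemma Orb_nonempty: assumes "Q \<in> Orb" obtains Y where "Y \<in> Q" "Y \<in> Ys m t" using OrbE[OF assms] orb_self Orb_eq(2)[OF assms] by metis

lemma chi_nz: "chi Y \<noteq> 0"
proof
 assume "chi Y = 0"
 then have "chi Y (uu (0\<^sub>m t m)) = 0" by simp
 then show False using chi_uu[of "0\<^sub>m t m" Y] by simp
qed

lemma chi_WW: "Y \<in> Q ==> chi Y \<in> WW Q" unfolding WW_def by (intro cfun.span_base) blast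

text \<open>Orthogonality at a level containing both \<open>Q\<close> and \<open>Y\<close>: for
  \<open>Y\<close> outside \<open>Q\<close> the coefficient of the character with itself would be
  0.\<close>

lemma chi_in_WW: assumes Q: "Q \<in> Orb" and Y: "Y \<in> Ys m t" "chi Y \<in> WW Q" shows "Y \<in> Q"
proof (rule ccontr)
 assume no: "Y \<notin> Q"
 obtain Y0 N where N: "Q \<subseteq> Yk m t N" using OrbE[OF Q] by metis
 obtain N' where N': "Y \<in> Yk m t N'" using Y(1) unfolding Ys_eq by blast
 let ?N = "max N N'"
 have 1: "Q \<subseteq> Yk m t ?N" "Y \<in> Yk m t ?N" using N N' Yk_mono[of N ?N m t] Yk_mono[of N' ?N m t] by auto
 obtain a where a: "chi Y = (\<Sum>Z\<in>Q. cscale (a Z) (chi Z))" using WW_elem[OF 1(1) Y(2)] .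
 have "ev X Y = (\<Sum>Z\<in>Q. a Z * ev X Z)" if "X \<in> Xr ?N" for X
  using sum_chi_uu[OF Xr_pm[OF that], of a Q] chi_uu[OF Xr_pm[OF that], of Y] a by simp
 then have "(\<Sum>X\<in>Xr ?N. ev X Y * ev (- X) Y) = (\<Sum>X\<in>Xr ?N. (\<Sum>Z\<in>Q. a Z * ev X Z) * ev (- X) Y)" by simp
 then show False using coefficient[OF 1, of a] ev_sum_orthogonal[OF 1(2,2)] no by simp
qed

lemma WW_stable: assumes Q: "Q \<in> Orb" and g: "g \<in> cg (t + m) r" and f: "f \<in> WW Q" shows "act g f \<in> WW Q"
proof -
 obtain Y0 N where Y0: "Y0 \<in> Ys m t" "Q = orb Y0" "Q \<subseteq> Yk m t N" using OrbE[OF Q] .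
 obtain a where a: "f = (\<Sum>Z\<in>Q. cscale (a Z) (chi Z))" using WW_elem[OF Y0(3) f] .
 show ?thesis unfolding a act_sum act_scale using orbit_space_stable[OF Y0(1) _ g] Y0(2)
  by (intro cfun.subspace_sum[OF WW_subspace] cfun.subspace_scale[OF WW_subspace]) auto
qed

lemma Orb_Ys: "Q \<in> Orb ==> Q \<subseteq> Ys m t" using Orb_eq(2) by blast

lemma Orb_finite: assumes "Q \<in> Orb" shows "finite Q" using OrbE[OF assms] orb_finite by metis

lemma tau_smooth: assumes Q: "Q \<in> Orb" shows "smooth_rep GG TT (WW Q, act)"
proof (rule smooth_sub)
 show sub: "WW Q \<subseteq> VV" using WW_VV[OF Orb_Ys[OF Q]] .
 then show "is_rep GG (WW Q, act)" unfolding is_rep_def prod.case linear_betw_def Gr_carrier[OF r1] Gr_mult Gr_one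
  using WW_subspace WW_stable[OF Q] act_one act_mult act_add act_scale by blast
qed

text \<open>A nonzero function has a nonzero Fourier coefficient; averaging over translations
  isolates that character inside \<open>U\<close>, and block-diagonal elements produce the rest of
  its orbit.\<close>

lemma stable_contains_orbit:
 assumes U: "cfun.subspace U" "U \<subseteq> VV" "U \<noteq> {0}" and st: "\<And>g u. g \<in> cg (t + m) r ==> u \<in> U ==> act g u \<in> U"
 obtains Q where "Q \<in> Orb" "WW Q \<subseteq> U"
proof -
 obtain f where f: "f \<in> U" "f \<noteq> 0" using U(3) cfun.subspace_0[OF U(1)] by blast
 have fV: "f \<in> VV" using f(1) U(2) by blast
 obtain N where N: "level N f" using VV_level[OF fV] .
 obtain a where a: "f = (\<Sum>Y\<in>Yk m t N. cscale (a Y) (chi Y))" using expansion[OF fV N] .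
 obtain Z where Z: "Z \<in> Yk m t N" "a Z \<noteq> 0"
 proof (rule ccontr)
  assume no: "\<not> thesis"
  then have "a Z = 0" if "Z \<in> Yk m t N" for Z using that \<open>\<And>Z. Z \<in> Yk m t N ==> a Z \<noteq> 0 ==> thesis\<close> by blast
  then have "f = 0" unfolding a by simp
  then show False using f(2) by blast
 qed
 have Zc: "chi Z \<in> U" by (rule chi_mem_stable[OF U(1) _ f(1) a _ Z]) (use st uu_cg in auto)
 have ZY: "Z \<in> Ys m t" using Z(1) Yk_Ys by blast
 have "chi Y \<in> U" if "Y \<in> orb Z" for Y using orb_translate[OF ZY that] st Zc by metis
 then have "WW (orb Z) \<subseteq> U" unfolding WW_def using U(1) by (intro cfun.span_minimal) auto
 then show thesis using that ZY unfolding Orb_def by blast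
qed

text \<open>A nonzero stable subspace contains a full orbit space by
  \<open>stable_contains_orbit\<close>, and orthogonality of characters forces that orbit to be
  \<open>Q\<close>.\<close>

lemma tau_irreducible: assumes Q: "Q \<in> Orb" shows "irreducible_rep GG (WW Q, act)" unfolding irreducible_rep_def prod.case
proof (intro conjI allI impI)
 show "is_rep GG (WW Q, act)" using tau_smooth[OF Q] unfolding smooth_rep_def by blast
 obtain Y where Y: "Y \<in> Q" using Orb_nonempty[OF Q] .
 show "WW Q \<noteq> {0}" using chi_WW[OF Y] chi_nz by auto
 fix U assume U: "cfun.subspace U \<and> U \<subseteq> WW Q \<and> (\<forall>g\<in>carrier GG. act g ` U \<subseteq> U)"
 show "U = {0} \<or> U = WW Q"
 proof (rule disjCI)
  assume ne: "U \<noteq> WW Q"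
  show "U = {0}"
  proof (rule ccontr)
   assume nz: "U \<noteq> {0}"
   have UV: "U \<subseteq> VV" using U WW_VV[OF Orb_Ys[OF Q]] by blast
   obtain Q' where O': "Q' \<in> Orb" "WW Q' \<subseteq> U"
   proof (rule stable_contains_orbit[OF _ UV nz])
    show "act g u \<in> U" if "g \<in> cg (t + m) r" "u \<in> U" for g u using U that unfolding Gr_carrier[OF r1] by blast
   qed (use U in blast)
   obtain Y' where Y': "Y' \<in> Q'" "Y' \<in> Ys m t" using Orb_nonempty[OF O'(1)] .
   have "chi Y' \<in> WW Q" using chi_WW[OF Y'(1)] O'(2) U by blast
   then have "Y' \<in> Q" using chi_in_WW[OF Q Y'(2)] by blast
   then have "Q = Q'" using Orb_eq(1)[OF Q] Orb_eq(1)[OF O'(1) Y'(1)] by blast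
   then show False using O'(2) U ne by blast
  qed
 qed
qed

text \<open>The image contains an orbit space. The preimage of that space is a nonzero stable
  subspace, hence everything, so the image is no larger.\<close>

lemma hom_onto_orbit_space:
 assumes \<pi>: "irreducible_rep GG \<pi>" and f: "f \<in> rep_hom GG \<pi> rho" and nz: "f \<noteq> 0"
 obtains Q where "Q \<in> Orb" "bij_betw f (fst \<pi>) (WW Q)" "f \<in> rep_hom GG \<pi> (WW Q, act)"
proof -
 have r: "is_rep GG \<pi>" using \<pi> unfolding irreducible_rep_def by blast
 note V = is_repD(1)[OF r]
 note fD = rep_homD[OF f, unfolded fst_conv snd_conv] linear_betwD[OF rep_homD(1)[OF f], unfolded fst_conv]
 note stab = linear_betwD(3)[OF is_repD(2)[OF r]]
 have f0: "f 0 = 0" using linear_betw_0[OF fD(1) V] .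
 let ?U = "f ` fst \<pi>"
 have Usub: "cfun.subspace ?U" using fD(1) V by (rule linear_betw_image)
 have UV: "?U \<subseteq> VV" using fD(7) by blast
 have Unz: "?U \<noteq> {0}"
 proof
  assume "?U = {0}"
  then have "f v = 0" for v using fD(3)[of v] by blast
  then show False using nz by (simp add: fun_eq_iff)
 qed
 obtain Q where Q: "Q \<in> Orb" "WW Q \<subseteq> ?U"
 proof (rule stable_contains_orbit[OF Usub UV Unz])
  fix g u assume g: "g \<in> cg (t + m) r" and "u \<in> ?U"
  then obtain v where v: "v \<in> fst \<pi>" "u = f v" by blast
  have g': "g \<in> carrier GG" using g Gr_carrier[OF r1] by blast
  show "act g u \<in> ?U" unfolding v(2) fD(2)[OF g' v(1), symmetric] by (intro imageI stab g' v(1))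
 qed
 let ?P = "{v \<in> fst \<pi>. f v \<in> WW Q}"
 have "?P = {0} \<or> ?P = fst \<pi>"
 proof (rule irreducibleD[OF \<pi>])
  show "cfun.subspace ?P"
  proof (rule cfun.subspaceI)
   show "0 \<in> ?P" using f0 cfun.subspace_0[OF V] cfun.subspace_0[OF WW_subspace] by simp
   show "x + y \<in> ?P" if "x \<in> ?P" "y \<in> ?P" for x y using that fD(5) cfun.subspace_add[OF V] cfun.subspace_add[OF WW_subspace] by simp
   show "cscale c x \<in> ?P" if "x \<in> ?P" for c x using that fD(6) cfun.subspace_scale[OF V] cfun.subspace_scale[OF WW_subspace] by simp
  qed
  fix g assume g: "g \<in> carrier GG"
  have g': "g \<in> cg (t + m) r" using g Gr_carrier[OF r1] by blast
  show "snd \<pi> g ` ?P \<subseteq> ?P" using stab[OF g] fD(2)[OF g] WW_stable[OF Q(1) g'] by auto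
 qed blast
 moreover have "?P \<noteq> {0}"
 proof -
  obtain Y where Y: "Y \<in> Q" using Orb_nonempty[OF Q(1)] .
  have "chi Y \<in> ?U" using Q(2) chi_WW[OF Y] by blast
  then obtain v where v: "chi Y = f v" "v \<in> fst \<pi>" by (rule imageE)
  then have "v \<in> ?P" "v \<noteq> 0" using chi_WW[OF Y] f0 chi_nz[of Y] unfolding v(1) by auto
  then show ?thesis by blast
 qed
 ultimately have P: "?P = fst \<pi>" by blast
 then have U: "?U = WW Q" using Q(2) by blast
 have "bij_betw f (fst \<pi>) (WW Q)" using hom_inj[OF \<pi> rho_rep f nz] U by (simp add: bij_betw_def)
 moreover have "f \<in> rep_hom GG \<pi> (WW Q, act)" unfolding rep_hom_def mem_Collect_eq fst_conv snd_conv
  using fD(2,3,5,6) U by (intro conjI ballI allI impI linear_betwI) auto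
 ultimately show thesis using that Q(1) by blast
qed

text \<open>Schur's lemma with the characters in place of an eigenvalue of an endomorphism: the
  preimage \<open>v\<close> of a character is an eigenvector of all translations, so
  \<open>f2 v\<close> is one with the same eigenvalues and therefore a multiple of that character.
  The corresponding combination of \<open>f1\<close> and \<open>f2\<close> kills \<open>v\<close>,
  hence vanishes.\<close>

lemma hom_one_dimensional:
 assumes \<pi>: "irreducible_rep GG \<pi>" and f1: "f1 \<in> rep_hom GG \<pi> rho" "f1 \<noteq> 0" and f2: "f2 \<in> rep_hom GG \<pi> rho"
 obtains c where "f2 = homscale c f1"
proof -
 have r: "is_rep GG \<pi>" using \<pi> unfolding irreducible_rep_def by blast
 note V = is_repD(1)[OF r]
 note fD = rep_homD[OF f1(1), unfolded fst_conv snd_conv] linear_betwD[OF rep_homD(1)[OF f1(1)], unfolded fst_conv]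
 note gD = rep_homD[OF f2, unfolded fst_conv snd_conv] linear_betwD[OF rep_homD(1)[OF f2], unfolded fst_conv]
 note inj = hom_inj[OF \<pi> rho_rep f1]
 obtain Q where Q: "Q \<in> Orb" "bij_betw f1 (fst \<pi>) (WW Q)" using hom_onto_orbit_space[OF \<pi> f1] by metis
 obtain Y where Y: "Y \<in> Q" "Y \<in> Ys m t" using Orb_nonempty[OF Q(1)] .
 have "chi Y \<in> f1 ` fst \<pi>" using Q(2) chi_WW[OF Y(1)] unfolding bij_betw_def by blast
 then obtain v where v': "chi Y = f1 v" and v1: "v \<in> fst \<pi>" by (rule imageE)
 note v = v1 v'[symmetric]
 have v0: "v \<noteq> 0"
 proof
  assume "v = 0"
  then show False using v' linear_betw_0[OF fD(1) V] chi_nz[of Y] by simp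
 qed
 \<comment> \<open>An eigenfunction of the translations is determined by its value at the identity,
   and \<open>chi Y\<close> has the value 1 there.\<close>
 define c where "c = f2 v (1\<^sub>m (t + m))"
 have f2v: "f2 v = cscale c (chi Y)"
 proof (rule VV_eqI)
  show "f2 v \<in> VV" using gD(7)[OF v(1)] .
  show "cscale c (chi Y) \<in> VV" using cfun.subspace_scale[OF VV_subspace chi_VV[OF Y(2)]] .
  fix X assume X: "X \<in> pm t m (int r)"
  have u: "uu X \<in> carrier GG" using uu_cg[OF X] Gr_carrier[OF r1] by blast
  have s: "snd \<pi> (uu X) v \<in> fst \<pi>" using linear_betwD(3)[OF is_repD(2)[OF r u]] v(1) .
  have "f1 (snd \<pi> (uu X) v) = f1 (cscale (ev X Y) v)" using fD(2)[OF u v(1)] fD(6)[OF v(1)] act_uu_chi[OF X] v(2) by simp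
  then have "snd \<pi> (uu X) v = cscale (ev X Y) v" using inj_onD[OF inj _ s cfun.subspace_scale[OF V v(1)]] by blast
  then have "act (uu X) (f2 v) = cscale (ev X Y) (f2 v)" using gD(2)[OF u v(1)] gD(6)[OF v(1)] by simp
  then have "act (uu X) (f2 v) (1\<^sub>m (t + m)) = ev X Y * c" by (simp add: cscale_def c_def)
  moreover have "act (uu X) (f2 v) (1\<^sub>m (t + m)) = f2 v (uu X)" using cg_carrier[OF uu_cg[OF X]] by (simp add: act_def)
  ultimately show "f2 v (uu X) = cscale c (chi Y) (uu X)" using chi_uu[OF X] by (simp add: cscale_def mult.commute)
 qed
 have sub: "f2 + homscale (- c) f1 \<in> rep_hom GG \<pi> rho"
  using chom.subspace_add[OF rep_hom_subspace[OF rho_rep] f2 chom.subspace_scale[OF rep_hom_subspace[OF rho_rep] f1(1)]] .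
 have "(f2 + homscale (- c) f1) v = 0" unfolding plus_fun_def homscale_def f2v v(2) by (simp add: cscale_def fun_eq_iff)
 then have z: "f2 + homscale (- c) f1 = 0" using hom_kernel[OF \<pi> rho_rep sub v(1) v0] by blast
 have "f2 = homscale c f1" using z unfolding chom.scale_minus_left by (simp only: eq_iff_diff_eq_0[of f2] add_uminus_conv_diff)
 then show thesis by (rule that)
qed

lemma mult_one:
 assumes \<pi>: "irreducible_rep GG \<pi>" and nz: "rep_hom GG \<pi> rho \<noteq> {0}"
 obtains f where "f \<in> rep_hom GG \<pi> rho" "f \<noteq> 0" "rep_hom GG \<pi> rho \<subseteq> chom.span {f}" "rep_mult GG \<pi> rho = 1"
proof -
 obtain f where f: "f \<in> rep_hom GG \<pi> rho" "f \<noteq> 0" using nz chom.subspace_0[OF rep_hom_subspace[OF rho_rep]] by blast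
 have sub: "rep_hom GG \<pi> rho \<subseteq> chom.span {f}"
 proof
  fix g assume g: "g \<in> rep_hom GG \<pi> rho"
  obtain c where "g = homscale c f" using hom_one_dimensional[OF \<pi> f g] .
  then show "g \<in> chom.span {f}" using chom.span_scale[OF chom.span_base] by blast
 qed
 have "chom.dim (rep_hom GG \<pi> rho) = 1" by (rule chom.dim_unique[OF _ sub]) (use f chom.dependent_single[of f] in auto)
 then show thesis using that f sub unfolding rep_mult_def by blast
qed

lemma mult_zero: "rep_hom GG \<pi> rho = {0} ==> rep_mult GG \<pi> rho = 0"
 unfolding rep_mult_def using chom.dim_unique[of "{}" "{0}" 0] by (simp add: chom.independent_empty)

definition cls :: "'k mat set \<Rightarrow> ('k mat, 'k mat) rep set" where
 "cls Q = {(\<pi>, \<pi>'). \<pi> \<in> smooth_irreps GG TT \<and> \<pi>' \<in> smooth_irreps GG TT \<and> rep_iso GG \<pi> \<pi>'} `` {(WW Q, act)}"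

lemma tau_irr: "Q \<in> Orb ==> (WW Q, act) \<in> smooth_irreps GG TT" unfolding smooth_irreps_def using tau_smooth tau_irreducible by blast

lemma hom_weaken: assumes "Q \<in> Orb" "f \<in> rep_hom GG \<pi> (WW Q, act)" shows "f \<in> rep_hom GG \<pi> rho"
proof -
 note fD = rep_homD[OF assms(2), unfolded fst_conv snd_conv] linear_betwD[OF rep_homD(1)[OF assms(2)], unfolded fst_conv]
 show ?thesis unfolding rep_hom_def mem_Collect_eq fst_conv snd_conv
  using fD(2,3,5,6,7) WW_VV[OF Orb_Ys[OF assms(1)]] by (intro conjI ballI allI impI linear_betwI) auto
qed

lemma cls_props:
 assumes Q: "Q \<in> Orb"
 shows "cls Q \<in> irr_classes GG TT" "rep_hom GG (rep_of (cls Q)) rho \<noteq> {0}" "rep_dim (rep_of (cls Q)) = card Q"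
proof -
 show c: "cls Q \<in> irr_classes GG TT" unfolding cls_def irr_classes_def by (rule quotientI) (rule tau_irr[OF Q])
 have "(WW Q, act) \<in> cls Q" unfolding cls_def by (rule equiv_class_self[OF iso_equiv tau_irr[OF Q]])
 then have "rep_iso GG (rep_of (cls Q)) (WW Q, act)" by (rule rep_of_class(2)[OF c])
 then obtain f where f: "f \<in> rep_hom GG (rep_of (cls Q)) (WW Q, act)" "bij_betw f (fst (rep_of (cls Q))) (WW Q)" unfolding rep_iso_def by auto
 have irr: "is_rep GG (rep_of (cls Q))" using rep_of_class(1)[OF c] unfolding smooth_irreps_def irreducible_rep_def by blast
 obtain Y where Y: "Y \<in> Q" using Orb_nonempty[OF Q] .
 have "chi Y \<in> f ` fst (rep_of (cls Q))" using f(2) chi_WW[OF Y] unfolding bij_betw_def by blast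
 then obtain v where "chi Y = f v" by (rule imageE)
 then have "f \<noteq> 0" using chi_nz[of Y] by auto
 then show "rep_hom GG (rep_of (cls Q)) rho \<noteq> {0}" using hom_weaken[OF Q f(1)] by blast
 obtain Y0 N where "Q \<subseteq> Yk m t N" using OrbE[OF Q] by metis
 then show "rep_dim (rep_of (cls Q)) = card Q"
  using dim_bij_betw[OF _ is_repD(1)[OF irr] f(2)] rep_homD(1)[OF f(1)] WW_dim unfolding rep_dim_def by simp
qed

text \<open>By \<open>hom_one_dimensional\<close> an isomorphism between two orbit spaces is a
  multiple of the inclusion, so the two spaces share a character and the orbits coincide.\<close>

lemma cls_inj: "inj_on cls Orb"
proof (rule inj_onI)
 fix Q Q' assume Q: "Q \<in> Orb" and O': "Q' \<in> Orb" and eq: "cls Q = cls Q'"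
 have "(WW Q', act) \<in> cls Q" unfolding eq unfolding cls_def by (rule equiv_class_self[OF iso_equiv tau_irr[OF O']])
 then have "rep_iso GG (WW Q, act) (WW Q', act)" unfolding cls_def by blast
 then obtain f where f: "f \<in> rep_hom GG (WW Q, act) (WW Q', act)" "bij_betw f (WW Q) (WW Q')" unfolding rep_iso_def by auto
 \<comment> \<open>The inclusion into the induced space, cut off as \<open>rep_hom\<close>
   demands.\<close>
 define i where "i v = (if v \<in> WW Q then v else 0)" for v
 note sub = WW_VV[OF Orb_Ys[OF Q]]
 have i: "i \<in> rep_hom GG (WW Q, act) rho" unfolding rep_hom_def mem_Collect_eq fst_conv snd_conv i_def
 proof (intro conjI ballI allI impI linear_betwI)
  fix g v assume "g \<in> carrier GG" "v \<in> WW Q"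
  then show "(if act g v \<in> WW Q then act g v else 0) = act g (if v \<in> WW Q then v else 0)"
   using WW_stable[OF Q, of g v] Gr_carrier[OF r1] by simp
 qed (use sub cfun.subspace_add[OF WW_subspace] cfun.subspace_scale[OF WW_subspace] in auto)
 obtain Y where Y: "Y \<in> Q" "Y \<in> Ys m t" using Orb_nonempty[OF Q] .
 have iY: "i (chi Y) = chi Y" using chi_WW[OF Y(1)] by (simp add: i_def)
 then have "i \<noteq> 0" using chi_nz[of Y] by auto
 then obtain c where c: "f = homscale c i" using hom_one_dimensional[OF tau_irreducible[OF Q] i _ hom_weaken[OF O' f(1)]] by blast
 have fY: "f (chi Y) = cscale c (chi Y)" unfolding c homscale_def iY ..
 have "c \<noteq> 0"
 proof
  assume "c = 0"
  then have "f (chi Y) = f 0" using fY linear_betw_0[OF rep_homD(1)[OF f(1)]] WW_subspace by simp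
  then show False using inj_onD[OF bij_betw_imp_inj_on[OF f(2)] _ chi_WW[OF Y(1)] cfun.subspace_0[OF WW_subspace]] chi_nz[of Y] by blast
 qed
 then have "chi Y = cscale (1 / c) (f (chi Y))" unfolding fY by (simp add: cscale_def)
 moreover have "cscale (1 / c) (f (chi Y)) \<in> WW Q'"
  by (rule cfun.subspace_scale[OF WW_subspace bij_betwE[OF f(2), rule_format, OF chi_WW[OF Y(1)]]])
 ultimately have "chi Y \<in> WW Q'" by simp
 then have "Y \<in> Q'" using chi_in_WW[OF O' Y(2)] by blast
 then show "Q = Q'" using Orb_eq(1)[OF Q Y(1)] Orb_eq(1)[OF O'] by blast
qed

lemma cls_surj:
 assumes C: "C \<in> irr_classes GG TT" "rep_hom GG (rep_of C) rho \<noteq> {0}"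
 obtains Q where "Q \<in> Orb" "C = cls Q"
proof -
 have p: "rep_of C \<in> smooth_irreps GG TT" using rep_of_class(1)[OF C(1)] .
 have irr: "irreducible_rep GG (rep_of C)" using p unfolding smooth_irreps_def by blast
 obtain f where f: "f \<in> rep_hom GG (rep_of C) rho" "f \<noteq> 0" using mult_one[OF irr C(2)] by metis
 obtain Q where Q: "Q \<in> Orb" "bij_betw f (fst (rep_of C)) (WW Q)" "f \<in> rep_hom GG (rep_of C) (WW Q, act)"
  using hom_onto_orbit_space[OF irr f] .
 have "rep_iso GG (rep_of C) (WW Q, act)" unfolding rep_iso_def using Q(2,3) by auto
 then have *: "(rep_of C, (WW Q, act)) \<in> {(\<pi>, \<pi>'). \<pi> \<in> smooth_irreps GG TT \<and> \<pi>' \<in> smooth_irreps GG TT \<and> rep_iso GG \<pi> \<pi>'}"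
  using p tau_irr[OF Q(1)] by blast
 have "C = cls Q" unfolding cls_def by (rule trans[OF rep_of_class(3)[OF C(1)] equiv_class_eq[OF iso_equiv *]])
 then show thesis using that Q(1) by blast
qed

lemma cls_bij: "bij_betw cls Orb {C \<in> irr_classes GG TT. rep_hom GG (rep_of C) rho \<noteq> {0}}"
proof (rule bij_betw_imageI[OF cls_inj], intro equalityI subsetI)
 fix C assume "C \<in> cls ` Orb"
 then obtain Q where C: "C = cls Q" "Q \<in> Orb" by (rule imageE)
 show "C \<in> {C \<in> irr_classes GG TT. rep_hom GG (rep_of C) rho \<noteq> {0}}"
  unfolding C(1) mem_Collect_eq using cls_props(1,2)[OF C(2)] by (rule conjI)
next
 fix C assume "C \<in> {C \<in> irr_classes GG TT. rep_hom GG (rep_of C) rho \<noteq> {0}}"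
 then have C: "C \<in> irr_classes GG TT" "rep_hom GG (rep_of C) rho \<noteq> {0}" unfolding mem_Collect_eq by (rule conjunct1, rule conjunct2)
 obtain Q where "Q \<in> Orb" "C = cls Q" by (rule cls_surj[OF C])
 then show "C \<in> cls ` Orb" by (intro image_eqI)
qed

lemma class_irreducible: "C \<in> irr_classes GG TT ==> irreducible_rep GG (rep_of C)"
 using rep_of_class(1)[of C GG TT] unfolding smooth_irreps_def mem_Collect_eq by (rule conjunct2)

lemma mult_cls: assumes "Q \<in> Orb" shows "rep_mult GG (rep_of (cls Q)) rho = 1"
 by (rule mult_one[OF class_irreducible[OF cls_props(1)[OF assms]] cls_props(2)[OF assms]])

lemma rho_smooth: "smooth_rep GG TT rho" using smooth_sub[OF rho_rep] by blast

lemma hom_finite_dimensional: assumes "C \<in> irr_classes GG TT"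
 shows "\<exists>B. finite B \<and> rep_hom GG (rep_of C) rho \<subseteq> chom.span B"
proof (cases "rep_hom GG (rep_of C) rho = {0}")
 case True
 then show ?thesis by (intro exI[of _ "{0}"]) (simp add: chom.span_zero)
next
 case False
 obtain f where "rep_hom GG (rep_of C) rho \<subseteq> chom.span {f}" by (rule mult_one[OF class_irreducible[OF assms] False])
 then show ?thesis by (intro exI[of _ "{f}"]) simp
qed

end

section \<open>The zeta function\<close>

text \<open>The factor by which \<open>V_coeff\<close> changes when \<open>j\<close> is added above
  a largest element \<open>i\<close>. Multiplied by \<open>q ^ (j * (m + t - j))\<close> it is also
  the number of lifts of rank \<open>j\<close> of a matrix of rank \<open>i\<close>; this
  coincidence is what ties the count to the formula.\<close>

definition trans_coeff :: "nat \<Rightarrow> nat \<Rightarrow> nat \<Rightarrow> nat \<Rightarrow> nat \<Rightarrow> real" where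
 "trans_coeff q m t i j = Vq q (m - i) * Vq q (t - i) / (Vq q (m - j) * Vq q (t - j) * Vq q (j - i))"

lemma trans_coeff_self: "q > 1 ==> trans_coeff q m t j j = 1" using Vq_pos[of q "m - j"] Vq_pos[of q "t - j"] by (simp add: trans_coeff_def)

text \<open>The largest element, with value 0 for the empty set, in the list form that
  \<open>V_coeff\<close> uses.\<close>

definition top_of :: "nat set \<Rightarrow> nat" where "top_of J = (0 # sorted_list_of_set J) ! card J"

lemma sorted_list_of_set_snoc:
 assumes "finite J" "\<And>x. x \<in> J ==> x < j"
 shows "sorted_list_of_set (insert j J) = sorted_list_of_set J @ [j]"
proof -
 have "j \<notin> J" using assms(2) by blast
 then have "sorted_list_of_set (insert j J) = insort j (sorted_list_of_set J)" using assms(1) by (rule sorted_list_of_set_insert[rotated])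
 also have "... = sorted_list_of_set J @ [j]" using assms by (intro sorted_insort_is_snoc) (auto simp: less_imp_le)
 finally show ?thesis .
qed

lemma top_of_insert: assumes "finite J" "\<And>x. x \<in> J ==> x < j" shows "top_of (insert j J) = j"
proof -
 have "j \<notin> J" using assms(2) by blast
 then have c: "card (insert j J) = Suc (card J)" using assms(1) by simp
 have l: "length (sorted_list_of_set J) = card J" by simp
 have s: "sorted_list_of_set (insert j J) = sorted_list_of_set J @ [j]" by (rule sorted_list_of_set_snoc[OF assms])
 show ?thesis unfolding top_of_def s c nth_Cons_Suc l[symmetric] by (rule nth_append_length)
qed

lemma top_of_empty [simp]: "top_of {} = 0" by (simp add: top_of_def)

lemma top_of_Max: assumes "finite J" "J \<noteq> {}" shows "top_of J = Max J"
proof -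
 have "J = insert (Max J) (J - {Max J})" using Max_in[OF assms] by blast
 moreover have "x < Max J" if "x \<in> J - {Max J}" for x using Max_ge[OF assms(1), of x] that by auto
 ultimately show ?thesis using top_of_insert[of "J - {Max J}" "Max J"] assms(1) by simp
qed

lemma V_coeff_eq:
 "V_coeff q n t J = Vq q t * Vq q (n - t) / (Vq q (t - top_of J) * Vq q (n - t - top_of J)) *
  (\<Prod>j=1..card J. inverse (Vq q ((0 # sorted_list_of_set J) ! j - (0 # sorted_list_of_set J) ! (j - 1))))"
 by (simp only: V_coeff_def Let_def top_of_def)

lemma V_coeff_empty: "q > 1 ==> V_coeff q n t {} = 1" using Vq_pos[of q t] Vq_pos[of q "n - t"] by (simp add: V_coeff_eq)

text \<open>A new largest element moves the boundary in the leading quotient from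
  \<open>top_of J\<close> to \<open>j\<close> and appends one factor to the product; the numerator
  of \<open>trans_coeff\<close> cancels the old boundary.\<close>

lemma V_coeff_insert:
 assumes q: "q > 1" and J: "finite J" "\<And>x. x \<in> J ==> x < j"
 shows "V_coeff q n t (insert j J) = V_coeff q n t J * trans_coeff q (n - t) t (top_of J) j"
proof -
 let ?xs = "0 # sorted_list_of_set J"
 have "j \<notin> J" using J(2) by blast
 then have c: "card (insert j J) = Suc (card J)" using J(1) by simp
 have xs: "0 # sorted_list_of_set (insert j J) = ?xs @ [j]" using sorted_list_of_set_snoc[OF J] by simp
 have t: "top_of (insert j J) = j" by (rule top_of_insert[OF J])
 have len: "length ?xs = Suc (card J)" using J(1) by simp
 define f where "f ys i = inverse (Vq q (ys ! i - ys ! (i - 1)))" for ys :: "nat list" and i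
 have old: "(\<Prod>i=1..card J. f (?xs @ [j]) i) = (\<Prod>i=1..card J. f ?xs i)"
 proof (intro prod.cong refl)
  fix i assume i: "i \<in> {1..card J}"
  have "(?xs @ [j]) ! k = ?xs ! k" if "k \<le> card J" for k using len that by (simp only: nth_append) simp
  moreover have "i \<le> card J" "i - 1 \<le> card J" using i by auto
  ultimately have "(?xs @ [j]) ! i = ?xs ! i" "(?xs @ [j]) ! (i - 1) = ?xs ! (i - 1)" by blast+
  then show "f (?xs @ [j]) i = f ?xs i" unfolding f_def by (simp only:)
 qed
 have "(?xs @ [j]) ! Suc (card J) = j" "(?xs @ [j]) ! card J = ?xs ! card J"
  using len nth_append_length[of ?xs j "[]"] by (simp_all only: nth_append) simp_all
 then have last: "f (?xs @ [j]) (Suc (card J)) = inverse (Vq q (j - top_of J))" unfolding f_def diff_Suc_1 top_of_def by (simp only:)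
 have "V_coeff q n t (insert j J) = Vq q t * Vq q (n - t) / (Vq q (t - j) * Vq q (n - t - j)) * (\<Prod>i=1..Suc (card J). f (?xs @ [j]) i)"
  by (simp only: V_coeff_eq t c xs f_def)
 also have "(\<Prod>i=1..Suc (card J). f (?xs @ [j]) i) = (\<Prod>i=1..card J. f ?xs i) * inverse (Vq q (j - top_of J))"
  unfolding old[symmetric] last[symmetric] by simp
 also have "Vq q t * Vq q (n - t) / (Vq q (t - j) * Vq q (n - t - j)) * ((\<Prod>i=1..card J. f ?xs i) * inverse (Vq q (j - top_of J))) =
  V_coeff q n t J * trans_coeff q (n - t) t (top_of J) j" unfolding V_coeff_eq trans_coeff_def f_def[symmetric]
  using Vq_pos[OF q, of "t - top_of J"] Vq_pos[OF q, of "n - t - top_of J"] by (simp add: field_simps)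
 finally show ?thesis .
qed

text \<open>The share of the final sum that comes from the sets with largest element
  \<open>j\<close>, read as chains of ranks rising from 0 to \<open>j\<close>.\<close>

definition chain_sum :: "nat \<Rightarrow> nat \<Rightarrow> nat \<Rightarrow> (nat \<Rightarrow> complex) \<Rightarrow> nat \<Rightarrow> complex" where
 "chain_sum q n t y j = (\<Sum>J\<in>{J \<in> Pow {1..t}. top_of J = j}. of_real (V_coeff q n t J) * (\<Prod>i\<in>J. y i))"

lemma top_of_0: assumes "J \<in> Pow {1..t}" shows "top_of J = 0 \<longleftrightarrow> J = {}"
proof
 assume 0: "top_of J = 0"
 have fin: "finite J" using assms finite_subset by auto
 show "J = {}"
 proof (rule ccontr)
  assume ne: "J \<noteq> {}"
  then have "Max J \<in> {1..t}" using Max_in[OF fin ne] assms by blast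
  then show False using 0 top_of_Max[OF fin ne] by simp
 qed
qed simp

lemma chain_sum_0: "q > 1 ==> chain_sum q n t y 0 = 1"
proof -
 have "{J \<in> Pow {1..t}. top_of J = 0} = {{}}" using top_of_0 by auto
 then show "q > 1 ==> ?thesis" by (simp add: chain_sum_def V_coeff_empty)
qed

lemma top_of_le: assumes "J \<in> Pow {1..t}" shows "top_of J \<le> t" "x \<in> J ==> x \<le> top_of J"
proof -
 have fin: "finite J" using assms finite_subset by auto
 show "top_of J \<le> t"
 proof (cases "J = {}")
  case False
  then show ?thesis using Max_in[OF fin] top_of_Max[OF fin] assms by auto
 qed simp
 show "x \<le> top_of J" if x: "x \<in> J"
 proof -
  have "J \<noteq> {}" using x by auto
  then show ?thesis using top_of_Max[OF fin] Max_ge[OF fin x] by simp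
 qed
qed

text \<open>Removing the largest element matches the sets with top \<open>j\<close> with those whose
  top is below \<open>j\<close>; grouping the latter by their top gives the recursion.\<close>

lemma chain_sum_rec:
 assumes q: "q > 1" and j: "1 \<le> j" "j \<le> t"
 shows "chain_sum q n t y j = y j * (\<Sum>i<j. of_real (trans_coeff q (n - t) t i j) * chain_sum q n t y i)"
proof -
 let ?A = "{J \<in> Pow {1..t}. top_of J < j}"
 have fin: "finite J" if "J \<in> ?A" for J using that finite_subset by auto
 have lt: "x < j" if "J \<in> ?A" "x \<in> J" for J x using top_of_le(2)[of J t x] that by force
 have inj: "inj_on (insert j) ?A"
 proof (rule inj_onI)
  fix J K assume JK: "J \<in> ?A" "K \<in> ?A" "insert j J = insert j K"
  have "j \<notin> J" "j \<notin> K" using lt JK by blast+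
  then show "J = K" using JK(3) insert_ident by metis
 qed
 have img: "{J \<in> Pow {1..t}. top_of J = j} = insert j ` ?A"
 proof (intro equalityI subsetI)
  fix J assume "J \<in> {J \<in> Pow {1..t}. top_of J = j}"
  then have J: "J \<in> Pow {1..t}" "top_of J = j" by auto
  have fJ: "finite J" using J(1) finite_subset by auto
  have ne: "J \<noteq> {}" using J j by auto
  then have jJ: "j \<in> J" using Max_in[OF fJ ne] top_of_Max[OF fJ ne] J(2) by simp
  have "top_of (J - {j}) < j"
  proof (cases "J - {j} = {}")
   case False
   have fin': "finite (J - {j})" using fJ by simp
   have "Max (J - {j}) \<in> J - {j}" by (rule Max_in[OF fin' False])
   then show ?thesis using top_of_le(2)[OF J(1), of "Max (J - {j})"] J(2) top_of_Max[OF fin' False] by auto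
  next
   case True
   then show ?thesis unfolding True using j by simp
  qed
  then have "J - {j} \<in> ?A" using J(1) by auto
  then show "J \<in> insert j ` ?A" using jJ by (intro image_eqI[of _ _ "J - {j}"]) auto
 next
  fix J assume "J \<in> insert j ` ?A"
  then obtain K where K: "J = insert j K" "K \<in> ?A" by blast
  then show "J \<in> {J \<in> Pow {1..t}. top_of J = j}" using top_of_insert[OF fin[OF K(2)] lt[OF K(2)]] j by auto
 qed
 have "chain_sum q n t y j = (\<Sum>J\<in>?A. of_real (V_coeff q n t (insert j J)) * (\<Prod>i\<in>insert j J. y i))"
  unfolding chain_sum_def img sum.reindex[OF inj] o_def ..
 also have "... = (\<Sum>J\<in>?A. y j * (of_real (trans_coeff q (n - t) t (top_of J) j) * (of_real (V_coeff q n t J) * (\<Prod>i\<in>J. y i))))"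
 proof (intro sum.cong refl)
  fix J assume J: "J \<in> ?A"
  have "j \<notin> J" using lt[OF J] by blast
  then show "of_real (V_coeff q n t (insert j J)) * (\<Prod>i\<in>insert j J. y i) =
    y j * (of_real (trans_coeff q (n - t) t (top_of J) j) * (of_real (V_coeff q n t J) * (\<Prod>i\<in>J. y i)))"
   using V_coeff_insert[OF q fin[OF J] lt[OF J], of n t] fin[OF J] by simp
 qed
 also have "... = (\<Sum>i<j. \<Sum>J\<in>{J \<in> ?A. top_of J = i}. y j * (of_real (trans_coeff q (n - t) t (top_of J) j) * (of_real (V_coeff q n t J) * (\<Prod>i\<in>J. y i))))"
  by (intro sum.group[symmetric]) auto
 also have "... = (\<Sum>i<j. y j * (of_real (trans_coeff q (n - t) t i j) * chain_sum q n t y i))"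
 proof (intro sum.cong refl)
  fix i assume i: "i \<in> {..<j}"
  have "{J \<in> ?A. top_of J = i} = {J \<in> Pow {1..t}. top_of J = i}" using i by auto
  then show "(\<Sum>J\<in>{J \<in> ?A. top_of J = i}. y j * (of_real (trans_coeff q (n - t) t (top_of J) j) * (of_real (V_coeff q n t J) * (\<Prod>i\<in>J. y i)))) =
    y j * (of_real (trans_coeff q (n - t) t i j) * chain_sum q n t y i)" unfolding chain_sum_def sum_distrib_left by (intro sum.cong) auto
 qed
 finally show ?thesis by (simp add: sum_distrib_left)
qed

lemma chain_sum_total:
 "(\<Sum>j\<le>t. chain_sum q n t y j) = (\<Sum>J\<in>Pow {1..t}. of_real (V_coeff q n t J) * (\<Prod>i\<in>J. y i))"
 unfolding chain_sum_def using top_of_le(1) by (intro sum.group) auto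

text \<open>The limit is the fixed point of the contraction \<open>a \<mapsto> x * (a + l)\<close>;
  the perturbation by \<open>b N - l\<close> dies out under the contraction.\<close>

lemma affine_recursion_limit:
 fixes a b :: "nat \<Rightarrow> complex"
 assumes rec: "\<And>N. a (Suc N) = x * (a N + b N)" and x: "norm x < 1" and b: "b \<longlonglongrightarrow> l"
 shows "a \<longlonglongrightarrow> x / (1 - x) * l"
proof -
 define L where "L = x / (1 - x) * l"
 have x1: "1 - x \<noteq> 0" using x by auto
 have L: "L = x * (L + l)" using x1 by (simp add: L_def field_simps)
 have step: "norm (a (Suc N) - L) \<le> norm x * norm (a N - L) + norm (b N - l)" for N
 proof -
  have "a (Suc N) - L = x * (a N - L) + x * (b N - l)" unfolding rec by (subst L) (simp add: algebra_simps)
  then have "norm (a (Suc N) - L) \<le> norm x * norm (a N - L) + norm x * norm (b N - l)"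
   using norm_triangle_ineq[of "x * (a N - L)" "x * (b N - l)"] by (simp add: norm_mult)
  also have "norm x * norm (b N - l) \<le> 1 * norm (b N - l)" using x by (intro mult_right_mono) auto
  finally show ?thesis by simp
 qed
 have "(\<lambda>N. a N - L) \<longlonglongrightarrow> 0"
 proof (rule LIMSEQ_I)
  fix e :: real assume e: "e > 0"
  \<comment> \<open>Chosen so that \<open>norm x * (e / 2) + d = e / 2\<close>, which makes the
    bound below stable under one step.\<close>
  define d where "d = e / 2 * (1 - norm x)"
  have d: "d > 0" using e x by (simp add: d_def)
  obtain N0 where N0: "\<And>N. N \<ge> N0 ==> norm (b N - l) < d" using LIMSEQ_D[OF b d] by blast
  have bound: "norm (a (N0 + k) - L) \<le> norm x ^ k * norm (a N0 - L) + e / 2" for k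
  proof (induction k)
   case 0
   then show ?case using e by simp
  next
   case (Suc k)
   have "norm (a (N0 + Suc k) - L) \<le> norm x * norm (a (N0 + k) - L) + norm (b (N0 + k) - l)" using step[of "N0 + k"] by simp
   also have "... \<le> norm x * (norm x ^ k * norm (a N0 - L) + e / 2) + d" using Suc N0[of "N0 + k"] by (intro add_mono mult_left_mono) auto
   also have "... = norm x ^ Suc k * norm (a N0 - L) + e / 2" by (simp add: d_def field_simps)
   finally show ?case .
  qed
  have "(\<lambda>k. norm x ^ k * norm (a N0 - L)) \<longlonglongrightarrow> 0 * norm (a N0 - L)"
   using x by (intro tendsto_mult LIMSEQ_power_zero tendsto_const) simp
  then obtain k0 where k0: "\<And>k. k \<ge> k0 ==> norm x ^ k * norm (a N0 - L) < e / 2"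
   using LIMSEQ_D[of "\<lambda>k. norm x ^ k * norm (a N0 - L)" 0 "e / 2"] e by fastforce
  show "\<exists>no. \<forall>N\<ge>no. norm (a N - L - 0) < e"
  proof (intro exI allI impI)
   fix N assume N: "N \<ge> N0 + k0"
   then have "norm (a (N0 + (N - N0)) - L) < e / 2 + e / 2" using bound[of "N - N0"] k0[of "N - N0"] by linarith
   then show "norm (a N - L - 0) < e" using N by simp
  qed
 qed
 then have "a \<longlonglongrightarrow> L" by (rule LIM_zero_cancel)
 then show ?thesis by (simp add: L_def)
qed

text \<open>The system is triangular with \<open>trans_coeff\<close> equal to 1 on the diagonal.
  Once the smaller indices converge, each row is an affine recursion; its factor
  \<open>x j / (1 - x j)\<close> sums the repetitions of the rank \<open>j\<close>.\<close>

lemma chain_limit: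
 fixes A :: "nat \<Rightarrow> nat \<Rightarrow> complex"
 assumes q: "q > 1" and x0: "x 0 = 1" and x: "\<And>j. 1 \<le> j ==> j \<le> t ==> norm (x j) < 1"
  and A0: "\<And>j. j \<le> t ==> A 0 j = (if j = 0 then 1 else 0)"
  and rec: "\<And>N j. j \<le> t ==> A (Suc N) j = x j * (\<Sum>i\<le>j. of_real (trans_coeff q (n - t) t i j) * A N i)"
  and j: "j \<le> t"
 shows "(\<lambda>N. A N j) \<longlonglongrightarrow> chain_sum q n t (\<lambda>i. x i / (1 - x i)) j" using j
proof (induction j rule: less_induct)
 case (less j)
 show ?case
 proof (cases "j = 0")
  case True
  have "A N 0 = 1" for N by (induction N) (simp_all add: A0 rec x0 trans_coeff_self[OF q])
  then show ?thesis using True chain_sum_0[OF q] by simp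
 next
  case False
  let ?y = "\<lambda>i. x i / (1 - x i)"
  define b where "b N = (\<Sum>i<j. of_real (trans_coeff q (n - t) t i j) * A N i)" for N
  have "A (Suc N) j = x j * (A N j + b N)" for N
  proof -
   have "{..j} = insert j {..<j}" by auto
   then show ?thesis unfolding rec[OF less.prems] b_def using trans_coeff_self[OF q, of "n - t" t j] by simp
  qed
  moreover have "b \<longlonglongrightarrow> (\<Sum>i<j. of_real (trans_coeff q (n - t) t i j) * chain_sum q n t ?y i)"
   unfolding b_def using less by (intro tendsto_sum tendsto_mult tendsto_const) auto
  ultimately have "(\<lambda>N. A N j) \<longlonglongrightarrow> x j / (1 - x j) * (\<Sum>i<j. of_real (trans_coeff q (n - t) t i j) * chain_sum q n t ?y i)"
   using x[of j] False less.prems by (intro affine_recursion_limit) auto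
  then show ?thesis using chain_sum_rec[OF q, of j t n ?y] False less.prems by simp
 qed
qed

section \<open>Sizes of orbits\<close>

context complete_dvr
begin

lemma redm_smult_redm: assumes "c \<in> S" "Y \<in> carrier_mat a b" shows "redm (c \<cdot>\<^sub>m redm Y) = redm (c \<cdot>\<^sub>m Y)"
proof -
 have "c \<cdot>\<^sub>m redm Y - c \<cdot>\<^sub>m Y = c \<cdot>\<^sub>m (redm Y - Y)" using assms(2) by (intro eq_matI) (auto simp: algebra_simps)
 moreover have "c \<cdot>\<^sub>m (redm Y - Y) \<in> pm a b (0 + 0)" using redm_diff(1)[OF assms(2)] assms(1) by (intro pm_smult) (simp_all add: pw_0)
 ultimately show ?thesis using redm_eq[of "c \<cdot>\<^sub>m redm Y" a b "c \<cdot>\<^sub>m Y"] assms(2) by simp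
qed

lemma redm_conj_eq:
 assumes D: "D \<in> Gl a" and A: "A \<in> Gl b" and U: "U \<in> carrier_mat a b" and V: "V \<in> carrier_mat a b"
 shows "redm (D * U * A) = redm (D * V * A) \<longleftrightarrow> redm U = redm V"
proof -
 note c = Gl_carrier[OF D] Gl_carrier[OF A] U V
 have "redm (D * U * A) = redm (D * V * A) \<longleftrightarrow> D * U * A - D * V * A \<in> pm a b 0" using c by (intro redm_eq) auto
 also have "D * U * A - D * V * A = D * (U - V) * A"
  using c by (simp add: mult_minus_distrib_mat[of _ a a _ b] minus_mult_distrib_mat[of _ a b _ _ b])
 also have "... \<in> pm a b 0 \<longleftrightarrow> D * (U - V) \<in> pm a b 0" using c by (intro Gl_cancel_right[OF A]) auto
 also have "... \<longleftrightarrow> U - V \<in> pm a b 0" using c by (intro Gl_cancel_left[OF D]) auto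
 also have "... \<longleftrightarrow> redm U = redm V" using redm_eq[OF U V] by simp
 finally show ?thesis .
qed

lemma cg_scaled: "D \<in> cg a k \<longleftrightarrow> (\<exists>D1\<in>pm a a 0. D = 1\<^sub>m a + w ^ k \<cdot>\<^sub>m D1)"
proof
 assume D: "D \<in> cg a k"
 note c = cg_carrier[OF D]
 let ?D1 = "w powi (- int k) \<cdot>\<^sub>m (D - 1\<^sub>m a)"
 have "?D1 \<in> pm a a (int k + - int k)" using D c by (subst pm_wpow) (auto simp: cg_def)
 moreover have "D = 1\<^sub>m a + w ^ k \<cdot>\<^sub>m ?D1" using c by (intro eq_matI) (auto simp: power_int_minus mult.assoc[symmetric])
 ultimately show "\<exists>D1\<in>pm a a 0. D = 1\<^sub>m a + w ^ k \<cdot>\<^sub>m D1" by auto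
next
 assume "\<exists>D1\<in>pm a a 0. D = 1\<^sub>m a + w ^ k \<cdot>\<^sub>m D1"
 then obtain D1 where D1: "D1 \<in> pm a a 0" "D = 1\<^sub>m a + w ^ k \<cdot>\<^sub>m D1" by blast
 note c = pm_carrier[OF D1(1)]
 have "D - 1\<^sub>m a = w powi int k \<cdot>\<^sub>m D1" unfolding D1(2) using c by (intro eq_matI) auto
 moreover have "w powi int k \<cdot>\<^sub>m D1 \<in> pm a a (0 + int k)" using D1(1) c by (subst pm_wpow) auto
 ultimately show "D \<in> cg a k" using c D1(2) by (simp add: cg_def)
qed

lemma commutator_scale:
 fixes Y :: "'k mat"
 assumes "D1 \<in> carrier_mat a a" "A1 \<in> carrier_mat b b" "Y \<in> carrier_mat a b"
 shows "(1\<^sub>m a + c \<cdot>\<^sub>m D1) * Y - Y * (1\<^sub>m b + c \<cdot>\<^sub>m A1) = D1 * (c \<cdot>\<^sub>m Y) - (c \<cdot>\<^sub>m Y) * A1"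
proof -
 have 1: "(1\<^sub>m a + c \<cdot>\<^sub>m D1) * Y = Y + c \<cdot>\<^sub>m (D1 * Y)"
  unfolding add_mult_distrib_mat[OF one_carrier_mat smult_carrier_mat[OF assms(1)] assms(3)]
   left_mult_one_mat[OF assms(3)] mult_smult_assoc_mat[OF assms(1,3)] ..
 have 2: "Y * (1\<^sub>m b + c \<cdot>\<^sub>m A1) = Y + c \<cdot>\<^sub>m (Y * A1)"
  unfolding mult_add_distrib_mat[OF assms(3) one_carrier_mat smult_carrier_mat[OF assms(2)]]
   right_mult_one_mat[OF assms(3)] mult_smult_distrib[OF assms(3,2)] ..
 note 3 = mult_smult_distrib[OF assms(1,3), of c] mult_smult_assoc_mat[OF assms(3,2), of c]
 define P Q where "P = D1 * Y" and "Q = Y * A1"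
 have "P \<in> carrier_mat a b" "Q \<in> carrier_mat a b" using assms by (auto simp: P_def Q_def)
 then show ?thesis unfolding 1 2 3 P_def[symmetric] Q_def[symmetric] using assms(3) by (intro eq_matI) auto
qed

text \<open>In \<open>D * Y - Y * A\<close> the identity parts of \<open>D\<close> and
  \<open>A\<close> cancel, so their congruence level turns into a power of \<open>w\<close> in front
  of \<open>Y\<close>. This is why the rank of w^r Y, not of Y, governs the orbit of Y.\<close>

lemma Jrel_scaled:
 assumes "Y \<in> carrier_mat a b"
 shows "Jrel a b (w ^ k \<cdot>\<^sub>m Y) E \<longleftrightarrow> (\<exists>D\<in>cg a k. \<exists>A\<in>cg b k. E - (D * Y - Y * A) \<in> pm a b 0)"
proof
 assume "Jrel a b (w ^ k \<cdot>\<^sub>m Y) E"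
 then obtain D1 A1 where *: "D1 \<in> pm a a 0" "A1 \<in> pm b b 0" "E - (D1 * (w ^ k \<cdot>\<^sub>m Y) - (w ^ k \<cdot>\<^sub>m Y) * A1) \<in> pm a b 0"
  unfolding Jrel_def by (elim bexE)
 have "1\<^sub>m a + w ^ k \<cdot>\<^sub>m D1 \<in> cg a k" "1\<^sub>m b + w ^ k \<cdot>\<^sub>m A1 \<in> cg b k" using cg_scaled *(1,2) by blast+
 then show "\<exists>D\<in>cg a k. \<exists>A\<in>cg b k. E - (D * Y - Y * A) \<in> pm a b 0"
  using *(3) unfolding commutator_scale[OF pm_carrier[OF *(1)] pm_carrier[OF *(2)] assms, symmetric] by (intro bexI)
next
 assume "\<exists>D\<in>cg a k. \<exists>A\<in>cg b k. E - (D * Y - Y * A) \<in> pm a b 0"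
 then obtain D A where *: "D \<in> cg a k" "A \<in> cg b k" "E - (D * Y - Y * A) \<in> pm a b 0" by (elim bexE)
 obtain D1 where D1: "D1 \<in> pm a a 0" "D = 1\<^sub>m a + w ^ k \<cdot>\<^sub>m D1" using *(1) cg_scaled by blast
 obtain A1 where A1: "A1 \<in> pm b b 0" "A = 1\<^sub>m b + w ^ k \<cdot>\<^sub>m A1" using *(2) cg_scaled by blast
 show "Jrel a b (w ^ k \<cdot>\<^sub>m Y) E"
  using *(3) D1(1) A1(1) unfolding D1(2) A1(2) commutator_scale[OF pm_carrier[OF D1(1)] pm_carrier[OF A1(1)] assms] Jrel_def by (intro bexI)
qed

lemma pm_zero_ge: "k \<ge> 0 ==> X \<in> pm a b k ==> X \<in> pm a b 0" by (rule pm_mono)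

end

context char_setting
begin

lemma scale_conj:
 assumes Y: "Y \<in> carrier_mat m t" and D: "D \<in> cg m r" and A: "A \<in> cg t r" and c: "c \<in> S"
 shows "redm (c \<cdot>\<^sub>m redm (D * Y * A)) = redm (D * redm (c \<cdot>\<^sub>m Y) * A)"
proof -
 note cs = cg_carrier[OF D] cg_carrier[OF A] Y
 have "redm (c \<cdot>\<^sub>m redm (D * Y * A)) = redm (c \<cdot>\<^sub>m (D * Y * A))" using c cs by (intro redm_smult_redm) auto
 also have "c \<cdot>\<^sub>m (D * Y * A) = D * (c \<cdot>\<^sub>m Y) * A"
  using cs by (simp add: mult_smult_assoc_mat[of _ m t _ t] mult_smult_distrib[of _ m m _ t] del: assoc_mult_mat)
 also have "redm ... = redm (D * redm (c \<cdot>\<^sub>m Y) * A)" using cs by (intro redm_conj[symmetric] D A) auto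
 finally show ?thesis .
qed

text \<open>If \<open>D * Y * A\<close> is \<open>Y + E\<close> with at most simple poles in
  \<open>E\<close>, multiplying by the inverse \<open>A'\<close> of \<open>A\<close> gives
  \<open>D * Y - Y * A' = E * A'\<close>. Modulo integral matrices \<open>A'\<close> may be dropped
  on the right, which leaves the linear condition \<open>Jrel\<close>.\<close>

lemma orbit_fibre:
 assumes Y: "Y \<in> Ys m t"
 shows "{Y' \<in> orb Y. redm (w \<cdot>\<^sub>m Y') = redm (w \<cdot>\<^sub>m Y)} =
  (\<lambda>E. redm (Y + E)) ` {E \<in> Yk m t 1. Jrel m t (redm (w ^ r \<cdot>\<^sub>m Y)) E}"
proof (intro equalityI subsetI)
 note cY = Ys_carrier[OF Y]
 fix Y' assume "Y' \<in> {Y' \<in> orb Y. redm (w \<cdot>\<^sub>m Y') = redm (w \<cdot>\<^sub>m Y)}"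
 then have Y': "Y' \<in> orb Y" "redm (w \<cdot>\<^sub>m Y') = redm (w \<cdot>\<^sub>m Y)" by simp_all
 obtain D A where DA: "Y' = redm (D * Y * A)" "D \<in> cg m r" "A \<in> cg t r" using orbE[OF Y'(1)] .
 obtain A' where A': "A' \<in> cg t r" "A * A' = 1\<^sub>m t" "A' * A = 1\<^sub>m t" using cg_inverse[OF DA(3) r1] .
 note c = cg_carrier[OF DA(2)] cg_carrier[OF DA(3)] cg_carrier[OF A'(1)] cY
 define W where "W = D * Y * A"
 have cW: "W \<in> carrier_mat m t" using c by (auto simp: W_def)
 define E0 where "E0 = W - Y"
 have cE: "E0 \<in> carrier_mat m t" using cW cY by (simp add: E0_def)
 have "redm (w \<cdot>\<^sub>m W) = redm (w \<cdot>\<^sub>m Y)" using redm_smult_redm[OF w_S cW] Y'(2) unfolding DA(1) W_def by simp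
 then have "w \<cdot>\<^sub>m W - w \<cdot>\<^sub>m Y \<in> pm m t 0" using redm_eq[of "w \<cdot>\<^sub>m W" m t "w \<cdot>\<^sub>m Y"] cW cY by simp
 moreover have "w \<cdot>\<^sub>m W - w \<cdot>\<^sub>m Y = w \<cdot>\<^sub>m E0" unfolding E0_def using cW cY by (intro eq_matI) (auto simp: algebra_simps)
 ultimately have E0: "E0 \<in> pm m t (-1)" using pm_w[OF cE, of "-1"] by simp
 have "Jrel m t (w ^ r \<cdot>\<^sub>m Y) E0" unfolding Jrel_scaled[OF cY]
 proof (intro bexI[OF _ DA(2)] bexI[OF _ A'(1)])
  have DY: "D * Y \<in> carrier_mat m t" using c by auto
  have "W * A' = D * Y * (A * A')" unfolding W_def by (rule assoc_mult_mat[OF DY c(2,3)])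
  then have "W * A' = D * Y" using right_mult_one_mat[OF DY] A'(2) by simp
  then have "D * Y - Y * A' = E0 * A'" unfolding E0_def using minus_mult_distrib_mat[OF cW cY c(3)] by simp
  moreover have "E0 - E0 * A' = - (E0 * (A' - 1\<^sub>m t))"
  proof -
   have "E0 * (A' - 1\<^sub>m t) = E0 * A' - E0" using c cE by (simp add: mult_minus_distrib_mat[of _ m t _ t])
   moreover have "E0 * A' \<in> carrier_mat m t" using cE c by auto
   ultimately show ?thesis using cE by (simp only:) (intro eq_matI, auto)
  qed
  moreover have "E0 * (A' - 1\<^sub>m t) \<in> pm m t (-1 + int r)" using E0 A'(1) by (intro pm_mult) (auto simp: cg_def)
  \<comment> \<open>Here \<open>r \<ge> 1\<close> is what cancels the simple pole of
    \<open>E0\<close>.\<close>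
  then have "- (E0 * (A' - 1\<^sub>m t)) \<in> pm m t 0" using r1 by (intro pm_minus) (erule pm_zero_ge[rotated], linarith)
  ultimately show "E0 - (D * Y - Y * A') \<in> pm m t 0" by simp
 qed
 then have J: "Jrel m t (redm (w ^ r \<cdot>\<^sub>m Y)) (redm E0)" by (rule Jrel_cong[rotated 6]) (use cE cY redm_diff(2) in auto)
 have "redm (Y + redm E0) = redm W"
 proof -
  have "Y + redm E0 - W = redm E0 - E0" unfolding E0_def using cY cW by (intro eq_matI) auto
  then show ?thesis using redm_eq[of "Y + redm E0" m t W] redm_diff(1)[OF cE] cE cY cW by simp
 qed
 moreover have "redm E0 \<in> Yk m t 1" using redm_Yk[OF cE, of 1] E0 by simp
 ultimately show "Y' \<in> (\<lambda>E. redm (Y + E)) ` {E \<in> Yk m t 1. Jrel m t (redm (w ^ r \<cdot>\<^sub>m Y)) E}"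
  using J unfolding DA(1) W_def by (intro image_eqI[of _ _ "redm E0"]) auto
next
 note cY = Ys_carrier[OF Y]
 fix Y' assume "Y' \<in> (\<lambda>E. redm (Y + E)) ` {E \<in> Yk m t 1. Jrel m t (redm (w ^ r \<cdot>\<^sub>m Y)) E}"
 then obtain E where E: "Y' = redm (Y + E)" "E \<in> Yk m t 1" "Jrel m t (redm (w ^ r \<cdot>\<^sub>m Y)) E" by blast
 note cE = Yk_carrier[OF E(2)]
 have Em: "E \<in> pm m t (-1)" using E(2) by (simp add: Yk_def)
 have "Jrel m t (w ^ r \<cdot>\<^sub>m Y) E" by (rule Jrel_cong[rotated 6, OF E(3)]) (use cE cY redm_diff(1) in auto)
 then obtain D A' where DA: "D \<in> cg m r" "A' \<in> cg t r" "E - (D * Y - Y * A') \<in> pm m t 0" unfolding Jrel_scaled[OF cY] by (elim bexE)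
 obtain A where A: "A \<in> cg t r" "A' * A = 1\<^sub>m t" using cg_inverse[OF DA(2) r1] by metis
 note c = cg_carrier[OF DA(1)] cg_carrier[OF DA(2)] cg_carrier[OF A(1)] cY
 define W where "W = D * Y * A"
 have cW: "W \<in> carrier_mat m t" using c by (auto simp: W_def)
 have DY: "D * Y \<in> carrier_mat m t" "Y * A' \<in> carrier_mat m t" "E * A \<in> carrier_mat m t" using c cE by auto
 have "(E - (D * Y - Y * A')) * A = E * A - (W - Y)"
 proof -
  have "(E - (D * Y - Y * A')) * A = E * A - (D * Y - Y * A') * A" using cE DY c by (intro minus_mult_distrib_mat[of _ m t _ _ t]) auto
  also have "(D * Y - Y * A') * A = W - Y * A' * A" unfolding W_def using DY c by (intro minus_mult_distrib_mat[of _ m t _ _ t]) auto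
  also have "Y * A' * A = Y" using c A(2) by (simp add: assoc_mult_mat[of _ m t _ t _ t])
  finally show ?thesis .
 qed
 then have 1: "E * A - (W - Y) \<in> pm m t 0" using pm_mult_S(2)[OF DA(3) cg_pm[OF A(1)]] by simp
 have "E * (A - 1\<^sub>m t) \<in> pm m t (-1 + int r)" using Em A(1) by (intro pm_mult) (auto simp: cg_def)
 moreover have "0 \<le> - 1 + int r" using r1 by linarith
 ultimately have "E * (A - 1\<^sub>m t) \<in> pm m t 0" by (intro pm_zero_ge)
 moreover have "E * (A - 1\<^sub>m t) = E * A - E" using c cE by (simp add: mult_minus_distrib_mat[of _ m t _ t])
 ultimately have 2: "E * A - E \<in> pm m t 0" by simp
 define EA where "EA = E * A"
 have cEA: "EA \<in> carrier_mat m t" using DY by (simp add: EA_def)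
 have "Y + E - W = (EA - (W - Y)) - (EA - E)" using cY cE cW cEA by (intro eq_matI) auto
 then have "Y + E - W \<in> pm m t 0" using pm_diff[OF 1 2] by (simp add: EA_def)
 then have "Y' = redm W" unfolding E(1) using redm_eq[of "Y + E" m t W] cY cE cW by simp
 then have "Y' \<in> orb Y" using orbI[OF _ DA(1) A(1)] by (simp add: W_def)
 moreover have "redm (w \<cdot>\<^sub>m Y') = redm (w \<cdot>\<^sub>m Y)"
 proof -
  have "redm (w \<cdot>\<^sub>m Y') = redm (w \<cdot>\<^sub>m (Y + E))" unfolding E(1) using cY cE by (intro redm_smult_redm[OF w_S]) auto
  moreover have "w \<cdot>\<^sub>m (Y + E) - w \<cdot>\<^sub>m Y = w \<cdot>\<^sub>m E" using cY cE by (intro eq_matI) (auto simp: algebra_simps)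
  moreover have "w \<cdot>\<^sub>m E \<in> pm m t 0" using pm_w[OF cE, of "-1"] Em by simp
  ultimately show ?thesis using redm_eq[of "w \<cdot>\<^sub>m (Y + E)" m t "w \<cdot>\<^sub>m Y"] cY cE by simp
 qed
 ultimately show "Y' \<in> {Y' \<in> orb Y. redm (w \<cdot>\<^sub>m Y') = redm (w \<cdot>\<^sub>m Y)}" by simp
qed

lemma card_orbit_fibre:
 assumes Y: "Y \<in> Ys m t"
 shows "card {Y' \<in> orb Y. redm (w \<cdot>\<^sub>m Y') = redm (w \<cdot>\<^sub>m Y)} =
  q ^ (rk m t (redm (w ^ r \<cdot>\<^sub>m Y)) * (m + t - rk m t (redm (w ^ r \<cdot>\<^sub>m Y))))"
proof -
 note cY = Ys_carrier[OF Y]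
 let ?Z = "redm (w ^ r \<cdot>\<^sub>m Y)"
 have Z: "?Z \<in> Ys m t" using cY by simp
 have "inj_on (\<lambda>E. redm (Y + E)) {E \<in> Yk m t 1. Jrel m t ?Z E}"
 proof (rule inj_onI)
  fix E F assume EF: "E \<in> {E \<in> Yk m t 1. Jrel m t ?Z E}" "F \<in> {E \<in> Yk m t 1. Jrel m t ?Z E}" "redm (Y + E) = redm (Y + F)"
  then have c: "E \<in> carrier_mat m t" "F \<in> carrier_mat m t" using Yk_carrier by blast+
  have "Y + E - (Y + F) = E - F" using c cY by (intro eq_matI) auto
  then have "redm E = redm F" using EF(3) redm_eq[of "Y + E" m t "Y + F"] redm_eq[OF c] c cY by simp
  then show "E = F" using EF(1,2) by (simp add: Yk_def)
 qed
 then have "card {Y' \<in> orb Y. redm (w \<cdot>\<^sub>m Y') = redm (w \<cdot>\<^sub>m Y)} = card {E \<in> Yk m t 1. Jrel m t ?Z E}"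
  unfolding orbit_fibre[OF Y] by (rule card_image)
 also have "... = q ^ (m * t - (m - rk m t ?Z) * (t - rk m t ?Z))" using card_Jrel[OF Ys_carrier[OF Z] rk[OF Z]] .
 finally show ?thesis using rank_exponent[of "rk m t ?Z" m t] rk_le[OF Z] by simp
qed

text \<open>Multiplication by \<open>w\<close> commutes with the action, so it maps the orbit onto
  the orbit of the image, and transitivity makes all fibres equally large.\<close>

lemma card_orb_step:
 assumes Y: "Y \<in> Ys m t"
 shows "card (orb Y) = q ^ (rk m t (redm (w ^ r \<cdot>\<^sub>m Y)) * (m + t - rk m t (redm (w ^ r \<cdot>\<^sub>m Y)))) * card (orb (redm (w \<cdot>\<^sub>m Y)))"
  (is "_ = ?f * _")
proof -
 note cY = Ys_carrier[OF Y]
 let ?Z = "redm (w \<cdot>\<^sub>m Y)"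
 have Z: "?Z \<in> Ys m t" using cY by simp
 have img: "redm (w \<cdot>\<^sub>m Y') \<in> orb ?Z" if Y': "Y' \<in> orb Y" for Y'
 proof -
  obtain D A where DA: "Y' = redm (D * Y * A)" "D \<in> cg m r" "A \<in> cg t r" using orbE[OF Y'] .
  show ?thesis unfolding DA(1) scale_conj[OF cY DA(2,3) w_S] using refl DA(2,3) by (rule orbI)
 qed
 have fib: "card {Y' \<in> orb Y. redm (w \<cdot>\<^sub>m Y') = Z'} = ?f" if Z': "Z' \<in> orb ?Z" for Z'
 proof -
  obtain D A where DA: "Z' = redm (D * ?Z * A)" "D \<in> cg m r" "A \<in> cg t r" using orbE[OF Z'] .
  have "bij_betw (\<lambda>Y'. redm (D * Y' * A)) {Y' \<in> orb Y. redm (w \<cdot>\<^sub>m Y') = ?Z} {Y' \<in> orb Y. redm (w \<cdot>\<^sub>m Y') = Z'}"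
  proof (rule bij_betw_filter[OF orb_bij[OF Y DA(2,3)]])
   fix Y' assume "Y' \<in> orb Y"
   then have c': "Y' \<in> carrier_mat m t" using orb_carrier[OF cY] by blast
   have "redm (w \<cdot>\<^sub>m redm (D * Y' * A)) = Z' \<longleftrightarrow> redm (redm (w \<cdot>\<^sub>m Y')) = redm ?Z"
    unfolding DA(1) scale_conj[OF c' DA(2,3) w_S] using cY c' by (intro redm_conj_eq[OF cg_Gl[OF DA(2) r1] cg_Gl[OF DA(3) r1]]) auto
   then show "redm (w \<cdot>\<^sub>m Y') = ?Z \<longleftrightarrow> redm (w \<cdot>\<^sub>m redm (D * Y' * A)) = Z'" by simp
  qed
  then have "card {Y' \<in> orb Y. redm (w \<cdot>\<^sub>m Y') = ?Z} = card {Y' \<in> orb Y. redm (w \<cdot>\<^sub>m Y') = Z'}"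
   by (rule bij_betw_same_card)
  then show ?thesis using card_orbit_fibre[OF Y] by simp
 qed
 have "card (orb Y) = (\<Sum>Y'\<in>orb Y. 1)" by simp
 also have "... = (\<Sum>Z'\<in>orb ?Z. \<Sum>Y'\<in>{Y' \<in> orb Y. redm (w \<cdot>\<^sub>m Y') = Z'}. 1)"
  using img by (intro sum.group[symmetric] orb_finite Y Z) auto
 also have "... = (\<Sum>Z'\<in>orb ?Z. ?f)" using fib by (intro sum.cong refl) simp
 finally show ?thesis by simp
qed

text \<open>The orbit size predicted by the ranks of \<open>X\<close> and its successive multiples
  by \<open>w\<close>, for \<open>k\<close> steps. It is applied to the class of w^r Y.\<close>

primrec lw :: "nat \<Rightarrow> 'k mat \<Rightarrow> nat" where
 "lw 0 X = 1"
| "lw (Suc k) X = q ^ (rk m t X * (m + t - rk m t X)) * lw k (redm (w \<cdot>\<^sub>m X))"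

lemma lw_pos: "lw k X > 0" using q_gt_1 by (induction k arbitrary: X) auto

lemma w_pow_S: "w ^ k \<in> S" using S_power[OF w_S] .

lemma Yk_0_orb: assumes "Y \<in> Yk m t 0" shows "card (orb Y) = 1"
proof -
 have "orb Y \<subseteq> {redm (0\<^sub>m m t)}" using orb_Yk[OF assms] unfolding Yk_0 .
 moreover have "Y \<in> orb Y" using orb_self assms Yk_Ys by blast
 ultimately have "orb Y = {redm (0\<^sub>m m t)}" by blast
 then show ?thesis by simp
qed

lemma redm_w_w: assumes "Y \<in> carrier_mat a b"
 shows "redm (w ^ k \<cdot>\<^sub>m redm (w \<cdot>\<^sub>m Y)) = redm (w ^ Suc k \<cdot>\<^sub>m Y)"
  "redm (w \<cdot>\<^sub>m redm (w ^ k \<cdot>\<^sub>m Y)) = redm (w ^ Suc k \<cdot>\<^sub>m Y)"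
proof -
 have "redm (w ^ k \<cdot>\<^sub>m redm (w \<cdot>\<^sub>m Y)) = redm (w ^ k \<cdot>\<^sub>m (w \<cdot>\<^sub>m Y))" using assms by (intro redm_smult_redm[OF w_pow_S, of _ a b]) simp
 then show "redm (w ^ k \<cdot>\<^sub>m redm (w \<cdot>\<^sub>m Y)) = redm (w ^ Suc k \<cdot>\<^sub>m Y)" by (simp add: smult_smult_mat mult.commute)
 have "redm (w \<cdot>\<^sub>m redm (w ^ k \<cdot>\<^sub>m Y)) = redm (w \<cdot>\<^sub>m (w ^ k \<cdot>\<^sub>m Y))" using assms by (intro redm_smult_redm[OF w_S, of _ a b]) simp
 then show "redm (w \<cdot>\<^sub>m redm (w ^ k \<cdot>\<^sub>m Y)) = redm (w ^ Suc k \<cdot>\<^sub>m Y)" by (simp add: smult_smult_mat)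
qed

lemma card_orb: "Y \<in> Yk m t k ==> card (orb Y) = lw k (redm (w ^ r \<cdot>\<^sub>m Y))"
proof (induction k arbitrary: Y)
 case 0
 then show ?case by (simp add: Yk_0_orb)
next
 case (Suc k)
 have Y: "Y \<in> Ys m t" using Suc.prems Yk_Ys by blast
 note cY = Ys_carrier[OF Y]
 have "card (orb (redm (w \<cdot>\<^sub>m Y))) = lw k (redm (w ^ r \<cdot>\<^sub>m redm (w \<cdot>\<^sub>m Y)))"
  using Suc.IH[OF Ys_scale[OF Suc.prems]] .
 also have "redm (w ^ r \<cdot>\<^sub>m redm (w \<cdot>\<^sub>m Y)) = redm (w \<cdot>\<^sub>m redm (w ^ r \<cdot>\<^sub>m Y))" unfolding redm_w_w[OF cY] ..
 finally show ?case using card_orb_step[OF Y] by simp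
qed

lemma rk_Yk_0: "X \<in> Yk m t 0 ==> rk m t X = 0"
proof -
 assume X: "X \<in> Yk m t 0"
 have "X \<in> Ys m t" using X Yk_Ys by blast
 moreover have "X \<in> pm m t 0" using X by (simp add: Yk_def)
 ultimately show ?thesis using rk_eq rank_is_0 by blast
qed

text \<open>After \<open>N\<close> multiplications by \<open>w\<close> the matrix is integral, and
  its rank 0 contributes the factor 1.\<close>

lemma lw_Suc_stable: "X \<in> Yk m t N ==> lw (Suc N) X = lw N X"
proof (induction N arbitrary: X)
 case 0
 then show ?case by (simp add: rk_Yk_0)
next
 case (Suc N)
 then show ?case using Ys_scale[OF Suc.prems] by simp
qed

lemma lw_stable: "X \<in> Yk m t N ==> lw (N + k) X = lw N X"
proof (induction k)
 case (Suc k)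
 have "X \<in> Yk m t (N + k)" using Suc.prems Yk_mono[of N "N + k"] by auto
 then show ?case using Suc lw_Suc_stable by simp
qed simp

lemma card_Yk_fibre: assumes "Z \<in> Yk m t k" shows "card {Y \<in> Yk m t (Suc k). redm (w \<cdot>\<^sub>m Y) = Z} = q ^ (m * t)"
 using bij_betw_same_card[OF Yk_lift_bij[OF assms]] card_Yk[of m t 1] by simp

lemma sum_Yk_Suc:
 fixes g :: "'k mat \<Rightarrow> complex"
 shows "(\<Sum>Y\<in>Yk m t (Suc k). g (redm (w \<cdot>\<^sub>m Y))) = of_nat (q ^ (m * t)) * (\<Sum>Z\<in>Yk m t k. g Z)"
proof -
 have "(\<Sum>Y\<in>Yk m t (Suc k). g (redm (w \<cdot>\<^sub>m Y))) =
  (\<Sum>Z\<in>Yk m t k. \<Sum>Y\<in>{Y \<in> Yk m t (Suc k). redm (w \<cdot>\<^sub>m Y) = Z}. g (redm (w \<cdot>\<^sub>m Y)))"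
  using Ys_scale by (intro sum.group[symmetric] Yk_finite) auto
 also have "... = (\<Sum>Z\<in>Yk m t k. of_nat (q ^ (m * t)) * g Z)"
 proof (intro sum.cong refl)
  fix Z assume Z: "Z \<in> Yk m t k"
  have "(\<Sum>Y\<in>{Y \<in> Yk m t (Suc k). redm (w \<cdot>\<^sub>m Y) = Z}. g (redm (w \<cdot>\<^sub>m Y))) = (\<Sum>Y\<in>{Y \<in> Yk m t (Suc k). redm (w \<cdot>\<^sub>m Y) = Z}. g Z)"
   by (intro sum.cong refl) auto
  then show "(\<Sum>Y\<in>{Y \<in> Yk m t (Suc k). redm (w \<cdot>\<^sub>m Y) = Z}. g (redm (w \<cdot>\<^sub>m Y))) = of_nat (q ^ (m * t)) * g Z"
   using card_Yk_fibre[OF Z] by simp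
 qed
 finally show ?thesis by (simp add: sum_distrib_left)
qed

text \<open>Each \<open>X\<close> is hit by \<open>q ^ (m * t * k)\<close> matrices; for
  \<open>k = r\<close> this becomes the leading factor of the zeta function.\<close>

lemma sum_Yk_shift:
 fixes g :: "'k mat \<Rightarrow> complex"
 shows "(\<Sum>Y\<in>Yk m t (N + k). g (redm (w ^ k \<cdot>\<^sub>m Y))) = of_nat (q ^ (m * t * k)) * (\<Sum>X\<in>Yk m t N. g X)"
proof (induction k)
 case 0
 have "redm (w ^ 0 \<cdot>\<^sub>m Y) = Y" if "Y \<in> Yk m t N" for Y
 proof -
  have "w ^ 0 \<cdot>\<^sub>m Y = Y" by (intro eq_matI) auto
  then show ?thesis using that by (simp only: Yk_def mem_Collect_eq)
 qed
 then show ?case by simp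
next
 case (Suc k)
 have "(\<Sum>Y\<in>Yk m t (N + Suc k). g (redm (w ^ Suc k \<cdot>\<^sub>m Y))) = (\<Sum>Y\<in>Yk m t (Suc (N + k)). g (redm (w ^ k \<cdot>\<^sub>m redm (w \<cdot>\<^sub>m Y))))"
  using redm_w_w(1)[OF Yk_carrier] by (intro sum.cong) auto
 also have "... = of_nat (q ^ (m * t)) * (\<Sum>Z\<in>Yk m t (N + k). g (redm (w ^ k \<cdot>\<^sub>m Z)))" by (rule sum_Yk_Suc)
 finally show ?case unfolding Suc by (simp add: power_add algebra_simps)
qed

lemma sum_orbit_sizes:
 fixes F :: "nat \<Rightarrow> complex"
 shows "(\<Sum>Y\<in>Yk m t (N + r). F (card (orb Y))) = of_nat (q ^ (m * t * r)) * (\<Sum>X\<in>Yk m t N. F (lw N X))"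
proof -
 have "(\<Sum>Y\<in>Yk m t (N + r). F (card (orb Y))) = (\<Sum>Y\<in>Yk m t (N + r). F (lw (N + r) (redm (w ^ r \<cdot>\<^sub>m Y))))"
  using card_orb by (intro sum.cong refl) simp
 also have "... = of_nat (q ^ (m * t * r)) * (\<Sum>X\<in>Yk m t N. F (lw (N + r) X))" by (rule sum_Yk_shift)
 finally show ?thesis using lw_stable by simp
qed

text \<open>Combines \<open>card_lifts\<close> with \<open>Rc_value\<close>. The exponents add up
  because i (m + t - i) + (j - i)(m + t - i - j) = j (m + t - j).\<close>

lemma card_lifts_rank:
 assumes Z: "Z \<in> Yk m t N" and i: "rk m t Z = i" and j: "j \<le> m" "j \<le> t"
 shows "real (card {X \<in> Yk m t (Suc N). redm (w \<cdot>\<^sub>m X) = Z \<and> rk m t X = j}) =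
  (if i \<le> j then real q ^ (j * (m + t - j)) * trans_coeff q m t i j else 0)"
proof -
 have rZ: "rank_is m t Z i" using rk[of Z m t] Z Yk_Ys i by blast
 have set: "{X \<in> Yk m t (Suc N). redm (w \<cdot>\<^sub>m X) = Z \<and> rk m t X = j} = {X \<in> Yk m t (Suc N). redm (w \<cdot>\<^sub>m X) = Z \<and> rank_is m t X j}"
  using rk_eq[of _ m t j] Yk_Ys by blast
 show ?thesis
 proof (cases "i \<le> j")
  case True
  have 1: "m * t - (m - i) * (t - i) = i * (m + t - i)" using rank_exponent[of i m t] True j by simp
  \<comment> \<open>Writing \<open>j\<close>, \<open>m\<close> and \<open>t\<close> as sums removes
    truncated subtraction from the exponent identity.\<close>
  obtain d where d: "j = i + d" using True le_Suc_ex by blast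
  obtain a where a: "m = i + d + a" using j(1) d le_Suc_ex by blast
  obtain b where b: "t = i + d + b" using j(2) d le_Suc_ex by blast
  have "i * (m + t - i) + (j - i) * ((m - i) + (t - i) - (j - i)) = j * (m + t - j)" unfolding d a b by (simp add: algebra_simps)
  then have e: "real q ^ (i * (m + t - i)) * real q ^ ((j - i) * ((m - i) + (t - i) - (j - i))) = real q ^ (j * (m + t - j))"
   by (simp flip: power_add)
  have le: "j - i \<le> m - i" "j - i \<le> t - i" "m - i - (j - i) = m - j" "t - i - (j - i) = t - j" using j True by auto
  have Rc: "real (Rc (m - i) (t - i) (j - i)) = real q ^ ((j - i) * ((m - i) + (t - i) - (j - i))) * trans_coeff q m t i j"
   unfolding Rc_value trans_coeff_def using le by simp
  show ?thesis unfolding set card_lifts(1)[OF Z rZ] using True by (simp add: 1 Rc flip: e)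
 next
  case False
  then show ?thesis unfolding set card_lifts(1)[OF Z rZ] by simp
 qed
qed

end

section \<open>Convergence and value of the Dirichlet series\<close>

lemma powr_nat: "c > 0 ==> (of_nat c :: complex) powr z = exp (z * of_real (ln (real c)))" by (simp add: powr_def Ln_of_nat)

lemma powr_nat_mult: "a > 0 ==> b > 0 ==> (of_nat (a * b) :: complex) powr z = of_nat a powr z * of_nat b powr z"
 by (simp add: powr_nat ln_mult exp_add[symmetric] distrib_left del: of_nat_mult) (simp add: ln_mult distrib_left)

lemma powr_nat_power: "q > 0 ==> (of_nat (q ^ k) :: complex) powr z = of_nat q powr (of_nat k * z)"
 by (simp add: powr_nat ln_realpow mult_ac del: of_nat_power) (simp add: ln_realpow mult_ac)

lemma norm_powr_nat: "c > 0 ==> norm ((of_nat c :: complex) powr z) = real c powr Re z" by (simp add: powr_nat powr_def)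

text \<open>Convergent norm sums along the exhaustion bound all finite norm sums, so the family is
  absolutely summable; the exhaustion is cofinal among finite subsets, which identifies the
  value.\<close>

lemma has_sum_exhaustion:
 fixes f :: "'a \<Rightarrow> complex"
 assumes inc: "\<And>M N. M \<le> N ==> B M \<subseteq> B N" and fin: "\<And>N. finite (B N)" and A: "A = (\<Union>N. B N)"
  and nrm: "convergent (\<lambda>N. \<Sum>x\<in>B N. norm (f x))" and z: "(\<lambda>N. sum f (B N)) \<longlonglongrightarrow> z"
 shows "(\<lambda>x. norm (f x)) summable_on A" "(f has_sum z) A"
proof -
 have ev: "eventually (\<lambda>N. X \<subseteq> B N) sequentially" if X: "finite X" "X \<subseteq> A" for X
 proof -
  have "\<forall>x\<in>X. eventually (\<lambda>N. x \<in> B N) sequentially"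
  proof
   fix x assume "x \<in> X"
   then obtain N where "x \<in> B N" using X A by blast
   then show "eventually (\<lambda>N. x \<in> B N) sequentially" using inc unfolding eventually_sequentially by blast
  qed
  then have "eventually (\<lambda>N. \<forall>x\<in>X. x \<in> B N) sequentially" using X(1) by (intro eventually_ball_finite)
  then show ?thesis by (simp add: subset_eq)
 qed
 obtain K where K: "\<And>N. (\<Sum>x\<in>B N. norm (f x)) \<le> K"
  using Bseq_bdd_above[OF convergent_imp_Bseq[OF nrm]] unfolding bdd_above_def by auto
 show abs: "(\<lambda>x. norm (f x)) summable_on A"
 proof (rule nonneg_bdd_above_summable_on)
  show "bdd_above (sum (\<lambda>x. norm (f x)) ` {F. F \<subseteq> A \<and> finite F})"
  proof (rule bdd_aboveI2)
   fix X assume "X \<in> {F. F \<subseteq> A \<and> finite F}"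
   then obtain N where "X \<subseteq> B N" using ev[of X] unfolding eventually_sequentially by auto
   then have "(\<Sum>x\<in>X. norm (f x)) \<le> (\<Sum>x\<in>B N. norm (f x))" by (intro sum_mono2 fin) auto
   then show "(\<Sum>x\<in>X. norm (f x)) \<le> K" using K[of N] by simp
  qed
 qed simp
 have hs: "(f has_sum infsum f A) A" by (rule has_sum_infsum[OF abs_summable_summable[OF abs]])
 have "filterlim B (finite_subsets_at_top A) sequentially" unfolding filterlim_finite_subsets_at_top
 proof (intro allI impI)
  fix X assume X: "finite X \<and> X \<subseteq> A"
  have sub: "B N \<subseteq> A" for N using A by blast
  show "eventually (\<lambda>N. finite (B N) \<and> X \<subseteq> B N \<and> B N \<subseteq> A) sequentially"
   by (rule eventually_mono[OF ev[OF conjunct1[OF X] conjunct2[OF X]]]) (use fin sub in blast)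
 qed
 then have "(\<lambda>N. sum f (B N)) \<longlonglongrightarrow> infsum f A" by (rule filterlim_compose[OF hs[unfolded has_sum_def]])
 then have "infsum f A = z" using z LIMSEQ_unique by blast
 then show "(f has_sum z) A" using hs by simp
qed

locale zeta_setting = char_setting S w q t m r \<psi> for S :: "'k::field set" and w q t m r \<psi> +
 assumes t1: "1 \<le> t" and tm: "t \<le> m"
begin

text \<open>A sum over matrices meets each orbit once per element; the extra 1 in the exponent
  compensates for this.\<close>

definition term_F :: "complex \<Rightarrow> nat \<Rightarrow> complex" where "term_F s c = of_nat c powr (- (1 + s))"

definition rank_sum :: "complex \<Rightarrow> nat \<Rightarrow> nat \<Rightarrow> complex" where
 "rank_sum s N j = (\<Sum>X\<in>{X \<in> Yk m t N. rk m t X = j}. term_F s (lw N X))"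

definition xq :: "complex \<Rightarrow> nat \<Rightarrow> complex" where
 "xq s j = of_nat q powr (- (of_nat (j * (t + m - j)) * s))"

lemma q0: "q > 0" using q_gt_1 by simp

lemma rank_sum_0: "rank_sum s 0 j = (if j = 0 then 1 else 0)"
proof -
 have "{X \<in> Yk m t 0. rk m t X = j} = (if j = 0 then {redm (0\<^sub>m m t)} else {})" using rk_Yk_0 unfolding Yk_0 by auto
 then show ?thesis by (simp add: rank_sum_def term_F_def)
qed

text \<open>The left side is the power of \<open>q\<close> in the number of lifts against the weight
  of one lift; the 1 in the exponent of \<open>term_F\<close> disappears.\<close>

lemma term_F_power: "of_nat (q ^ e) * term_F s (q ^ e) = of_nat q powr (- (of_nat e * s))"
proof -
 have "of_nat (q ^ e) * term_F s (q ^ e) = of_nat (q ^ e) powr 1 * of_nat (q ^ e) powr (- (1 + s))" using q0 by (simp add: term_F_def)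
 also have "... = of_nat (q ^ e) powr (1 + - (1 + s))" by (rule powr_add[symmetric])
 also have "... = of_nat q powr (of_nat e * (1 + - (1 + s)))" by (rule powr_nat_power[OF q0])
 finally show ?thesis by simp
qed

text \<open>Group the matrices \<open>X\<close> by \<open>Z\<close>, the class of w X: the weight of
  \<open>X\<close> is a factor for its own rank times the weight of \<open>Z\<close>, and
  \<open>card_lifts_rank\<close> counts the \<open>X\<close> above each \<open>Z\<close>.\<close>

lemma rank_sum_Suc:
 assumes j: "j \<le> t"
 shows "rank_sum s (Suc N) j = xq s j * (\<Sum>i\<le>j. of_real (trans_coeff q m t i j) * rank_sum s N i)"
proof -
 let ?e = "j * (m + t - j)" and ?B = "{X \<in> Yk m t (Suc N). rk m t X = j}"
 define h where "h Z = term_F s (lw N Z)" for Z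
 have "rank_sum s (Suc N) j = (\<Sum>X\<in>?B. term_F s (q ^ ?e) * h (redm (w \<cdot>\<^sub>m X)))" unfolding rank_sum_def h_def
 proof (intro sum.cong refl)
  fix X assume "X \<in> ?B"
  then show "term_F s (lw (Suc N) X) = term_F s (q ^ ?e) * term_F s (lw N (redm (w \<cdot>\<^sub>m X)))"
   using q0 lw_pos unfolding term_F_def lw.simps by (subst powr_nat_mult) auto
 qed
 also have "... = term_F s (q ^ ?e) * (\<Sum>X\<in>?B. h (redm (w \<cdot>\<^sub>m X)))" by (simp add: sum_distrib_left)
 also have "(\<Sum>X\<in>?B. h (redm (w \<cdot>\<^sub>m X))) = (\<Sum>Z\<in>Yk m t N. \<Sum>X\<in>{X \<in> ?B. redm (w \<cdot>\<^sub>m X) = Z}. h (redm (w \<cdot>\<^sub>m X)))"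
  using Ys_scale by (intro sum.group[symmetric] Yk_finite finite_subset[OF _ Yk_finite[of m t "Suc N"]]) auto
 also have "... = (\<Sum>Z\<in>Yk m t N. (if rk m t Z \<le> j then of_nat (q ^ ?e) * of_real (trans_coeff q m t (rk m t Z) j) else 0) * h Z)"
 proof (intro sum.cong refl)
  fix Z assume Z: "Z \<in> Yk m t N"
  let ?L = "{X \<in> Yk m t (Suc N). redm (w \<cdot>\<^sub>m X) = Z \<and> rk m t X = j}"
  have set: "{X \<in> ?B. redm (w \<cdot>\<^sub>m X) = Z} = ?L" by blast
  have "(\<Sum>X\<in>?L. h (redm (w \<cdot>\<^sub>m X))) = (\<Sum>X\<in>?L. h Z)" by (intro sum.cong refl) auto
  also have "... = of_real (real (card ?L)) * h Z" by simp
  also have "(of_real (real (card ?L)) :: complex) = (if rk m t Z \<le> j then of_nat (q ^ ?e) * of_real (trans_coeff q m t (rk m t Z) j) else 0)"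
   unfolding card_lifts_rank[OF Z refl le_trans[OF j tm] j] by simp
  finally show "(\<Sum>X\<in>{X \<in> ?B. redm (w \<cdot>\<^sub>m X) = Z}. h (redm (w \<cdot>\<^sub>m X))) =
    (if rk m t Z \<le> j then of_nat (q ^ ?e) * of_real (trans_coeff q m t (rk m t Z) j) else 0) * h Z" unfolding set .
 qed
 also have "... = (\<Sum>i\<le>t. \<Sum>Z\<in>{Z \<in> Yk m t N. rk m t Z = i}. (if rk m t Z \<le> j then of_nat (q ^ ?e) * of_real (trans_coeff q m t (rk m t Z) j) else 0) * h Z)"
  using rk_le subsetD[OF Yk_Ys] by (intro sum.group[symmetric] Yk_finite) auto
 also have "... = (\<Sum>i\<le>t. (if i \<le> j then of_nat (q ^ ?e) * of_real (trans_coeff q m t i j) else 0) * rank_sum s N i)"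
  unfolding rank_sum_def h_def sum_distrib_left by (intro sum.cong refl) auto
 also have "... = (\<Sum>i\<in>{..j}. (if i \<le> j then of_nat (q ^ ?e) * of_real (trans_coeff q m t i j) else 0) * rank_sum s N i)"
  using j by (intro sum.mono_neutral_right) auto
 also have "... = of_nat (q ^ ?e) * (\<Sum>i\<le>j. of_real (trans_coeff q m t i j) * rank_sum s N i)"
  unfolding sum_distrib_left by (intro sum.cong refl) auto
 finally have "rank_sum s (Suc N) j = (of_nat (q ^ ?e) * term_F s (q ^ ?e)) * (\<Sum>i\<le>j. of_real (trans_coeff q m t i j) * rank_sum s N i)"
  by (simp only: mult_ac)
 then show ?thesis unfolding term_F_power xq_def by (simp only: add.commute[of m t])
qed

lemma rank_sum_total: "(\<Sum>X\<in>Yk m t N. term_F s (lw N X)) = (\<Sum>j\<le>t. rank_sum s N j)"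
 unfolding rank_sum_def using rk_le subsetD[OF Yk_Ys] by (intro sum.group[symmetric] Yk_finite) auto

lemma card_Orb_pos: assumes "Q \<in> Orb" shows "card Q > 0" using Orb_finite[OF assms] Orb_nonempty[OF assms] card_gt_0_iff by blast

lemma orbit_sum: "(\<Sum>Q\<in>orb ` Yk m t N. of_nat (card Q) powr (- s)) = (\<Sum>Y\<in>Yk m t N. term_F s (card (orb Y)))"
proof -
 have "(\<Sum>Y\<in>Yk m t N. term_F s (card (orb Y))) = (\<Sum>Q\<in>orb ` Yk m t N. \<Sum>Y\<in>{Y \<in> Yk m t N. orb Y = Q}. term_F s (card (orb Y)))"
  by (intro sum.group[symmetric] Yk_finite finite_imageI) auto
 also have "... = (\<Sum>Q\<in>orb ` Yk m t N. of_nat (card Q) powr (- s))"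
 proof (intro sum.cong refl)
  fix Q assume "Q \<in> orb ` Yk m t N"
  then obtain Y0 where Y0: "Q = orb Y0" "Y0 \<in> Yk m t N" by (rule imageE)
  have O: "Q \<in> Orb" unfolding Y0(1) Orb_def using Y0(2) Yk_Ys by (intro imageI) blast
  have "{Y \<in> Yk m t N. orb Y = Q} = Q"
  proof (intro equalityI subsetI)
   fix Y assume "Y \<in> {Y \<in> Yk m t N. orb Y = Q}"
   then show "Y \<in> Q" using orb_self[of Y] subsetD[OF Yk_Ys, of Y] by blast
  next
   fix Y assume Y: "Y \<in> Q"
   then show "Y \<in> {Y \<in> Yk m t N. orb Y = Q}" using orb_Yk[OF Y0(2)] Y0(1) Orb_eq(1)[OF O Y] by blast
  qed
  moreover have "(\<Sum>Y\<in>{Y \<in> Yk m t N. orb Y = Q}. term_F s (card (orb Y))) = (\<Sum>Y\<in>{Y \<in> Yk m t N. orb Y = Q}. term_F s (card Q))"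
   by (intro sum.cong refl) auto
  ultimately have "(\<Sum>Y\<in>{Y \<in> Yk m t N. orb Y = Q}. term_F s (card (orb Y))) = of_nat (card Q) powr 1 * of_nat (card Q) powr (- (1 + s))"
   using card_Orb_pos[OF O] by (simp add: term_F_def)
  also have "... = of_nat (card Q) powr (1 + - (1 + s))" by (rule powr_add[symmetric])
  also have "1 + - (1 + s) = - s" by simp
  finally show "(\<Sum>Y\<in>{Y \<in> Yk m t N. orb Y = Q}. term_F s (card (orb Y))) = of_nat (card Q) powr (- s)" .
 qed
 finally show ?thesis by simp
qed

definition zval :: "complex \<Rightarrow> complex" where
 "zval s = of_nat q ^ (r * t * m) * (\<Sum>J\<in>Pow {1..t}. of_real (V_coeff q (t + m) t J) * (\<Prod>j\<in>J. xq s j / (1 - xq s j)))"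

lemma xq_small: assumes s: "Re s > 0" and j: "1 \<le> j" "j \<le> t" shows "norm (xq s j) < 1"
proof -
 have "j * (t + m - j) > 0" using j tm by simp
 then have "Re (- (of_nat (j * (t + m - j)) * s)) < 0" using s by (simp del: of_nat_mult)
 moreover have "1 < real q" using q_gt_1 by simp
 ultimately have "real q powr Re (- (of_nat (j * (t + m - j)) * s)) < 1" by (intro powr_less_one)
 then show ?thesis unfolding xq_def norm_powr_nat[OF q0] .
qed

lemma partial_sums:
 assumes s: "Re s > 0"
 shows "(\<lambda>N. \<Sum>Q\<in>orb ` Yk m t (N + r). of_nat (card Q) powr (- s)) \<longlonglongrightarrow> zval s"
proof -
 have lim: "(\<lambda>N. rank_sum s N j) \<longlonglongrightarrow> chain_sum q (t + m) t (\<lambda>i. xq s i / (1 - xq s i)) j" if "j \<le> t" for j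
 proof (rule chain_limit[OF q_gt_1 _ _ _ _ that])
  show "xq s 0 = 1" using q0 by (simp add: xq_def)
  show "norm (xq s j) < 1" if "1 \<le> j" "j \<le> t" for j using xq_small[OF s that] .
  show "rank_sum s 0 j = (if j = 0 then 1 else 0)" for j by (rule rank_sum_0)
  show "rank_sum s (Suc N) j = xq s j * (\<Sum>i\<le>j. of_real (trans_coeff q (t + m - t) t i j) * rank_sum s N i)" if "j \<le> t" for N j
   unfolding diff_add_inverse by (rule rank_sum_Suc[OF that])
 qed
 have "(\<Sum>Q\<in>orb ` Yk m t (N + r). of_nat (card Q) powr (- s)) = of_nat q ^ (r * t * m) * (\<Sum>j\<le>t. rank_sum s N j)" for N
 proof -
  have "m * t * r = r * t * m" by simp
  then show ?thesis unfolding orbit_sum sum_orbit_sizes rank_sum_total by (simp only: of_nat_power)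
 qed
 moreover have "(\<lambda>N. of_nat q ^ (r * t * m) * (\<Sum>j\<le>t. rank_sum s N j)) \<longlonglongrightarrow>
   of_nat q ^ (r * t * m) * (\<Sum>j\<le>t. chain_sum q (t + m) t (\<lambda>i. xq s i / (1 - xq s i)) j)"
  using lim by (intro tendsto_mult tendsto_const tendsto_sum) auto
 ultimately show ?thesis unfolding chain_sum_total zval_def by simp
qed

lemma norm_dim_powr: assumes "Q \<in> Orb" shows "norm ((of_nat (card Q) :: complex) powr (- s)) = real (card Q) powr (- Re s)"
 using norm_powr_nat[OF card_Orb_pos[OF assms], of "- s"] by simp

lemma orbit_has_sum:
 assumes s: "Re s > 0"
 shows "(\<lambda>Q. norm ((of_nat (card Q) :: complex) powr (- s))) summable_on Orb"
  "((\<lambda>Q. of_nat (card Q) powr (- s)) has_sum zval s) Orb"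
proof -
 let ?B = "\<lambda>N. orb ` Yk m t (N + r)"
 have inc: "?B M \<subseteq> ?B N" if "M \<le> N" for M N using Yk_mono[of "M + r" "N + r" m t] that by (intro image_mono) simp
 have un: "Orb = (\<Union>N. ?B N)"
 proof (intro equalityI subsetI)
  fix Q assume "Q \<in> Orb"
  then obtain Y where Y: "Q = orb Y" "Y \<in> Ys m t" unfolding Orb_def by (rule imageE)
  obtain N where N: "Y \<in> Yk m t N" using Y(2) unfolding Ys_eq by blast
  have "Y \<in> Yk m t (N + r)" using N Yk_mono[of N "N + r" m t] by auto
  then show "Q \<in> (\<Union>N. ?B N)" unfolding Y(1) by blast
 next
  fix Q assume "Q \<in> (\<Union>N. ?B N)"
  then show "Q \<in> Orb" unfolding Orb_def using Yk_Ys by blast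
 qed
 have fin: "finite (?B N)" for N using Yk_finite by blast
 \<comment> \<open>The norms are the terms at the real part of \<open>s\<close>, where
   \<open>partial_sums\<close> already gives convergence.\<close>
 have nrm: "convergent (\<lambda>N. \<Sum>Q\<in>?B N. norm ((of_nat (card Q) :: complex) powr (- s)))"
 proof -
  have "(\<Sum>Q\<in>?B N. norm ((of_nat (card Q) :: complex) powr (- s))) = Re (\<Sum>Q\<in>?B N. of_nat (card Q) powr (- of_real (Re s)))" for N
   unfolding Re_sum
  proof (intro sum.cong refl)
   fix Q assume "Q \<in> ?B N"
   then have O: "Q \<in> Orb" using un by blast
   have "Re ((of_nat (card Q) :: complex) powr (- of_real (Re s))) = real (card Q) powr (- Re s)"
    using card_Orb_pos[OF O] by (simp add: powr_nat powr_def Re_exp)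
   then show "norm ((of_nat (card Q) :: complex) powr (- s)) = Re (of_nat (card Q) powr (- of_real (Re s)))"
    using norm_dim_powr[OF O, of s] by simp
  qed
  moreover have "(\<lambda>N. Re (\<Sum>Q\<in>?B N. of_nat (card Q) powr (- of_real (Re s)))) \<longlonglongrightarrow> Re (zval (of_real (Re s)))"
   using s by (intro tendsto_Re partial_sums) simp
  ultimately show ?thesis unfolding convergent_def by auto
 qed
 show "(\<lambda>Q. norm ((of_nat (card Q) :: complex) powr (- s))) summable_on Orb"
  by (rule has_sum_exhaustion(1)[OF inc fin un nrm partial_sums[OF s]])
 show "((\<lambda>Q. of_nat (card Q) powr (- s)) has_sum zval s) Orb" by (rule has_sum_exhaustion(2)[OF inc fin un nrm partial_sums[OF s]])
qed

text \<open>Absolute convergence at \<open>s = 1\<close> leaves room for only finitely many terms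
  equal to \<open>1 / d\<close>.\<close>

lemma orbits_finite_dim: "finite {Q \<in> Orb. card Q = d}"
proof (cases "d = 0")
 case True
 then have "{Q \<in> Orb. card Q = d} = {}" using card_Orb_pos by force
 then show ?thesis by (simp only: finite.emptyI)
next
 case False
 let ?f = "\<lambda>Q. norm ((of_nat (card Q) :: complex) powr (- 1))"
 have sm: "?f summable_on Orb" using orbit_has_sum(1)[of 1] by simp
 obtain C :: nat where C: "real d * infsum ?f Orb \<le> real C" using real_arch_simple by blast
 have "card F \<le> C" if F: "F \<subseteq> {Q \<in> Orb. card Q = d}" "finite F" for F
 proof -
  have "(\<Sum>Q\<in>F. ?f Q) \<le> infsum ?f Orb" using F by (intro finite_sum_le_infsum[OF sm]) auto
  moreover have "?f Q = 1 / real d" if "Q \<in> F" for Q using F(1) that norm_dim_powr[of Q 1] False by (auto simp: powr_minus divide_inverse)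
  ultimately have "real (card F) / real d \<le> infsum ?f Orb" by simp
  then have "real (card F) \<le> real d * infsum ?f Orb" using False by (simp add: field_simps)
  then show ?thesis using C by simp
 qed
 then show ?thesis using finite_if_finite_subsets_card_bdd by blast
qed

text \<open>This supplies the lower bound for the abscissa. Finitely many sizes would mean finitely
  many orbits, each finite, and so finitely many matrices in \<open>Ys m t\<close>.\<close>

lemma orbit_dims_infinite: "infinite (card ` Orb)"
proof
 assume fin: "finite (card ` Orb)"
 have "Orb = (\<Union>d\<in>card ` Orb. {Q \<in> Orb. card Q = d})" by blast
 then have "finite Orb" using fin orbits_finite_dim by (metis (no_types, lifting) finite_UN_I)
 moreover have "Ys m t \<subseteq> \<Union>Orb" using orb_self unfolding Orb_def by blast
 ultimately have fY: "finite (Ys m t)" using Orb_finite by (meson finite_Union finite_subset)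
 \<comment> \<open>Level \<open>c\<close> alone has \<open>q ^ (c * (m * t))\<close> elements,
   already more than \<open>c\<close>.\<close>
 define c where "c = card (Ys m t)"
 have "card (Yk m t c) \<le> c" unfolding c_def by (rule card_mono[OF fY Yk_Ys])
 then have "q ^ (c * (m * t)) \<le> c" by (simp only: card_Yk)
 moreover have "c < 2 ^ c" by (rule less_exp)
 moreover have "(2::nat) ^ c \<le> q ^ c" using q_gt_1 by (intro power_mono) auto
 moreover have "q ^ c \<le> q ^ (c * (m * t))" using q_gt_1 t1 tm by (intro power_increasing) auto
 ultimately show False by linarith
qed

lemma zeta_summand_cls: assumes "Q \<in> Orb" shows "zeta_summand GG rho s (cls Q) = of_nat (card Q) powr (- s)"
 unfolding zeta_summand_def mult_cls[OF assms] cls_props(3)[OF assms] by simp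

lemma cls_image: "cls ` Orb = {C \<in> irr_classes GG TT. rep_hom GG (rep_of C) rho \<noteq> {0}}" using cls_bij by (rule bij_betw_imp_surj_on)

lemma zeta_value: assumes s: "Re s > 0" shows "has_zeta_value GG TT rho s (zval s)"
proof -
 have "((zeta_summand GG rho s \<circ> cls) has_sum zval s) Orb"
  using orbit_has_sum(2)[OF s] by (rule has_sum_cong[THEN iffD1, rotated]) (simp add: zeta_summand_cls)
 then have "(zeta_summand GG rho s has_sum zval s) (cls ` Orb)" unfolding has_sum_reindex[OF cls_inj] .
 then show ?thesis unfolding has_zeta_value_def
 proof (rule has_sum_cong_neutral[THEN iffD1, rotated 3])
  fix C assume "C \<in> irr_classes GG TT - cls ` Orb"
  then have "rep_hom GG (rep_of C) rho = {0}" unfolding cls_image by blast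
  then have "rep_mult GG (rep_of C) rho = 0" by (rule mult_zero)
  then show "zeta_summand GG rho s C = 0" unfolding zeta_summand_def by simp
 next
  fix C assume "C \<in> cls ` Orb - irr_classes GG TT"
  then show "zeta_summand GG rho s C = 0" unfolding cls_image by blast
 qed simp
qed

lemma classes_of_dim_eq: "classes_of_dim GG TT rho d = cls ` {Q \<in> Orb. card Q = d}"
proof (intro equalityI subsetI)
 fix C assume "C \<in> classes_of_dim GG TT rho d"
 then have C: "C \<in> cls ` Orb" "rep_dim (rep_of C) = d" unfolding classes_of_dim_def cls_image by simp_all
 obtain Q where "C = cls Q" "Q \<in> Orb" using C(1) by (rule imageE)
 then show "C \<in> cls ` {Q \<in> Orb. card Q = d}" using C(2) cls_props(3) by auto
next
 fix C assume "C \<in> cls ` {Q \<in> Orb. card Q = d}"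
 then obtain Q where O: "C = cls Q" "Q \<in> Orb" "card Q = d" by blast
 show "C \<in> classes_of_dim GG TT rho d" unfolding classes_of_dim_def O(1) mem_Collect_eq using cls_props[OF O(2)] O(3) by (intro conjI) simp_all
qed

lemma constituents_finite: "finitely_many_constituents GG TT rho" unfolding finitely_many_constituents_def classes_of_dim_eq
 using orbits_finite_dim hom_finite_dimensional by (intro conjI allI ballI finite_imageI) blast+

lemma zeta_coeff_eq: "zeta_coeff GG TT rho d = card {Q \<in> Orb. card Q = d}"
proof -
 have inj: "inj_on cls {Q \<in> Orb. card Q = d}" using cls_inj by (rule inj_on_subset) blast
 show ?thesis unfolding zeta_coeff_def classes_of_dim_eq sum.reindex[OF inj] by (simp add: mult_cls)
qed

lemma dirichlet_summable:
 assumes s: "Re s > 0"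
 shows "summable (\<lambda>d. of_nat (zeta_coeff GG TT rho d) * of_nat d powr (- s) :: complex)"
proof (rule summable_norm_cancel, rule summableI_nonneg_bounded)
 let ?f = "\<lambda>Q. norm ((of_nat (card Q) :: complex) powr (- s))"
 fix D :: nat
 have fin: "finite {Q \<in> Orb. card Q < D}"
 proof -
  have "{Q \<in> Orb. card Q < D} = (\<Union>d<D. {Q \<in> Orb. card Q = d})" by auto
  then show ?thesis using orbits_finite_dim by (metis (no_types, lifting) finite_UN_I finite_lessThan)
 qed
 have "(\<Sum>d<D. norm (of_nat (zeta_coeff GG TT rho d) * of_nat d powr (- s) :: complex)) =
   (\<Sum>d<D. \<Sum>Q\<in>{Q \<in> {Q \<in> Orb. card Q < D}. card Q = d}. ?f Q)"
 proof (intro sum.cong refl)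
  fix d assume "d \<in> {..<D}"
  then have "{Q \<in> {Q \<in> Orb. card Q < D}. card Q = d} = {Q \<in> Orb. card Q = d}" by auto
  moreover have "(\<Sum>Q\<in>{Q \<in> Orb. card Q = d}. ?f Q) = (\<Sum>Q\<in>{Q \<in> Orb. card Q = d}. norm ((of_nat d :: complex) powr (- s)))"
   by (intro sum.cong refl) auto
  ultimately show "norm (of_nat (zeta_coeff GG TT rho d) * of_nat d powr (- s) :: complex) =
    (\<Sum>Q\<in>{Q \<in> {Q \<in> Orb. card Q < D}. card Q = d}. ?f Q)" unfolding zeta_coeff_eq by (simp add: norm_mult)
 qed
 also have "... = (\<Sum>Q\<in>{Q \<in> Orb. card Q < D}. ?f Q)" using fin by (intro sum.group) auto
 also have "... \<le> infsum ?f Orb" using fin by (intro finite_sum_le_infsum[OF orbit_has_sum(1)[OF s]]) auto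
 finally show "(\<Sum>d<D. norm (of_nat (zeta_coeff GG TT rho d) * of_nat d powr (- s) :: complex)) \<le> infsum ?f Orb" .
qed simp

text \<open>Infinitely many dimensions occur, each with coefficient at least 1, so for negative real
  part the terms cannot tend to 0.\<close>

lemma dirichlet_not_summable:
 assumes sm: "summable (\<lambda>d. of_nat (zeta_coeff GG TT rho d) * of_nat d powr (- s) :: complex)"
 shows "Re s \<ge> 0"
proof (rule ccontr)
 assume neg: "\<not> Re s \<ge> 0"
 obtain N where N: "\<And>d. d \<ge> N ==> norm (of_nat (zeta_coeff GG TT rho d) * of_nat d powr (- s) :: complex) < 1"
  using LIMSEQ_D[OF summable_LIMSEQ_zero[OF sm], of 1] by auto
 obtain d where d: "d \<ge> N" "d \<in> card ` Orb" using orbit_dims_infinite unfolding infinite_nat_iff_unbounded_le by blast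
 obtain Q where O: "d = card Q" "Q \<in> Orb" using d(2) by (rule imageE)
 have d0: "d > 0" using card_Orb_pos[OF O(2)] O(1) by simp
 have "Q \<in> {Q \<in> Orb. card Q = d}" using O by simp
 then have "card {Q \<in> Orb. card Q = d} > 0" using orbits_finite_dim card_gt_0_iff by blast
 then have "1 * 1 \<le> real (zeta_coeff GG TT rho d) * real d powr (- Re s)"
  unfolding zeta_coeff_eq using d0 neg by (intro mult_mono ge_one_powr_ge_zero) auto
 also have "... = norm (of_nat (zeta_coeff GG TT rho d) * of_nat d powr (- s) :: complex)"
  using norm_powr_nat[OF d0, of "- s"] by (simp add: norm_mult)
 finally show False using N[OF d(1)] by simp
qed

lemma abscissa_zero: "abscissa GG TT rho = 0"
proof (rule antisym)
 have le: "abscissa GG TT rho \<le> 0 + ereal e" if "e > 0" for e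
 proof -
  have "abscissa GG TT rho \<le> ereal (Re (of_real e))" unfolding abscissa_def using that by (intro INF_lower) (simp add: dirichlet_summable)
  then show ?thesis by simp
 qed
 show "abscissa GG TT rho \<le> 0" by (rule ereal_le_epsilon2) (rule le)
 show "0 \<le> abscissa GG TT rho" unfolding abscissa_def by (intro INF_greatest) (use dirichlet_not_summable in auto)
qed

end

section \<open>The given maximal ideal and the conclusion\<close>

context complete_dvr
begin

lemma pw_1_ideal: "ideal (pw 1) (ring_on S)"
proof -
 have R: "cring (ring_on S)" by (rule cring_ring_on) (auto intro: S_add S_minus S_mult)
 have inv: "\<ominus>\<^bsub>ring_on S\<^esub> x = - x" if "x \<in> S" for x using a_inv_ring_on[OF that R S_minus[OF that]] .
 have sub: "x \<in> S" if "x \<in> pw 1" for x using pw_S[of 1 x] that by simp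
 show ?thesis
 proof (rule idealI)
  show "Ring.ring (ring_on S)" using R by (simp add: cring_def)
  have ag: "abelian_group (ring_on S)" using R by (simp add: cring_def Ring.ring_def)
  have "a_inv (ring_on S) x \<in> pw 1" if "x \<in> pw 1" for x unfolding inv[OF sub[OF that]] using that by simp
  moreover have ne: "pw 1 \<noteq> {}" using pw_zero[of 1] by blast
  ultimately show "subgroup (pw 1) (add_monoid (ring_on S))" using sub ne by (intro group.subgroupI[OF abelian_group.a_group[OF ag]])
    (auto simp: a_inv_def intro: pw_add)
 qed (auto intro: pw_mult_S)
qed

text \<open>A proper ideal contains no unit and therefore lies in \<open>pw 1\<close>; maximality
  gives equality.\<close>

lemma maximal_ideal_eq:
 assumes P: "maximalideal P (ring_on S)"
  and nonunit: "\<And>x. x \<in> S ==> x = 0 \<or> inverse x \<notin> S ==> x / w \<in> S"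
 shows "P = pw 1"
proof -
 interpret P: maximalideal P "ring_on S" by (rule P)
 have "P \<subseteq> pw 1"
 proof
  fix x assume x: "x \<in> P"
  have xS: "x \<in> S" using P.a_subset x by auto
  have "x = 0 \<or> inverse x \<notin> S"
  proof (rule ccontr)
   assume "\<not> (x = 0 \<or> inverse x \<notin> S)"
   then have "inverse x \<otimes>\<^bsub>ring_on S\<^esub> x \<in> P" "inverse x * x = 1" using P.I_l_closed[OF x, of "inverse x"] by auto
   then have "P = carrier (ring_on S)" using P.one_imp_carrier by simp
   then show False using P.I_notcarr by simp
  qed
  then show "x \<in> pw 1" using nonunit xS by (simp add: pw_1)
 qed
 moreover have "pw 1 \<subseteq> carrier (ring_on S)" using pw_S[of 1] by auto
 moreover have "pw 1 \<noteq> carrier (ring_on S)" using one_notin_pw1 by auto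
 ultimately show ?thesis using P.I_maximal[OF pw_1_ideal] by blast
qed

lemma residue_field_card: "card (carrier (ring_on S Quot pw 1)) = q"
proof -
 have "pw 1 +>\<^bsub>ring_on S\<^esub> x = {y \<in> S. (y - x) / w \<in> S}" if x: "x \<in> S" for x
 proof (intro equalityI subsetI)
  fix y assume "y \<in> pw 1 +>\<^bsub>ring_on S\<^esub> x"
  then obtain h where "h \<in> pw 1" "y = h + x" by (auto simp: a_r_coset_def')
  then show "y \<in> {y \<in> S. (y - x) / w \<in> S}" using x by (auto simp: pw_1 intro: S_add)
 next
  fix y assume "y \<in> {y \<in> S. (y - x) / w \<in> S}"
  then have "y - x \<in> pw 1" using x by (auto simp: pw_1 intro: S_diff)
  then show "y \<in> pw 1 +>\<^bsub>ring_on S\<^esub> x" by (auto simp: a_r_coset_def' intro!: bexI[of _ "y - x"])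
 qed
 then have "carrier (ring_on S Quot pw 1) = (\<lambda>x. {y \<in> S. (y - x) / w \<in> S}) ` S"
  unfolding FactRing_def by (simp add: A_RCOSETS_def' UNION_singleton_eq_range)
 then show ?thesis by (simp add: q_eq)
qed

end

theorem theorem7p4:
  fixes p q e n t r :: nat
    and Qp :: "'k::field_char_0 set" and absp :: "'k \<Rightarrow> real"
    and S P :: "'k set"
    and G :: "'k mat monoid" and T :: "'k mat topology" and H :: "'k mat set"
    and \<rho> :: "('k mat, 'k mat) rep"
  assumes "padic_field p Qp absp"
    and "S = integers_of Qp absp"
    and "maximalideal P (ring_on S)"
    and "q = card (carrier (ring_on S Quot P))"
    and "cgenideal (ring_on S) (of_nat p) = ideal_power S P e"
    and "1 \<le> t" and "t \<le> n - t"
    and "1 \<le> r"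
    and "p = 2 \<Longrightarrow> r \<ge> 2 * e"
    and "p > 2 \<Longrightarrow> real r \<ge> real e / (real p - 2)"
    and "G = congruence_subgroup n S P r"
    and "T = subtopology (GL_topology n S P) (carrier G)"
    and "H = block_subgroup n t S \<inter> carrier G"
    and "\<rho> = ind_trivial G T H"
  shows "smooth_rep G T \<rho> \<and> finitely_many_constituents G T \<rho> \<and>
    (\<forall>s. Re s > 0 \<longrightarrow> has_zeta_value G T \<rho> s
       (of_nat q ^ (r * t * (n - t)) *
        (\<Sum>J\<in>Pow {1..t}. complex_of_real (V_coeff q n t J) *
           (\<Prod>j\<in>J. of_nat q powr (- (of_nat (j * (n - j)) * s)) /
                  (1 - of_nat q powr (- (of_nat (j * (n - j)) * s))))))) \<and>
    abscissa G T \<rho> = 0"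
proof -
 interpret padic_field_ext p Qp absp using assms(1) unfolding padic_field_def by unfold_locales auto
 obtain w where w: "complete_dvr S w (card ((\<lambda>x. {y \<in> S. (y - x) / w \<in> S}) ` S))"
  "\<And>x. x \<in> S ==> x = 0 \<or> inverse x \<notin> S ==> x / w \<in> S" by (rule integers_complete_dvr[folded assms(2)]) (rule that; blast)
 \<comment> \<open>The number of residue classes is at first written out. Only after
   \<open>P\<close> is identified with \<open>pw 1\<close> can it be equated with \<open>q\<close>,
   and the structure is then interpreted anew.\<close>
 interpret D: complete_dvr S w "card ((\<lambda>x. {y \<in> S. (y - x) / w \<in> S}) ` S)" by (rule w(1))
 have P: "P = D.pw 1" by (rule D.maximal_ideal_eq[OF assms(3) w(2)])
 have q: "card ((\<lambda>x. {y \<in> S. (y - x) / w \<in> S}) ` S) = q" using D.residue_field_card assms(4) P by simp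
 have dvr: "complete_dvr S w q" using w(1) unfolding q .
 \<comment> \<open>A nontrivial value at 1/w is all that nondegeneracy of the pairing requires
   beyond triviality on \<open>S\<close>.\<close>
 have "1 / w \<notin> S" using D.w_nonunit by (simp add: divide_inverse)
 then obtain \<psi> :: "'k \<Rightarrow> complex" where psi: "\<And>x y. \<psi> (x + y) = \<psi> x * \<psi> y" "\<And>x. \<psi> x \<noteq> 0"
   "\<And>x. x \<in> S ==> \<psi> x = 1" "\<psi> (1 / w) \<noteq> 1" using additive_char_exists[of S "1 / w"] D.S_zero D.S_diff by metis
 interpret E: complete_dvr S w q by (rule dvr)
 interpret Z: zeta_setting S w q t "n - t" r \<psi> using psi assms(6,7,8) by unfold_locales auto
 \<comment> \<open>As \<open>t\<close> is positive and at most \<open>n - t\<close>, the subtraction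
   is not truncated.\<close>
 have n: "n = t + (n - t)" using assms(6,7) by simp
 have P': "P = E.pw 1" by (rule E.maximal_ideal_eq[OF assms(3) w(2)])
 have G: "G = congruence_subgroup (t + (n - t)) S (E.pw 1) r" using assms(11) n P' by simp
 have T: "T = subtopology (GL_topology (t + (n - t)) S (E.pw 1)) (carrier (congruence_subgroup (t + (n - t)) S (E.pw 1) r))"
  unfolding assms(12) G P' n[symmetric] ..
 have H: "H = Z.HH" unfolding assms(13) Z.HH_def G n[symmetric] ..
 have rho: "\<rho> = (Z.VV, Z.act)" unfolding assms(14) G T H Z.rho_eq ..
 have zeta: "has_zeta_value G T \<rho> s
   (of_nat q ^ (r * t * (n - t)) *
    (\<Sum>J\<in>Pow {1..t}. complex_of_real (V_coeff q n t J) *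
     (\<Prod>j\<in>J. of_nat q powr (- (of_nat (j * (n - j)) * s)) /
         (1 - of_nat q powr (- (of_nat (j * (n - j)) * s))))))" if "Re s > 0" for s
  using Z.zeta_value[OF that] unfolding Z.zval_def Z.xq_def n[symmetric] G T rho .
 show ?thesis using Z.rho_smooth Z.constituents_finite Z.abscissa_zero zeta unfolding G T rho by blast
qed

end
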